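(* Let $$\mathscr{I}_0(H,H)=\int_{\mathbb{R}}\int_{\mathbb{R}}H(x)H(y)|x-y|^2\log|x-y|\,dx\,dy,\qquad \lambda_0:=\exp\Big(\tfrac12\mathscr{I}_0(H,H)\Big),$$ $$G_0(x)=\lambda_0H(\lambda_0x)=\frac{2\lambda_0}{\pi(1+\lambda_0^2x^2)^2},\quad x\in\mathbb{R}.$$ Then $\mathscr{I}_0(H,H)>0$ and: (i) for any choice of steady states $G_\gamma\in\mathscr{E}_\gamma$ ($\gamma>0$) and any bounded continuous $\varphi:\mathbb{R}\to\mathbb{R}$, $$\lim_{\gamma\to0^+}\int_{\mathbb{R}}G_\gamma(x)\varphi(x)\,dx=\int_{\mathbb{R}}G_0(x)\varphi(x)\,dx;$$ (ii) for any $\delta\in(0,\frac12)$ there exist $C_0>0$ and $\gamma_\star\in(0,1)$, both depending on $\delta$, such that $$\|G_\gamma\|_{L^2}\le C_0,\qquad M_k(G_\gamma)\le C_0\qquad\text{for all }\gamma\in[0,\gamma_\star)\text{ and all }k\in(0,3-\delta),$$ where $G_\gamma$ denotes any element of $\mathscr{E}_\gamma$ if $\gamma\in(0,\gamma_\star)$, and the function $G_0$ above if $\gamma=0$.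
   Context: $H(x)=\frac{2}{\pi(1+x^2)^2}$, $x\in\mathbb{R}$. $M_s(f)=\int_{\mathbb{R}}f(x)|x|^s\,dx$. For $k\in\mathbb{R}$ let $w_k(x)=(1+|x|)^k$, $x\in\mathbb{R}$, and let $L^1(w_k)$ be the space of measurable $f:\mathbb{R}\to\mathbb{R}$ with $\|f\|_{L^1(w_k)}=\int_{\mathbb{R}}|f(x)|w_k(x)\,dx<\infty$. For $\gamma\in[0,1]$, $\mathcal{Q}_\gamma$ is defined in weak form by $$\int_{\mathbb{R}}\mathcal{Q}_\gamma(f,g)(x)\varphi(x)\,dx=\frac12\int_{\mathbb{R}^2}f(x)g(y)\Big[2\varphi\big(\tfrac{x+y}{2}\big)-\varphi(x)-\varphi(y)\Big]|x-y|^\gamma\,dx\,dy .$$ For $\gamma\in[0,1)$, $\mathscr{E}_\gamma$ is the set of nonnegative functions $G\in\bigcap_{s<3}L^1(w_s)$ with $\int_{\mathbb{R}}G\,dx=1$, $\int_{\mathbb{R}}xG(x)\,dx=0$, which solve $\frac14\partial_x(xG)=\mathcal{Q}_\gamma(G,G)$, that is, $$-\frac14\int_{\mathbb{R}}x\varphi'(x)G(x)\,dx=\int_{\mathbb{R}}\mathcal{Q}_\gamma(G,G)(x)\varphi(x)\,dx\quad\text{for all }\varphi\in\mathcal{C}^1_b(\mathbb{R})$$ ($C^1$ functions bounded together with their derivative). *)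

theory Defs
  imports "HOL-Analysis.Analysis"
begin

text \<open>
  Integrals over the line are taken with respect to \<^term>\<open>lebesgue\<close>, so that every
  Lebesgue measurable function is admitted.
\<close>

definition H :: "real \<Rightarrow> real" where
  "H x = 2 / (pi * (1 + x\<^sup>2)\<^sup>2)"

text \<open>
  On the diagonal the factor \<open>\<bar>x - y\<bar>\<^sup>2\<close> vanishes, so the library value \<open>ln 0 = 0\<close> plays no role.
\<close>
definition I0 :: "(real \<Rightarrow> real) \<Rightarrow> (real \<Rightarrow> real) \<Rightarrow> real" where
  "I0 f g = (LINT y|lebesgue. LINT x|lebesgue. f x * g y * \<bar>x - y\<bar>\<^sup>2 * ln \<bar>x - y\<bar>)"

definition lambda0 :: real where
  "lambda0 = exp (I0 H H / 2)"

definition G0 :: "real \<Rightarrow> real" where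
  "G0 x = lambda0 * H (lambda0 * x)"

lemma G0_eq: "G0 x = 2 * lambda0 / (pi * (1 + lambda0\<^sup>2 * x\<^sup>2)\<^sup>2)"
  by (simp add: G0_def H_def power_mult_distrib)

definition moment :: "real \<Rightarrow> (real \<Rightarrow> real) \<Rightarrow> real" where
  "moment s f = (LINT x|lebesgue. f x * \<bar>x\<bar> powr s)"

definition weight :: "real \<Rightarrow> real \<Rightarrow> real" where
  "weight k x = (1 + \<bar>x\<bar>) powr k"

definition L1_weight :: "real \<Rightarrow> (real \<Rightarrow> real) set" where
  "L1_weight k = {f \<in> borel_measurable lebesgue. integrable lebesgue (\<lambda>x. \<bar>f x\<bar> * weight k x)}"

definition L2 :: "(real \<Rightarrow> real) set" where
  "L2 = {f \<in> borel_measurable lebesgue. integrable lebesgue (\<lambda>x. (f x)\<^sup>2)}"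

text \<open>The following is the norm only for \<open>f \<in> L2\<close>; otherwise the integral defaults to 0.\<close>
definition L2_norm :: "(real \<Rightarrow> real) \<Rightarrow> real" where
  "L2_norm f = sqrt (LINT x|lebesgue. (f x)\<^sup>2)"

definition C1_bounded :: "(real \<Rightarrow> real) set" where
  "C1_bounded = {\<phi>. \<phi> C1_differentiable_on UNIV \<and> bounded (range \<phi>) \<and> bounded (range (deriv \<phi>))}"

text \<open>
  \<open>Q_weak \<gamma> f g \<phi>\<close> is the pairing of the collision operator \<open>Q\<^sub>\<gamma>(f,g)\<close> with the test function
  \<open>\<phi>\<close>; the operator is defined through this pairing only. For \<open>\<gamma> = 0\<close> the library value
  \<open>0 powr 0 = 0\<close> occurs only for \<open>x = y\<close>, where the bracket vanishes.
\<close>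
definition Q_weak :: "real \<Rightarrow> (real \<Rightarrow> real) \<Rightarrow> (real \<Rightarrow> real) \<Rightarrow> (real \<Rightarrow> real) \<Rightarrow> real" where
  "Q_weak \<gamma> f g \<phi> =
     1/2 * (LINT (x, y)|(lebesgue \<Otimes>\<^sub>M lebesgue).
        f x * g y * (2 * \<phi> ((x + y) / 2) - \<phi> x - \<phi> y) * \<bar>x - y\<bar> powr \<gamma>)"

text \<open>
  Meant for \<open>0 \<le> \<gamma> < 1\<close>. As elements of a Lebesgue space, steady states are nonnegative almost
  everywhere.
\<close>
definition steady_states :: "real \<Rightarrow> (real \<Rightarrow> real) set" where
  "steady_states \<gamma> = {G.
     (AE x in lebesgue. 0 \<le> G x) \<and>
     (\<forall>s<3. G \<in> L1_weight s) \<and>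
     (LINT x|lebesgue. G x) = 1 \<and>
     (LINT x|lebesgue. x * G x) = 0 \<and>
     (\<forall>\<phi>\<in>C1_bounded. - (1/4) * (LINT x|lebesgue. x * deriv \<phi> x * G x) = Q_weak \<gamma> G G \<phi>)}"

end

theory Submission
  imports Defs "HOL-Probability.Probability"
begin

text \<open>
  Let \<open>\<sigma>\<^sup>2\<close> be the variance of a steady state and \<open>s = \<sigma>^\<gamma>\<close>. The rescaled law \<open>M\<close> of variance one solves
  the equation with kernel \<open>s |x - y|^\<gamma>\<close>, a perturbation of the equation for \<open>\<gamma> = 0\<close>. Testing with
  \<open>|x|^2\<close> gives \<open>s \<integral>\<integral> |x - y|^(2 + \<gamma>) = 2\<close>. Testing with \<open>|x|^k\<close> for \<open>2 < k < 3\<close> bounds the moments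
  uniformly in small \<open>\<gamma>\<close>, because \<open>2 (1 - 2^(1 - k)) > k / 2\<close> by strict concavity; hence
  \<open>1 - s = O(\<gamma>)\<close>. The characteristic function \<open>\<Phi>\<close> of \<open>M\<close> then satisfies
  \<open>\<Phi>(x) - x \<Phi>'(x) / 4 = \<Phi>(x/2)\<^sup>2\<close> up to an error \<open>O(\<gamma> |x|^(5/2))\<close>. Without error term the solution of
  variance one is \<open>(1 + |x|) e^(-|x|)\<close>, the transform of \<open>H\<close>, and a contraction argument shows that \<open>\<Phi>\<close>
  is close to it. To first order in \<open>\<gamma>\<close> the energy identity now reads \<open>(1/s - 1) / \<gamma> \<rightarrow> I0 H H / 2\<close>, so
  that \<open>\<sigma> = s^(1/\<gamma>) \<rightarrow> 1 / lambda0\<close>. Positivity of \<open>I0 H H\<close> follows from \<open>d\<^sup>2 ln |d| \<ge> (d\<^sup>2 - 1) / 2\<close> and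
  \<open>\<integral>\<integral> |x - y|\<^sup>2 H(x) H(y) = 2\<close>. For the bound in \<open>L\<^sup>2\<close>, closeness of \<open>\<Phi>\<close> to the transform of \<open>H\<close> gives
  uniform decay of \<open>\<Phi>\<close>, which absorbs the gain term when the equation is tested with a Gaussian
  mollification of \<open>M\<close>.
\<close>

section \<open>Product integrals of real distributions\<close>

text \<open>For \<gamma> = 0 the equation is invariant under dilations, so the limit equation cannot
  select the scale: every dilate of \<open>H\<close> solves it, and at order zero the energy
  identity for variance one only says 2 = 2. This is why the scale is factored out and recovered
  from the next order in \<gamma>. Since \<sigma> = s^(1/\<gamma>), knowing s -> 1 does not suffice;
  a rate 1 - s = O(\<gamma>) is required even to keep \<sigma> away from zero. \<open>H\<close>
  decays like |x|^(-4), so only moments below three exist and third-order expansions are out of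
  reach. The Fourier estimates are made at order 5/2, and the weight 11/4 leaves room for the small
  powers lost to the factor |x - y|^\<gamma> and to logarithms. However small \<gamma> is, |x -
  y|^\<gamma> is not close to 1 near the diagonal. What makes this harmless is that little mass lies
  there, and this is again read off from the characteristic function, averaged over a Gaussian.
  Nothing is known about how a steady state depends on \<gamma>, so thresholds and constants have to
  be the same for all profiles; hence the explicit numbers.\<close>

lemma C1_boundedI:
  fixes \<phi> :: "real \<Rightarrow> real"
  assumes "\<And>x. (\<phi> has_real_derivative D x) (at x)" "continuous_on UNIV D"
    and "\<And>x. \<bar>\<phi> x\<bar> \<le> B" "\<And>x. \<bar>D x\<bar> \<le> B'"
  shows "\<phi> \<in> C1_bounded" and "deriv \<phi> = D"
proof -
  show d: "deriv \<phi> = D" using assms(1) DERIV_imp_deriv by blast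
  have "\<phi> C1_differentiable_on UNIV"
    unfolding C1_differentiable_on_def
    using assms(1,2) has_real_derivative_iff_has_vector_derivative by blast
  moreover have "bounded (range \<phi>)" "bounded (range (deriv \<phi>))"
    using assms(3,4) by (auto simp: bounded_iff d)
  ultimately show "\<phi> \<in> C1_bounded" by (simp add: C1_bounded_def)
qed

lemma has_real_derivative_abs_powr:
  fixes x p :: real
  assumes "1 < p"
  shows "((\<lambda>x. \<bar>x\<bar> powr p) has_real_derivative p * sgn x * \<bar>x\<bar> powr (p - 1)) (at x)"
proof (cases "x = 0")
  case True
  have "((\<lambda>h::real. \<bar>h\<bar> powr (p - 1)) \<longlongrightarrow> \<bar>0\<bar> powr (p - 1)) (at 0)"
    using assms by (intro tendsto_powr' tendsto_intros) auto
  hence *: "((\<lambda>h::real. \<bar>h\<bar> powr (p - 1)) \<longlongrightarrow> 0) (at 0)" by simp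
  have "\<bar>h\<bar> powr p / h = sgn h * \<bar>h\<bar> powr (p - 1)" if "h \<noteq> 0" for h :: real
    using that by (auto simp: powr_diff sgn_if)
  hence "((\<lambda>h::real. \<bar>h\<bar> powr p / h) \<longlongrightarrow> 0) (at 0)"
    by (intro Lim_null_comparison[OF _ *]) (auto simp: eventually_at_filter powr_diff)
  thus ?thesis using True by (simp add: DERIV_def)
next
  case False
  show ?thesis
  proof (cases "x > 0")
    case True
    have "((\<lambda>x. x powr p) has_real_derivative p * x powr (p - 1)) (at x)"
      using True by (auto intro!: derivative_eq_intros)
    moreover have "eventually (\<lambda>x. x powr p = \<bar>x\<bar> powr p) (nhds x)"
      using eventually_nhds_in_open[of "{0<..}" x] True by (auto elim!: eventually_mono)
    ultimately show ?thesis using True DERIV_cong_ev by fastforce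
  next
    case f: False
    with False have x: "x < 0" by simp
    have "((\<lambda>x. (-x) powr p) has_real_derivative p * -1 * (-x) powr (p - 1)) (at x)"
      using x by (auto intro!: derivative_eq_intros)
    moreover have "eventually (\<lambda>x. (-x) powr p = \<bar>x\<bar> powr p) (nhds x)"
      using eventually_nhds_in_open[of "{..<0}" x] x by (auto elim!: eventually_mono)
    ultimately show ?thesis using x DERIV_cong_ev by fastforce
  qed
qed

lemma continuous_abs_powr_deriv:
  fixes p :: real
  assumes "1 < p"
  shows "continuous_on UNIV (\<lambda>x::real. p * sgn x * \<bar>x\<bar> powr (p - 1))"
proof -
  \<comment> \<open>Powers of the positive and negative parts are continuous, which hides the jump
    of \<open>sgn\<close> at 0.\<close>
  have *: "(\<lambda>x::real. p * sgn x * \<bar>x\<bar> powr (p - 1)) =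
     (\<lambda>x. p * (max x 0 powr (p - 1) - max (-x) 0 powr (p - 1)))"
    by (auto simp: sgn_if max_def fun_eq_iff)
  show ?thesis
    unfolding * using assms by (intro continuous_intros continuous_on_powr') auto
qed

context real_distribution
begin

sublocale pp: pair_prob_space M M ..

lemma integrable_prod_mult:
  fixes f g :: "real \<Rightarrow> real"
  assumes f: "integrable M f" and g: "integrable M g"
  shows "integrable (M \<Otimes>\<^sub>M M) (\<lambda>(x, y). f x * g y)"
proof -
  note [measurable] = borel_measurable_integrable[OF f] borel_measurable_integrable[OF g]
  show ?thesis
    by (rule pp.Fubini_integrable) (use f g in \<open>auto simp: abs_mult\<close>)
qed

lemma integral_prod_mult:
  fixes f g :: "real \<Rightarrow> real"
  assumes f: "integrable M f" and g: "integrable M g"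
  shows "(\<integral>(x, y). f x * g y \<partial>(M \<Otimes>\<^sub>M M)) = (\<integral>x. f x \<partial>M) * (\<integral>x. g x \<partial>M)"
  using pp.integral_fst'[OF integrable_prod_mult[OF f g]] by simp

lemma
  fixes f :: "real \<Rightarrow> real"
  assumes f: "integrable M f"
  shows integrable_prod_fst: "integrable (M \<Otimes>\<^sub>M M) (\<lambda>(x, y). f x)"
    and integrable_prod_snd: "integrable (M \<Otimes>\<^sub>M M) (\<lambda>(x, y). f y)"
    and integral_prod_fst: "(\<integral>(x, y). f x \<partial>(M \<Otimes>\<^sub>M M)) = (\<integral>x. f x \<partial>M)"
    and integral_prod_snd: "(\<integral>(x, y). f y \<partial>(M \<Otimes>\<^sub>M M)) = (\<integral>x. f x \<partial>M)"
  using integrable_prod_mult[OF f, of "\<lambda>_. 1"] integrable_prod_mult[OF _ f, of "\<lambda>_. 1"]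
    integral_prod_mult[OF f, of "\<lambda>_. 1"] integral_prod_mult[OF _ f, of "\<lambda>_. 1"]
  using prob_space by (auto simp: space_eq_univ)

definition weighted_moment :: "real \<Rightarrow> real" where
  "weighted_moment q = (\<integral>x. (1 + \<bar>x\<bar>) powr q \<partial>M)"

lemma prod_weight_bound:
  fixes x y q :: real
  assumes "0 \<le> q"
  shows "(1 + \<bar>x\<bar> + \<bar>y\<bar>) powr q \<le> (1 + \<bar>x\<bar>) powr q * (1 + \<bar>y\<bar>) powr q"
proof -
  have "(1 + \<bar>x\<bar> + \<bar>y\<bar>) powr q \<le> ((1 + \<bar>x\<bar>) * (1 + \<bar>y\<bar>)) powr q"
    using assms by (intro powr_mono2) (auto simp: algebra_simps)
  thus ?thesis by (simp add: powr_mult)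
qed

text \<open>Since 1 + |x| + |y| \<le> (1 + |x|)(1 + |y|), polynomial growth of order
  \<open>q\<close> in both variables costs one weighted moment per variable. Most kernels on the
  product are shown integrable in this way, and the second claim gives estimates whose constants
  depend on the law only through that moment.\<close>

lemma
  assumes q: "0 \<le> q" and int: "integrable M (\<lambda>x. (1 + \<bar>x\<bar>) powr q)"
    and f: "f \<in> borel_measurable (M \<Otimes>\<^sub>M M)"
    and le: "\<And>x y. norm (f (x, y) :: 'b::{banach, second_countable_topology}) \<le> C * (1 + \<bar>x\<bar> + \<bar>y\<bar>) powr q"
  shows integrable_prod_dom: "integrable (M \<Otimes>\<^sub>M M) f"
    and integral_prod_dom: "(\<integral>p. norm (f p) \<partial>(M \<Otimes>\<^sub>M M)) \<le> C * (weighted_moment q)\<^sup>2"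
proof -
  have i2: "integrable (M \<Otimes>\<^sub>M M) (\<lambda>(x, y). (1 + \<bar>x\<bar>) powr q * (1 + \<bar>y\<bar>) powr q)"
    by (intro integrable_prod_mult int)
  have C: "0 \<le> C" using order_trans[OF norm_ge_zero le[of 0 0]] by simp
  have b: "norm (f p) \<le> (case p of (x, y) \<Rightarrow> C * ((1 + \<bar>x\<bar>) powr q * (1 + \<bar>y\<bar>) powr q))" for p
  proof (cases p)
    case (Pair x y)
    thus ?thesis
      using le[of x y] mult_left_mono[OF prod_weight_bound[OF q, of x y] C] by simp
  qed
  have i3: "integrable (M \<Otimes>\<^sub>M M) (\<lambda>(x, y). C * ((1 + \<bar>x\<bar>) powr q * (1 + \<bar>y\<bar>) powr q))"
    using integrable_mult_right[OF i2, of C] by (simp add: split_beta')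
  show i: "integrable (M \<Otimes>\<^sub>M M) f"
    by (intro Bochner_Integration.integrable_bound[OF i3 f] AE_I2, unfold real_norm_def)
      (rule order_trans[OF b abs_ge_self])
  have "(\<integral>p. norm (f p) \<partial>(M \<Otimes>\<^sub>M M)) \<le> (\<integral>(x, y). C * ((1 + \<bar>x\<bar>) powr q * (1 + \<bar>y\<bar>) powr q) \<partial>(M \<Otimes>\<^sub>M M))"
    using b by (intro integral_mono i3 integrable_norm i) auto
  also have "\<dots> = C * (\<integral>(x, y). ((1 + \<bar>x\<bar>) powr q * (1 + \<bar>y\<bar>) powr q) \<partial>(M \<Otimes>\<^sub>M M))"
    by (simp add: split_beta')
  also have "\<dots> = C * (weighted_moment q)\<^sup>2"
    by (subst integral_prod_mult[OF int int]) (simp add: weighted_moment_def power2_eq_square)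
  finally show "(\<integral>p. norm (f p) \<partial>(M \<Otimes>\<^sub>M M)) \<le> C * (weighted_moment q)\<^sup>2" .
qed

lemma integrable_dom:
  assumes int: "integrable M (\<lambda>x. (1 + \<bar>x\<bar>) powr q)"
    and f: "f \<in> borel_measurable borel"
    and le: "\<And>x. norm (f x :: 'b::{banach, second_countable_topology}) \<le> C * (1 + \<bar>x\<bar>) powr q"
  shows "integrable M f" and "(\<integral>p. norm (f p) \<partial>M) \<le> C * weighted_moment q"
proof -
  show i: "integrable M f"
  proof (rule Bochner_Integration.integrable_bound[OF integrable_mult_right[OF int, of C]])
    show "f \<in> borel_measurable M" using f by simp
    show "AE x in M. norm (f x) \<le> norm (C * (1 + \<bar>x\<bar>) powr q)"
      by (intro AE_I2, unfold real_norm_def) (rule order_trans[OF le abs_ge_self])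
  qed
  have "(\<integral>p. norm (f p) \<partial>M) \<le> (\<integral>x. C * (1 + \<bar>x\<bar>) powr q \<partial>M)"
    using le int by (intro integral_mono integrable_norm i) auto
  thus "(\<integral>p. norm (f p) \<partial>M) \<le> C * weighted_moment q" by (simp add: weighted_moment_def)
qed

end

section \<open>Normalized profiles and moments\<close>

text \<open>The drift term is invariant under dilations and |x - y|^\<gamma> is homogeneous, so
  dividing the variable by \<sigma> changes the equation only by the factor \<open>s\<close>. Mean
  zero and variance one fix the Taylor polynomial of order two of the characteristic function. The
  relation between \<open>s\<close> and \<sigma> is not recorded here; it reappears as
  \<open>s powr (1 / \<gamma>)\<close>.\<close>

locale profile = real_distribution M for M +
  fixes s \<gamma> :: real
  assumes gamma_pos: "0 < \<gamma>" and gamma_less: "\<gamma> < 1" and s_pos: "0 < s"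
    and moments: "q < 3 \<Longrightarrow> integrable M (\<lambda>x. (1 + \<bar>x\<bar>) powr q)"
    and mean_zero: "(\<integral>x. x \<partial>M) = 0"
    and var_one: "(\<integral>x. x\<^sup>2 \<partial>M) = 1"
    and weak: "\<phi> \<in> C1_bounded \<Longrightarrow> - (1/4) * (\<integral>x. x * deriv \<phi> x \<partial>M)
      = s / 2 * (\<integral>(x, y). (2 * \<phi> ((x + y) / 2) - \<phi> x - \<phi> y) * \<bar>x - y\<bar> powr \<gamma> \<partial>(M \<Otimes>\<^sub>M M))"

section \<open>Convexity inequalities for real powers\<close>

lemma powr_le_affine:
  fixes t a :: real
  assumes "0 \<le> t" "0 \<le> a" "a \<le> 1"
  shows "t powr a \<le> 1 + a * (t - 1)"
proof (cases "t = 0")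
  case False
  define b where "b = t powr a"
  define l where "l = ln t"
  have t: "t = exp l" and b: "b = exp (a * l)" "0 \<le> b"
    using False assms by (auto simp: l_def b_def powr_def)
  have "b * (1 - a * l) \<le> b * exp (- (a * l))"
    using exp_ge_add_one_self[of "- (a * l)"] b(2) by (intro mult_left_mono) auto
  hence 1: "b * (1 - a * l) \<le> 1" by (simp add: b exp_minus)
  have "b * (1 + (1 - a) * l) \<le> b * exp ((1 - a) * l)"
    using exp_ge_add_one_self[of "(1 - a) * l"] b(2) by (intro mult_left_mono) auto
  hence 2: "b * (1 + (1 - a) * l) \<le> t" by (simp add: b t algebra_simps flip: exp_add)
  \<comment> \<open>Bernoulli's inequality: the convex combination with weights 1 - a and a of the
    two bounds cancels the logarithm.\<close>
  have "b = (1 - a) * (b * (1 - a * l)) + a * (b * (1 + (1 - a) * l))" by (simp add: algebra_simps)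
  also have "\<dots> \<le> (1 - a) * 1 + a * t" using 1 2 assms by (intro add_mono mult_left_mono) auto
  finally show ?thesis by (simp add: b_def algebra_simps)
qed (use assms in auto)

lemma abs_powr_2: "\<bar>x::real\<bar> powr 2 = x\<^sup>2"
  by simp

text \<open>In the variable v = u^2 the left side is the tangent at v = 1 of the convex function
  v^(1 + a/2). It is affine in u^2, so its mean is known exactly once the variance is.\<close>

lemma abs_powr_ge_tangent:
  fixes u a :: real
  assumes "0 \<le> a"
  shows "u\<^sup>2 + a / 2 * (u\<^sup>2 - 1) \<le> \<bar>u\<bar> powr (2 + a)"
proof (cases "u = 0")
  case False
  have "u\<^sup>2 * ln (u\<^sup>2) \<ge> u\<^sup>2 - 1"
    using ln_le_minus_one[of "1 / u\<^sup>2"] False by (simp add: ln_div field_simps)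
  hence "a / 2 * (u\<^sup>2 - 1) \<le> a / 2 * (u\<^sup>2 * ln (u\<^sup>2))" using assms by (intro mult_left_mono) auto
  also have "\<dots> = u\<^sup>2 * (a * ln \<bar>u\<bar>)" using ln_realpow[of "\<bar>u\<bar>" 2] False by simp
  finally have "u\<^sup>2 + a / 2 * (u\<^sup>2 - 1) \<le> u\<^sup>2 * (1 + a * ln \<bar>u\<bar>)" by (simp add: algebra_simps)
  also have "\<dots> \<le> u\<^sup>2 * exp (a * ln \<bar>u\<bar>)" by (intro mult_left_mono exp_ge_add_one_self) auto
  also have "\<dots> = \<bar>u\<bar> powr (2 + a)" unfolding powr_add abs_powr_2 using False by (simp add: powr_def)
  finally show ?thesis .
qed (use assms in auto)

text \<open>The bound is arranged so that its double integral is twice the moment of order 2 + a, up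
  to a factor 1 + O(a): the product x y must appear with its exact coefficient because only its mean
  vanishes, and every other mixed term carries a factor a. If |x - y| \<le> 1 the factor |x - y|^a
  is at most 1. Otherwise the square is expanded; the two squares use |x - y| \<le> max 1 |x| (1 +
  |y|), and the product term uses 0 \<le> |x - y|^a - 1 \<le> a (|x| + |y|).\<close>

lemma abs_powr_diff_upper:
  fixes x y a :: real
  defines "A \<equiv> \<lambda>x. x\<^sup>2 * max 1 (\<bar>x\<bar> powr a)"
  assumes a: "0 < a" "a < 1"
  shows "\<bar>x - y\<bar> powr (2 + a) \<le> A x * (1 + a * \<bar>y\<bar>) + A y * (1 + a * \<bar>x\<bar>) - 2 * (x * y)
    + 2 * a * (\<bar>x\<bar> * \<bar>y\<bar> * (\<bar>x\<bar> + \<bar>y\<bar>))"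
proof -
  have Age: "x\<^sup>2 \<le> A x * (1 + a * \<bar>y\<bar>)" for x y
  proof -
    have "x\<^sup>2 * 1 \<le> A x" unfolding A_def by (intro mult_left_mono) auto
    moreover have "A x * 1 \<le> A x * (1 + a * \<bar>y\<bar>)"
      using a by (intro mult_left_mono) (auto simp: A_def)
    ultimately show ?thesis by linarith
  qed
  have D: "\<bar>x - y\<bar> powr (2 + a) = (x - y)\<^sup>2 * \<bar>x - y\<bar> powr a" by (simp add: powr_add)
  have sq: "(x - y)\<^sup>2 = x\<^sup>2 + y\<^sup>2 - 2 * (x * y)" by (simp add: power2_eq_square algebra_simps)
  have nn: "0 \<le> 2 * a * (\<bar>x\<bar> * \<bar>y\<bar> * (\<bar>x\<bar> + \<bar>y\<bar>))" using a by auto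
  show ?thesis
  proof (cases "\<bar>x - y\<bar> \<le> 1")
    case True
    hence "\<bar>x - y\<bar> powr a \<le> 1" using a by (intro powr_le1) auto
    hence "(x - y)\<^sup>2 * \<bar>x - y\<bar> powr a \<le> (x - y)\<^sup>2 * 1" by (intro mult_left_mono) auto
    thus ?thesis using Age[of x y] Age[of y x] nn unfolding D using sq by linarith
  next
    case False
    have B: "x\<^sup>2 * \<bar>x - y\<bar> powr a \<le> A x * (1 + a * \<bar>y\<bar>)" for x y
    proof -
      have "\<bar>x - y\<bar> \<le> max 1 \<bar>x\<bar> * (1 + \<bar>y\<bar>)"
      proof -
        have "1 * \<bar>y\<bar> \<le> max 1 \<bar>x\<bar> * \<bar>y\<bar>" by (intro mult_right_mono) auto
        moreover have "\<bar>x\<bar> \<le> max 1 \<bar>x\<bar>" by simp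
        ultimately show ?thesis unfolding distrib_left using abs_triangle_ineq4[of x y] by linarith
      qed
      hence "\<bar>x - y\<bar> powr a \<le> (max 1 \<bar>x\<bar> * (1 + \<bar>y\<bar>)) powr a"
        using a by (intro powr_mono2) auto
      also have "\<dots> = max 1 \<bar>x\<bar> powr a * (1 + \<bar>y\<bar>) powr a" by (simp add: powr_mult)
      also have "max 1 \<bar>x\<bar> powr a = max 1 (\<bar>x\<bar> powr a)"
        using a ge_one_powr_ge_zero[of "\<bar>x\<bar>" a] powr_le1[of a "\<bar>x\<bar>"] by (auto simp: max_def)
      also have "max 1 (\<bar>x\<bar> powr a) * (1 + \<bar>y\<bar>) powr a \<le> max 1 (\<bar>x\<bar> powr a) * (1 + a * \<bar>y\<bar>)"
        using powr_le_affine[of "1 + \<bar>y\<bar>" a] a by (intro mult_left_mono) auto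
      finally show ?thesis unfolding A_def by (simp add: mult.assoc mult_left_mono)
    qed
    have "1 \<le> \<bar>x - y\<bar> powr a" using False a by (intro ge_one_powr_ge_zero) auto
    moreover have "\<bar>x - y\<bar> powr a \<le> 1 + a * (\<bar>x - y\<bar> - 1)" using a by (intro powr_le_affine) auto
    moreover have "a * (\<bar>x - y\<bar> - 1) \<le> a * (\<bar>x\<bar> + \<bar>y\<bar>)" using a by (intro mult_left_mono) auto
    ultimately have "\<bar>\<bar>x - y\<bar> powr a - 1\<bar> \<le> a * (\<bar>x\<bar> + \<bar>y\<bar>)" by linarith
    hence "\<bar>x * y\<bar> * \<bar>\<bar>x - y\<bar> powr a - 1\<bar> \<le> \<bar>x * y\<bar> * (a * (\<bar>x\<bar> + \<bar>y\<bar>))" by (intro mult_left_mono) auto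
    moreover have "\<bar>(x * y) * (\<bar>x - y\<bar> powr a - 1)\<bar> = \<bar>x * y\<bar> * \<bar>\<bar>x - y\<bar> powr a - 1\<bar>" by (rule abs_mult)
    ultimately have C: "- 2 * ((x * y) * (\<bar>x - y\<bar> powr a - 1)) \<le> 2 * (\<bar>x * y\<bar> * (a * (\<bar>x\<bar> + \<bar>y\<bar>)))"
      by linarith
    have "(x - y)\<^sup>2 * \<bar>x - y\<bar> powr a = x\<^sup>2 * \<bar>x - y\<bar> powr a + y\<^sup>2 * \<bar>y - x\<bar> powr a - 2 * (x * y)
       - 2 * ((x * y) * (\<bar>x - y\<bar> powr a - 1))"
      unfolding sq by (simp add: algebra_simps abs_minus_commute)
    thus ?thesis using B[of x y] B[of y x] C unfolding D by (simp add: abs_mult algebra_simps)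
  qed
qed

text \<open>Convexity of |.|^p through the tangent at the midpoint. The tangent inequality is
  Bernoulli's inequality \<open>powr_le_affine\<close> with exponent 1/p, applied to a p-th
  power.\<close>

lemma midpoint_powr_le:
  fixes u v p :: real
  assumes "1 \<le> p"
  shows "2 * \<bar>(u + v) / 2\<bar> powr p \<le> \<bar>u\<bar> powr p + \<bar>v\<bar> powr p"
proof -
  have *: "2 * ((a + b) / 2) powr p \<le> a powr p + b powr p" if "0 \<le> a" "0 \<le> b" for a b :: real
  proof -
    define m where "m = (a + b) / 2"
    show ?thesis
    proof (cases "m = 0")
      case False
      hence m: "0 < m" using that by (simp add: m_def)
      have T: "m powr p + p * m powr (p - 1) * (c - m) \<le> c powr p" if "0 \<le> c" for c
      proof (cases "c = 0")
        case True
        have "m powr (p - 1) * m = m powr p" using m by (simp add: powr_diff)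
        thus ?thesis using True assms m by (simp add: algebra_simps mult_le_cancel_right1)
      next
        case False
        hence c: "0 < c" using that by simp
        have "1 + p * (c / m - 1) \<le> (c / m) powr p"
        proof -
          have "((c/m) powr p) powr (1/p) \<le> 1 + (1/p) * ((c/m) powr p - 1)"
            using assms c m by (intro powr_le_affine) auto
          moreover have "((c/m) powr p) powr (1/p) = c / m"
            using assms c m by (simp add: powr_powr del: powr_divide)
          ultimately have "c / m \<le> 1 + (1/p) * ((c/m) powr p - 1)" by simp
          thus ?thesis using assms by (simp add: field_simps)
        qed
        hence "m powr p * (1 + p * (c / m - 1)) \<le> m powr p * (c / m) powr p" by (intro mult_left_mono) auto
        also have "\<dots> = c powr p" using c m by (simp flip: powr_mult)
        finally show ?thesis using m by (simp add: powr_diff field_simps)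
      qed
      have "2 * m powr p = (m powr p + p * m powr (p - 1) * (a - m)) + (m powr p + p * m powr (p - 1) * (b - m))"
        by (simp add: m_def field_simps)
      thus ?thesis using T[OF that(1)] T[OF that(2)] unfolding m_def by linarith
    qed (auto simp flip: m_def)
  qed
  have "\<bar>(u + v) / 2\<bar> powr p \<le> ((\<bar>u\<bar> + \<bar>v\<bar>) / 2) powr p"
    using assms by (intro powr_mono2) auto
  thus ?thesis using *[of "\<bar>u\<bar>" "\<bar>v\<bar>"] by linarith
qed

text \<open>Coercivity of the collision term on powers. If |y| is much smaller than |x|, the bracket
  is close to (1 - 2^(1-k)) |x|^k and the kernel to |x|^a. If they are comparable, the coefficient 4
  makes the left side nonpositive while the right side is nonnegative by convexity. With |y| \<le>
  |x|, t = |y| / |x| and c = 1 - 2^(1-k), everything is divided by |x|^(k+a): the left side is at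
  most c - 3t, the right side at least (c - 2t)(1 - t) when c > 3t. The subtracted terms are of
  lower order in each variable.\<close>

lemma powr_collision_lower:
  fixes x y k a :: real
  assumes k: "2 \<le> k" and a: "0 < a" "a < 1"
  shows "(1 - 2 powr (1 - k)) * (\<bar>x\<bar> powr (k + a) + \<bar>y\<bar> powr (k + a))
      - 4 * (\<bar>x\<bar> powr (k + a - 1) * \<bar>y\<bar> + \<bar>y\<bar> powr (k + a - 1) * \<bar>x\<bar>)
    \<le> (\<bar>x\<bar> powr k + \<bar>y\<bar> powr k - 2 * \<bar>(x + y) / 2\<bar> powr k) * \<bar>x - y\<bar> powr a" (is "?L x y \<le> ?R x y")
proof -
  have *: "?L x y \<le> ?R x y" if le: "\<bar>y\<bar> \<le> \<bar>x\<bar>" for x y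
  proof (cases "x = 0")
    case True
    thus ?thesis using le k a by simp
  next
    case False
    define c where "c = 1 - 2 powr (1 - k)"
    define X where "X = \<bar>x\<bar>"
    define t where "t = \<bar>y\<bar> / X"
    have X: "0 < X" using False by (simp add: X_def)
    have t: "0 \<le> t" "t \<le> 1" "\<bar>y\<bar> = t * X" using X le by (auto simp: t_def X_def)
    have c: "0 \<le> c" "c \<le> 1" using k powr_mono[of "1 - k" 0 2] by (auto simp: c_def)
    have B0: "0 \<le> \<bar>x\<bar> powr k + \<bar>y\<bar> powr k - 2 * \<bar>(x + y) / 2\<bar> powr k" (is "0 \<le> ?B")
      using midpoint_powr_le[of k x y] k by simp
    have tp: "t powr q \<le> t" if "1 \<le> q" for q
    proof (cases "t = 0")
      case False
      thus ?thesis using powr_mono'[of 1 q t] t that by simp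
    qed auto
    have Xm: "(t * X) powr (k + a) = t powr (k + a) * X powr (k + a)" 
      "(t * X) powr (k + a - 1) * X = t powr (k + a - 1) * X powr (k + a)"
      "X powr (k + a - 1) * (t * X) = t * X powr (k + a)"
      using t X by (auto simp: powr_mult powr_diff)
    have "?L x y = X powr (k + a) * (c * (1 + t powr (k + a)) - 4 * (t + t powr (k + a - 1)))"
      unfolding X_def[symmetric] t(3) c_def[symmetric] Xm by (simp add: algebra_simps)
    also have "\<dots> \<le> X powr (k + a) * (c - 3 * t)"
    proof (intro mult_left_mono)
      have "c * (1 + t powr (k + a)) \<le> c * (1 + t)" using c tp[of "k + a"] k a by (intro mult_left_mono) auto
      moreover have "c * t \<le> 1 * t" using c t by (intro mult_right_mono) auto
      moreover have "0 \<le> t powr (k + a - 1)" by simp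
      ultimately show "c * (1 + t powr (k + a)) - 4 * (t + t powr (k + a - 1)) \<le> c - 3 * t"
        unfolding distrib_left by linarith
    qed auto
    finally have L: "?L x y \<le> X powr (k + a) * (c - 3 * t)" .
    show ?thesis
    proof (cases "c - 3 * t \<le> 0")
      case True
      hence "X powr (k + a) * (c - 3 * t) \<le> 0" by (intro mult_nonneg_nonpos) auto
      moreover have "0 \<le> ?R x y" using B0 by (intro mult_nonneg_nonneg) auto
      ultimately show ?thesis using L by linarith
    next
      case pos: False
      have "2 * \<bar>(x + y) / 2\<bar> powr k \<le> X powr k * (2 powr (1 - k) + 2 * t)"
      proof -
        have "\<bar>(x + y) / 2\<bar> powr k \<le> (X * ((1 + t) / 2)) powr k"
          using k abs_triangle_ineq[of x y] t(3) by (intro powr_mono2) (auto simp: X_def field_simps)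
        also have "\<dots> = X powr k * ((1 + t) / 2) powr k" using X t by (intro powr_mult)
        \<comment> \<open>Chord of the convex power between 1/2 and 1: (1 + t)/2 is their
          combination with weights 1 - t and t.\<close>
        also have "((1 + t) / 2) powr k \<le> 2 powr (-k) + t"
        proof -
          have "((1 + t) / 2) powr k = ((1 - t) * (1/2) + t * 1) powr k" by (simp add: field_simps)
          also have "\<dots> \<le> (1 - t) * (1/2) powr k + t * 1 powr k"
          proof -
            have cv: "convex_on {0<..} (\<lambda>x::real. x powr k)" using k by (intro powr_convex) auto
            show ?thesis using convex_onD[OF cv, of t "1/2" 1] t by simp
          qed
          also have "\<dots> \<le> 1 * (1/2) powr k + t" using t by (intro add_mono mult_right_mono) auto
          finally show ?thesis by (simp add: powr_minus powr_divide divide_simps)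
        qed
        finally have "\<bar>(x + y) / 2\<bar> powr k \<le> X powr k * (2 powr (-k) + t)"
          by (simp add: mult_left_mono)
        thus ?thesis by (simp add: powr_diff powr_minus field_simps)
      qed
      moreover have "X powr k * (c - 2 * t) = X powr k - X powr k * (2 powr (1 - k) + 2 * t)"
        by (simp add: c_def algebra_simps)
      moreover have "0 \<le> \<bar>y\<bar> powr k" by simp
      ultimately have B: "X powr k * (c - 2 * t) \<le> ?B" unfolding X_def by linarith
      have "(X * (1 - t)) powr a \<le> \<bar>x - y\<bar> powr a"
        using a t abs_triangle_ineq2[of x y] X by (intro powr_mono2) (auto simp: X_def algebra_simps)
      moreover have "X powr a * (1 - t) \<le> (X * (1 - t)) powr a"
      proof -
        have "1 - t \<le> (1 - t) powr a"
          using powr_mono'[of a 1 "1 - t"] t a by (cases "t = 1") auto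
        thus ?thesis using X t by (simp add: powr_mult mult_left_mono)
      qed
      ultimately have D: "X powr a * (1 - t) \<le> \<bar>x - y\<bar> powr a" by linarith
      have "(c - 3 * t) \<le> (c - 2 * t) * (1 - t)"
      proof -
        have "c * t \<le> t" using c t by (simp add: mult_left_le_one_le)
        moreover have "0 \<le> t * t" by simp
        moreover have "(c - 2 * t) * (1 - t) = c - c * t - 2 * t + 2 * (t * t)" by (simp add: algebra_simps)
        ultimately show ?thesis by linarith
      qed
      hence "X powr (k + a) * (c - 3 * t) \<le> X powr (k + a) * ((c - 2 * t) * (1 - t))" by (intro mult_left_mono) auto
      also have "\<dots> = (X powr k * (c - 2 * t)) * (X powr a * (1 - t))" by (simp add: powr_add)
      also have "\<dots> \<le> ?B * \<bar>x - y\<bar> powr a" using B D B0 t by (intro mult_mono) auto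
      finally show ?thesis using L by linarith
    qed
  qed
  show ?thesis
  proof (cases "\<bar>y\<bar> \<le> \<bar>x\<bar>")
    case False
    thus ?thesis using *[of x y] by (simp add: add.commute abs_minus_commute)
  qed (rule *)
qed

section \<open>The equation tested with powers of |x|\<close>

context profile
begin

text \<open>The power a(x) = |x|^p is not bounded, so it is replaced by N a / (N + a) with N tending
  to infinity. These functions are C^1, bounded by N and by a, and x times their derivative is
  bounded by p a uniformly in N. Dominated convergence then applies on both sides, with the
  integrable majorant of order p + \<gamma> on the product.\<close>

lemma moment_eq:
  assumes p: "2 \<le> p" "p + \<gamma> < 3"
  shows "p / 2 * (\<integral>x. \<bar>x\<bar> powr p \<partial>M)
    = s * (\<integral>(x, y). (\<bar>x\<bar> powr p + \<bar>y\<bar> powr p - 2 * \<bar>(x + y) / 2\<bar> powr p) * \<bar>x - y\<bar> powr \<gamma> \<partial>(M \<Otimes>\<^sub>M M))"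
proof -
  define a where "a x = \<bar>x\<bar> powr p" for x :: real
  define a' where "a' x = p * sgn x * \<bar>x\<bar> powr (p - 1)" for x :: real
  define N where "N n = real (Suc n)" for n
  define \<phi> where "\<phi> n x = N n * a x / (N n + a x)" for n x
  define D where "D n x = (N n)\<^sup>2 * a' x / (N n + a x)\<^sup>2" for n x
  have a0: "0 \<le> a x" for x by (simp add: a_def)
  have N1: "1 \<le> N n" for n by (simp add: N_def)
  have da: "(a has_real_derivative a' x) (at x)" for x
    unfolding a_def[abs_def] a'_def using has_real_derivative_abs_powr[of p x] p by simp
  have ca': "continuous_on UNIV a'"
    unfolding a'_def[abs_def] using continuous_abs_powr_deriv[of p] p by simp
  have ca: "continuous_on UNIV a"
    using da by (meson DERIV_isCont continuous_at_imp_continuous_on)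
  have [measurable]: "a \<in> borel_measurable borel" "a' \<in> borel_measurable borel"
    using ca ca' by (auto intro: borel_measurable_continuous_onI)
  have \<phi>m[measurable]: "\<phi> n \<in> borel_measurable borel" "D n \<in> borel_measurable borel" for n
    unfolding \<phi>_def[abs_def] D_def[abs_def] by measurable
  have NA: "0 < N n + a x" for n x using a0[of x] N1[of n] by linarith
  have d\<phi>: "(\<phi> n has_real_derivative D n x) (at x)" for n x
    unfolding \<phi>_def[abs_def] D_def using NA[of n x]
    by (auto intro!: derivative_eq_intros da simp: power2_eq_square field_simps)
  have \<phi>0: "0 \<le> \<phi> n x" for n x unfolding \<phi>_def using NA[of n x] a0[of x] N1[of n] by simp
  have \<phi>N: "\<phi> n x \<le> N n" for n x
    unfolding \<phi>_def using NA[of n x] a0[of x] N1[of n] by (simp add: field_simps)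
  have \<phi>a: "\<phi> n x \<le> a x" for n x
    unfolding \<phi>_def using NA[of n x] a0[of x] N1[of n] by (simp add: field_simps)
  have a'le: "\<bar>a' x\<bar> \<le> p * (1 + a x)" for x
  proof -
    have "\<bar>x\<bar> powr (p - 1) \<le> 1 + \<bar>x\<bar> powr p"
    proof (cases "\<bar>x\<bar> \<le> 1")
      case True
      hence "\<bar>x\<bar> powr (p - 1) \<le> 1" using p by (intro powr_le1) auto
      thus ?thesis by (simp add: add_increasing2)
    next
      case False
      hence "\<bar>x\<bar> powr (p - 1) \<le> \<bar>x\<bar> powr p" by (intro powr_mono) auto
      thus ?thesis by simp
    qed
    thus ?thesis unfolding a'_def a_def using p
      by (auto simp: abs_mult sgn_if intro!: mult_left_mono add_nonneg_nonneg)
  qed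
  have Dle: "\<bar>D n x\<bar> \<le> (N n)\<^sup>2 * p" for n x
  proof -
    have "1 + a x \<le> (N n + a x)\<^sup>2"
      using N1[of n] a0[of x] self_le_power[of "N n + a x" 2] by linarith
    hence "p * (1 + a x) \<le> p * (N n + a x)\<^sup>2" using p by (intro mult_left_mono) auto
    hence "\<bar>a' x\<bar> \<le> p * (N n + a x)\<^sup>2" using a'le[of x] by linarith
    hence "\<bar>a' x\<bar> / (N n + a x)\<^sup>2 \<le> p" using NA[of n x] by (simp add: field_simps)
    hence "(N n)\<^sup>2 * (\<bar>a' x\<bar> / (N n + a x)\<^sup>2) \<le> (N n)\<^sup>2 * p" by (intro mult_left_mono) auto
    thus ?thesis by (simp add: D_def abs_mult)
  qed
  have xa': "x * a' x = p * a x" for x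
    by (auto simp: a'_def a_def sgn_if powr_diff)
  have xD: "\<bar>x * D n x\<bar> \<le> p * a x" for n x
  proof -
    have e: "x * D n x = (N n)\<^sup>2 / (N n + a x)\<^sup>2 * (p * a x)"
      unfolding D_def xa'[symmetric] by (simp add: field_simps)
    have "(N n)\<^sup>2 / (N n + a x)\<^sup>2 \<le> 1"
      using N1[of n] a0[of x] NA[of n x] by (simp add: power_mono divide_le_eq)
    hence "(N n)\<^sup>2 / (N n + a x)\<^sup>2 * (p * a x) \<le> p * a x"
      by (intro mult_left_le_one_le) (use p a0[of x] in auto)
    thus ?thesis unfolding e using p a0[of x] by (subst abs_of_nonneg) auto
  qed
  have Dcont: "continuous_on UNIV (D n)" for n
    unfolding D_def[abs_def] using NA by (intro continuous_intros ca' ca) (metis less_numeral_extra(3) power_not_zero)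
  have C1: "\<phi> n \<in> C1_bounded" "deriv (\<phi> n) = D n" for n
    using C1_boundedI[of "\<phi> n" "D n" "N n" "(N n)\<^sup>2 * p", OF d\<phi> Dcont _ Dle]
    \<phi>0 \<phi>N by (auto simp: abs_of_nonneg)
  define F where "F \<psi> = (\<lambda>(x, y). (2 * \<psi> ((x + y) / 2) - \<psi> x - \<psi> y) * \<bar>x - y\<bar> powr \<gamma>)" for \<psi> :: "real \<Rightarrow> real"
  have Fm[measurable]: "F \<psi> \<in> borel_measurable (M \<Otimes>\<^sub>M M)" if [measurable]: "\<psi> \<in> borel_measurable borel" for \<psi>
    unfolding F_def by measurable
  have eq: "- (1/4) * (\<integral>x. x * D n x \<partial>M) = s / 2 * (\<integral>z. F (\<phi> n) z \<partial>(M \<Otimes>\<^sub>M M))" for n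
    using weak[OF C1(1)[of n]] by (simp add: C1(2) F_def)
  have Nlim: "filterlim N at_top sequentially"
    unfolding N_def using filterlim_Suc filterlim_compose filterlim_real_sequentially by blast
  have r: "(\<lambda>n. N n / (N n + c)) \<longlonglongrightarrow> 1" for c
  proof -
    have "(\<lambda>n. 1 - c / (N n + c)) \<longlonglongrightarrow> 1 - 0"
      using filterlim_tendsto_add_at_top[OF tendsto_const Nlim, of c]
      by (intro tendsto_intros real_tendsto_divide_at_top[OF tendsto_const]) (simp add: add.commute)
    moreover have "eventually (\<lambda>n. 1 - c / (N n + c) = N n / (N n + c)) sequentially"
      using Nlim[unfolded filterlim_at_top_dense, rule_format, of "-c"]
      by eventually_elim (auto simp: field_simps)
    ultimately show ?thesis by (simp add: tendsto_cong)
  qed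
  have \<phi>lim: "(\<lambda>n. \<phi> n x) \<longlonglongrightarrow> a x" for x
    using tendsto_mult[OF r[of "a x"] tendsto_const[of "a x"]] by (simp add: \<phi>_def)
  have Dlim: "(\<lambda>n. D n x) \<longlonglongrightarrow> a' x" for x
    using tendsto_mult[OF tendsto_power[OF r[of "a x"], of 2] tendsto_const[of "a' x"]]
    by (simp add: D_def power_divide)
  have ale: "a x \<le> (1 + \<bar>x\<bar>) powr p" for x
    unfolding a_def using p by (intro powr_mono2) auto
  have inta: "integrable M a"
    by (rule integrable_dom(1)[OF moments[of p], of _ 1]) (use p gamma_pos ale a0 in auto)
  have L: "(\<lambda>n. \<integral>x. x * D n x \<partial>M) \<longlonglongrightarrow> (\<integral>x. x * a' x \<partial>M)"
  proof (rule integral_dominated_convergence[where w="\<lambda>x. p * a x"])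
    show "integrable M (\<lambda>x. p * a x)" using inta by simp
  qed (use xD in \<open>auto intro!: AE_I2 tendsto_intros Dlim\<close>)
  have w: "a x \<le> (1 + \<bar>x\<bar> + \<bar>y\<bar>) powr p" "a y \<le> (1 + \<bar>x\<bar> + \<bar>y\<bar>) powr p"
    "a ((x + y)/2) \<le> (1 + \<bar>x\<bar> + \<bar>y\<bar>) powr p" 
    "\<bar>x - y\<bar> powr \<gamma> \<le> (1 + \<bar>x\<bar> + \<bar>y\<bar>) powr \<gamma>" for x y :: real
    unfolding a_def using p gamma_pos by (auto intro!: powr_mono2)
  have R: "(\<lambda>n. \<integral>z. F (\<phi> n) z \<partial>(M \<Otimes>\<^sub>M M)) \<longlonglongrightarrow> (\<integral>z. F a z \<partial>(M \<Otimes>\<^sub>M M))"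
  proof (rule integral_dominated_convergence[where w="\<lambda>(x, y). 4 * (1 + \<bar>x\<bar> + \<bar>y\<bar>) powr (p + \<gamma>)"])
    show "integrable (M \<Otimes>\<^sub>M M) (\<lambda>(x, y). 4 * (1 + \<bar>x\<bar> + \<bar>y\<bar>) powr (p + \<gamma>))"
      by (rule integrable_prod_dom[OF _ moments[of "p + \<gamma>"], of _ 4]) (use p gamma_pos in auto)
    show "AE z in M \<Otimes>\<^sub>M M. (\<lambda>n. F (\<phi> n) z) \<longlonglongrightarrow> F a z"
      unfolding F_def by (auto intro!: AE_I2 tendsto_intros \<phi>lim)
    fix n
    show "AE z in M \<Otimes>\<^sub>M M. norm (F (\<phi> n) z) \<le> (\<lambda>(x, y). 4 * (1 + \<bar>x\<bar> + \<bar>y\<bar>) powr (p + \<gamma>)) z"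
    proof (intro AE_I2, clarify)
      fix x y :: real
      have "\<bar>2 * \<phi> n ((x + y) / 2) - \<phi> n x - \<phi> n y\<bar> \<le> 4 * (1 + \<bar>x\<bar> + \<bar>y\<bar>) powr p"
        using w(1)[of x y] w(2)[of y x] w(3)[of x y] \<phi>a[of n x] \<phi>a[of n y] \<phi>a[of n "(x+y)/2"]
          \<phi>0[of n x] \<phi>0[of n y] \<phi>0[of n "(x+y)/2"] by linarith
      thus "norm (F (\<phi> n) (x, y)) \<le> 4 * (1 + \<bar>x\<bar> + \<bar>y\<bar>) powr (p + \<gamma>)"
        using w(4)[of x y] by (auto simp: F_def abs_mult powr_add mult.assoc[symmetric] intro!: mult_mono)
    qed
  qed measurable
  have "- (1/4) * (\<integral>x. x * a' x \<partial>M) = s / 2 * (\<integral>z. F a z \<partial>(M \<Otimes>\<^sub>M M))"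
    using LIMSEQ_unique[OF tendsto_mult[OF tendsto_const L, of "-(1/4)"] tendsto_mult[OF tendsto_const R, of "s/2", folded eq]] .
  moreover have "(\<integral>(x, y). (\<bar>x\<bar> powr p + \<bar>y\<bar> powr p - 2 * \<bar>(x + y) / 2\<bar> powr p) * \<bar>x - y\<bar> powr \<gamma> \<partial>(M \<Otimes>\<^sub>M M))
     = - (\<integral>z. F a z \<partial>(M \<Otimes>\<^sub>M M))"
    unfolding Bochner_Integration.integral_minus[symmetric]
    by (rule arg_cong[where f="integral\<^sup>L _"]) (auto simp: F_def a_def fun_eq_iff algebra_simps)
  ultimately show ?thesis by (simp add: xa' a_def)
qed

end

section \<open>Energy identity, bounds on \<open>s\<close>, moment bounds\<close>

context profile
begin

abbreviation "Mp p \<equiv> (\<integral>x. \<bar>x\<bar> powr p \<partial>M)"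

lemma integrable_abs_powr: 
  assumes "0 \<le> p" "p < 3"
  shows "integrable M (\<lambda>x. \<bar>x\<bar> powr p)"
  by (rule integrable_dom(1)[OF moments[of p], of _ 1]) (use assms in \<open>auto intro!: powr_mono2\<close>)

lemma integrable_id: "integrable M (\<lambda>x. x)" and integrable_abs: "integrable M (\<lambda>x. \<bar>x\<bar>)"
  and integrable_sq: "integrable M (\<lambda>x. x\<^sup>2)"
proof -
  show "integrable M (\<lambda>x. x)" 
    by (rule integrable_dom(1)[OF moments[of 1], of _ 1]) auto
  thus "integrable M (\<lambda>x. \<bar>x\<bar>)" by simp
  show "integrable M (\<lambda>x. x\<^sup>2)" using integrable_abs_powr[of 2] by simp
qed

lemma first_abs_moment: "(\<integral>x. \<bar>x\<bar> \<partial>M) \<le> 1"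
proof -
  have "(\<integral>x. \<bar>x\<bar> \<partial>M) \<le> (\<integral>x. (1 + x\<^sup>2) / 2 \<partial>M)"
  proof (intro integral_mono integrable_abs)
    fix x :: real
    have "0 \<le> (\<bar>x\<bar> - 1)\<^sup>2" by simp
    hence "2 * \<bar>x\<bar> \<le> 1 + x\<^sup>2" by (simp add: power2_diff)
    thus "\<bar>x\<bar> \<le> (1 + x\<^sup>2) / 2" by simp
  qed (use integrable_sq in auto)
  also have "\<dots> = 1" using integrable_sq var_one prob_space by (simp add: )
  finally show ?thesis .
qed

lemma integrable_diff_powr:
  assumes "0 \<le> p" "p < 3"
  shows "integrable (M \<Otimes>\<^sub>M M) (\<lambda>(x, y). \<bar>x - y\<bar> powr p)"
  by (rule integrable_prod_dom(1)[OF _ moments[of p], of _ 1]) (use assms in \<open>auto intro!: powr_mono2\<close>)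

lemma
  shows integrable_diff_sq: "integrable (M \<Otimes>\<^sub>M M) (\<lambda>(x, y). (x - y)\<^sup>2)"
    and integral_diff_sq: "(\<integral>(x, y). (x - y)\<^sup>2 \<partial>(M \<Otimes>\<^sub>M M)) = 2"
proof -
  show "integrable (M \<Otimes>\<^sub>M M) (\<lambda>(x, y). (x - y)\<^sup>2)" using integrable_diff_powr[of 2] by simp
  have "(\<integral>(x, y). (x - y)\<^sup>2 \<partial>(M \<Otimes>\<^sub>M M)) =
     (\<integral>z. (case z of (x, y) \<Rightarrow> x\<^sup>2) + (case z of (x, y) \<Rightarrow> y\<^sup>2) - 2 * (case z of (x, y) \<Rightarrow> x * y) \<partial>(M \<Otimes>\<^sub>M M))"
    by (rule arg_cong[where f="integral\<^sup>L _"]) (auto simp: power2_diff fun_eq_iff)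
  also have "\<dots> = 1 + 1 - 2 * (0 * 0)"
    using integrable_prod_fst[OF integrable_sq] integrable_prod_snd[OF integrable_sq]
      integrable_prod_mult[OF integrable_id integrable_id]
    by (simp add: integral_prod_fst[OF integrable_sq] integral_prod_snd[OF integrable_sq]
       integral_prod_mult[OF integrable_id integrable_id] var_one mean_zero)
  finally show "(\<integral>(x, y). (x - y)\<^sup>2 \<partial>(M \<Otimes>\<^sub>M M)) = 2" by simp
qed

text \<open>For p = 2 the bracket is exactly (x - y)^2 / 2, by the parallelogram identity, so the
  moment equation closes.\<close>

lemma energy_identity: "s * (\<integral>(x, y). \<bar>x - y\<bar> powr (2 + \<gamma>) \<partial>(M \<Otimes>\<^sub>M M)) = 2"
proof -
  have e1: "(\<integral>x. \<bar>x\<bar> powr 2 \<partial>M) = 1" using var_one by simp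
  have pt: "(\<bar>x\<bar> powr 2 + \<bar>y\<bar> powr 2 - 2 * \<bar>(x + y) / 2\<bar> powr 2) * \<bar>x - y\<bar> powr \<gamma>
    = 1/2 * \<bar>x - y\<bar> powr (2 + \<gamma>)" for x y :: real
    unfolding powr_add abs_powr_2 by (simp add: power2_eq_square field_simps)
  have e2: "(\<integral>(x, y). (\<bar>x\<bar> powr 2 + \<bar>y\<bar> powr 2 - 2 * \<bar>(x + y) / 2\<bar> powr 2) * \<bar>x - y\<bar> powr \<gamma> \<partial>(M \<Otimes>\<^sub>M M))
     = (\<integral>(x, y). 1/2 * \<bar>x - y\<bar> powr (2 + \<gamma>) \<partial>(M \<Otimes>\<^sub>M M))"
    by (simp only: pt)
  have e3: "(\<integral>(x, y). 1/2 * \<bar>x - y\<bar> powr (2 + \<gamma>) \<partial>(M \<Otimes>\<^sub>M M)) = 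
    1/2 * (\<integral>(x, y). \<bar>x - y\<bar> powr (2 + \<gamma>) \<partial>(M \<Otimes>\<^sub>M M))"
    by (simp add: split_beta')
  have "2 + \<gamma> < 3" using gamma_less by simp
  from moment_eq[OF order_refl this, unfolded e1 e2 e3] show ?thesis by simp
qed

lemma tangent_at_1: "x\<^sup>2 + \<gamma> * (x\<^sup>2 - 1) / 2 \<le> \<bar>x\<bar> powr (2 + \<gamma>)"
  using abs_powr_ge_tangent[of \<gamma> x] gamma_pos by simp

text \<open>The difference of two independent variables has second moment 2, so the mean of the
  tangent bound is 2 + \<gamma>/2, and the energy identity leaves no room for s > 1.\<close>

lemma s_le_1: "s \<le> 1"
proof -
  have "(\<integral>(x, y). (x - y)\<^sup>2 + \<gamma> / 2 * ((x - y)\<^sup>2 - 1) \<partial>(M \<Otimes>\<^sub>M M))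
     \<le> (\<integral>(x, y). \<bar>x - y\<bar> powr (2 + \<gamma>) \<partial>(M \<Otimes>\<^sub>M M))"
    using integrable_diff_powr[of "2 + \<gamma>"] integrable_diff_sq gamma_pos gamma_less
    by (intro integral_mono) (auto intro!: tangent_at_1 simp: split_beta')
  also have "(\<integral>(x, y). (x - y)\<^sup>2 + \<gamma> / 2 * ((x - y)\<^sup>2 - 1) \<partial>(M \<Otimes>\<^sub>M M)) = 2 + \<gamma> / 2 * (2 - 1)"
    using integrable_diff_sq integral_diff_sq pp.prob_space by (simp add: split_beta')
  finally have "2 \<le> (\<integral>(x, y). \<bar>x - y\<bar> powr (2 + \<gamma>) \<partial>(M \<Otimes>\<^sub>M M))" using gamma_pos by simp
  hence "s * 2 \<le> 2" using energy_identity s_pos by (metis less_eq_real_def mult_left_mono)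
  thus ?thesis by simp
qed

lemma Mp_ge_1: "1 \<le> Mp (2 + \<gamma>)"
proof -
  have "(\<integral>x. x\<^sup>2 + \<gamma> / 2 * (x\<^sup>2 - 1) \<partial>M) \<le> Mp (2 + \<gamma>)"
    using integrable_abs_powr[of "2 + \<gamma>"] integrable_sq gamma_pos gamma_less
    by (intro integral_mono) (auto intro!: tangent_at_1)
  also have "(\<integral>x. x\<^sup>2 + \<gamma> / 2 * (x\<^sup>2 - 1) \<partial>M) = 1"
    using integrable_sq var_one prob_space by simp
  finally show ?thesis .
qed

text \<open>Integration of \<open>abs_powr_diff_upper\<close>. The product term disappears because
  the mean is zero, and the first absolute moment is at most 1. The factor 5 collects the errors,
  using 1 \<le> \<open>Mp (2 + \<gamma>)\<close> and \<gamma>^2 \<le> \<gamma>.\<close>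

lemma energy_upper: "(\<integral>(x, y). \<bar>x - y\<bar> powr (2 + \<gamma>) \<partial>(M \<Otimes>\<^sub>M M)) \<le> 2 * (Mp (2 + \<gamma>) * (1 + 5 * \<gamma>))"
proof -
  define m where "m = Mp (2 + \<gamma>)"
  \<comment> \<open>Replaces x^2 max 1 (|x|^\<gamma>) by a function of known mean: where
    |x|^\<gamma> < 1, the tangent bound gives x^2 \<le> |x|^(2+\<gamma>) + \<gamma>.\<close>
  define A where "A x = \<bar>x\<bar> powr (2 + \<gamma>) + \<gamma>" for x :: real
  have A: "x\<^sup>2 * max 1 (\<bar>x\<bar> powr \<gamma>) \<le> A x" for x
  proof (cases "1 \<le> \<bar>x\<bar> powr \<gamma>")
    case True
    thus ?thesis using gamma_pos by (simp add: A_def powr_add max_def)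
  next
    case False
    have "0 \<le> \<gamma> / 2 * x\<^sup>2" using gamma_pos by simp
    hence "x\<^sup>2 \<le> A x" using abs_powr_ge_tangent[of \<gamma> x] gamma_pos
      unfolding A_def right_diff_distrib by linarith
    thus ?thesis using False by (simp add: max_def)
  qed
  have iA: "integrable M A" unfolding A_def using integrable_abs_powr[of "2 + \<gamma>"] gamma_pos gamma_less by auto
  have EA: "(\<integral>x. A x \<partial>M) = m + \<gamma>" unfolding A_def m_def
    using integrable_abs_powr[of "2 + \<gamma>"] gamma_pos gamma_less prob_space by simp
  define m1 where "m1 = (\<integral>x. \<bar>x\<bar> \<partial>M)"
  have i1: "integrable M (\<lambda>x. 1 + \<gamma> * \<bar>x\<bar>)" using integrable_abs by simp
  have E1: "(\<integral>x. 1 + \<gamma> * \<bar>x\<bar> \<partial>M) = 1 + \<gamma> * m1" using integrable_abs prob_space by (simp add: m1_def)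
  define G where "G = (\<lambda>z. (case z of (x, y) \<Rightarrow> A x * (1 + \<gamma> * \<bar>y\<bar>)) + (case z of (x, y) \<Rightarrow> (1 + \<gamma> * \<bar>x\<bar>) * A y)
    - 2 * (case z of (x, y) \<Rightarrow> x * y) + 2 * \<gamma> * ((case z of (x, y) \<Rightarrow> x\<^sup>2 * \<bar>y\<bar>) + (case z of (x, y) \<Rightarrow> \<bar>x\<bar> * y\<^sup>2)))"
  note ints = integrable_prod_mult[OF iA i1] integrable_prod_mult[OF i1 iA] integrable_prod_mult[OF integrable_id integrable_id]
     integrable_prod_mult[OF integrable_sq integrable_abs] integrable_prod_mult[OF integrable_abs integrable_sq]
  note vals = integral_prod_mult[OF iA i1] integral_prod_mult[OF i1 iA] integral_prod_mult[OF integrable_id integrable_id]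
     integral_prod_mult[OF integrable_sq integrable_abs] integral_prod_mult[OF integrable_abs integrable_sq]
  have "(\<integral>(x, y). \<bar>x - y\<bar> powr (2 + \<gamma>) \<partial>(M \<Otimes>\<^sub>M M)) \<le> (\<integral>z. G z \<partial>(M \<Otimes>\<^sub>M M))"
  proof (rule integral_mono)
    show "integrable (M \<Otimes>\<^sub>M M) (\<lambda>(x, y). \<bar>x - y\<bar> powr (2 + \<gamma>))"
      using integrable_diff_powr[of "2 + \<gamma>"] gamma_pos gamma_less by simp
    show "integrable (M \<Otimes>\<^sub>M M) G" unfolding G_def using ints by simp
    fix z :: "real \<times> real"
    obtain x y where z: "z = (x, y)" by (cases z)
    have "x\<^sup>2 * max 1 (\<bar>x\<bar> powr \<gamma>) * (1 + \<gamma> * \<bar>y\<bar>) \<le> A x * (1 + \<gamma> * \<bar>y\<bar>)"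
      "y\<^sup>2 * max 1 (\<bar>y\<bar> powr \<gamma>) * (1 + \<gamma> * \<bar>x\<bar>) \<le> A y * (1 + \<gamma> * \<bar>x\<bar>)"
      using gamma_pos A by (auto intro!: mult_right_mono)
    moreover have "2 * \<gamma> * (\<bar>x\<bar> * \<bar>y\<bar> * (\<bar>x\<bar> + \<bar>y\<bar>)) = 2 * \<gamma> * (x\<^sup>2 * \<bar>y\<bar> + \<bar>x\<bar> * y\<^sup>2)"
      by (simp add: algebra_simps power2_eq_square)
    moreover have "(1 + \<gamma> * \<bar>x\<bar>) * A y = A y * (1 + \<gamma> * \<bar>x\<bar>)" by simp
    ultimately show "(case z of (x, y) \<Rightarrow> \<bar>x - y\<bar> powr (2 + \<gamma>)) \<le> G z"
      unfolding z G_def prod.case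
      using abs_powr_diff_upper[OF gamma_pos gamma_less, of x y] by linarith
  qed
  also have "\<dots> = 2 * ((m + \<gamma>) * (1 + \<gamma> * m1)) + 2 * \<gamma> * (2 * m1)"
    unfolding G_def using ints by (simp add: vals EA E1 var_one mean_zero flip: m1_def)
  also have "\<dots> \<le> 2 * ((m + \<gamma>) * (1 + \<gamma> * 1)) + 2 * \<gamma> * (2 * 1)"
    using first_abs_moment gamma_pos Mp_ge_1
    by (intro add_mono mult_left_mono) (auto simp: m1_def m_def)
  also have "\<dots> \<le> 2 * (m * (1 + 5 * \<gamma>))"
  proof -
    have "\<gamma> * 1 \<le> \<gamma> * m" using Mp_ge_1 gamma_pos by (intro mult_left_mono) (auto simp: m_def)
    moreover have "\<gamma> * \<gamma> \<le> \<gamma> * 1" using gamma_pos gamma_less by (intro mult_left_mono) auto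
    ultimately show ?thesis by (simp add: algebra_simps)
  qed
  finally show ?thesis by (simp add: m_def)
qed

lemma s_Mp: "1 \<le> s * Mp (2 + \<gamma>) * (1 + 5 * \<gamma>)"
proof -
  have "s * (\<integral>(x, y). \<bar>x - y\<bar> powr (2 + \<gamma>) \<partial>(M \<Otimes>\<^sub>M M)) \<le> s * (2 * (Mp (2 + \<gamma>) * (1 + 5 * \<gamma>)))"
    using energy_upper s_pos by (intro mult_left_mono) auto
  thus ?thesis unfolding energy_identity by (simp add: mult.assoc)
qed

text \<open>Chebyshev's association inequality: under the probability measure x^2 dM the functions
  |x|^(k-2) and |x|^\<gamma> both increase with |x|, hence are positively correlated. Together with
  \<open>s_Mp\<close> it bounds s \<open>Mp (k + \<gamma>)\<close> from below by a multiple of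
  \<open>Mp k\<close> that does not involve \<open>s\<close>, at a stage where no lower bound on
  \<open>s\<close> is known.\<close>

lemma moment_chebyshev:
  assumes "2 \<le> k" "k + \<gamma> < 3"
  shows "Mp k * Mp (2 + \<gamma>) \<le> Mp (k + \<gamma>)"
proof -
  note k = assms gamma_pos
  have ik: "integrable M (\<lambda>x. \<bar>x\<bar> powr k)" "integrable M (\<lambda>x. \<bar>x\<bar> powr (2 + \<gamma>))"
     "integrable M (\<lambda>x. \<bar>x\<bar> powr (k + \<gamma>))" using k integrable_abs_powr[of k] integrable_abs_powr[of "2 + \<gamma>"]
      integrable_abs_powr[of "k + \<gamma>"] by simp_all
  note ints = integrable_prod_mult[OF ik(1,2)] integrable_prod_mult[OF ik(2,1)] 
     integrable_prod_mult[OF integrable_sq ik(3)] integrable_prod_mult[OF ik(3) integrable_sq]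
  note vals = integral_prod_mult[OF ik(1,2)] integral_prod_mult[OF ik(2,1)] 
     integral_prod_mult[OF integrable_sq ik(3)] integral_prod_mult[OF ik(3) integrable_sq]
  have "0 \<le> (\<integral>z. (case z of (x, y) \<Rightarrow> x\<^sup>2 * \<bar>y\<bar> powr (k + \<gamma>)) + (case z of (x, y) \<Rightarrow> \<bar>x\<bar> powr (k + \<gamma>) * y\<^sup>2)
     - (case z of (x, y) \<Rightarrow> \<bar>x\<bar> powr k * \<bar>y\<bar> powr (2 + \<gamma>)) - (case z of (x, y) \<Rightarrow> \<bar>x\<bar> powr (2 + \<gamma>) * \<bar>y\<bar> powr k) \<partial>(M \<Otimes>\<^sub>M M))"
  proof (intro Bochner_Integration.integral_nonneg, clarsimp)
    fix x y :: real
    have *: "0 \<le> (\<bar>x\<bar> powr (k - 2) - \<bar>y\<bar> powr (k - 2)) * (\<bar>x\<bar> powr \<gamma> - \<bar>y\<bar> powr \<gamma>)"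
      if "x \<noteq> 0" "y \<noteq> 0"
    proof (cases "\<bar>x\<bar> \<le> \<bar>y\<bar>")
      case True
      hence "\<bar>x\<bar> powr (k - 2) \<le> \<bar>y\<bar> powr (k - 2)" "\<bar>x\<bar> powr \<gamma> \<le> \<bar>y\<bar> powr \<gamma>"
        using k that by (auto intro!: powr_mono2)
      thus ?thesis by (intro mult_nonpos_nonpos) auto
    next
      case False
      hence "\<bar>y\<bar> powr (k - 2) \<le> \<bar>x\<bar> powr (k - 2)" "\<bar>y\<bar> powr \<gamma> \<le> \<bar>x\<bar> powr \<gamma>"
        using k that by (auto intro!: powr_mono2)
      thus ?thesis by (intro mult_nonneg_nonneg) auto
    qed
    have e: "\<bar>u\<bar> powr (2 + \<gamma>) = u\<^sup>2 * \<bar>u\<bar> powr \<gamma>" "\<bar>u\<bar> powr k = u\<^sup>2 * \<bar>u\<bar> powr (k - 2)"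
      "\<bar>u\<bar> powr (k + \<gamma>) = u\<^sup>2 * (\<bar>u\<bar> powr (k - 2) * \<bar>u\<bar> powr \<gamma>)" if "u \<noteq> 0" for u :: real
      using powr_add[of "\<bar>u\<bar>" 2 \<gamma>] powr_add[of "\<bar>u\<bar>" 2 "k - 2"] powr_add[of "\<bar>u\<bar>" k \<gamma>]
      by simp_all
    show "\<bar>x\<bar> powr (2 + \<gamma>) * \<bar>y\<bar> powr k \<le> x\<^sup>2 * \<bar>y\<bar> powr (k + \<gamma>) + \<bar>x\<bar> powr (k + \<gamma>) * y\<^sup>2 - \<bar>x\<bar> powr k * \<bar>y\<bar> powr (2 + \<gamma>)"
    proof (cases "x = 0 \<or> y = 0")
      case True
      thus ?thesis by auto
    next
      case False
      hence "0 \<le> x\<^sup>2 * y\<^sup>2 * ((\<bar>x\<bar> powr (k - 2) - \<bar>y\<bar> powr (k - 2)) * (\<bar>x\<bar> powr \<gamma> - \<bar>y\<bar> powr \<gamma>))"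
        using * by (intro mult_nonneg_nonneg[of "x\<^sup>2 * y\<^sup>2"]) auto
      moreover have "x \<noteq> 0" "y \<noteq> 0" using False by auto
      ultimately show ?thesis
        by (simp only: e[OF \<open>x \<noteq> 0\<close>] e[OF \<open>y \<noteq> 0\<close>]) (simp add: algebra_simps)
    qed
  qed
  also have "\<dots> = 2 * (Mp (k + \<gamma>) - Mp k * Mp (2 + \<gamma>))"
    using ints by (simp add: vals var_one)
  finally show ?thesis by simp
qed

text \<open>The moment equation of order k balances k/2 \<open>Mp k\<close> against s times the
  collision term, which by \<open>powr_collision_lower\<close> is at least 2c
  \<open>Mp (k + \<gamma>)\<close> - 16 with c = 1 - 2^(1-k). Here 16 = 8 * 2 * 1, from a moment of
  order k + \<gamma> - 1 < 2 and the first absolute moment. Eliminating \<open>s\<close> by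
  \<open>moment_chebyshev\<close> leaves an inequality for \<open>Mp k\<close> alone; it is a bound
  as soon as the bracket on the left is positive.\<close>

lemma moment_bound:
  assumes k: "2 \<le> k" "k + \<gamma> < 3"
  shows "Mp k * (2 * (1 - 2 powr (1 - k)) / (1 + 5 * \<gamma>) - k / 2) \<le> 16"
proof -
  define c where "c = 1 - 2 powr (1 - k)"
  have c: "0 \<le> c" using k powr_mono[of "1 - k" 0 2] by (auto simp: c_def)
  define P where "P x = \<bar>x\<bar> powr (k + \<gamma>)" for x :: real
  define Q where "Q x = \<bar>x\<bar> powr (k + \<gamma> - 1)" for x :: real
  have iP: "integrable M P" and iQ: "integrable M Q"
    unfolding P_def Q_def using k gamma_pos by (auto intro!: integrable_abs_powr)
  have Q2: "(\<integral>x. Q x \<partial>M) \<le> 2"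
  proof -
    have "(\<integral>x. Q x \<partial>M) \<le> (\<integral>x. 1 + x\<^sup>2 \<partial>M)"
    proof (intro integral_mono iQ)
      fix x :: real
      show "Q x \<le> 1 + x\<^sup>2"
      proof (cases "\<bar>x\<bar> \<le> 1")
        case True
        hence "Q x \<le> 1" unfolding Q_def using k gamma_pos by (intro powr_le1) auto
        thus ?thesis by (simp add: add_increasing2)
      next
        case False
        hence "Q x \<le> \<bar>x\<bar> powr 2" unfolding Q_def using k gamma_pos by (intro powr_mono) auto
        thus ?thesis by simp
      qed
    qed (use integrable_sq in auto)
    also have "\<dots> = 2" using integrable_sq var_one prob_space by simp
    finally show ?thesis .
  qed
  note ints = integrable_prod_fst[OF iP] integrable_prod_snd[OF iP] integrable_prod_mult[OF iQ integrable_abs]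
     integrable_prod_mult[OF integrable_abs iQ]
  note vals = integral_prod_fst[OF iP] integral_prod_snd[OF iP] integral_prod_mult[OF iQ integrable_abs]
     integral_prod_mult[OF integrable_abs iQ]
  define L where "L = (\<lambda>z. c * ((case z of (x, y) \<Rightarrow> P x) + (case z of (x, y) \<Rightarrow> P y))
     - 4 * ((case z of (x, y) \<Rightarrow> Q x * \<bar>y\<bar>) + (case z of (x, y) \<Rightarrow> \<bar>x\<bar> * Q y)))"
  define B where "B = (\<lambda>(x, y). (\<bar>x\<bar> powr k + \<bar>y\<bar> powr k - 2 * \<bar>(x + y) / 2\<bar> powr k) * \<bar>x - y\<bar> powr \<gamma>)"
  have "(\<integral>z. L z \<partial>(M \<Otimes>\<^sub>M M)) \<le> (\<integral>z. B z \<partial>(M \<Otimes>\<^sub>M M))"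
  proof (rule integral_mono)
    show "integrable (M \<Otimes>\<^sub>M M) L" unfolding L_def using ints by simp
    show "integrable (M \<Otimes>\<^sub>M M) B"
    proof (rule integrable_prod_dom(1)[OF _ moments[of "k + \<gamma>"], of _ 4])
      fix x y :: real
      have w: "\<bar>x\<bar> powr k \<le> (1 + \<bar>x\<bar> + \<bar>y\<bar>) powr k" "\<bar>y\<bar> powr k \<le> (1 + \<bar>x\<bar> + \<bar>y\<bar>) powr k"
        "\<bar>(x + y) / 2\<bar> powr k \<le> (1 + \<bar>x\<bar> + \<bar>y\<bar>) powr k" "\<bar>x - y\<bar> powr \<gamma> \<le> (1 + \<bar>x\<bar> + \<bar>y\<bar>) powr \<gamma>"
        using k gamma_pos by (auto intro!: powr_mono2)
      have nn: "0 \<le> \<bar>x\<bar> powr k" "0 \<le> \<bar>y\<bar> powr k" "0 \<le> \<bar>(x + y) / 2\<bar> powr k" by auto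
      have "\<bar>\<bar>x\<bar> powr k + \<bar>y\<bar> powr k - 2 * \<bar>(x + y) / 2\<bar> powr k\<bar> \<le> 4 * (1 + \<bar>x\<bar> + \<bar>y\<bar>) powr k"
      proof -
        have "\<bar>a + b - 2 * c\<bar> \<le> 4 * d" if "a \<le> d" "b \<le> d" "c \<le> d" "0 \<le> a" "0 \<le> b" "0 \<le> c" for a b c d :: real
          using that by linarith
        from this[OF w(1-3) nn] show ?thesis .
      qed
      thus "norm (B (x, y)) \<le> 4 * (1 + \<bar>x\<bar> + \<bar>y\<bar>) powr (k + \<gamma>)"
        unfolding B_def using w(4) by (auto simp: abs_mult powr_add mult.assoc[symmetric] intro!: mult_mono)
    qed (use k gamma_pos in \<open>auto simp: B_def\<close>)
    fix z :: "real \<times> real"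
    show "L z \<le> B z"
      using powr_collision_lower[OF k(1) gamma_pos gamma_less, of "fst z" "snd z"]
      by (cases z) (simp add: L_def B_def P_def Q_def c_def mult.commute)
  qed
  moreover have "(\<integral>z. L z \<partial>(M \<Otimes>\<^sub>M M)) = c * ((\<integral>x. P x \<partial>M) + (\<integral>x. P x \<partial>M))
    - 4 * ((\<integral>x. Q x \<partial>M) * (\<integral>x. \<bar>x\<bar> \<partial>M) + (\<integral>x. \<bar>x\<bar> \<partial>M) * (\<integral>x. Q x \<partial>M))"
    unfolding L_def using ints by (simp add: vals)
  ultimately have "2 * c * (\<integral>x. P x \<partial>M) - 8 * ((\<integral>x. Q x \<partial>M) * (\<integral>x. \<bar>x\<bar> \<partial>M)) \<le> (\<integral>z. B z \<partial>(M \<Otimes>\<^sub>M M))"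
    by (simp add: algebra_simps)
  moreover have "(\<integral>x. Q x \<partial>M) * (\<integral>x. \<bar>x\<bar> \<partial>M) \<le> 2 * 1"
    using Q2 first_abs_moment by (intro mult_mono) auto
  ultimately have "2 * c * Mp (k + \<gamma>) - 16 \<le> (\<integral>z. B z \<partial>(M \<Otimes>\<^sub>M M))" by (simp add: P_def)
  hence "s * (2 * c * Mp (k + \<gamma>) - 16) \<le> k / 2 * Mp k"
    unfolding moment_eq[OF k] B_def using s_pos by (intro mult_left_mono) auto
  moreover have "s * 16 \<le> 16" using s_le_1 by simp
  moreover have "2 * c * Mp k / (1 + 5 * \<gamma>) \<le> s * (2 * c * Mp (k + \<gamma>))"
  proof -
    have Mk: "0 \<le> Mp k" by (intro Bochner_Integration.integral_nonneg) auto
    have g: "0 < 1 + 5 * \<gamma>" using gamma_pos by simp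
    have "1 / (1 + 5 * \<gamma>) \<le> s * Mp (2 + \<gamma>)" using s_Mp g by (simp add: field_simps)
    hence "(2 * c * Mp k) * (1 / (1 + 5 * \<gamma>)) \<le> (2 * c * Mp k) * (s * Mp (2 + \<gamma>))"
      using c Mk by (intro mult_left_mono) auto
    also have "\<dots> = 2 * c * s * (Mp k * Mp (2 + \<gamma>))" by simp
    also have "\<dots> \<le> 2 * c * s * Mp (k + \<gamma>)" using moment_chebyshev[OF k] c s_pos by (intro mult_left_mono) auto
    finally show ?thesis by (simp add: algebra_simps)
  qed
  ultimately show ?thesis by (simp add: algebra_simps flip: c_def)
qed

text \<open>Converse of \<open>s_le_1\<close> to first order in \<gamma>. Bernoulli's inequality for
  (|x|^(1/2))^(2\<gamma>), which needs 2\<gamma> \<le> 1, replaces the moment of order 2 + \<gamma>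
  by 1 + O(\<gamma>) at the price of a moment of order 5/2.\<close>

lemma s_lower:
  assumes "\<gamma> < 1/2"
  shows "1 \<le> s * ((1 + 2 * \<gamma> * Mp (5/2)) * (1 + 5 * \<gamma>))"
proof -
  have "Mp (2 + \<gamma>) \<le> (\<integral>x. x\<^sup>2 + 2 * \<gamma> * \<bar>x\<bar> powr (5/2) \<partial>M)"
  proof (intro integral_mono integrable_abs_powr)
    fix x :: real
    show "\<bar>x\<bar> powr (2 + \<gamma>) \<le> x\<^sup>2 + 2 * \<gamma> * \<bar>x\<bar> powr (5/2)"
    proof -
      have "(\<bar>x\<bar> powr (1/2)) powr (2 * \<gamma>) \<le> 1 + 2 * \<gamma> * (\<bar>x\<bar> powr (1/2) - 1)"
        using assms gamma_pos by (intro powr_le_affine) auto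
      also have "\<dots> \<le> 1 + 2 * \<gamma> * \<bar>x\<bar> powr (1/2)" using gamma_pos by simp
      finally have "x\<^sup>2 * (\<bar>x\<bar> powr \<gamma>) \<le> x\<^sup>2 * (1 + 2 * \<gamma> * \<bar>x\<bar> powr (1/2))"
        by (intro mult_left_mono) (auto simp: powr_powr)
      moreover have "\<bar>x\<bar> powr (5/2) = x\<^sup>2 * \<bar>x\<bar> powr (1/2)"
        using powr_add[of "\<bar>x\<bar>" 2 "1/2"] by simp
      ultimately show ?thesis by (simp add: powr_add algebra_simps)
    qed
  qed (use assms gamma_pos integrable_sq integrable_abs_powr[of "5/2"] in auto)
  also have "\<dots> = 1 + 2 * \<gamma> * Mp (5/2)" using integrable_sq integrable_abs_powr[of "5/2"] var_one by simp
  finally have "Mp (2 + \<gamma>) * (1 + 5 * \<gamma>) \<le> (1 + 2 * \<gamma> * Mp (5/2)) * (1 + 5 * \<gamma>)"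
    using gamma_pos by (intro mult_right_mono) auto
  hence "s * (Mp (2 + \<gamma>) * (1 + 5 * \<gamma>)) \<le> s * ((1 + 2 * \<gamma> * Mp (5/2)) * (1 + 5 * \<gamma>))"
    using s_pos by (intro mult_left_mono) auto
  thus ?thesis using s_Mp by (simp add: mult.assoc)
qed

end

section \<open>The equation for the characteristic function\<close>

lemma Re_iexp: "Re (iexp u) = cos u" and Im_iexp: "Im (iexp u) = sin u" for u :: real
  by (simp_all flip: cis_conv_exp)

lemma Re_mult_of_real: "Re (b * complex_of_real r) = Re b * r"
  and Im_mult_of_real: "Im (b * complex_of_real r) = Im b * r"
  by simp_all

lemma Re_2: "Re (2 * b) = 2 * Re b" and Im_2: "Im (2 * b) = 2 * Im b"
  by simp_all

lemma iexp_taylor2: "cmod (iexp u - 1 - \<i> * u) \<le> u\<^sup>2 / 2" for u :: real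
  using iexp_approx1[of u 1] by (simp add: power2_eq_square diff_diff_eq)

text \<open>The first-order Taylor remainder of e^(iu) is at most u^2 / 2, so a finite second moment
  makes the error of the difference quotient O(|y - t|), with an explicit constant.\<close>

lemma (in real_distribution) char_has_vector_derivative:
  assumes int: "integrable M (\<lambda>x. x\<^sup>2)"
  shows "(char M has_vector_derivative (\<integral>x. \<i> * x * iexp (t * x) \<partial>M)) (at t)"
proof -
  have int1: "integrable M (\<lambda>x. x)"
  proof (rule Bochner_Integration.integrable_bound[of M "\<lambda>x. 1 + x\<^sup>2"])
    show "AE x in M. norm x \<le> norm (1 + x\<^sup>2)"
    proof (intro AE_I2)
      fix x :: real
      have "0 \<le> (\<bar>x\<bar> - 1)\<^sup>2" by simp
      hence "2 * \<bar>x\<bar> \<le> 1 + x\<^sup>2" by (simp add: power2_diff)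
      thus "norm x \<le> norm (1 + x\<^sup>2)" by simp
    qed
  qed (use int in auto)
  let ?D = "\<integral>x. \<i> * x * iexp (t * x) \<partial>M"
  have i2: "integrable M (\<lambda>x. \<i> * x * iexp (t * x))" for t
    by (rule Bochner_Integration.integrable_bound[OF int1]) (auto simp: norm_mult)
  have i3: "integrable M (\<lambda>x. iexp (t * x))" for t
    using integrable_iexp[of "\<lambda>x. of_real (t * x)"] by simp
  have key: "norm (char M y - char M t - (y - t) *\<^sub>R ?D) \<le> (y - t)\<^sup>2 * (\<integral>x. x\<^sup>2 / 2 \<partial>M)" for y
  proof -
    have "char M y - char M t - (y - t) *\<^sub>R ?D
        = (\<integral>x. iexp (y * x) - iexp (t * x) - (y - t) *\<^sub>R (\<i> * x * iexp (t * x)) \<partial>M)"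
      unfolding char_def using i2 i3 by simp
    also have "norm \<dots> \<le> (\<integral>x. (y - t)\<^sup>2 * (x\<^sup>2 / 2) \<partial>M)"
    proof (rule order_trans[OF integral_norm_bound integral_mono])
      fix x :: real
      have "iexp (y * x) - iexp (t * x) - (y - t) *\<^sub>R (\<i> * x * iexp (t * x))
          = iexp (t * x) * (iexp ((y - t) * x) - 1 - \<i> * ((y - t) * x))"
        by (simp add: exp_add[symmetric] scaleR_conv_of_real algebra_simps)
      hence "norm (iexp (y * x) - iexp (t * x) - (y - t) *\<^sub>R (\<i> * x * iexp (t * x)))
         = cmod (iexp ((y - t) * x) - 1 - \<i> * ((y - t) * x))"
        by (simp add: norm_mult)
      also have "\<dots> \<le> ((y - t) * x)\<^sup>2 / 2" using iexp_taylor2[of "(y - t) * x"] by simp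
      finally show "norm (iexp (y * x) - iexp (t * x) - (y - t) *\<^sub>R (\<i> * x * iexp (t * x))) \<le> (y - t)\<^sup>2 * (x\<^sup>2 / 2)"
        by (simp add: power_mult_distrib)
    qed (use i2 i3 int in auto)
    finally show ?thesis by simp
  qed
  define c where "c = (\<integral>x. x\<^sup>2 / 2 \<partial>M)"
  show ?thesis
    unfolding has_vector_derivative_def
  proof (rule has_derivativeI_sandwich[of 1 _ _ _ _ "\<lambda>y. \<bar>y - t\<bar> * c"])
    show "((\<lambda>y. \<bar>y - t\<bar> * c) \<longlongrightarrow> 0) (at t)"
      by (auto intro!: tendsto_eq_intros)
    fix y assume "y \<noteq> t"
    hence "norm (char M y - char M t - (y - t) *\<^sub>R ?D) / norm (y - t) \<le> (y - t)\<^sup>2 * c / norm (y - t)"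
      using key[of y] by (intro divide_right_mono) (auto simp: c_def)
    thus "norm (char M y - char M t - (y - t) *\<^sub>R ?D) / norm (y - t) \<le> \<bar>y - t\<bar> * c"
      using \<open>y \<noteq> t\<close> by (simp add: power2_eq_square abs_mult_self_eq[of "y - t", symmetric] del: abs_mult_self_eq)
  qed (auto intro!: bounded_linear_intros)
qed

lemma (in real_distribution) char_uminus: "char M (- t) = cnj (char M t)"
proof -
  have "iexp (- t * x) = cnj (iexp (t * x))" for x by (simp add: exp_cnj)
  thus ?thesis unfolding char_def by (simp only: Bochner_Integration.integral_cnj)
qed

lemma (in real_distribution) cmod_char_uminus: "cmod (char M (- t)) = cmod (char M t)"
  by (simp add: char_uminus)

text \<open>With midpoint phase z and half difference d, e^(i(z+d)) + e^(i(z-d)) = 2 e^(iz) cos d.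
  The bracket is thus a unimodular factor times a real factor, which is bounded by 4 and quadratic
  near the diagonal.\<close>

lemma midpoint_bracket:
  fixes x y \<xi> :: real
  shows "2 * iexp (\<xi> * ((x + y) / 2)) - iexp (\<xi> * x) - iexp (\<xi> * y)
     = iexp (\<xi> * ((x + y) / 2)) * of_real (2 - 2 * cos (\<xi> * (x - y) / 2))"
proof -
  define z where "z = \<xi> * ((x + y) / 2)"
  define d where "d = \<xi> * (x - y) / 2"
  have 1: "\<xi> * x = z + d" "\<xi> * y = z - d" by (simp_all add: z_def d_def field_simps)
  moreover have "of_real (2 - 2 * cos d) = 2 - iexp d - iexp (- d)"
    by (rule complex_eqI) (simp_all add: Re_iexp Im_iexp del: of_real_minus)
  moreover have "iexp (z + d) = iexp z * iexp d" "iexp (z - d) = iexp z * iexp (- d)"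
    by (simp_all add: exp_add[symmetric] algebra_simps)
  moreover have "2 * a - a * b - a * c = a * (2 - b - c)" for a b c :: complex
    by (simp add: algebra_simps)
  ultimately show ?thesis
    by (simp only: z_def[symmetric] d_def[symmetric])
qed

text \<open>The last bound interpolates between |v|^3 for small v and v^2 for large v. The resulting
  order 5/2 lies below three, so it can be integrated against a profile; the next two lemmas serve
  the same purpose.\<close>

lemma one_minus_cos_bounds:
  fixes v :: real
  shows "0 \<le> 2 - 2 * cos v" "2 - 2 * cos v \<le> v\<^sup>2" "2 - 2 * cos v \<le> 4"
    "\<bar>2 - 2 * cos v - v\<^sup>2\<bar> \<le> v\<^sup>2 * sqrt \<bar>v\<bar>"
proof -
  show nn: "0 \<le> 2 - 2 * cos v" and "2 - 2 * cos v \<le> 4"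
    using cos_ge_minus_one[of v] cos_le_one[of v] by linarith+
  have c: "cos v = 1 - 2 * (sin (v / 2))\<^sup>2" using cos_double_sin[of "v / 2"] by simp
  have "(sin (v / 2))\<^sup>2 \<le> (v / 2)\<^sup>2" using abs_sin_x_le_abs_x[of "v / 2"] by (simp only: abs_le_square_iff)
  thus le: "2 - 2 * cos v \<le> v\<^sup>2" unfolding c by (simp add: power2_eq_square field_simps)
  show "\<bar>2 - 2 * cos v - v\<^sup>2\<bar> \<le> v\<^sup>2 * sqrt \<bar>v\<bar>"
  proof (cases "\<bar>v\<bar> \<le> 1")
    case True
    have "cmod (iexp v - (\<Sum>k\<le>2. (\<i> * v)^k / fact k)) \<le> \<bar>v\<bar>^3 / 6"
      using iexp_approx1[of v 2] by (simp add: numeral_eq_Suc fact_numeral)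
    hence a: "\<bar>Re (iexp v - (\<Sum>k\<le>2. (\<i> * v)^k / fact k))\<bar> \<le> \<bar>v\<bar>^3 / 6"
      using abs_Re_le_cmod order_trans by blast
    have b: "Re (iexp v - (\<Sum>k\<le>2. (\<i> * v)^k / fact k)) = cos v - (1 - v\<^sup>2 / 2)"
      by (simp add: numeral_eq_Suc cis_conv_exp[symmetric] power2_eq_square)
    have "0 \<le> \<bar>v\<bar> ^ 3" by simp
    hence "\<bar>2 - 2 * cos v - v\<^sup>2\<bar> \<le> \<bar>v\<bar>^3" using a[unfolded b] by linarith
    also have "\<dots> = v\<^sup>2 * \<bar>v\<bar>" by (simp add: power3_eq_cube power2_eq_square)
    also have "\<dots> \<le> v\<^sup>2 * sqrt \<bar>v\<bar>"
    proof (intro mult_left_mono)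
      show "\<bar>v\<bar> \<le> sqrt \<bar>v\<bar>" using mult_right_mono[OF True, of "\<bar>v\<bar>"]
        by (intro real_le_rsqrt) (simp add: power2_eq_square)
    qed auto
    finally show ?thesis .
  next
    case False
    hence "1 \<le> sqrt \<bar>v\<bar>" by simp
    hence "v\<^sup>2 * 1 \<le> v\<^sup>2 * sqrt \<bar>v\<bar>" by (intro mult_left_mono) auto
    thus ?thesis using le nn by linarith
  qed
qed

lemma iexp_minus_1_bound: "cmod (iexp u - 1) \<le> 2 * sqrt \<bar>u\<bar>" for u :: real
proof -
  have a: "cmod (iexp u - 1) \<le> \<bar>u\<bar>" using iexp_approx1[of u 0] by simp
  have b: "cmod (iexp u - 1) \<le> 2" using norm_triangle_ineq4[of "iexp u" 1] by simp
  show ?thesis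
  proof (cases "\<bar>u\<bar> \<le> 1")
    case True
    have "\<bar>u\<bar> \<le> sqrt \<bar>u\<bar>" using mult_right_mono[OF True, of "\<bar>u\<bar>"]
      by (intro real_le_rsqrt) (simp add: power2_eq_square)
    thus ?thesis using a by simp
  next
    case False
    hence "1 \<le> sqrt \<bar>u\<bar>" by simp
    thus ?thesis using b by linarith
  qed
qed

text \<open>The subtracted term is the Taylor term of order two in \<xi>. It is removed because it
  integrates to zero against s |x - y|^\<gamma> - 1, see \<open>integral_kernel\<close>.\<close>

lemma bracket_second_order:
  fixes x y \<xi> :: real
  shows "cmod (2 * iexp (\<xi> * ((x + y) / 2)) - iexp (\<xi> * x) - iexp (\<xi> * y) - of_real (\<xi>\<^sup>2 * (x - y)\<^sup>2 / 4))
     \<le> \<xi>\<^sup>2 * sqrt \<bar>\<xi>\<bar> * ((x - y)\<^sup>2 * sqrt (1 + \<bar>x\<bar> + \<bar>y\<bar>))"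
proof -
  define z where "z = \<xi> * ((x + y) / 2)"
  define v where "v = \<xi> * (x - y) / 2"
  define w where "w = 1 + \<bar>x\<bar> + \<bar>y\<bar>"
  have sz: "sqrt \<bar>z\<bar> \<le> sqrt \<bar>\<xi>\<bar> * sqrt w" "sqrt \<bar>v\<bar> \<le> sqrt \<bar>\<xi>\<bar> * sqrt w"
  proof -
    have a: "\<bar>(x + y) / 2\<bar> \<le> w" "\<bar>(x - y) / 2\<bar> \<le> w"
      using abs_triangle_ineq[of x y] abs_triangle_ineq4[of x y] by (auto simp: w_def)
    have "\<bar>\<xi>\<bar> * \<bar>(x + y) / 2\<bar> \<le> \<bar>\<xi>\<bar> * w" "\<bar>\<xi>\<bar> * \<bar>(x - y) / 2\<bar> \<le> \<bar>\<xi>\<bar> * w"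
      by (rule mult_left_mono[OF a(1) abs_ge_zero] mult_left_mono[OF a(2) abs_ge_zero])+
    thus "sqrt \<bar>z\<bar> \<le> sqrt \<bar>\<xi>\<bar> * sqrt w" "sqrt \<bar>v\<bar> \<le> sqrt \<bar>\<xi>\<bar> * sqrt w"
      unfolding real_sqrt_mult[symmetric] real_sqrt_le_iff z_def v_def by (auto simp: abs_mult)
  qed
  have v2: "v\<^sup>2 = \<xi>\<^sup>2 * (x - y)\<^sup>2 / 4" by (simp add: v_def power_mult_distrib power_divide)
  have mb: "2 * iexp (\<xi> * ((x + y) / 2)) - iexp (\<xi> * x) - iexp (\<xi> * y) = iexp z * of_real (2 - 2 * cos v)"
    unfolding z_def v_def by (rule midpoint_bracket)
  have "2 * iexp (\<xi> * ((x + y) / 2)) - iexp (\<xi> * x) - iexp (\<xi> * y) - of_real (\<xi>\<^sup>2 * (x - y)\<^sup>2 / 4)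
    = (iexp z - 1) * of_real (2 - 2 * cos v) + of_real (2 - 2 * cos v - v\<^sup>2)"
    unfolding mb v2[symmetric] by (simp add: algebra_simps)
  also have "cmod \<dots> \<le> cmod (iexp z - 1) * \<bar>2 - 2 * cos v\<bar> + \<bar>2 - 2 * cos v - v\<^sup>2\<bar>"
    using norm_triangle_ineq[of "(iexp z - 1) * of_real (2 - 2 * cos v)" "of_real (2 - 2 * cos v - v\<^sup>2)"]
    by (simp only: norm_mult norm_of_real)
  also have "\<dots> \<le> (2 * sqrt \<bar>z\<bar>) * v\<^sup>2 + v\<^sup>2 * sqrt \<bar>v\<bar>"
    using one_minus_cos_bounds[of v] iexp_minus_1_bound[of z] by (intro add_mono mult_mono) auto
  also have "\<dots> = v\<^sup>2 * (2 * sqrt \<bar>z\<bar> + sqrt \<bar>v\<bar>)" by (simp add: algebra_simps)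
  also have "\<dots> \<le> v\<^sup>2 * (3 * (sqrt \<bar>\<xi>\<bar> * sqrt w))"
    using sz by (intro mult_left_mono) auto
  also have "\<dots> = 3/4 * (\<xi>\<^sup>2 * sqrt \<bar>\<xi>\<bar> * ((x - y)\<^sup>2 * sqrt w))" by (simp add: v2)
  also have "\<dots> \<le> 1 * (\<xi>\<^sup>2 * sqrt \<bar>\<xi>\<bar> * ((x - y)\<^sup>2 * sqrt w))" by (intro mult_right_mono) (auto simp: w_def)
  finally show ?thesis by (simp add: w_def)
qed

section \<open>The perturbed equation in Fourier variables\<close>

context profile
begin

abbreviation "Phi \<equiv> char M"
abbreviation "Phi' t \<equiv> (\<integral>x. \<i> * x * iexp (t * x) \<partial>M)"

definition exp_bracket :: "real \<Rightarrow> real \<times> real \<Rightarrow> complex" where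
  "exp_bracket \<xi> = (\<lambda>(x, y). 2 * iexp (\<xi> * ((x + y) / 2)) - iexp (\<xi> * x) - iexp (\<xi> * y))"

text \<open>Difference between the collision terms for the kernels s |x - y|^\<gamma> and 1, both
  tested with e^(i \<xi> x): the whole deviation from the equation for \<gamma> = 0.\<close>

definition remainder :: "real \<Rightarrow> complex" where
  "remainder \<xi> = (\<integral>z. exp_bracket \<xi> z * of_real (case z of (x, y) \<Rightarrow> s * \<bar>x - y\<bar> powr \<gamma> - 1) \<partial>(M \<Otimes>\<^sub>M M)) / 2"

lemma exp_bracket_measurable [measurable]: "exp_bracket \<xi> \<in> borel_measurable (M \<Otimes>\<^sub>M M)"
  unfolding exp_bracket_def by measurable

lemma cmod_exp_bracket_le: "cmod (exp_bracket \<xi> z) \<le> 4"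
proof (cases z)
  case (Pair x y)
  show ?thesis unfolding Pair exp_bracket_def prod.case midpoint_bracket
    using one_minus_cos_bounds[of "\<xi> * (x - y) / 2"] by (simp only: norm_mult norm_of_real) simp
qed

lemma integrable_iexp_M: "integrable M (\<lambda>x. iexp (t * x))"
  using integrable_iexp[of "\<lambda>x. of_real (t * x)"] by simp

lemma integrable_exp_bracket: "integrable (M \<Otimes>\<^sub>M M) (exp_bracket \<xi>)"
  using cmod_exp_bracket_le by (intro pp.integrable_const_bound[of _ 4]) auto

lemma integrable_exp_bracket_powr: "integrable (M \<Otimes>\<^sub>M M) (\<lambda>z. exp_bracket \<xi> z * of_real (case z of (x, y) \<Rightarrow> \<bar>x - y\<bar> powr \<gamma>))"
proof (rule integrable_prod_dom(1)[OF _ moments[of \<gamma>], of _ 4])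
  fix x y :: real
  have "\<bar>x - y\<bar> powr \<gamma> \<le> (1 + \<bar>x\<bar> + \<bar>y\<bar>) powr \<gamma>" using gamma_pos by (intro powr_mono2) auto
  thus "norm (exp_bracket \<xi> (x, y) * of_real (case (x, y) of (x, y) \<Rightarrow> \<bar>x - y\<bar> powr \<gamma>)) \<le> 4 * (1 + \<bar>x\<bar> + \<bar>y\<bar>) powr \<gamma>"
    using cmod_exp_bracket_le[of \<xi> "(x, y)"] by (auto simp: norm_mult intro!: mult_mono)
qed (use gamma_pos gamma_less in auto)

text \<open>Test functions are real, so the equation is used for cos and sin separately and the two
  are reassembled as real and imaginary parts.\<close>

lemma fourier_weak: "- (\<xi> / 4) * Phi' \<xi>
   = s / 2 * (\<integral>z. exp_bracket \<xi> z * of_real (case z of (x, y) \<Rightarrow> \<bar>x - y\<bar> powr \<gamma>) \<partial>(M \<Otimes>\<^sub>M M))"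
proof -
  define c where "c x = cos (\<xi> * x)" for x :: real
  define d where "d x = sin (\<xi> * x)" for x :: real
  have dc: "(c has_real_derivative - \<xi> * sin (\<xi> * x)) (at x)" 
    and dd: "(d has_real_derivative \<xi> * cos (\<xi> * x)) (at x)" for x
    unfolding c_def[abs_def] d_def[abs_def] by (auto intro!: derivative_eq_intros)
  have b: "\<bar>- \<xi> * sin (\<xi> * x)\<bar> \<le> \<bar>\<xi>\<bar>" "\<bar>\<xi> * cos (\<xi> * x)\<bar> \<le> \<bar>\<xi>\<bar>" for x
    by (auto simp: abs_mult mult_left_le)
  have c: "c \<in> C1_bounded" "deriv c = (\<lambda>x. - \<xi> * sin (\<xi> * x))"
    by (rule C1_boundedI[of c _ 1 "\<bar>\<xi>\<bar>", OF dc _ _ b(1)]; auto simp: c_def intro!: continuous_intros)+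
  have d: "d \<in> C1_bounded" "deriv d = (\<lambda>x. \<xi> * cos (\<xi> * x))"
    by (rule C1_boundedI[of d _ 1 "\<bar>\<xi>\<bar>", OF dd _ _ b(2)]; auto simp: d_def intro!: continuous_intros)+
  have i2: "integrable M (\<lambda>x. \<i> * x * iexp (\<xi> * x))"
    by (rule Bochner_Integration.integrable_bound[OF integrable_id]) (auto simp: norm_mult)
  define J where "J = (\<integral>z. exp_bracket \<xi> z * of_real (case z of (x, y) \<Rightarrow> \<bar>x - y\<bar> powr \<gamma>) \<partial>(M \<Otimes>\<^sub>M M))"
  have ReJ: "Re J = (\<integral>(x, y). (2 * c ((x + y) / 2) - c x - c y) * \<bar>x - y\<bar> powr \<gamma> \<partial>(M \<Otimes>\<^sub>M M))"
    unfolding J_def integral_Re[OF integrable_exp_bracket_powr, symmetric]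
    by (simp only: Re_mult_of_real exp_bracket_def c_def split_beta' fst_conv snd_conv minus_complex.sel Re_2 Re_iexp)
  have ImJ: "Im J = (\<integral>(x, y). (2 * d ((x + y) / 2) - d x - d y) * \<bar>x - y\<bar> powr \<gamma> \<partial>(M \<Otimes>\<^sub>M M))"
    unfolding J_def integral_Im[OF integrable_exp_bracket_powr, symmetric]
    by (simp only: Im_mult_of_real exp_bracket_def d_def split_beta' fst_conv snd_conv minus_complex.sel Im_2 Im_iexp)
  have ri: "Re (\<i> * of_real x * b) = - (x * Im b)" "Im (\<i> * of_real x * b) = x * Re b" for x b by simp_all
  have ReP: "Re (Phi' \<xi>) = (\<integral>x. - (x * sin (\<xi> * x)) \<partial>M)"
    unfolding integral_Re[OF i2, symmetric] by (simp only: ri Re_iexp Im_iexp)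
  have ImP: "Im (Phi' \<xi>) = (\<integral>x. x * cos (\<xi> * x) \<partial>M)"
    unfolding integral_Im[OF i2, symmetric] by (simp only: ri Re_iexp Im_iexp)
  have 1: "(\<integral>x. x * (- \<xi> * sin (\<xi> * x)) \<partial>M) = \<xi> * Re (Phi' \<xi>)"
    unfolding ReP by (simp flip: integral_mult_right_zero add: mult_ac)
  have 2: "(\<integral>x. x * (\<xi> * cos (\<xi> * x)) \<partial>M) = \<xi> * Im (Phi' \<xi>)"
    unfolding ImP by (simp flip: integral_mult_right_zero add: mult_ac)
  have "- (1/4) * (\<xi> * Re (Phi' \<xi>)) = s / 2 * Re J"
    using weak[OF c(1)] unfolding c(2) ReJ 1 .
  moreover have "- (1/4) * (\<xi> * Im (Phi' \<xi>)) = s / 2 * Im J"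
    using weak[OF d(1)] unfolding d(2) ImJ 2 .
  ultimately show ?thesis unfolding J_def[symmetric] by (simp add: complex_eq_iff)
qed

lemma integral_exp_bracket: "(\<integral>z. exp_bracket \<xi> z \<partial>(M \<Otimes>\<^sub>M M)) = 2 * (Phi (\<xi> / 2))\<^sup>2 - 2 * Phi \<xi>"
proof -
  define e where "e t x = iexp (t * x)" for t x :: real
  have ie: "integrable M (e t)" for t using integrable_iexp_M[of t] by (simp add: e_def[abs_def])
  have Pe: "Phi t = (\<integral>x. e t x \<partial>M)" for t by (simp add: e_def char_def)
  have exp_bracket: "exp_bracket \<xi> (x, y) = 2 * e (\<xi> / 2) x * e (\<xi> / 2) y - e \<xi> x - e \<xi> y" for x y
    by (simp add: exp_bracket_def e_def exp_add[symmetric] algebra_simps add_divide_distrib)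
  have I: "(\<integral>y. exp_bracket \<xi> (x, y) \<partial>M) = 2 * e (\<xi> / 2) x * Phi (\<xi> / 2) - e \<xi> x - Phi \<xi>" for x
    unfolding exp_bracket Pe using ie prob_space by simp
  have "(\<integral>z. exp_bracket \<xi> z \<partial>(M \<Otimes>\<^sub>M M)) = (\<integral>x. 2 * e (\<xi> / 2) x * Phi (\<xi> / 2) - e \<xi> x - Phi \<xi> \<partial>M)"
    using pp.integral_fst'[OF integrable_exp_bracket[of \<xi>]] unfolding I by simp
  also have "\<dots> = 2 * Phi (\<xi> / 2) * Phi (\<xi> / 2) - Phi \<xi> - Phi \<xi>"
    using ie prob_space Pe by simp
  finally show ?thesis by (simp add: power2_eq_square)
qed

lemma fourier_eq: "Phi \<xi> - (\<xi> / 4) * Phi' \<xi> = (Phi (\<xi> / 2))\<^sup>2 + remainder \<xi>"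
proof -
  define J where "J = (\<integral>z. exp_bracket \<xi> z * of_real (case z of (x, y) \<Rightarrow> \<bar>x - y\<bar> powr \<gamma>) \<partial>(M \<Otimes>\<^sub>M M))"
  define P where "P = Phi' \<xi>"
  have "exp_bracket \<xi> z * of_real (case z of (x, y) \<Rightarrow> s * \<bar>x - y\<bar> powr \<gamma> - 1)
    = s * (exp_bracket \<xi> z * of_real (case z of (x, y) \<Rightarrow> \<bar>x - y\<bar> powr \<gamma>)) - exp_bracket \<xi> z" for z
    by (cases z) (simp add: algebra_simps)
  hence "remainder \<xi> = (s * J - (2 * (Phi (\<xi> / 2))\<^sup>2 - 2 * Phi \<xi>)) / 2"
    unfolding remainder_def J_def using integrable_exp_bracket integrable_exp_bracket_powr integral_exp_bracket by simp
  moreover have "- (\<xi> / 4) * P = s / 2 * J" unfolding P_def J_def using fourier_weak[of \<xi>] by simp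
  ultimately show ?thesis unfolding P_def[symmetric] by (simp add: diff_divide_distrib)
qed

end

text \<open>The characteristic function of the density \<^term>\<open>H\<close>.\<close>
definition psi :: "real \<Rightarrow> real" where "psi x = (1 + \<bar>x\<bar>) * exp (- \<bar>x\<bar>)"

lemma psi_bounds: "0 \<le> psi x" "psi x \<le> 1"
proof -
  show "0 \<le> psi x" by (simp add: psi_def)
  have "(1 + \<bar>x\<bar>) * exp (- \<bar>x\<bar>) \<le> exp \<bar>x\<bar> * exp (- \<bar>x\<bar>)"
    using exp_ge_add_one_self[of "\<bar>x\<bar>"] by (intro mult_right_mono) auto
  thus "psi x \<le> 1" by (simp add: psi_def exp_minus)
qed

lemma psi_derivative: "0 < x \<Longrightarrow> (psi has_real_derivative - (x * exp (- x))) (at x)"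
proof -
  assume x: "0 < x"
  have "((\<lambda>x. (1 + x) * exp (- x)) has_real_derivative - (x * exp (- x))) (at x)"
    by (auto intro!: derivative_eq_intros simp: algebra_simps)
  moreover have "eventually (\<lambda>x. (1 + x) * exp (- x) = psi x) (nhds x)"
    using eventually_nhds_in_open[of "{0<..}" x] x by (auto elim!: eventually_mono simp: psi_def)
  ultimately show ?thesis using DERIV_cong_ev by fastforce
qed

lemma psi_eq: "0 < x \<Longrightarrow> psi x - x / 4 * (- (x * exp (- x))) = (psi (x / 2))\<^sup>2"
  by (simp add: psi_def power2_eq_square algebra_simps exp_add[symmetric] add_divide_distrib)

text \<open>f = psi - 1 + t^2/2 has derivative t (1 - e^(-t)), which lies between 0 and t^2. Hence 0
  \<le> f \<le> x^3 / 3, while f \<le> x^2 / 2 from psi \<le> 1; the two are interpolated at x =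
  1.\<close>

lemma psi_taylor:
  assumes "0 < x"
  shows "\<bar>psi x - 1 + x\<^sup>2 / 2\<bar> \<le> x powr (5/2)"
proof -
  have p52: "x powr (5/2) = x\<^sup>2 * sqrt x" using assms powr_add[of x 2 "1/2"] by (simp add: powr_half_sqrt)
  define f where "f t = (1 + t) * exp (- t) - 1 + t\<^sup>2 / 2" for t :: real
  define g where "g t = t ^ 3 / 3 - f t" for t
  have df: "(f has_real_derivative t * (1 - exp (- t))) (at t)" for t
    unfolding f_def[abs_def] by (auto intro!: derivative_eq_intros simp: algebra_simps)
  have dg: "(g has_real_derivative t * (t - (1 - exp (- t)))) (at t)" for t
    unfolding g_def[abs_def] by (auto intro!: derivative_eq_intros df simp: algebra_simps power2_eq_square)
  have "f 0 \<le> f x"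
    by (rule DERIV_nonneg_imp_nondecreasing[of 0 x f]) (use assms df in \<open>auto intro!: exI mult_nonneg_nonneg\<close>)
  hence 1: "0 \<le> f x" by (simp add: f_def)
  have "g 0 \<le> g x"
  proof (rule DERIV_nonneg_imp_nondecreasing[of 0 x g])
    fix t assume "0 \<le> t" "t \<le> x"
    moreover have "1 - exp (- t) \<le> t" using exp_ge_add_one_self[of "- t"] by simp
    ultimately show "\<exists>y. (g has_real_derivative y) (at t) \<and> 0 \<le> y"
      using dg by (intro exI[of _ "t * (t - (1 - exp (- t)))"]) auto
  qed (use assms in auto)
  hence 2: "f x \<le> x ^ 3 / 3" by (simp add: g_def f_def)
  have 3: "f x \<le> x\<^sup>2 / 2" using psi_bounds[of x] assms by (simp add: f_def psi_def)
  have "f x \<le> x\<^sup>2 * sqrt x"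
  proof (cases "x \<le> 1")
    case True
    have "x \<le> sqrt x" using True assms mult_right_mono[OF True, of x]
      by (intro real_le_rsqrt) (simp add: power2_eq_square)
    hence "x\<^sup>2 * x \<le> x\<^sup>2 * sqrt x" by (intro mult_left_mono) auto
    moreover have "x ^ 3 / 3 \<le> x\<^sup>2 * x" using assms by (simp add: power3_eq_cube power2_eq_square)
    ultimately show ?thesis using 2 by linarith
  next
    case False
    hence "x\<^sup>2 * 1 \<le> x\<^sup>2 * sqrt x" by (intro mult_left_mono) auto
    moreover have "0 \<le> x\<^sup>2" by simp
    ultimately show ?thesis using 3 by linarith
  qed
  thus ?thesis using 1 assms unfolding p52 by (simp add: f_def psi_def)
qed

text \<open>The equation is integrated from infinity, where \<open>h x / x^4\<close> vanishes.\<close>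
lemma ode_bound:
  fixes h h' :: "real \<Rightarrow> complex"
  assumes der: "\<And>x. 0 < x \<Longrightarrow> (h has_vector_derivative h' x) (at x)"
    and bnd: "\<And>x. 0 < x \<Longrightarrow> cmod (h x - of_real (x / 4) * h' x) \<le> A * x powr q"
    and B: "\<And>x. 0 < x \<Longrightarrow> cmod (h x) \<le> B"
    and A: "0 \<le> A" and q: "q < 4" and x: "0 < x"
  shows "cmod (h x) \<le> 4 * A / (4 - q) * x powr q"
proof -
  \<comment> \<open>Integrating factor: (t^(-4) h)' = -4 t^(-5) (h - t h'/4), and the right side is
    controlled by the hypothesis. The function \<phi> below is a primitive of the resulting
    bound.\<close>
  define f where "f t = (t powr (-4)) *\<^sub>R h t" for t
  define f' where "f' t = (t powr (-4)) *\<^sub>R h' t + (- 4 * t powr (-5)) *\<^sub>R h t" for t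
  define \<phi> where "\<phi> t = - (4 * A / (4 - q)) * t powr (q - 4)" for t
  have df: "(f has_vector_derivative f' t) (at t)" if "0 < t" for t
  proof -
    have "((\<lambda>t. t powr (-4)) has_real_derivative - 4 * t powr (- 5)) (at t)"
      using that by (auto intro!: derivative_eq_intros)
    from has_vector_derivative_scaleR[OF this der[OF that]] show ?thesis
      unfolding f_def[abs_def] f'_def by simp
  qed
  have d\<phi>: "(\<phi> has_vector_derivative 4 * A * t powr (q - 5)) (at t)" if "0 < t" for t
  proof -
    have "(\<phi> has_real_derivative 4 * A * t powr (q - 5)) (at t)"
      unfolding \<phi>_def[abs_def] using that q
      by (auto intro!: derivative_eq_intros) (simp add: field_simps)
    thus ?thesis by (simp add: has_real_derivative_iff_has_vector_derivative)
  qed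
  have f'le: "norm (f' t) \<le> 4 * A * t powr (q - 5)" if "0 < t" for t
  proof -
    have "t powr (-4) = t powr (-5) * t" using that powr_add[of t "-5" 1] by simp
    hence "f' t = (- 4 * t powr (-5)) *\<^sub>R (h t - of_real (t / 4) * h' t)"
      unfolding f'_def by (simp add: scaleR_conv_of_real algebra_simps)
    hence "norm (f' t) = 4 * t powr (-5) * cmod (h t - of_real (t / 4) * h' t)" by simp
    also have "\<dots> \<le> 4 * t powr (-5) * (A * t powr q)" using bnd[OF that] by (intro mult_left_mono) auto
    also have "\<dots> = 4 * A * t powr (q - 5)" using powr_add[of t "-5" q] by simp
    finally show ?thesis .
  qed
  have main: "cmod (h x) \<le> 4 * A / (4 - q) * x powr q + x powr 4 * (B * T powr (-4))" if T: "x < T" for T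
  proof -
    have "norm (f T - f x) \<le> \<phi> T - \<phi> x"
    proof (rule differentiable_bound_general[OF T, where f' = f' and \<phi>' = "\<lambda>t. 4 * A * t powr (q - 5)"])
      have "isCont f t" "isCont \<phi> t" if "0 < t" for t
        using has_vector_derivative_continuous[OF df[OF that]] has_vector_derivative_continuous[OF d\<phi>[OF that]] .
      thus "continuous_on {x..T} f" "continuous_on {x..T} \<phi>"
        using x by (auto intro!: continuous_at_imp_continuous_on)
    qed (use x in \<open>auto intro!: df d\<phi> f'le\<close>)
    also have "\<dots> \<le> - \<phi> x" using A q by (simp add: \<phi>_def)
    finally have "norm (f x) \<le> - \<phi> x + norm (f T)" using norm_triangle_ineq3[of "f T" "f x"] by linarith
    also have "norm (f T) = T powr (-4) * cmod (h T)" by (simp add: f_def)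
    also have "\<dots> \<le> T powr (-4) * B" using B[of T] T x by (intro mult_left_mono) auto
    finally have "x powr (-4) * cmod (h x) \<le> - \<phi> x + T powr (-4) * B" by (simp add: f_def)
    hence "x powr 4 * (x powr (-4) * cmod (h x)) \<le> x powr 4 * (- \<phi> x + T powr (-4) * B)"
      by (intro mult_left_mono) auto
    moreover have "x powr 4 * x powr (-4) = 1" using x by (simp only: powr_add[symmetric]) simp
    moreover have "x powr 4 * x powr (q - 4) = x powr q" by (simp only: powr_add[symmetric]) simp
    moreover have "x powr 4 * (- \<phi> x + T powr (-4) * B) = 4 * A / (4 - q) * (x powr 4 * x powr (q - 4)) + x powr 4 * (B * T powr (-4))"
      unfolding \<phi>_def by (simp only: distrib_left) (simp add: mult_ac)
    ultimately show ?thesis by (simp only: mult.assoc[symmetric] mult_1)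
  qed
  \<comment> \<open>The boundary term at T vanishes because h is bounded; the bound on the
    derivative is integrable at infinity because q < 4.\<close>
  have "((\<lambda>T::real. T powr (-4)) \<longlongrightarrow> 0) at_top" by (rule tendsto_neg_powr) (auto simp: filterlim_ident)
  hence "((\<lambda>T. 4 * A / (4 - q) * x powr q + x powr 4 * (B * T powr (-4))) \<longlongrightarrow> 4 * A / (4 - q) * x powr q + x powr 4 * (B * 0)) at_top"
    by (intro tendsto_intros)
  from tendsto_lowerbound[OF this eventually_mono[OF eventually_gt_at_top[of x] main]]
  show ?thesis by simp
qed

section \<open>Explicit bounds for small \<gamma> and closeness of the characteristic function to
  \<open>psi\<close>\<close>

locale small_profile = profile +
  assumes gamma_small: "\<gamma> \<le> 1/500"
begin

text \<open>\<open>6404 = 4 (1 + 1600)\<close>, from \<open>(1 + |x|)^(11/4) \<le> 4 (1 + |x|^(11/4))\<close> and the moment bound below.\<close>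
definition K :: real where "K = 6404"

text \<open>The threshold \<gamma> \<le> 1/500 comes from here: with 1 + 5\<gamma> \<le> 101/100 the
  bracket in \<open>moment_bound\<close> at k = 11/4 is still at least 1/100, and 1600 = 16 *
  100.\<close>

lemma Mp_11_4: "Mp (11/4) \<le> 1600"
proof -
  define a :: real where "a = 2 powr (1 - 11/4)"
  have a: "a \<le> 298/1000"
  proof (rule ccontr)
    assume "\<not> ?thesis"
    \<comment> \<open>The fourth power clears the exponent: a^4 = 2^(-7) = 1/128, just below
      0.298^4.\<close>
    hence "(298/1000) ^ 4 < a ^ 4" by (intro power_strict_mono) auto
    moreover have "a ^ 4 = 2 powr (-7)" by (simp add: a_def powr_power)
    moreover have "(2::real) powr (-7) = 1 / 128" by (simp add: powr_minus powr_numeral)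
    ultimately show False by (simp add: power_numeral_reduce)
  qed
  have g: "1 + 5 * \<gamma> \<le> 101/100" "0 < 1 + 5 * \<gamma>" using gamma_small gamma_pos by auto
  have "(1::real)/100 \<le> 2 * (702/1000) / (101/100) - (11/4) / 2" by simp
  also have "2 * (702/1000) / (101/100) \<le> 2 * (1 - a) / (1 + 5 * \<gamma>)"
    using a g by (intro frac_le) auto
  finally have l: "1/100 \<le> 2 * (1 - a) / (1 + 5 * \<gamma>) - (11/4) / 2" by simp
  have "0 \<le> Mp (11/4)" by (intro Bochner_Integration.integral_nonneg) auto
  from mult_left_mono[OF l this] moment_bound[of "11/4", folded a_def] gamma_small
  show ?thesis by linarith
qed

lemma weighted_moment_11_4: "weighted_moment (11/4) \<le> K"
proof -
  have "weighted_moment (11/4) \<le> (\<integral>x. 4 * (1 + \<bar>x\<bar> powr (11/4)) \<partial>M)"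
    unfolding weighted_moment_def
  proof (intro integral_mono moments)
    fix x :: real
    have "2 * \<bar>(1 + \<bar>x\<bar>) / 2\<bar> powr (11/4) \<le> \<bar>1\<bar> powr (11/4) + \<bar>\<bar>x\<bar>\<bar> powr (11/4)"
      by (rule midpoint_powr_le) simp
    hence "2 * ((1 + \<bar>x\<bar>) / 2) powr (11/4) \<le> 1 + \<bar>x\<bar> powr (11/4)" by (simp del: powr_divide)
    hence "2 * ((1 + \<bar>x\<bar>) powr (11/4) / 2 powr (11/4)) \<le> 1 + \<bar>x\<bar> powr (11/4)" by (simp add: powr_divide)
    moreover have "(2::real) powr (11/4) \<le> 2 powr 3" by (intro powr_mono) auto
    moreover have "(2::real) powr 3 = 8" by simp
    moreover have "0 < (2::real) powr (11/4)" by simp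
    ultimately have "(1 + \<bar>x\<bar>) powr (11/4) \<le> (1 + \<bar>x\<bar> powr (11/4)) * (2 powr (11/4) / 2)"
      by (simp add: field_simps)
    also have "\<dots> \<le> (1 + \<bar>x\<bar> powr (11/4)) * 4"
      using \<open>(2::real) powr (11/4) \<le> 2 powr 3\<close> by (intro mult_left_mono) auto
    finally show "(1 + \<bar>x\<bar>) powr (11/4) \<le> 4 * (1 + \<bar>x\<bar> powr (11/4))" by simp
  qed (use integrable_abs_powr[of "11/4"] in auto)
  also have "\<dots> = 4 * (1 + Mp (11/4))" using integrable_abs_powr[of "11/4"] prob_space by simp
  finally show ?thesis using Mp_11_4 by (simp add: K_def)
qed

lemma weighted_moment_nonneg: "0 \<le> weighted_moment q" unfolding weighted_moment_def by (intro Bochner_Integration.integral_nonneg) auto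

lemma Mp_5_2: "Mp (5/2) \<le> K"
proof -
  have "Mp (5/2) \<le> weighted_moment (11/4)" unfolding weighted_moment_def
  proof (intro integral_mono moments integrable_abs_powr)
    fix x :: real
    have "\<bar>x\<bar> powr (5/2) \<le> (1 + \<bar>x\<bar>) powr (5/2)" by (intro powr_mono2) auto
    also have "\<dots> \<le> (1 + \<bar>x\<bar>) powr (11/4)" by (intro powr_mono) auto
    finally show "\<bar>x\<bar> powr (5/2) \<le> (1 + \<bar>x\<bar>) powr (11/4)" .
  qed auto
  thus ?thesis using weighted_moment_11_4 by simp
qed

lemma one_minus_s: "1 - s \<le> 13 * K * \<gamma>"
proof -
  \<comment> \<open>The excess of (1 + 2\<gamma>K)(1 + 5\<gamma>) over 1. It is at most (12K +
    5)\<gamma>, whence the 13.\<close>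
  define e where "e = 2 * (\<gamma> * K) + 5 * \<gamma> + 10 * (\<gamma> * \<gamma> * K)"
  have "s * ((1 + 2 * \<gamma> * Mp (5/2)) * (1 + 5 * \<gamma>)) \<le> s * ((1 + 2 * \<gamma> * K) * (1 + 5 * \<gamma>))"
    using Mp_5_2 s_pos gamma_pos by (intro mult_left_mono mult_right_mono) auto
  also have "\<dots> = s + s * e" by (simp add: e_def algebra_simps)
  finally have "1 \<le> s + s * e" using s_lower gamma_small by simp
  moreover have e0: "0 \<le> e" using gamma_pos by (simp add: e_def K_def)
  moreover have "s * e \<le> 1 * e" using s_le_1 e0 by (intro mult_right_mono) auto
  moreover have "\<gamma> * \<gamma> \<le> \<gamma> * 1" using gamma_pos gamma_less by (intro mult_left_mono) auto
  hence "e \<le> 13 * K * \<gamma>" using gamma_pos by (simp add: e_def K_def)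
  ultimately show ?thesis by simp
qed

text \<open>For |u| \<le> 1 this is the tangent bound. For |u| > 1 Bernoulli's inequality is applied
  to (|u|^(1/8))^(8\<gamma>), so that the factor \<gamma> is gained for only 1/8 of a power: 17/8 =
  2 + 1/8.\<close>

lemma sq_powr_minus_1_bound:
  fixes u :: real
  shows "u\<^sup>2 * \<bar>\<bar>u\<bar> powr \<gamma> - 1\<bar> \<le> 9 * \<gamma> * (1 + \<bar>u\<bar>) powr (17/8)"
proof (cases "\<bar>u\<bar> \<le> 1")
  case True
  have "\<bar>u\<bar> powr \<gamma> \<le> 1" using True gamma_pos by (intro powr_le1) auto
  hence "u\<^sup>2 * \<bar>\<bar>u\<bar> powr \<gamma> - 1\<bar> = u\<^sup>2 - \<bar>u\<bar> powr (2 + \<gamma>)" by (simp add: powr_add algebra_simps)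
  also have "\<dots> \<le> \<gamma> * 1" 
  proof -
    define p where "p = \<bar>u\<bar> powr (2 + \<gamma>)"
    have "0 \<le> \<gamma> * u\<^sup>2" using gamma_pos by simp
    moreover have "u\<^sup>2 + (\<gamma> * u\<^sup>2 - \<gamma> * 1) / 2 \<le> p"
      using tangent_at_1[of u] unfolding right_diff_distrib p_def .
    moreover have "a - p \<le> g * 1" if "0 \<le> b" "a + (b - g * 1) / 2 \<le> p" "0 < g" for a b g p :: real
      using that by argo
    ultimately show ?thesis using gamma_pos unfolding p_def[symmetric] by blast
  qed
  also have "\<dots> \<le> 9 * \<gamma> * (1 + \<bar>u\<bar>) powr (17/8)"
    using gamma_pos ge_one_powr_ge_zero[of "1 + \<bar>u\<bar>" "17/8"] by (simp add: mult_mono)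
  finally show ?thesis .
next
  case False
  have "(\<bar>u\<bar> powr (1/8)) powr (8 * \<gamma>) \<le> 1 + 8 * \<gamma> * (\<bar>u\<bar> powr (1/8) - 1)"
    using gamma_small gamma_pos by (intro powr_le_affine) auto
  moreover have "(\<bar>u\<bar> powr (1/8)) powr (8 * \<gamma>) = \<bar>u\<bar> powr \<gamma>" by (simp add: powr_powr)
  moreover have "1 \<le> \<bar>u\<bar> powr \<gamma>" using False gamma_pos by (intro ge_one_powr_ge_zero) auto
  ultimately have "\<bar>\<bar>u\<bar> powr \<gamma> - 1\<bar> \<le> 9 * \<gamma> * \<bar>u\<bar> powr (1/8)" 
    using gamma_pos mult_nonneg_nonneg[of \<gamma> "\<bar>u\<bar> powr (1/8)"] by (simp add: algebra_simps)
  hence "u\<^sup>2 * \<bar>\<bar>u\<bar> powr \<gamma> - 1\<bar> \<le> u\<^sup>2 * (9 * \<gamma> * \<bar>u\<bar> powr (1/8))" by (intro mult_left_mono) auto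
  also have "\<dots> = 9 * \<gamma> * \<bar>u\<bar> powr (17/8)" using powr_add[of "\<bar>u\<bar>" 2 "1/8"] by simp
  also have "\<dots> \<le> 9 * \<gamma> * (1 + \<bar>u\<bar>) powr (17/8)" using gamma_pos by (intro mult_left_mono powr_mono2) auto
  finally show ?thesis .
qed

lemma sq_kernel_bound:
  fixes x y :: real
  shows "(x - y)\<^sup>2 * \<bar>s * \<bar>x - y\<bar> powr \<gamma> - 1\<bar> \<le> 14 * K * \<gamma> * (1 + \<bar>x\<bar> + \<bar>y\<bar>) powr (17/8)"
proof -
  define w where "w = 1 + \<bar>x\<bar> + \<bar>y\<bar>"
  define u where "u = x - y"
  have uw: "\<bar>u\<bar> \<le> w" "1 + \<bar>u\<bar> \<le> w" "1 \<le> w" using abs_triangle_ineq4[of x y] by (auto simp: w_def u_def)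
  have K0: "0 < K" by (simp add: K_def)
  have e: "s * \<bar>u\<bar> powr \<gamma> - 1 = s * (\<bar>u\<bar> powr \<gamma> - 1) - (1 - s)" by (simp add: algebra_simps)
  have "\<bar>s * \<bar>u\<bar> powr \<gamma> - 1\<bar> \<le> \<bar>s * (\<bar>u\<bar> powr \<gamma> - 1)\<bar> + \<bar>1 - s\<bar>"
    unfolding e by (rule abs_triangle_ineq4)
  also have "\<dots> = s * \<bar>\<bar>u\<bar> powr \<gamma> - 1\<bar> + (1 - s)"
    using s_pos s_le_1 by (simp add: abs_mult)
  also have "\<dots> \<le> 1 * \<bar>\<bar>u\<bar> powr \<gamma> - 1\<bar> + 13 * K * \<gamma>"
    using s_le_1 one_minus_s by (intro add_mono mult_right_mono) auto
  finally have "u\<^sup>2 * \<bar>s * \<bar>u\<bar> powr \<gamma> - 1\<bar> \<le> u\<^sup>2 * (1 * \<bar>\<bar>u\<bar> powr \<gamma> - 1\<bar> + 13 * K * \<gamma>)"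
    by (intro mult_left_mono) auto
  also have "\<dots> = u\<^sup>2 * \<bar>\<bar>u\<bar> powr \<gamma> - 1\<bar> + 13 * K * \<gamma> * u\<^sup>2" by (simp add: algebra_simps)
  also have "\<dots> \<le> 9 * \<gamma> * w powr (17/8) + 13 * K * \<gamma> * w powr (17/8)"
  proof (intro add_mono)
    have "(1 + \<bar>u\<bar>) powr (17/8) \<le> w powr (17/8)" using uw by (intro powr_mono2) auto
    hence "9 * \<gamma> * (1 + \<bar>u\<bar>) powr (17/8) \<le> 9 * \<gamma> * w powr (17/8)"
      using gamma_pos by (intro mult_left_mono) auto
    thus "u\<^sup>2 * \<bar>\<bar>u\<bar> powr \<gamma> - 1\<bar> \<le> 9 * \<gamma> * w powr (17/8)" using sq_powr_minus_1_bound[of u] by linarith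
    have "\<bar>u\<bar> powr 2 \<le> w powr 2" using uw by (intro powr_mono2) auto
    also have "\<dots> \<le> w powr (17/8)" using uw by (intro powr_mono) auto
    finally show "13 * K * \<gamma> * u\<^sup>2 \<le> 13 * K * \<gamma> * w powr (17/8)"
      using gamma_pos K0 by (intro mult_left_mono) auto
  qed
  also have "\<dots> = (9 + 13 * K) * (\<gamma> * w powr (17/8))" by (simp add: algebra_simps)
  also have "\<dots> \<le> (14 * K) * (\<gamma> * w powr (17/8))" using gamma_pos by (intro mult_right_mono) (auto simp: K_def)
  finally show ?thesis by (simp add: u_def w_def mult.assoc)
qed

lemma integrable_kernel: 
  "integrable (M \<Otimes>\<^sub>M M) (\<lambda>z. of_real (case z of (x, y) \<Rightarrow> (x - y)\<^sup>2) * complex_of_real (case z of (x, y) \<Rightarrow> s * \<bar>x - y\<bar> powr \<gamma> - 1))"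
proof (rule integrable_prod_dom(1)[OF _ moments[of "17/8"], of _ "14 * K * \<gamma>"])
  fix x y :: real
  show "norm (of_real (case (x, y) of (x, y) \<Rightarrow> (x - y)\<^sup>2) * complex_of_real (case (x, y) of (x, y) \<Rightarrow> s * \<bar>x - y\<bar> powr \<gamma> - 1))
     \<le> 14 * K * \<gamma> * (1 + \<bar>x\<bar> + \<bar>y\<bar>) powr (17 / 8)"
    using sq_kernel_bound[of x y] by (simp only: norm_mult norm_of_real prod.case abs_power2)
qed auto

text \<open>The energy identity gives s E|x - y|^(2+\<gamma>) = 2, and variance one gives E(x - y)^2
  = 2. This cancellation is what makes the remainder vanish to order higher than two at \<xi> =
  0.\<close>

lemma integral_kernel: 
  "(\<integral>z. of_real (case z of (x, y) \<Rightarrow> (x - y)\<^sup>2) * complex_of_real (case z of (x, y) \<Rightarrow> s * \<bar>x - y\<bar> powr \<gamma> - 1) \<partial>(M \<Otimes>\<^sub>M M)) = 0"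
proof -
  have *: "(case z of (x, y) \<Rightarrow> (x - y)\<^sup>2) * (case z of (x, y) \<Rightarrow> s * \<bar>x - y\<bar> powr \<gamma> - 1)
    = s * (case z of (x, y) \<Rightarrow> \<bar>x - y\<bar> powr (2 + \<gamma>)) - (case z of (x, y) \<Rightarrow> (x - y)\<^sup>2)" for z :: "real \<times> real"
    by (cases z) (simp add: powr_add algebra_simps)
  have "(\<integral>z. s * (case z of (x, y) \<Rightarrow> \<bar>x - y\<bar> powr (2 + \<gamma>)) - (case z of (x, y) \<Rightarrow> (x - y)\<^sup>2) \<partial>(M \<Otimes>\<^sub>M M)) = 0"
    using integrable_diff_sq integrable_diff_powr[of "2 + \<gamma>"] energy_identity integral_diff_sq gamma_pos gamma_less
    by simp
  thus ?thesis unfolding of_real_mult[symmetric] * integral_complex_of_real by simp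
qed

text \<open>After the second-order term is subtracted, the bracket contributes |\<xi>|^(5/2) (x -
  y)^2 w^(1/2) with w = 1 + |x| + |y|, and (x - y)^2 times the kernel deviation is O(\<gamma>)
  w^(17/8). The total order 21/8 is below 11/4, the order of the available moment.\<close>

lemma remainder_bound: "cmod (remainder \<xi>) \<le> 7 * K ^ 3 * \<gamma> * \<bar>\<xi>\<bar> powr (5/2)"
proof -
  define k where "k = (\<lambda>z. complex_of_real (case z of (x, y) \<Rightarrow> s * \<bar>x - y\<bar> powr \<gamma> - 1))"
  define d where "d = (\<lambda>z. complex_of_real (case z of (x, y) \<Rightarrow> (x - y)\<^sup>2))"
  define F where "F = (\<lambda>z. (exp_bracket \<xi> z - of_real (\<xi>\<^sup>2 / 4) * d z) * k z)"
  have [measurable]: "k \<in> borel_measurable (M \<Otimes>\<^sub>M M)" "d \<in> borel_measurable (M \<Otimes>\<^sub>M M)"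
    unfolding k_def d_def by measurable
  have idk: "integrable (M \<Otimes>\<^sub>M M) (\<lambda>z. d z * k z)" unfolding d_def k_def by (rule integrable_kernel)
  have ibk: "integrable (M \<Otimes>\<^sub>M M) (\<lambda>z. exp_bracket \<xi> z * k z)"
  proof -
    have "exp_bracket \<xi> z * k z = s * (exp_bracket \<xi> z * of_real (case z of (x, y) \<Rightarrow> \<bar>x - y\<bar> powr \<gamma>)) - exp_bracket \<xi> z" for z
      by (cases z) (simp add: algebra_simps k_def)
    thus ?thesis using integrable_exp_bracket integrable_exp_bracket_powr by simp
  qed
  have Fe: "F z = exp_bracket \<xi> z * k z - of_real (\<xi>\<^sup>2 / 4) * (d z * k z)" for z by (simp add: F_def algebra_simps)
  have iF: "integrable (M \<Otimes>\<^sub>M M) F" unfolding Fe[abs_def] using ibk idk by simp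
  have E: "(\<integral>z. F z \<partial>(M \<Otimes>\<^sub>M M)) = 2 * remainder \<xi>"
    unfolding Fe using ibk idk integral_kernel by (simp add: remainder_def k_def d_def)
  have K0: "0 < K" by (simp add: K_def)
  define c where "c = 14 * K * \<gamma> * \<bar>\<xi>\<bar> powr (5/2)"
  have c0: "0 \<le> c" using K0 gamma_pos by (simp add: c_def)
  have "(\<integral>z. norm (F z) \<partial>(M \<Otimes>\<^sub>M M)) \<le> c * (weighted_moment (11/4))\<^sup>2"
  proof (rule integral_prod_dom[OF _ moments])
    fix x y :: real
    define w where "w = 1 + \<bar>x\<bar> + \<bar>y\<bar>"
    have w1: "1 \<le> w" by (simp add: w_def)
    have x52: "\<xi>\<^sup>2 * sqrt \<bar>\<xi>\<bar> = \<bar>\<xi>\<bar> powr (5/2)"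
      using powr_add[of "\<bar>\<xi>\<bar>" 2 "1/2"] by (simp add: powr_half_sqrt)
    have "norm (F (x, y)) = cmod (2 * iexp (\<xi> * ((x + y) / 2)) - iexp (\<xi> * x) - iexp (\<xi> * y) - of_real (\<xi>\<^sup>2 * (x - y)\<^sup>2 / 4))
       * \<bar>s * \<bar>x - y\<bar> powr \<gamma> - 1\<bar>"
      unfolding F_def exp_bracket_def d_def k_def prod.case norm_mult norm_of_real by (simp add: mult.commute)
    also have "\<dots> \<le> (\<bar>\<xi>\<bar> powr (5/2) * ((x - y)\<^sup>2 * sqrt w)) * \<bar>s * \<bar>x - y\<bar> powr \<gamma> - 1\<bar>"
      using bracket_second_order[of \<xi> x y] by (intro mult_right_mono) (auto simp: w_def x52)
    also have "\<dots> = \<bar>\<xi>\<bar> powr (5/2) * sqrt w * ((x - y)\<^sup>2 * \<bar>s * \<bar>x - y\<bar> powr \<gamma> - 1\<bar>)" by simp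
    also have "\<dots> \<le> \<bar>\<xi>\<bar> powr (5/2) * sqrt w * (14 * K * \<gamma> * w powr (17/8))"
      using sq_kernel_bound[of x y] w1 by (intro mult_left_mono) (auto simp: w_def)
    also have "\<dots> = c * w powr (21/8)"
      using powr_add[of w "1/2" "17/8"] w1 by (simp add: c_def powr_half_sqrt)
    also have "\<dots> \<le> c * w powr (11/4)" using w1 c0 by (intro mult_left_mono powr_mono) auto
    finally show "norm (F (x, y)) \<le> c * (1 + \<bar>x\<bar> + \<bar>y\<bar>) powr (11/4)" by (simp add: w_def)
  qed (use iF in auto)
  also have "\<dots> \<le> c * K\<^sup>2" using weighted_moment_11_4 weighted_moment_nonneg c0 by (intro mult_left_mono power_mono) auto
  finally have "cmod (2 * remainder \<xi>) \<le> c * K\<^sup>2"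
    unfolding E[symmetric] using integral_norm_bound[of "M \<Otimes>\<^sub>M M" F] by linarith
  thus ?thesis by (simp add: c_def norm_mult power3_eq_cube power2_eq_square mult_ac)
qed

text \<open>Mean zero and variance one identify the Taylor polynomial; the error interpolates the
  Taylor bounds of orders three and two. Compared with \<open>psi_taylor\<close> it shows that the
  weighted distance between the two functions is finite, without which the contraction could not
  start.\<close>

lemma Phi_taylor: "cmod (Phi x - 1 + x\<^sup>2 / 2) \<le> K * \<bar>x\<bar> powr (5/2)"
proof -
  have "integrable M (\<lambda>y. (x * y)\<^sup>2 / 2)" "integrable M (\<lambda>y. x * y)"
    using integrable_id integrable_sq by (simp_all add: power_mult_distrib)
  hence c: "integrable M (\<lambda>y. \<i> * complex_of_real (x * y))" "integrable M (\<lambda>y. complex_of_real ((x * y)\<^sup>2 / 2))"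
    by (intro integrable_mult_right, simp_all only: complex_of_real_integrable_eq)
  have i1: "integrable M (\<lambda>y. iexp (x * y) - 1 - \<i> * complex_of_real (x * y) + complex_of_real ((x * y)\<^sup>2 / 2))"
    by (intro Bochner_Integration.integrable_add Bochner_Integration.integrable_diff c integrable_iexp_M integrable_const)
  have "Phi x - 1 + x\<^sup>2 / 2 = (\<integral>y. iexp (x * y) - 1 - \<i> * (x * y) + of_real ((x * y)\<^sup>2 / 2) \<partial>M)"
  proof -
    have a: "(\<integral>y. \<i> * (x * y) \<partial>M) = 0" using mean_zero by simp
    have b: "(\<integral>y. complex_of_real ((x * y)\<^sup>2 / 2) \<partial>M) = of_real (x\<^sup>2 / 2)"
      unfolding integral_complex_of_real using var_one by (simp add: power_mult_distrib)
    have "(\<integral>y. iexp (x * y) - 1 - \<i> * complex_of_real (x * y) + complex_of_real ((x * y)\<^sup>2 / 2) \<partial>M)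
       = (\<integral>y. iexp (x * y) \<partial>M) - (\<integral>y. 1 \<partial>M) - (\<integral>y. \<i> * complex_of_real (x * y) \<partial>M) + (\<integral>y. complex_of_real ((x * y)\<^sup>2 / 2) \<partial>M)"
      using integrable_iexp_M[of x] c by (simp del: of_real_mult of_real_power of_real_divide)
    thus ?thesis using a b prob_space unfolding char_def by simp
  qed
  also have "cmod \<dots> \<le> (\<integral>y. \<bar>x\<bar> powr (5/2) * \<bar>y\<bar> powr (5/2) \<partial>M)"
  proof (rule order_trans[OF integral_norm_bound integral_mono])
    fix y :: real
    define u where "u = x * y"
    have s2: "(\<Sum>k\<le>2. (\<i> * u)^k / fact k) = 1 + \<i> * u - of_real (u\<^sup>2 / 2)"
    proof -
      have "{..2::nat} = {0, 1, 2}" by auto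
      thus ?thesis by (simp add: power_mult_distrib)
    qed
    have 3: "cmod (iexp u - (1 + \<i> * u - of_real (u\<^sup>2 / 2))) \<le> \<bar>u\<bar> ^ 3 / 6"
      using iexp_approx1[of u 2] unfolding s2 by (simp add: numeral_eq_Suc)
    have 2: "cmod (iexp u - (1 + \<i> * u - of_real (u\<^sup>2 / 2))) \<le> u\<^sup>2"
      using iexp_approx2[of u 2] unfolding s2 by simp
    have u52: "u\<^sup>2 * sqrt \<bar>u\<bar> = \<bar>u\<bar> powr (5/2)"
      using powr_add[of "\<bar>u\<bar>" 2 "1/2"] by (simp add: powr_half_sqrt)
    have "cmod (iexp u - (1 + \<i> * u - of_real (u\<^sup>2 / 2))) \<le> u\<^sup>2 * sqrt \<bar>u\<bar>"
    proof (cases "\<bar>u\<bar> \<le> 1")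
      case True
      have "\<bar>u\<bar> \<le> sqrt \<bar>u\<bar>" using mult_right_mono[OF True, of "\<bar>u\<bar>"]
        by (intro real_le_rsqrt) (simp add: power2_eq_square)
      hence "u\<^sup>2 * \<bar>u\<bar> \<le> u\<^sup>2 * sqrt \<bar>u\<bar>" by (intro mult_left_mono) auto
      moreover have "\<bar>u\<bar> ^ 3 = u\<^sup>2 * \<bar>u\<bar>" "0 \<le> u\<^sup>2 * \<bar>u\<bar>" by (simp_all add: power3_eq_cube power2_eq_square)
      ultimately show ?thesis using 3 by linarith
    next
      case False
      hence "u\<^sup>2 * 1 \<le> u\<^sup>2 * sqrt \<bar>u\<bar>" by (intro mult_left_mono) auto
      thus ?thesis using 2 by linarith
    qed
    thus "cmod (iexp (x * y) - 1 - \<i> * (x * y) + of_real ((x * y)\<^sup>2 / 2)) \<le> \<bar>x\<bar> powr (5/2) * \<bar>y\<bar> powr (5/2)"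
      unfolding u52 by (simp add: u_def abs_mult powr_mult algebra_simps)
  qed (use i1 integrable_abs_powr[of "5/2"] in auto)
  also have "\<dots> = \<bar>x\<bar> powr (5/2) * Mp (5/2)" by simp
  also have "\<dots> \<le> \<bar>x\<bar> powr (5/2) * K" using Mp_5_2 by (intro mult_left_mono) auto
  finally show ?thesis by (simp add: mult.commute)
qed

text \<open>
  The equation for \<open>char H\<close> is a contraction for the norm \<open>sup |h x| / |x|^(5/2)\<close>, because
  \<open>2^(3-k) < 4 - k\<close> for \<open>2 < k < 3\<close>.
\<close>
lemma Phi_close: "cmod (Phi x - psi x) \<le> 378 * K ^ 3 * \<gamma> * \<bar>x\<bar> powr (5/2)"
proof -
  define h where "h x = Phi x - psi x" for x
  define h' where "h' x = Phi' x - of_real (- (x * exp (- x)))" for x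
  define c where "c = 7 * K ^ 3 * \<gamma>"
  have K0: "0 < K" by (simp add: K_def)
  have c0: "0 \<le> c" using K0 gamma_pos by (simp add: c_def)
  have dh: "(h has_vector_derivative h' x) (at x)" if "0 < x" for x
  proof -
    have "((\<lambda>x. complex_of_real (psi x)) has_vector_derivative of_real (- (x * exp (- x)))) (at x)"
      using psi_derivative[OF that] has_vector_derivative_of_real has_real_derivative_iff_has_vector_derivative by blast
    from has_vector_derivative_diff[OF char_has_vector_derivative[OF integrable_sq] this]
    show ?thesis unfolding h_def[abs_def] h'_def .
  qed
  have h2: "cmod (h x) \<le> 2" for x
    using norm_triangle_ineq4[of "Phi x" "of_real (psi x)"] cmod_char_le_1[of x] psi_bounds[of x]
    by (simp add: h_def)
  have apriori: "cmod (h x) \<le> (K + 1) * x powr (5/2)" if "0 < x" for x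
  proof -
    have "h x = (Phi x - 1 + x\<^sup>2 / 2) - of_real (psi x - 1 + x\<^sup>2 / 2)" by (simp add: h_def)
    hence "cmod (h x) \<le> cmod (Phi x - 1 + x\<^sup>2 / 2) + \<bar>psi x - 1 + x\<^sup>2 / 2\<bar>"
      using norm_triangle_ineq4[of "Phi x - 1 + x\<^sup>2 / 2" "of_real (psi x - 1 + x\<^sup>2 / 2)"]
      by (simp only: norm_of_real)
    thus ?thesis using Phi_taylor[of x] psi_taylor[OF that] that by (simp add: algebra_simps)
  qed
  \<comment> \<open>One round of the contraction. Both functions are at most 1 in modulus, so their
    squares at t/2 differ by at most 2 |h(t/2)|, which gives b = 2 * 2^(-5/2). Integration of the
    equation costs 4 / (4 - 5/2) = 8/3, and (8/3) b = 0.943 to three digits, below 19/20; the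
    rational 57/80 \<ge> sqrt(1/2) is chosen to give exactly 19/20.\<close>
  have step: "cmod (h x) \<le> (19/20 * U + 8/3 * c) * x powr (5/2)"
    if U: "0 \<le> U" "\<And>x. 0 < x \<Longrightarrow> cmod (h x) \<le> U * x powr (5/2)" and x: "0 < x" for U x
  proof -
    define b :: real where "b = 2 * (1/2) powr (5/2)"
    have b: "0 \<le> b" "8/3 * b \<le> 19/20"
    proof -
      show "0 \<le> b" by (simp add: b_def)
      have "(1/2::real) powr (5/2) = (1/2)\<^sup>2 * sqrt (1/2)"
        using powr_add[of "1/2::real" 2 "1/2"] by (simp add: powr_half_sqrt del: powr_divide)
      hence "b = sqrt (1/2) / 2" by (simp add: b_def power2_eq_square)
      moreover have "sqrt (1/2) \<le> 57/80" by (intro real_le_lsqrt) (auto simp: power2_eq_square)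
      ultimately show "8/3 * b \<le> 19/20" by simp
    qed
    have bnd: "cmod (h t - of_real (t / 4) * h' t) \<le> (b * U + c) * t powr (5/2)" if t: "0 < t" for t :: real
    proof -
      have "h t - of_real (t / 4) * h' t = (Phi t - of_real (t / 4) * Phi' t) - of_real (psi t - t / 4 * (- (t * exp (- t))))"
        by (simp add: h_def h'_def algebra_simps)
      also have "\<dots> = (Phi (t / 2))\<^sup>2 + remainder t - of_real ((psi (t / 2))\<^sup>2)"
      proof -
        have "Phi t - of_real (t / 4) * Phi' t = (Phi (t / 2))\<^sup>2 + remainder t" using fourier_eq[of t] by simp
        thus ?thesis unfolding psi_eq[OF t] by (simp only:)
      qed
      also have "\<dots> = h (t / 2) * (Phi (t / 2) + psi (t / 2)) + remainder t"
        by (simp add: h_def power2_eq_square algebra_simps)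
      finally have "cmod (h t - of_real (t / 4) * h' t) \<le> cmod (h (t / 2)) * cmod (Phi (t / 2) + psi (t / 2)) + cmod (remainder t)"
        by (metis norm_mult norm_triangle_ineq)
      also have "\<dots> \<le> (U * (t / 2) powr (5/2)) * 2 + 7 * K ^ 3 * \<gamma> * \<bar>t\<bar> powr (5/2)"
      proof (intro add_mono mult_mono remainder_bound U)
        show "cmod (Phi (t / 2) + psi (t / 2)) \<le> 2"
          using norm_triangle_ineq[of "Phi (t / 2)" "of_real (psi (t / 2))"] cmod_char_le_1[of "t / 2"] psi_bounds[of "t / 2"]
          by simp
      qed (use U t in auto)
      also have "(t / 2) powr (5/2) = (1/2) powr (5/2) * t powr (5/2)"
        using powr_mult[of "1/2" t "5/2"] by simp
      finally show "cmod (h t - of_real (t / 4) * h' t) \<le> (b * U + c) * t powr (5/2)"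
        using t by (simp add: b_def c_def algebra_simps)
    qed
    have "0 \<le> b * U + c" using mult_nonneg_nonneg[OF b(1) U(1)] c0 by linarith
    hence "cmod (h x) \<le> 4 * (b * U + c) / (4 - 5/2) * x powr (5/2)"
      using ode_bound[of h h' "b * U + c" "5/2" 2 x, OF dh bnd h2 _ _ x] by simp
    also have "4 * (b * U + c) / (4 - 5/2) = 8/3 * b * U + 8/3 * c" by simp
    also have "(8/3 * b * U + 8/3 * c) * x powr (5/2) \<le> (19/20 * U + 8/3 * c) * x powr (5/2)"
      using mult_right_mono[OF b(2) U(1)] by (intro mult_right_mono) auto
    finally show ?thesis .
  qed
  \<comment> \<open>(160/3) c is the fixed point of U -> (19/20) U + (8/3) c, so only the a priori
    part decays under iteration.\<close>
  have iter: "cmod (h x) \<le> ((19/20) ^ n * (K + 1) + 160/3 * c) * x powr (5/2)" if "0 < x" for n x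
    using that
  proof (induction n arbitrary: x)
    case 0
    have "(K + 1) * x powr (5/2) \<le> ((19/20) ^ 0 * (K + 1) + 160/3 * c) * x powr (5/2)"
      using c0 by (intro mult_right_mono) auto
    thus ?case using apriori[OF 0] by linarith
  next
    case (Suc n)
    have "0 \<le> (19/20) ^ n * (K + 1) + 160/3 * c" using c0 K0 by simp
    from step[OF this Suc.IH Suc.prems]
    have "cmod (h x) \<le> (19/20 * ((19/20) ^ n * (K + 1) + 160/3 * c) + 8/3 * c) * x powr (5/2)" .
    also have "19/20 * ((19/20) ^ n * (K + 1) + 160/3 * c) + 8/3 * c = (19/20) ^ Suc n * (K + 1) + 160/3 * c"
    proof -
      have "19/20 * (P + 160/3 * c) + 8/3 * c = 19/20 * P + 160/3 * c" for P by (simp add: field_simps)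
      from this[of "(19/20) ^ n * (K + 1)"] show ?thesis by (simp only: power_Suc mult.assoc)
    qed
    finally show ?case .
  qed
  have pos: "cmod (h x) \<le> 160/3 * c * x powr (5/2)" if "0 < x" for x
  proof (rule LIMSEQ_le_const)
    have "(\<lambda>n. ((19/20) ^ n * (K + 1) + 160/3 * c) * x powr (5/2)) \<longlonglongrightarrow> (0 * (K + 1) + 160/3 * c) * x powr (5/2)"
      by (intro tendsto_intros LIMSEQ_realpow_zero) auto
    thus "(\<lambda>n. ((19/20) ^ n * (K + 1) + 160/3 * c) * x powr (5/2)) \<longlonglongrightarrow> 160/3 * c * x powr (5/2)" by simp
  qed (use iter[OF that] in auto)
  have "cmod (h x) = cmod (h \<bar>x\<bar>)"
  proof (cases "0 \<le> x")
    case False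
    have "h (- x) = cnj (h x)" by (simp add: h_def char_uminus psi_def)
    thus ?thesis using False by simp
  qed simp
  moreover have "cmod (h \<bar>x\<bar>) \<le> 160/3 * c * \<bar>x\<bar> powr (5/2)"
  proof (cases "x = 0")
    case True
    thus ?thesis using char_zero by (simp add: h_def psi_def)
  qed (use pos in auto)
  \<comment> \<open>With c = 7 K^3 \<gamma>, (160/3) * 7 is below 378.\<close>
  moreover have "160/3 * c * \<bar>x\<bar> powr (5/2) \<le> 378 * K ^ 3 * \<gamma> * \<bar>x\<bar> powr (5/2)"
    using c0 K0 gamma_pos by (intro mult_right_mono) (auto simp: c_def)
  ultimately show ?thesis unfolding h_def by linarith
qed

end

section \<open>Uniform decay of the characteristic function\<close>

abbreviation "N \<equiv> std_normal_distribution"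

interpretation N: real_distribution N by (rule real_dist_normal_dist)

text \<open>A Gaussian is its own transform. Hence a Gaussian double average over any law becomes an
  average of characteristic functions over the probability measure \<open>N\<close>, where Fubini
  needs only bounded integrands.\<close>

lemma gauss_eq: "complex_of_real (exp (- (t\<^sup>2) / 2)) = (\<integral>u. iexp (t * u) \<partial>N)"
  using char_std_normal_distribution by (simp add: char_def fun_eq_iff)

context real_distribution
begin

lemma gauss_fubini:
  fixes c :: "real \<Rightarrow> complex"
  assumes [measurable]: "c \<in> borel_measurable borel" and le: "\<And>u. cmod (c u) \<le> 1"
  shows "(\<integral>y. (\<integral>u. iexp (b * u * y) * c u \<partial>N) \<partial>M) = (\<integral>u. char M (b * u) * c u \<partial>N)"
    and "integrable M (\<lambda>y. (\<integral>u. iexp (b * u * y) * c u \<partial>N))"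
proof -
  interpret q: pair_prob_space N M ..
  have i: "integrable (N \<Otimes>\<^sub>M M) (\<lambda>(u, y). iexp (b * u * y) * c u)"
    by (rule q.integrable_const_bound[of _ 1]) (auto simp: norm_mult le)
  have "(\<integral>y. (\<integral>u. iexp (b * u * y) * c u \<partial>N) \<partial>M) = (\<integral>u. (\<integral>y. iexp (b * u * y) * c u \<partial>M) \<partial>N)"
    using q.Fubini_integral[OF i] by simp
  also have "\<dots> = (\<integral>u. char M (b * u) * c u \<partial>N)"
    unfolding char_def by simp
  finally show "(\<integral>y. (\<integral>u. iexp (b * u * y) * c u \<partial>N) \<partial>M) = (\<integral>u. char M (b * u) * c u \<partial>N)" .
  show "integrable M (\<lambda>y. (\<integral>u. iexp (b * u * y) * c u \<partial>N))"
    using q.integrable_snd[OF i] by simp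
qed

text \<open>Convolution of the law with a Gaussian of width 1/a, without the normalizing factor a /
  sqrt(2 pi); so it stays between 0 and 1.\<close>

definition gauss_average :: "real \<Rightarrow> real \<Rightarrow> real" where
  "gauss_average a x = (\<integral>y. exp (- (a * (x - y))\<^sup>2 / 2) \<partial>M)"

text \<open>For a law with square integrable density g this behaves like sqrt(2 pi) / a times the
  integral of g^2 as a grows. A bound of order 1/a, uniform in a, is therefore the form in which
  square integrability is proved.\<close>

definition gauss_energy :: "real \<Rightarrow> real" where
  "gauss_energy a = (\<integral>x. gauss_average a x \<partial>M)"

definition char_average :: "real \<Rightarrow> real" where
  "char_average R = (\<integral>u. cmod (char M (R * u)) \<partial>N)"

lemma integrable_gauss: "integrable M (\<lambda>y. exp (- (a * (x - y))\<^sup>2 / 2))"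
  by (rule integrable_const_bound[of _ 1]) auto

lemma gauss_average_fourier: "complex_of_real (gauss_average a x) = (\<integral>u. iexp (a * u * x) * char M (- a * u) \<partial>N)"
proof -
  have "complex_of_real (gauss_average a x) = (\<integral>y. complex_of_real (exp (- (a * (x - y))\<^sup>2 / 2)) \<partial>M)"
    unfolding gauss_average_def by (rule integral_complex_of_real[symmetric])
  also have "\<dots> = (\<integral>y. (\<integral>u. iexp (- a * u * y) * iexp (a * u * x) \<partial>N) \<partial>M)"
    unfolding gauss_eq by (simp add: exp_add[symmetric] algebra_simps)
  also have "\<dots> = (\<integral>u. char M (- a * u) * iexp (a * u * x) \<partial>N)"
    by (rule gauss_fubini) auto
  finally show ?thesis by (simp add: mult.commute)
qed

lemma gauss_average_bounds: "0 \<le> gauss_average a x" "gauss_average a x \<le> 1"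
proof -
  show "0 \<le> gauss_average a x" unfolding gauss_average_def by (intro Bochner_Integration.integral_nonneg) auto
  have "gauss_average a x \<le> (\<integral>y. 1 \<partial>M)" unfolding gauss_average_def
    by (intro integral_mono integrable_gauss) auto
  thus "gauss_average a x \<le> 1" using prob_space by simp
qed

lemma gauss_average_le_char_average: "gauss_average a x \<le> char_average a"
proof -
  have "gauss_average a x = cmod (\<integral>u. iexp (a * u * x) * char M (- a * u) \<partial>N)"
    unfolding gauss_average_fourier[symmetric] using gauss_average_bounds by simp
  also have "\<dots> \<le> (\<integral>u. norm (iexp (a * u * x) * char M (- a * u)) \<partial>N)" by (rule integral_norm_bound)
  also have "\<dots> = char_average a" unfolding char_average_def by (simp add: norm_mult cmod_char_uminus)
  finally show ?thesis .
qed

lemma gauss_average_measurable [measurable]: "gauss_average a \<in> borel_measurable borel"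
proof -
  have "gauss_average a \<in> borel_measurable M"
    unfolding gauss_average_def[abs_def] by (rule borel_measurable_lebesgue_integral) measurable
  thus ?thesis by simp
qed

lemma integrable_gauss_average: "integrable M (gauss_average a)"
  by (rule integrable_const_bound[of _ 1]) (use gauss_average_bounds in auto)

lemma gauss_energy_fourier: "gauss_energy a = (\<integral>u. (cmod (char M (a * u)))\<^sup>2 \<partial>N)"
proof -
  have "complex_of_real (gauss_energy a) = (\<integral>x. (\<integral>u. iexp (a * u * x) * char M (- a * u) \<partial>N) \<partial>M)"
    unfolding gauss_energy_def gauss_average_fourier[symmetric] by (rule integral_complex_of_real[symmetric])
  also have "\<dots> = (\<integral>u. char M (a * u) * char M (- a * u) \<partial>N)"
    by (rule gauss_fubini) (auto simp: cmod_char_le_1)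
  also have "\<dots> = (\<integral>u. complex_of_real ((cmod (char M (a * u)))\<^sup>2) \<partial>N)"
    by (simp add: char_uminus complex_norm_square[symmetric] del: of_real_power)
  finally show ?thesis unfolding integral_complex_of_real of_real_eq_iff .
qed

text \<open>Read off from the double Gaussian average. On the Fourier side it says that averaged
  decay at one frequency scale carries over to all higher scales.\<close>

lemma gauss_energy_antimono:
  assumes "0 \<le> a" "a \<le> b" shows "gauss_energy b \<le> gauss_energy a"
  unfolding gauss_energy_def
proof (intro integral_mono integrable_gauss_average)
  fix x :: real
  show "gauss_average b x \<le> gauss_average a x" unfolding gauss_average_def
  proof (intro integral_mono integrable_gauss)
    fix y :: real
    have "(a * \<bar>x - y\<bar>)\<^sup>2 \<le> (b * \<bar>x - y\<bar>)\<^sup>2" using assms by (intro power_mono mult_right_mono) auto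
    thus "exp (- (b * (x - y))\<^sup>2 / 2) \<le> exp (- (a * (x - y))\<^sup>2 / 2)" by (simp add: power_mult_distrib)
  qed
qed

lemma gauss_energy_le_char_average: "gauss_energy a \<le> char_average a"
proof -
  have "gauss_energy a \<le> (\<integral>x. char_average a \<partial>M)" unfolding gauss_energy_def
    by (intro integral_mono integrable_gauss_average gauss_average_le_char_average) auto
  thus ?thesis using prob_space by simp
qed

lemma gauss_energy_nonneg: "0 \<le> gauss_energy a"
  unfolding gauss_energy_def using gauss_average_bounds by (intro Bochner_Integration.integral_nonneg) auto

end

lemma std_normal_density_lower:
  assumes "\<bar>u\<bar> \<le> 1" shows "1 \<le> 6 * std_normal_density u"
proof -
  have "sqrt (2 * pi) \<le> 3" using pi_less_4 pi_approx by (intro real_le_lsqrt) auto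
  hence "1/3 \<le> 1 / sqrt (2 * pi)" by (intro divide_left_mono) auto
  moreover have "1/2 \<le> exp (- u\<^sup>2 / 2)"
  proof -
    have "u\<^sup>2 \<le> 1" using assms by (simp add: abs_square_le_1)
    thus ?thesis using exp_ge_add_one_self[of "- u\<^sup>2 / 2"] by simp
  qed
  ultimately have "(1/3) * (1/2) \<le> 1 / sqrt (2 * pi) * exp (- u\<^sup>2 / 2)" by (intro mult_mono) auto
  thus ?thesis by (simp add: std_normal_density_def)
qed

context profile
begin

text \<open>Averaged decay becomes pointwise decay by integrating the equation over one dyadic
  interval. For g(u) = u^(-4) Phi(2 \<xi> u) it reads g' = -4 u^(-5) (Phi(\<xi> u)^2 + remainder),
  with g(1/2) = 16 Phi(\<xi>) and |g(1)| \<le> 1. The boundary value yields 1/16. On [1/2, 1] one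
  has 4 u^(-5) \<le> 128, and the integral of |Phi(\<xi> u)|^2 is at most 6 times the Gaussian
  energy, since the normal density is at least 1/6 there: 128 * 6 / 16 = 48 and 128 / (2 * 16) =
  4.\<close>

lemma Phi_local_bound:
  assumes \<rho>: "\<And>x. cmod (remainder x) \<le> \<rho>" and \<xi>: "0 < \<xi>"
  shows "cmod (Phi \<xi>) \<le> 1/16 + 4 * \<rho> + 48 * gauss_energy \<xi>"
proof -
  define g where "g u = (u powr (-4)) *\<^sub>R Phi (2 * \<xi> * u)" for u
  define g' where "g' u = (- 4 * u powr (-5)) *\<^sub>R ((Phi (\<xi> * u))\<^sup>2 + remainder (2 * \<xi> * u))" for u
  define p where "p u = 128 * ((cmod (Phi (\<xi> * u)))\<^sup>2 + \<rho>)" for u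
  define \<phi> where "\<phi> t = integral {1/2..t} p" for t :: real
  have \<rho>0: "0 \<le> \<rho>" using order_trans[OF norm_ge_zero \<rho>[of 0]] .
  have contPhi: "continuous_on S (\<lambda>u. Phi (c * u))" for c :: real and S
    by (intro continuous_at_imp_continuous_on ballI isCont_o2[OF _ isCont_char] continuous_intros)
  have pc: "continuous_on S p" for S unfolding p_def[abs_def] by (intro continuous_intros contPhi)
  have dg: "(g has_vector_derivative g' u) (at u)" if "0 < u" for u
  proof -
    have a: "((\<lambda>u. u powr (-4)) has_real_derivative - 4 * u powr (- 5)) (at u)"
      using that by (auto intro!: derivative_eq_intros)
    have b: "((\<lambda>u. Phi (2 * \<xi> * u)) has_vector_derivative (2 * \<xi>) *\<^sub>R Phi' (2 * \<xi> * u)) (at u)"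
    proof -
      have "((\<lambda>u. 2 * \<xi> * u) has_vector_derivative 2 * \<xi>) (at u)"
        by (auto intro!: derivative_eq_intros simp: has_real_derivative_iff_has_vector_derivative[symmetric])
      from vector_diff_chain_at[OF this char_has_vector_derivative[OF integrable_sq]]
      show ?thesis by (simp add: o_def)
    qed
    have u5: "u powr (-4) = u powr (-5) * u" using that powr_add[of u "-5" 1] by simp
    have fe: "(Phi (\<xi> * u))\<^sup>2 + remainder (2 * \<xi> * u) = Phi (2 * \<xi> * u) - of_real (2 * \<xi> * u / 4) * Phi' (2 * \<xi> * u)"
      using fourier_eq[of "2 * \<xi> * u"] by simp
    have "g' u = (u powr (-4)) *\<^sub>R ((2 * \<xi>) *\<^sub>R Phi' (2 * \<xi> * u)) + (- 4 * u powr (-5)) *\<^sub>R Phi (2 * \<xi> * u)"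
      unfolding g'_def fe u5 by (simp add: scaleR_conv_of_real algebra_simps)
    thus ?thesis using has_vector_derivative_scaleR[OF a b] unfolding g_def[abs_def] by simp
  qed
  have "norm (g 1 - g (1/2)) \<le> \<phi> 1 - \<phi> (1/2)"
  proof (rule differentiable_bound_general[where f' = g' and \<phi>' = p])
    have "isCont g t" if "0 < t" for t using has_vector_derivative_continuous[OF dg[OF that]] .
    thus "continuous_on {1/2..1} g" by (auto intro!: continuous_at_imp_continuous_on)
    show "continuous_on {1/2..1} \<phi>" unfolding \<phi>_def[abs_def]
      by (intro indefinite_integral_continuous_1 integrable_continuous_real pc)
    fix u :: real assume u: "1/2 < u" "u < 1"
    show "(g has_vector_derivative g' u) (at u)" using u by (intro dg) auto
    have "(\<phi> has_vector_derivative p u) (at u within {1/2..1})" unfolding \<phi>_def[abs_def]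
      using u by (intro integral_has_vector_derivative pc) auto
    thus "(\<phi> has_vector_derivative p u) (at u)"
      using u by (simp add: at_within_interior[of u "{1/2..1}"])
    have "u powr (-5) \<le> (1/2) powr (-5)" using u by (intro powr_mono2') auto
    also have "(1/2::real) powr (-5) = 32" by (simp add: powr_minus powr_divide)
    finally have u5: "4 * u powr (-5) \<le> 128" by simp
    have "norm (g' u) = 4 * u powr (-5) * cmod ((Phi (\<xi> * u))\<^sup>2 + remainder (2 * \<xi> * u))" by (simp add: g'_def)
    also have "\<dots> \<le> 128 * ((cmod (Phi (\<xi> * u)))\<^sup>2 + \<rho>)"
      using u5 norm_triangle_ineq[of "(Phi (\<xi> * u))\<^sup>2" "remainder (2 * \<xi> * u)"] \<rho>[of "2 * \<xi> * u"]
      by (intro mult_mono) (auto simp: norm_power)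
    finally show "norm (g' u) \<le> p u" by (simp add: p_def)
  qed auto
  also have "\<dots> = integral {1/2..1} p" by (simp add: \<phi>_def)
  finally have "norm (g (1/2)) \<le> norm (g 1) + integral {1/2..1} p"
    using norm_triangle_ineq3[of "g (1/2)" "g 1"] by (simp add: norm_minus_commute)
  moreover have "g (1/2) = 16 *\<^sub>R Phi \<xi>" by (simp add: g_def powr_minus powr_divide)
  moreover have "norm (g 1) \<le> 1" using cmod_char_le_1 by (simp add: g_def)
  moreover have "integral {1/2..1} p \<le> 128 * (6 * gauss_energy \<xi> + \<rho> / 2)"
  proof -
    have int: "(LINT u:{1/2..1}|lborel. p u) = integral {1/2..1} p"
      using borel_integrable_compact[of "{1/2..1}" p] pc
      by (intro set_borel_integral_eq_integral(2)) (simp add: set_integrable_def)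
    have ii: "integrable lborel (indicator {1/2..1} :: real \<Rightarrow> real)"
      using borel_integrable_compact[of "{1/2..1::real}" "\<lambda>_. 1::real"] by simp
    have bnd: "integrable lborel (\<lambda>u. std_normal_density u * (cmod (Phi (\<xi> * u)))\<^sup>2)"
    proof -
      have "integrable N (\<lambda>u. (cmod (Phi (\<xi> * u)))\<^sup>2)"
        by (rule N.integrable_const_bound[of _ 1]) (auto simp: power_le_one cmod_char_le_1)
      thus ?thesis by (subst (asm) integrable_density) auto
    qed
    have "(LINT u:{1/2..1}|lborel. p u) \<le> (\<integral>u. 768 * (std_normal_density u * (cmod (Phi (\<xi> * u)))\<^sup>2) + 128 * \<rho> * indicator {1/2..1} u \<partial>lborel)"
      unfolding set_lebesgue_integral_def
    proof (rule integral_mono)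
      show "integrable lborel (\<lambda>u. indicator {1/2..1} u *\<^sub>R p u)"
        using borel_integrable_compact[of "{1/2..1}" p] pc by (simp add: set_integrable_def)
      show "integrable lborel (\<lambda>u. 768 * (std_normal_density u * (cmod (Phi (\<xi> * u)))\<^sup>2) + 128 * \<rho> * indicator {1/2..1} u)"
        by (intro Bochner_Integration.integrable_add integrable_mult_right bnd ii)
      fix u :: real
      show "indicator {1/2..1} u *\<^sub>R p u \<le> 768 * (std_normal_density u * (cmod (Phi (\<xi> * u)))\<^sup>2) + 128 * \<rho> * indicator {1/2..1} u"
      proof (cases "u \<in> {1/2..1}")
        case True
        hence "1 * (cmod (Phi (\<xi> * u)))\<^sup>2 \<le> 6 * std_normal_density u * (cmod (Phi (\<xi> * u)))\<^sup>2"
          by (intro mult_right_mono std_normal_density_lower) auto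
        thus ?thesis using True by (simp add: p_def)
      qed simp
    qed
    also have "\<dots> = 768 * (\<integral>u. std_normal_density u * (cmod (Phi (\<xi> * u)))\<^sup>2 \<partial>lborel) + 128 * \<rho> * (1/2)"
      using bnd ii by simp
    also have "(\<integral>u. std_normal_density u * (cmod (Phi (\<xi> * u)))\<^sup>2 \<partial>lborel) = gauss_energy \<xi>"
      unfolding gauss_energy_fourier by (subst integral_density) auto
    finally show ?thesis unfolding int by simp
  qed
  ultimately show ?thesis by simp
qed

end

context small_profile
begin

text \<open>\<open>Phi_close\<close> is averaged over \<open>N\<close>, with |u|^(5/2) \<le> 1 +
  u^4; the 4 is 1 plus the fourth normal moment 3.\<close>

lemma char_average_bound:
  assumes R: "0 < R"
  shows "char_average R \<le> (\<integral>u. psi (R * u) \<partial>N) + 378 * K ^ 3 * \<gamma> * (R powr (5/2) * 4)"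
proof -
  have ip: "integrable N (\<lambda>u. psi (R * u))"
  proof (rule N.integrable_const_bound[of _ 1])
    show "(\<lambda>u. psi (R * u)) \<in> borel_measurable N" unfolding psi_def[abs_def] by measurable
  qed (use psi_bounds in auto)
  have i4: "integrable N (\<lambda>u. u ^ 4)" by (rule integrable_std_normal_distribution_moment)
  have e4: "(\<integral>u. u ^ 4 \<partial>N) = 3"
    using std_normal_distribution_even_moments(1)[of 2] by (simp add: fact_numeral)
  define c where "c = 378 * K ^ 3 * \<gamma>"
  have c0: "0 \<le> c" using gamma_pos by (simp add: c_def K_def)
  have "char_average R \<le> (\<integral>u. psi (R * u) + c * (R powr (5/2) * (1 + u ^ 4)) \<partial>N)"
    unfolding char_average_def
  proof (rule integral_mono)
    show "integrable N (\<lambda>u. cmod (Phi (R * u)))"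
      by (rule N.integrable_const_bound[of _ 1]) (auto simp: cmod_char_le_1)
    show "integrable N (\<lambda>u. psi (R * u) + c * (R powr (5/2) * (1 + u ^ 4)))" using ip i4 by simp
    fix u :: real
    have "cmod (Phi (R * u)) \<le> cmod (Phi (R * u) - psi (R * u)) + cmod (psi (R * u))"
      using norm_triangle_ineq[of "Phi (R * u) - psi (R * u)" "psi (R * u)"] by simp
    also have "\<dots> \<le> c * \<bar>R * u\<bar> powr (5/2) + psi (R * u)"
      using Phi_close[of "R * u"] psi_bounds[of "R * u"] by (simp add: c_def)
    also have "\<bar>R * u\<bar> powr (5/2) = R powr (5/2) * \<bar>u\<bar> powr (5/2)" using R by (simp add: abs_mult powr_mult)
    also have "c * (R powr (5/2) * \<bar>u\<bar> powr (5/2)) \<le> c * (R powr (5/2) * (1 + u ^ 4))"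
    proof (intro mult_left_mono c0)
      show "\<bar>u\<bar> powr (5/2) \<le> 1 + u ^ 4"
      proof (cases "\<bar>u\<bar> \<le> 1")
        case True
        hence "\<bar>u\<bar> powr (5/2) \<le> 1" by (intro powr_le1) auto
        thus ?thesis by (simp add: add_increasing2)
      next
        case False
        hence "\<bar>u\<bar> powr (5/2) \<le> \<bar>u\<bar> powr 4" by (intro powr_mono) auto
        thus ?thesis by simp
      qed
    qed auto
    finally show "cmod (Phi (R * u)) \<le> psi (R * u) + c * (R powr (5/2) * (1 + u ^ 4))" by simp
  qed
  also have "\<dots> = (\<integral>u. psi (R * u) \<partial>N) + c * (R powr (5/2) * (1 + 3))"
    using ip i4 e4 N.prob_space by simp
  finally show ?thesis by (simp add: c_def)
qed

text \<open>A smooth majorant of the indicator of |d| < 1/R. It lets the mass near the diagonal be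
  estimated by Gaussian averages, hence by characteristic functions.\<close>

lemma gauss_indicator:
  fixes R d :: real
  assumes "1 \<le> R"
  shows "\<bar>d\<bar> < 1 / R \<Longrightarrow> 1 \<le> 2 * exp (- (R * d)\<^sup>2 / 2)"
proof -
  assume "\<bar>d\<bar> < 1 / R"
  hence "\<bar>R * d\<bar> \<le> 1" using assms by (simp add: abs_mult field_simps)
  hence "(R * d)\<^sup>2 \<le> 1" by (simp add: abs_square_le_1)
  thus ?thesis using exp_ge_add_one_self[of "- (R * d)\<^sup>2 / 2"] by simp
qed

lemma powr_lower: 
  assumes "1 \<le> R"
  shows "1 - \<gamma> * R \<le> (1 / R) powr \<gamma>" "(1 / R) powr \<gamma> \<le> 1"
proof -
  have "ln R \<le> R" using ln_le_minus_one[of R] assms by simp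
  hence "1 - \<gamma> * R \<le> 1 + - (\<gamma> * ln R)" using gamma_pos by simp
  also have "\<dots> \<le> exp (- (\<gamma> * ln R))" by (rule exp_ge_add_one_self)
  also have "\<dots> = (1 / R) powr \<gamma>" using assms by (simp add: powr_def ln_div)
  finally show "1 - \<gamma> * R \<le> (1 / R) powr \<gamma>" .
  show "(1 / R) powr \<gamma> \<le> 1" using assms gamma_pos by (intro powr_le1) auto
qed

text \<open>The kernel is at least (1/R)^\<gamma> \<ge> 1 - \<gamma>R except for |x - y| < 1/R, and
  the mass of that ball is at most twice the Gaussian average around x, whatever x is.\<close>

lemma Sigma_lower:
  assumes R: "1 \<le> R"
  shows "1 - \<gamma> * R - 2 * char_average R \<le> (\<integral>y. \<bar>x - y\<bar> powr \<gamma> \<partial>M)"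
proof -
  define r where "r = (1 / R) powr \<gamma>"
  have r: "1 - \<gamma> * R \<le> r" "r \<le> 1" "0 \<le> r" using powr_lower[OF R] by (auto simp: r_def)
  have "r * 1 - r * (2 * gauss_average R x) = (\<integral>y. r * 1 - r * (2 * exp (- (R * (x - y))\<^sup>2 / 2)) \<partial>M)"
    unfolding gauss_average_def using integrable_gauss[of R x] prob_space by simp
  also have "\<dots> \<le> (\<integral>y. \<bar>x - y\<bar> powr \<gamma> \<partial>M)"
  proof (rule integral_mono)
    show "integrable M (\<lambda>y. r * 1 - r * (2 * exp (- (R * (x - y))\<^sup>2 / 2)))" using integrable_gauss[of R x] by simp
    show "integrable M (\<lambda>y. \<bar>x - y\<bar> powr \<gamma>)"
    proof (rule integrable_dom(1)[OF moments[of \<gamma>], of _ "(1 + \<bar>x\<bar>) powr \<gamma>"])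
      fix y :: real
      have "\<bar>x - y\<bar> powr \<gamma> \<le> (1 + \<bar>x\<bar> + \<bar>y\<bar>) powr \<gamma>" using gamma_pos by (intro powr_mono2) auto
      thus "norm (\<bar>x - y\<bar> powr \<gamma>) \<le> (1 + \<bar>x\<bar>) powr \<gamma> * (1 + \<bar>y\<bar>) powr \<gamma>"
        using prod_weight_bound[of \<gamma> x y] gamma_pos by simp
    qed (use gamma_less in auto)
    fix y :: real
    show "r * 1 - r * (2 * exp (- (R * (x - y))\<^sup>2 / 2)) \<le> \<bar>x - y\<bar> powr \<gamma>"
    proof (cases "\<bar>x - y\<bar> < 1 / R")
      case True
      from gauss_indicator[OF R True] have "r * 1 \<le> r * (2 * exp (- (R * (x - y))\<^sup>2 / 2))"
        using r by (intro mult_left_mono) auto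
      moreover have "0 \<le> \<bar>x - y\<bar> powr \<gamma>" by simp
      ultimately show ?thesis by linarith
    next
      case False
      hence "r \<le> \<bar>x - y\<bar> powr \<gamma>" unfolding r_def using R gamma_pos by (intro powr_mono2) auto
      moreover have "0 \<le> r * (2 * exp (- (R * (x - y))\<^sup>2 / 2))" using r by simp
      ultimately show ?thesis by linarith
    qed
  qed
  finally have "r - r * (2 * gauss_average R x) \<le> (\<integral>y. \<bar>x - y\<bar> powr \<gamma> \<partial>M)" by simp
  moreover have "r * (2 * gauss_average R x) \<le> 1 * (2 * char_average R)"
    using r gauss_average_bounds gauss_average_le_char_average by (intro mult_mono) auto
  ultimately show ?thesis using r by simp
qed

text \<open>\<open>remainder_bound\<close> grows with \<xi> and is of no help at high frequency.
  Here the bracket is only bounded by 4, and the kernel deviation is integrated directly: it is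
  O(\<gamma>) with linear growth away from the diagonal, and O(1) within distance 1/R of it, where
  \<open>gauss_energy\<close> measures the mass.\<close>

lemma remainder_uniform:
  assumes R: "1 \<le> R"
  shows "cmod (remainder \<xi>) \<le> 2 * (13 * K * \<gamma> + 2 * \<gamma> + \<gamma> * R + 2 * char_average R)"
proof -
  define k where "k = (\<lambda>z. complex_of_real (case z of (x, y) \<Rightarrow> s * \<bar>x - y\<bar> powr \<gamma> - 1))"
  have [measurable]: "k \<in> borel_measurable (M \<Otimes>\<^sub>M M)" unfolding k_def by measurable
  define G where "G = (\<lambda>z. (13 * K * \<gamma> + \<gamma> * R) + \<gamma> * ((case z of (x, y) \<Rightarrow> \<bar>x\<bar>) + (case z of (x, y) \<Rightarrow> \<bar>y\<bar>))
     + 2 * (case z of (x, y) \<Rightarrow> exp (- (R * (x - y))\<^sup>2 / 2)))"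
  have ig: "integrable (M \<Otimes>\<^sub>M M) (\<lambda>(x, y). exp (- (R * (x - y))\<^sup>2 / 2))"
    by (rule pp.integrable_const_bound[of _ 1]) auto
  have iG: "integrable (M \<Otimes>\<^sub>M M) G" unfolding G_def
    using ig integrable_prod_fst[OF integrable_abs] integrable_prod_snd[OF integrable_abs] by simp
  have Eg: "(\<integral>(x, y). exp (- (R * (x - y))\<^sup>2 / 2) \<partial>(M \<Otimes>\<^sub>M M)) = gauss_energy R"
    using pp.integral_fst'[OF ig] by (simp add: gauss_energy_def gauss_average_def)
  have kG: "norm (k z) \<le> G z" for z
  proof (cases z)
    case (Pair x y)
    define d where "d = x - y"
    have dle: "\<bar>d\<bar> \<le> \<bar>x\<bar> + \<bar>y\<bar>" using abs_triangle_ineq4[of x y] by (simp add: d_def)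
    define e where "e = exp (- (R * d)\<^sup>2 / 2)"
    have e0: "0 < e" by (simp add: e_def)
    have p: "\<bar>\<bar>d\<bar> powr \<gamma> - 1\<bar> \<le> \<gamma> * \<bar>d\<bar> + \<gamma> * R + 2 * e"
    proof -
      have gd: "0 \<le> \<gamma> * \<bar>d\<bar>" "0 \<le> \<gamma> * R" using gamma_pos R by auto
      consider "1 \<le> \<bar>d\<bar>" | "1 / R \<le> \<bar>d\<bar>" "\<bar>d\<bar> < 1" | "\<bar>d\<bar> < 1 / R" "\<bar>d\<bar> < 1" by linarith
      thus ?thesis
      proof cases
        case 1
        hence "1 \<le> \<bar>d\<bar> powr \<gamma>" using gamma_pos by (intro ge_one_powr_ge_zero) auto
        moreover have "\<bar>d\<bar> powr \<gamma> \<le> 1 + \<gamma> * (\<bar>d\<bar> - 1)" using gamma_pos gamma_less by (intro powr_le_affine) auto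
        ultimately show ?thesis using gd e0 gamma_pos by (simp add: right_diff_distrib)
      next
        case 2
        have "(1 / R) powr \<gamma> \<le> \<bar>d\<bar> powr \<gamma>" using 2 R gamma_pos by (intro powr_mono2) auto
        moreover have "\<bar>d\<bar> powr \<gamma> \<le> 1" using 2 gamma_pos by (intro powr_le1) auto
        ultimately show ?thesis using gd e0 powr_lower(1)[OF R] by simp
      next
        case 3
        have "\<bar>d\<bar> powr \<gamma> \<le> 1" using 3 gamma_pos by (intro powr_le1) auto
        moreover have "0 \<le> \<bar>d\<bar> powr \<gamma>" by simp
        moreover have "1 \<le> 2 * e" using gauss_indicator[OF R 3(1)] by (simp add: e_def)
        ultimately show ?thesis using gd by linarith
      qed
    qed
    have eq: "s * \<bar>d\<bar> powr \<gamma> - 1 = s * (\<bar>d\<bar> powr \<gamma> - 1) - (1 - s)" by (simp add: algebra_simps)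
    have "\<bar>s * \<bar>d\<bar> powr \<gamma> - 1\<bar> \<le> \<bar>s * (\<bar>d\<bar> powr \<gamma> - 1)\<bar> + \<bar>1 - s\<bar>"
      unfolding eq by (rule abs_triangle_ineq4)
    also have "\<dots> = s * \<bar>\<bar>d\<bar> powr \<gamma> - 1\<bar> + (1 - s)" using s_pos s_le_1 by (simp add: abs_mult)
    also have "\<dots> \<le> 1 * \<bar>\<bar>d\<bar> powr \<gamma> - 1\<bar> + 13 * K * \<gamma>"
      using s_le_1 one_minus_s by (intro add_mono mult_right_mono) auto
    also have "\<dots> \<le> (\<gamma> * (\<bar>x\<bar> + \<bar>y\<bar>) + \<gamma> * R + 2 * e) + 13 * K * \<gamma>"
    proof -
      have "\<gamma> * \<bar>d\<bar> \<le> \<gamma> * (\<bar>x\<bar> + \<bar>y\<bar>)" using dle gamma_pos by (intro mult_left_mono) auto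
      thus ?thesis using p by simp
    qed
    finally show ?thesis unfolding k_def G_def Pair prod.case norm_of_real by (simp add: d_def e_def)
  qed
  have ib: "norm (exp_bracket \<xi> z * k z) \<le> 4 * G z" for z
    unfolding norm_mult using kG[of z] cmod_exp_bracket_le[of \<xi> z] by (intro mult_mono) auto
  have "cmod (\<integral>z. exp_bracket \<xi> z * k z \<partial>(M \<Otimes>\<^sub>M M)) \<le> (\<integral>z. 4 * G z \<partial>(M \<Otimes>\<^sub>M M))"
  proof (rule order_trans[OF integral_norm_bound integral_mono])
    show "integrable (M \<Otimes>\<^sub>M M) (\<lambda>z. norm (exp_bracket \<xi> z * k z))"
      by (rule Bochner_Integration.integrable_bound[of _ "\<lambda>z. 4 * G z"])
        (use iG ib in \<open>auto intro!: AE_I2 intro: order_trans[OF _ abs_ge_self]\<close>)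
  qed (use iG ib in auto)
  also have "\<dots> = 4 * ((13 * K * \<gamma> + \<gamma> * R) + \<gamma> * ((\<integral>x. \<bar>x\<bar> \<partial>M) + (\<integral>x. \<bar>x\<bar> \<partial>M)) + 2 * gauss_energy R)"
    unfolding G_def using ig integrable_prod_fst[OF integrable_abs] integrable_prod_snd[OF integrable_abs]
      Eg by (simp add: integral_prod_fst[OF integrable_abs] integral_prod_snd[OF integrable_abs] pp.prob_space)
  also have "\<dots> \<le> 4 * ((13 * K * \<gamma> + \<gamma> * R) + \<gamma> * (1 + 1) + 2 * char_average R)"
    using first_abs_moment gamma_pos gauss_energy_le_char_average[of R] by (intro mult_left_mono add_mono order_refl) auto
  finally show ?thesis by (simp add: remainder_def k_def norm_divide)
qed

end

lemma psi_scaled_limit: "(\<lambda>n. \<integral>u. psi (real n * u) \<partial>N) \<longlonglongrightarrow> 0"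
proof -
  have "(\<lambda>n. \<integral>u. psi (real n * u) \<partial>N) \<longlonglongrightarrow> (\<integral>u. 0 \<partial>N)"
  proof (rule integral_dominated_convergence[where w = "\<lambda>_. 1"])
    show "(\<lambda>u. psi (real n * u)) \<in> borel_measurable N" for n unfolding psi_def[abs_def] by measurable
    show "AE u in N. norm (psi (real n * u)) \<le> 1" for n using psi_bounds by (intro AE_I2) auto
    have "AE u in lborel. u \<noteq> (0::real)" by (rule AE_lborel_singleton)
    hence "AE u in N. u \<noteq> 0" by (subst AE_density) auto
    thus "AE u in N. (\<lambda>n. psi (real n * u)) \<longlonglongrightarrow> 0"
    proof eventually_elim
      case (elim u)
      have "((\<lambda>x::real. (1 + x) * exp (- x)) \<longlongrightarrow> 0) at_top" by real_asymp
      moreover have "filterlim (\<lambda>n. \<bar>real n * u\<bar>) at_top sequentially"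
        using elim by (simp add: abs_mult filterlim_tendsto_pos_mult_at_top[OF tendsto_const] filterlim_real_sequentially mult.commute)
      ultimately show ?case unfolding psi_def by (rule filterlim_compose)
    qed
  qed auto
  thus ?thesis by simp
qed

text \<open>Order of choice: \<open>R\<close> depends on \<open>psi\<close> alone, the threshold for
  \<gamma> on \<open>R\<close>. Closeness to \<open>psi\<close> is used only at the scale
  \<open>R\<close>, because its error grows like |x|^(5/2); larger frequencies are reached through
  \<open>gauss_energy_antimono\<close> and \<open>Phi_local_bound\<close>. With 1/4000 for each
  source of error, the averaged characteristic function at \<open>R\<close> is at most 1/2000 and
  the remainder at most 1/400, and 1/16 + 4/400 + 48/2000 < 1/8.\<close>

lemma uniform_decay:
  obtains R \<gamma>\<^sub>1 where "1 \<le> R" "0 < \<gamma>\<^sub>1" "\<gamma>\<^sub>1 \<le> 1/500"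
    "\<And>M s \<gamma> \<xi>. profile M s \<gamma> \<Longrightarrow> \<gamma> < \<gamma>\<^sub>1 \<Longrightarrow> R \<le> \<bar>\<xi>\<bar> \<Longrightarrow> cmod (char M \<xi>) \<le> 1/8"
    "\<And>M s \<gamma> x. profile M s \<gamma> \<Longrightarrow> \<gamma> < \<gamma>\<^sub>1 \<Longrightarrow> 1/2 \<le> (\<integral>y. \<bar>x - y\<bar> powr \<gamma> \<partial>M)"
proof -
  have "eventually (\<lambda>n. (\<integral>u. psi (real n * u) \<partial>N) < 1/4000) sequentially"
    using psi_scaled_limit by (rule order_tendstoD) simp
  with eventually_ge_at_top[of 1] have "eventually (\<lambda>n. 1 \<le> n \<and> (\<integral>u. psi (real n * u) \<partial>N) < 1/4000) sequentially"
    by eventually_elim simp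
  then obtain n :: nat where n: "1 \<le> n" "(\<integral>u. psi (real n * u) \<partial>N) < 1/4000"
    using eventually_happens by fastforce
  define R where "R = real n"
  have R: "1 \<le> R" using n by (simp add: R_def)
  define k :: real where "k = 6404"
  define A where "A = 378 * k ^ 3 * (R powr (5/2) * 4) + 13 * k + 2 + R"
  have A: "0 < A" using R by (auto simp: A_def k_def intro!: add_pos_pos add_nonneg_pos)
  define g where "g = min (1/500) (1 / (4000 * A))"
  have main: "\<gamma> * (378 * k ^ 3 * (R powr (5/2) * 4)) \<le> 1/4000 \<and> \<gamma> * (13 * k + 2 + R) \<le> 1/4000"
    if "0 < \<gamma>" "\<gamma> < g" for \<gamma>
  proof -
    have "\<gamma> * A \<le> 1 / (4000 * A) * A" using that A by (intro mult_right_mono) (auto simp: g_def)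
    also have "\<dots> = 1/4000" using A by simp
    finally have "\<gamma> * A \<le> 1/4000" .
    moreover have "0 \<le> \<gamma> * (378 * k ^ 3 * (R powr (5/2) * 4))" "0 \<le> \<gamma> * (13 * k + 2 + R)"
      using that R by (auto simp: k_def)
    moreover have "\<gamma> * A = \<gamma> * (378 * k ^ 3 * (R powr (5/2) * 4)) + \<gamma> * (13 * k + 2 + R)"
      by (simp add: A_def algebra_simps)
    ultimately show ?thesis by linarith
  qed
  show ?thesis
  proof (rule that[of R g])
    fix M s \<gamma> assume p: "profile M s \<gamma>" and g: "\<gamma> < g"
    interpret profile M s \<gamma> by fact
    interpret small_profile M s \<gamma> by unfold_locales (use g in \<open>simp add: g_def\<close>)
    have Kk: "K = k" by (simp add: K_def k_def)
    note m = main[OF gamma_pos g]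
    have char_average: "char_average R \<le> 1/2000"
      using char_average_bound[of R] n(2) R m unfolding Kk R_def[symmetric] by (simp add: mult_ac)
    show "1/2 \<le> (\<integral>y. \<bar>x - y\<bar> powr \<gamma> \<partial>M)" for x
    proof -
      have "\<gamma> * R \<le> \<gamma> * (13 * k + 2 + R)" using gamma_pos by (intro mult_left_mono) (auto simp: k_def)
      thus ?thesis using Sigma_lower[OF R, of x] char_average m by linarith
    qed
    define \<rho> where "\<rho> = 2 * (13 * K * \<gamma> + 2 * \<gamma> + \<gamma> * R + 2 * char_average R)"
    have "\<rho> = 2 * (\<gamma> * (13 * k + 2 + R)) + 4 * char_average R" by (simp add: \<rho>_def Kk algebra_simps)
    hence \<rho>: "\<rho> \<le> 1/400" using m char_average by linarith
    have pos: "cmod (Phi x) \<le> 1/8" if "R \<le> x" for x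
    proof -
      have "cmod (Phi x) \<le> 1/16 + 4 * \<rho> + 48 * gauss_energy x"
        using remainder_uniform[OF R] that R by (intro Phi_local_bound) (auto simp: \<rho>_def)
      moreover have "gauss_energy x \<le> char_average R" using gauss_energy_antimono[of R x] gauss_energy_le_char_average[of R] that R by simp
      ultimately show ?thesis using \<rho> char_average by linarith
    qed
    show "cmod (char M \<xi>) \<le> 1/8" if "R \<le> \<bar>\<xi>\<bar>" for \<xi>
      using pos[of "\<bar>\<xi>\<bar>"] that cmod_char_uminus[of "\<bar>\<xi>\<bar>"] by (cases "0 \<le> \<xi>") auto
  qed (use R A in \<open>auto simp: g_def\<close>)
qed

section \<open>Square integrability\<close>

lemma has_real_derivative_quadratic:
  fixes f :: "real \<Rightarrow> real"
  assumes "\<And>y. \<bar>f y - f x - (y - x) * D\<bar> \<le> C * (y - x)\<^sup>2"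
  shows "(f has_real_derivative D) (at x)"
  unfolding has_field_derivative_def
proof (rule has_derivativeI_sandwich[of 1 _ _ _ _ "\<lambda>y. C * \<bar>y - x\<bar>"])
  show "((\<lambda>y. C * \<bar>y - x\<bar>) \<longlongrightarrow> 0) (at x)" by (auto intro!: tendsto_eq_intros)
  fix y assume "y \<noteq> x"
  have "norm (f y - f x - D * (y - x)) / norm (y - x) \<le> C * (y - x)\<^sup>2 / norm (y - x)"
    using assms[of y] by (intro divide_right_mono) (auto simp: mult.commute)
  also have "\<dots> = C * \<bar>y - x\<bar>" using \<open>y \<noteq> x\<close> by (simp add: power2_eq_square field_simps)
  finally show "norm (f y - f x - D * (y - x)) / norm (y - x) \<le> C * \<bar>y - x\<bar>" .
qed (auto intro!: bounded_linear_intros)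

definition dgauss :: "real \<Rightarrow> real" where "dgauss v = - v * exp (- v\<^sup>2 / 2)"

lemma dgauss_measurable [measurable]: "dgauss \<in> borel_measurable borel"
  unfolding dgauss_def[abs_def] by measurable

lemma gauss_derivative: "((\<lambda>v. exp (- v\<^sup>2 / 2)) has_real_derivative dgauss v) (at v)"
  unfolding dgauss_def by (auto intro!: derivative_eq_intros)

lemma sq_gauss_le: "v\<^sup>2 * exp (- v\<^sup>2 / 2) \<le> 1" for v :: real
proof -
  define t where "t = v\<^sup>2 / 4"
  have "1 + t \<le> exp t" by (rule exp_ge_add_one_self)
  hence "(1 + t)\<^sup>2 \<le> (exp t)\<^sup>2" by (intro power_mono) (auto simp: t_def)
  moreover have "(exp t)\<^sup>2 = exp (v\<^sup>2 / 2)" by (simp add: t_def power2_eq_square exp_add[symmetric])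
  moreover have "v\<^sup>2 \<le> (1 + t)\<^sup>2"
  proof -
    have "0 \<le> (1 - t)\<^sup>2" by simp
    thus ?thesis by (simp add: t_def power2_eq_square algebra_simps)
  qed
  ultimately have "v\<^sup>2 \<le> exp (v\<^sup>2 / 2)" by linarith
  hence "v\<^sup>2 * exp (- (v\<^sup>2 / 2)) \<le> exp (v\<^sup>2 / 2) * exp (- (v\<^sup>2 / 2))" by (intro mult_right_mono) auto
  thus ?thesis by (simp add: exp_minus)
qed

lemma dgauss_bound: "\<bar>dgauss v\<bar> \<le> 1"
proof -
  have "(dgauss v)\<^sup>2 = v\<^sup>2 * exp (- v\<^sup>2 / 2) * exp (- v\<^sup>2 / 2)" by (simp add: dgauss_def power2_eq_square)
  also have "\<dots> \<le> 1 * 1" using sq_gauss_le by (intro mult_mono) auto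
  finally show ?thesis by (simp add: abs_square_le_1)
qed

lemma dgauss_lipschitz: "\<bar>dgauss y - dgauss x\<bar> \<le> \<bar>y - x\<bar>"
proof -
  have "norm (dgauss y - dgauss x) \<le> 1 * norm (y - x)"
  proof (rule field_differentiable_bound[of UNIV dgauss "\<lambda>v. (v\<^sup>2 - 1) * exp (- v\<^sup>2 / 2)" 1])
    fix v :: real
    show "(dgauss has_field_derivative (v\<^sup>2 - 1) * exp (- v\<^sup>2 / 2)) (at v within UNIV)"
      unfolding dgauss_def[abs_def]
      by (auto intro!: derivative_eq_intros simp: power2_eq_square algebra_simps)
    have "exp (- v\<^sup>2 / 2) \<le> 1" "0 \<le> exp (- v\<^sup>2 / 2)" "0 \<le> v\<^sup>2 * exp (- v\<^sup>2 / 2)" by auto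
    thus "norm ((v\<^sup>2 - 1) * exp (- v\<^sup>2 / 2)) \<le> 1"
      using sq_gauss_le[of v] unfolding left_diff_distrib real_norm_def by linarith
  qed auto
  thus ?thesis by simp
qed

lemma gauss_taylor:
  fixes x y :: real
  shows "\<bar>exp (- y\<^sup>2 / 2) - exp (- x\<^sup>2 / 2) - (y - x) * dgauss x\<bar> \<le> (y - x)\<^sup>2"
proof -
  have *: "\<exists>z. \<bar>z - x\<bar> \<le> \<bar>y - x\<bar> \<and> exp (- y\<^sup>2 / 2) - exp (- x\<^sup>2 / 2) = (y - x) * dgauss z"
  proof (cases x y rule: linorder_cases)
    case less
    from MVT2[OF less gauss_derivative] obtain z where "x < z" "z < y"
      "exp (- y\<^sup>2 / 2) - exp (- x\<^sup>2 / 2) = (y - x) * dgauss z" by blast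
    thus ?thesis by (intro exI[of _ z]) auto
  next
    case greater
    from MVT2[OF greater gauss_derivative] obtain z where "y < z" "z < x"
      "exp (- x\<^sup>2 / 2) - exp (- y\<^sup>2 / 2) = (x - y) * dgauss z" by blast
    thus ?thesis by (intro exI[of _ z]) (auto simp: algebra_simps)
  qed auto
  then obtain z where z: "\<bar>z - x\<bar> \<le> \<bar>y - x\<bar>"
    "exp (- y\<^sup>2 / 2) - exp (- x\<^sup>2 / 2) = (y - x) * dgauss z" by blast
  have "\<bar>exp (- y\<^sup>2 / 2) - exp (- x\<^sup>2 / 2) - (y - x) * dgauss x\<bar> = \<bar>y - x\<bar> * \<bar>dgauss z - dgauss x\<bar>"
    unfolding z(2) right_diff_distrib[symmetric] abs_mult by simp
  also have "\<dots> \<le> \<bar>y - x\<bar> * \<bar>y - x\<bar>" using dgauss_lipschitz[of z x] z(1) by (intro mult_left_mono) auto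
  finally show ?thesis by (simp add: power2_eq_square)
qed

context real_distribution
begin

definition gauss_average_deriv :: "real \<Rightarrow> real \<Rightarrow> real" where
  "gauss_average_deriv a x = (\<integral>y. a * dgauss (a * (x - y)) \<partial>M)"

lemma integrable_dgauss: "integrable M (\<lambda>y. a * dgauss (a * (x - y)))"
  by (rule integrable_const_bound[of _ "\<bar>a\<bar>"]) (auto simp: abs_mult mult_left_le dgauss_bound)

lemma gauss_average_derivative: "(gauss_average a has_real_derivative gauss_average_deriv a x) (at x)"
proof (rule has_real_derivative_quadratic[where C = "a\<^sup>2"])
  fix y :: real
  have "gauss_average a y - gauss_average a x - (y - x) * gauss_average_deriv a x
    = (\<integral>t. exp (- (a * (y - t))\<^sup>2 / 2) - exp (- (a * (x - t))\<^sup>2 / 2) - (y - x) * (a * dgauss (a * (x - t))) \<partial>M)"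
    unfolding gauss_average_def gauss_average_deriv_def
    using integrable_gauss[of a x] integrable_gauss[of a y] integrable_dgauss[of a x] by simp
  also have "\<bar>\<dots>\<bar> \<le> (\<integral>t. a\<^sup>2 * (y - x)\<^sup>2 \<partial>M)"
    unfolding real_norm_def[symmetric]
  proof (rule order_trans[OF integral_norm_bound integral_mono])
    fix t :: real
    have "(a * (y - t) - a * (x - t)) = a * (y - x)" by (simp add: algebra_simps)
    thus "norm (exp (- (a * (y - t))\<^sup>2 / 2) - exp (- (a * (x - t))\<^sup>2 / 2) - (y - x) * (a * dgauss (a * (x - t)))) \<le> a\<^sup>2 * (y - x)\<^sup>2"
      using gauss_taylor[of "a * (y - t)" "a * (x - t)"] by (simp add: power_mult_distrib mult_ac)
  qed (use integrable_gauss[of a x] integrable_gauss[of a y] integrable_dgauss[of a x] in auto)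
  finally show "\<bar>gauss_average a y - gauss_average a x - (y - x) * gauss_average_deriv a x\<bar> \<le> a\<^sup>2 * (y - x)\<^sup>2"
    using prob_space by simp
qed

lemma gauss_average_deriv_bound: "\<bar>gauss_average_deriv a x\<bar> \<le> \<bar>a\<bar>"
proof -
  have "norm (gauss_average_deriv a x) \<le> (\<integral>y. \<bar>a\<bar> \<partial>M)" unfolding gauss_average_deriv_def
    by (rule order_trans[OF integral_norm_bound integral_mono])
      (use integrable_dgauss[of a x] in \<open>auto simp: abs_mult mult_left_le dgauss_bound\<close>)
  thus ?thesis using prob_space by simp
qed

lemma gauss_average_deriv_lipschitz: "\<bar>gauss_average_deriv a y - gauss_average_deriv a x\<bar> \<le> a\<^sup>2 * \<bar>y - x\<bar>"
proof -
  have "gauss_average_deriv a y - gauss_average_deriv a x = (\<integral>t. a * dgauss (a * (y - t)) - a * dgauss (a * (x - t)) \<partial>M)"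
    unfolding gauss_average_deriv_def using integrable_dgauss[of a x] integrable_dgauss[of a y] by simp
  also have "norm \<dots> \<le> (\<integral>t. a\<^sup>2 * \<bar>y - x\<bar> \<partial>M)"
  proof (rule order_trans[OF integral_norm_bound integral_mono])
    fix t :: real
    have "\<bar>a\<bar> * \<bar>dgauss (a * (y - t)) - dgauss (a * (x - t))\<bar> \<le> \<bar>a\<bar> * \<bar>a * (y - t) - a * (x - t)\<bar>"
      by (intro mult_left_mono dgauss_lipschitz) auto
    also have "a * (y - t) - a * (x - t) = a * (y - x)" by (simp add: algebra_simps)
    also have "\<bar>a\<bar> * \<bar>a * (y - x)\<bar> = a\<^sup>2 * \<bar>y - x\<bar>" by (simp add: abs_mult power2_eq_square)
    finally show "norm (a * dgauss (a * (y - t)) - a * dgauss (a * (x - t))) \<le> a\<^sup>2 * \<bar>y - x\<bar>"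
      by (simp add: abs_mult[symmetric] right_diff_distrib)
  qed (use integrable_dgauss[of a x] integrable_dgauss[of a y] in auto)
  finally show ?thesis using prob_space by simp
qed

lemma gauss_average_deriv_continuous: "continuous_on UNIV (gauss_average_deriv a)"
proof (intro continuous_at_imp_continuous_on ballI)
  fix x :: real
  have "(gauss_average_deriv a \<longlongrightarrow> gauss_average_deriv a x) (at x)"
  proof (subst tendsto_dist_iff, rule tendsto_sandwich[OF _ _ tendsto_const])
    show "((\<lambda>y. a\<^sup>2 * \<bar>y - x\<bar>) \<longlongrightarrow> 0) (at x)" by (auto intro!: tendsto_eq_intros)
  qed (use gauss_average_deriv_lipschitz in \<open>auto simp: dist_real_def\<close>)
  thus "isCont (gauss_average_deriv a) x" by (simp add: isCont_def)
qed

text \<open>Makes the mollified law itself an admissible test function.\<close>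

lemma gauss_average_C1: "gauss_average a \<in> C1_bounded" "deriv (gauss_average a) = gauss_average_deriv a"
  using C1_boundedI[of "gauss_average a" "gauss_average_deriv a" 1 "\<bar>a\<bar>", OF gauss_average_derivative gauss_average_deriv_continuous _ gauss_average_deriv_bound]
    gauss_average_bounds by auto

text \<open>Substituting 2u for u on the Fourier side produces the factor 2 and the density at 2u,
  which is at most the density at u. This compares Phi(a u/2), which the midpoint in the gain term
  produces, with Phi(a u).\<close>

lemma gauss_energy_half: "gauss_energy (a / 2) \<le> 2 * gauss_energy a"
proof -
  define f where "f u = (cmod (char M (a * u)))\<^sup>2" for u
  have [measurable]: "f \<in> borel_measurable borel" unfolding f_def[abs_def] by measurable
  have f: "0 \<le> f u" "f u \<le> 1" for u using cmod_char_le_1 by (auto simp: f_def power_le_one)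
  have iN: "integrable N (\<lambda>u. f (u * c))" for c by (rule N.integrable_const_bound[of _ 1]) (use f in auto)
  have il: "integrable lborel (\<lambda>u. std_normal_density u * f (u * c))" for c
    using iN[of c] by (subst (asm) integrable_density) auto
  have E: "gauss_energy a = (\<integral>u. std_normal_density u * f u \<partial>lborel)"
    unfolding gauss_energy_fourier f_def[symmetric] by (subst integral_density) auto
  have "gauss_energy (a / 2) = (\<integral>u. std_normal_density u * f (u / 2) \<partial>lborel)"
    unfolding gauss_energy_fourier by (subst integral_density) (auto simp: f_def mult.commute)
  also have "\<dots> = 2 * (\<integral>u. std_normal_density (2 * u) * f u \<partial>lborel)"
    using lborel_integral_real_affine[of 2 "\<lambda>u. std_normal_density u * f (u / 2)" 0] by simp
  also have "\<dots> \<le> 2 * (\<integral>u. std_normal_density u * f u \<partial>lborel)"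
  proof (intro mult_left_mono integral_mono)
    show "integrable lborel (\<lambda>u. std_normal_density (2 * u) * f u)"
      using lborel_integrable_real_affine[OF il[of "1/2"], of 2 0] by simp
    show "integrable lborel (\<lambda>u. std_normal_density u * f u)" using il[of 1] by simp
    fix u :: real
    have "exp (- (2 * u)\<^sup>2 / 2) \<le> exp (- u\<^sup>2 / 2)" by (simp add: power_mult_distrib)
    thus "std_normal_density (2 * u) * f u \<le> std_normal_density u * f u"
      using f by (intro mult_right_mono) (auto simp: std_normal_density_def divide_right_mono)
  qed auto
  finally show ?thesis unfolding E .
qed

end

lemma N_ball: assumes "0 \<le> r" shows "(\<integral>u. indicator {- r..r} u \<partial>N) \<le> r"
proof -
  have pi4: "2 \<le> sqrt (2 * pi)" using pi_gt3 by (intro real_le_rsqrt) auto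
  have dle: "std_normal_density u \<le> 1/2" for u
  proof -
    have "1 / sqrt (2 * pi) \<le> 1/2" using pi4 by (intro divide_left_mono) auto
    moreover have "exp (- u\<^sup>2 / 2) \<le> 1" by simp
    ultimately have "1 / sqrt (2 * pi) * exp (- u\<^sup>2 / 2) \<le> 1/2 * 1" by (intro mult_mono) auto
    thus ?thesis by (simp add: std_normal_density_def)
  qed
  have ii: "integrable lborel (indicator {-r..r} :: real \<Rightarrow> real)"
    using borel_integrable_compact[of "{-r..r}" "\<lambda>_. 1::real"] by simp
  have "(\<integral>u. indicator {- r..r} u \<partial>N) = (\<integral>u. std_normal_density u * indicator {-r..r} u \<partial>lborel)"
    by (subst integral_density) auto
  also have "\<dots> \<le> (\<integral>u. 1/2 * indicator {-r..r} u \<partial>lborel)"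
  proof (rule integral_mono)
    have "integrable N (indicator {-r..r} :: real \<Rightarrow> real)" by (rule N.integrable_const_bound[of _ 1]) auto
    thus "integrable lborel (\<lambda>u. std_normal_density u * indicator {-r..r} u)"
      by (subst (asm) integrable_density) auto
    show "integrable lborel (\<lambda>u. 1/2 * indicator {-r..r} u :: real)" using ii by simp
  qed (use dle in \<open>auto simp: indicator_def\<close>)
  also have "\<dots> = r" using assms by simp
  finally show ?thesis .
qed

context small_profile
begin

text \<open>
  Testing the equation against the Gaussian mollification of \<open>M\<close> gives an \<open>L^2\<close> estimate: the drift
  term has a sign, the loss term is coercive by the lower bound on the collision frequency, and the
  gain term is absorbed thanks to the decay of the characteristic function.
\<close>
lemma energy_estimate:
  assumes R: "0 < R" and dec: "\<And>\<xi>. R \<le> \<bar>\<xi>\<bar> \<Longrightarrow> cmod (Phi \<xi>) \<le> 1/8"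
    and sig: "\<And>x. 1/2 \<le> (\<integral>y. \<bar>x - y\<bar> powr \<gamma> \<partial>M)" and a: "0 < a"
  shows "gauss_energy a \<le> 5 * R / a"
proof -
  define p where "p = gauss_average a"
  define I where "I x = (\<integral>y. p ((x + y) / 2) \<partial>M)" for x
  have [measurable]: "p \<in> borel_measurable borel" by (simp add: p_def)
  have p: "0 \<le> p x" "p x \<le> 1" for x using gauss_average_bounds by (auto simp: p_def)
  have Dw: "\<bar>x - y\<bar> powr \<gamma> \<le> (1 + \<bar>x\<bar> + \<bar>y\<bar>) powr \<gamma>" for x y :: real
    using gamma_pos by (intro powr_mono2) auto
  have dom: "integrable (M \<Otimes>\<^sub>M M) (\<lambda>(x, y). f x y * \<bar>x - y\<bar> powr \<gamma>)"
    if [measurable]: "(\<lambda>(x, y). f x y) \<in> borel_measurable (M \<Otimes>\<^sub>M M)" and f: "\<And>x y. 0 \<le> f x y" "\<And>x y. f x y \<le> 1"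
    for f :: "real \<Rightarrow> real \<Rightarrow> real"
  proof (rule integrable_prod_dom(1)[OF _ moments[of \<gamma>], of _ 1])
    fix x y :: real
    have "f x y * \<bar>x - y\<bar> powr \<gamma> \<le> 1 * (1 + \<bar>x\<bar> + \<bar>y\<bar>) powr \<gamma>" using f Dw by (intro mult_mono) auto
    thus "norm (case (x, y) of (x, y) \<Rightarrow> f x y * \<bar>x - y\<bar> powr \<gamma>) \<le> 1 * (1 + \<bar>x\<bar> + \<bar>y\<bar>) powr \<gamma>"
      using f by (simp add: abs_mult)
  qed (use gamma_pos gamma_less in \<open>auto simp: split_beta'\<close>)
  have iz: "integrable (M \<Otimes>\<^sub>M M) (\<lambda>(x, y). p ((x + y) / 2) * \<bar>x - y\<bar> powr \<gamma>)"
    and ix: "integrable (M \<Otimes>\<^sub>M M) (\<lambda>(x, y). p x * \<bar>x - y\<bar> powr \<gamma>)"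
    and iy: "integrable (M \<Otimes>\<^sub>M M) (\<lambda>(x, y). p y * \<bar>x - y\<bar> powr \<gamma>)"
    by (intro dom p; simp)+
  define Z where "Z = (\<integral>(x, y). p ((x + y) / 2) * \<bar>x - y\<bar> powr \<gamma> \<partial>(M \<Otimes>\<^sub>M M))"
  define X where "X = (\<integral>(x, y). p x * \<bar>x - y\<bar> powr \<gamma> \<partial>(M \<Otimes>\<^sub>M M))"
  have Y: "(\<integral>(x, y). p y * \<bar>x - y\<bar> powr \<gamma> \<partial>(M \<Otimes>\<^sub>M M)) = X"
    using pp.integral_product_swap[OF borel_measurable_integrable[OF ix]]
    unfolding X_def by (simp add: abs_minus_commute)
  \<comment> \<open>Exchanging x and y turns the factor x into (x - y)/2, because the derivative of
    the Gaussian is odd; (x - y) times this derivative is then nonpositive.\<close>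
  have drift: "(\<integral>x. x * gauss_average_deriv a x \<partial>M) \<le> 0"
  proof -
    define F where "F = (\<lambda>(x, y). x * (a * dgauss (a * (x - y))))"
    have iF: "integrable (M \<Otimes>\<^sub>M M) F"
    proof (rule integrable_prod_dom(1)[OF _ moments[of 1], of _ a])
      fix x y :: real
      have "\<bar>x\<bar> * (a * \<bar>dgauss (a * (x - y))\<bar>) \<le> (1 + \<bar>x\<bar> + \<bar>y\<bar>) * (a * 1)"
        using a dgauss_bound by (intro mult_mono) auto
      thus "norm (F (x, y)) \<le> a * (1 + \<bar>x\<bar> + \<bar>y\<bar>) powr 1"
        using a by (simp add: F_def abs_mult mult.commute)
    qed (auto simp: F_def)
    have "(\<integral>x. x * gauss_average_deriv a x \<partial>M) = (\<integral>z. F z \<partial>(M \<Otimes>\<^sub>M M))"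
      unfolding pp.integral_fst'[OF iF, symmetric] unfolding F_def gauss_average_deriv_def by simp
    also have "\<dots> = ((\<integral>z. F z \<partial>(M \<Otimes>\<^sub>M M)) + (\<integral>(x, y). F (y, x) \<partial>(M \<Otimes>\<^sub>M M))) / 2"
      using pp.integral_product_swap[OF borel_measurable_integrable[OF iF]] by simp
    also have "\<dots> = (\<integral>z. F z + (case z of (x, y) \<Rightarrow> F (y, x)) \<partial>(M \<Otimes>\<^sub>M M)) / 2"
      using iF pp.integrable_product_swap[OF iF] by simp
    also have "\<dots> \<le> 0"
    proof -
      have "F z + (case z of (x, y) \<Rightarrow> F (y, x)) \<le> 0" for z
      proof (cases z)
        case (Pair x y)
        have "dgauss (a * (y - x)) = - dgauss (a * (x - y))"
          by (simp add: dgauss_def algebra_simps power2_eq_square)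
        hence "F z + (case z of (x, y) \<Rightarrow> F (y, x)) = (x - y) * (a * dgauss (a * (x - y)))"
          by (simp add: F_def Pair algebra_simps)
        also have "\<dots> = - (a\<^sup>2 * (x - y)\<^sup>2 * exp (- (a * (x - y))\<^sup>2 / 2))"
          by (simp add: dgauss_def power2_eq_square)
        finally show ?thesis by simp
      qed
      hence "0 \<le> (\<integral>z. - (F z + (case z of (x, y) \<Rightarrow> F (y, x))) \<partial>(M \<Otimes>\<^sub>M M))"
        by (intro Bochner_Integration.integral_nonneg) (simp only: neg_0_le_iff_le)
      thus ?thesis by (simp only: Bochner_Integration.integral_minus)
    qed
    finally show ?thesis .
  qed
  have "0 \<le> s / 2 * (\<integral>(x, y). (2 * p ((x + y) / 2) - p x - p y) * \<bar>x - y\<bar> powr \<gamma> \<partial>(M \<Otimes>\<^sub>M M))"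
    using weak[OF gauss_average_C1(1)[of a]] drift unfolding gauss_average_C1(2) p_def by linarith
  hence "0 \<le> (\<integral>(x, y). (2 * p ((x + y) / 2) - p x - p y) * \<bar>x - y\<bar> powr \<gamma> \<partial>(M \<Otimes>\<^sub>M M))"
    using s_pos by (simp add: zero_le_mult_iff)
  also have "\<dots> = (\<integral>z. 2 * (case z of (x, y) \<Rightarrow> p ((x + y) / 2) * \<bar>x - y\<bar> powr \<gamma>)
      - (case z of (x, y) \<Rightarrow> p x * \<bar>x - y\<bar> powr \<gamma>) - (case z of (x, y) \<Rightarrow> p y * \<bar>x - y\<bar> powr \<gamma>) \<partial>(M \<Otimes>\<^sub>M M))"
    by (intro Bochner_Integration.integral_cong refl) (auto simp: algebra_simps)
  also have "\<dots> = 2 * Z - X - X" using iz ix iy Y by (simp add: Z_def X_def)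
  finally have XZ: "X \<le> Z" by simp
  have "gauss_energy a / 2 \<le> X"
  proof -
    have "gauss_energy a / 2 = (\<integral>x. p x * (1/2) \<partial>M)" by (simp add: gauss_energy_def p_def)
    also have "\<dots> \<le> (\<integral>x. (\<integral>y. p x * \<bar>x - y\<bar> powr \<gamma> \<partial>M) \<partial>M)"
    proof (rule integral_mono)
      show "integrable M (\<lambda>x. p x * (1/2))" using integrable_gauss_average[of a] by (simp add: p_def)
      show "integrable M (\<lambda>x. \<integral>y. p x * \<bar>x - y\<bar> powr \<gamma> \<partial>M)" using pp.integrable_fst'[OF ix] by simp
      fix x show "p x * (1/2) \<le> (\<integral>y. p x * \<bar>x - y\<bar> powr \<gamma> \<partial>M)"
        using mult_left_mono[OF sig[of x] p(1)[of x]] by simp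
    qed
    also have "\<dots> = X" unfolding X_def using pp.integral_fst'[OF ix] by simp
    finally show ?thesis .
  qed
  moreover have "Z \<le> (R / a + gauss_energy a / 4) + 3 * \<gamma> * gauss_energy a"
  proof -
    have i0: "integrable (M \<Otimes>\<^sub>M M) (\<lambda>(x, y). p ((x + y) / 2))"
      by (rule pp.integrable_const_bound[of _ 1]) (use p in auto)
    have i1: "integrable (M \<Otimes>\<^sub>M M) (\<lambda>(x, y). \<bar>x\<bar> * p ((x + y) / 2))"
    proof (rule integrable_prod_dom(1)[OF _ moments[of 1], of _ 1])
      fix x y :: real
      have "\<bar>x\<bar> * p ((x + y) / 2) \<le> (1 + \<bar>x\<bar> + \<bar>y\<bar>) * 1" using p by (intro mult_mono) auto
      thus "norm (case (x, y) of (x, y) \<Rightarrow> \<bar>x\<bar> * p ((x + y) / 2)) \<le> 1 * (1 + \<bar>x\<bar> + \<bar>y\<bar>) powr 1"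
        using p by (simp add: abs_mult)
    qed auto
    have i2: "integrable (M \<Otimes>\<^sub>M M) (\<lambda>(x, y). \<bar>y\<bar> * p ((x + y) / 2))"
      and v2: "(\<integral>(x, y). \<bar>y\<bar> * p ((x + y) / 2) \<partial>(M \<Otimes>\<^sub>M M)) = (\<integral>(x, y). \<bar>x\<bar> * p ((x + y) / 2) \<partial>(M \<Otimes>\<^sub>M M))"
      using pp.integrable_product_swap[OF i1] pp.integral_product_swap[OF borel_measurable_integrable[OF i1]]
      by (simp_all add: add.commute)
    define J where "J = (\<integral>u. cmod (Phi (a / 2 * u)) * cmod (Phi (a * u)) \<partial>N)"
    have iq: "integrable N (\<lambda>u. (cmod (Phi (b * u)))\<^sup>2)" for b
      by (rule N.integrable_const_bound[of _ 1]) (auto simp: power_le_one cmod_char_le_1)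
    have If: "complex_of_real (I x) = (\<integral>u. Phi (a / 2 * u) * (iexp (a / 2 * u * x) * Phi (- a * u)) \<partial>N)" for x
    proof -
      have "complex_of_real (I x) = (\<integral>y. complex_of_real (p ((x + y) / 2)) \<partial>M)"
        unfolding I_def by (rule integral_complex_of_real[symmetric])
      also have "\<dots> = (\<integral>y. (\<integral>u. iexp (a / 2 * u * y) * (iexp (a / 2 * u * x) * Phi (- a * u)) \<partial>N) \<partial>M)"
      proof -
        have e: "iexp (a * u * ((x + y) / 2)) = iexp (a / 2 * u * y) * iexp (a / 2 * u * x)" for u y
          by (simp add: exp_add[symmetric] algebra_simps add_divide_distrib)
        show ?thesis unfolding p_def gauss_average_fourier by (simp only: e) (simp only: mult.assoc)
      qed
      also have "\<dots> = (\<integral>u. Phi (a / 2 * u) * (iexp (a / 2 * u * x) * Phi (- a * u)) \<partial>N)"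
        by (rule gauss_fubini) (auto simp: norm_mult cmod_char_le_1)
      finally show ?thesis .
    qed
    \<comment> \<open>In the Fourier form the point x enters only through a phase, so the bound is
      uniform in x; the factor |x| in \<open>T2\<close> then costs just the first absolute
      moment.\<close>
    have IJ: "I x \<le> J" for x
    proof -
      have "I x \<le> cmod (complex_of_real (I x))" by simp
      also have "\<dots> \<le> J" unfolding If J_def
        by (rule order_trans[OF integral_norm_bound]) (simp add: norm_mult cmod_char_uminus)
      finally show ?thesis .
    qed
    have JE: "J \<le> 3/2 * gauss_energy a"
    proof -
      have "J \<le> (\<integral>u. 1/2 * (cmod (Phi (a / 2 * u)))\<^sup>2 + 1/2 * (cmod (Phi (a * u)))\<^sup>2 \<partial>N)"
        unfolding J_def
      proof (rule integral_mono)
        show "integrable N (\<lambda>u. cmod (Phi (a / 2 * u)) * cmod (Phi (a * u)))"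
          by (rule N.integrable_const_bound[of _ 1]) (auto intro!: mult_le_one cmod_char_le_1)
        fix u :: real
        have "0 \<le> (cmod (Phi (a / 2 * u)) - cmod (Phi (a * u)))\<^sup>2" by simp
        thus "cmod (Phi (a / 2 * u)) * cmod (Phi (a * u)) \<le> 1/2 * (cmod (Phi (a / 2 * u)))\<^sup>2 + 1/2 * (cmod (Phi (a * u)))\<^sup>2"
          by (simp add: power2_diff)
      qed (intro Bochner_Integration.integrable_add integrable_mult_right iq)
      also have "\<dots> = 1/2 * gauss_energy (a / 2) + 1/2 * gauss_energy a"
        unfolding gauss_energy_fourier using iq[of "a / 2"] iq[of a] by simp
      finally show ?thesis using gauss_energy_half[of a] by simp
    qed
    have T2: "(\<integral>(x, y). \<bar>x\<bar> * p ((x + y) / 2) \<partial>(M \<Otimes>\<^sub>M M)) \<le> 3/2 * gauss_energy a"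
    proof -
      have "(\<integral>(x, y). \<bar>x\<bar> * p ((x + y) / 2) \<partial>(M \<Otimes>\<^sub>M M)) = (\<integral>x. \<bar>x\<bar> * I x \<partial>M)"
        unfolding pp.integral_fst'[OF i1, symmetric] by (simp add: I_def)
      also have "\<dots> \<le> (\<integral>x. \<bar>x\<bar> * J \<partial>M)"
      proof (rule integral_mono)
        show "integrable M (\<lambda>x. \<bar>x\<bar> * I x)" using pp.integrable_fst'[OF i1] by (simp add: I_def)
      qed (use integrable_abs IJ in \<open>auto intro!: mult_left_mono\<close>)
      also have "\<dots> = (\<integral>x. \<bar>x\<bar> \<partial>M) * J" by simp
      also have "\<dots> \<le> 1 * (3/2 * gauss_energy a)"
        using JE first_abs_moment gauss_energy_nonneg[of a]
        by (intro mult_mono) (auto simp: J_def intro!: Bochner_Integration.integral_nonneg)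
      finally show ?thesis by simp
    qed
    \<comment> \<open>The gain term is an average of Phi(a u/2)^2 Phi(-a u). For |u| > R/a the last
      factor is at most 1/8, and \<open>gauss_energy_half\<close> turns the rest into a quarter of
      the energy; the range |u| \<le> R/a has normal mass at most R/a.\<close>
    have T1: "(\<integral>(x, y). p ((x + y) / 2) \<partial>(M \<Otimes>\<^sub>M M)) \<le> R / a + gauss_energy a / 4"
    proof -
      have "complex_of_real (\<integral>(x, y). p ((x + y) / 2) \<partial>(M \<Otimes>\<^sub>M M)) = complex_of_real (\<integral>x. I x \<partial>M)"
        unfolding pp.integral_fst'[OF i0, symmetric] by (simp add: I_def)
      also have "\<dots> = (\<integral>x. (\<integral>u. iexp (a / 2 * u * x) * (Phi (a / 2 * u) * Phi (- a * u)) \<partial>N) \<partial>M)"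
        unfolding integral_complex_of_real[symmetric] If by (simp add: mult_ac)
      also have "\<dots> = (\<integral>u. Phi (a / 2 * u) * (Phi (a / 2 * u) * Phi (- a * u)) \<partial>N)"
        by (rule gauss_fubini) (auto simp: norm_mult intro!: mult_le_one cmod_char_le_1)
      finally have e: "complex_of_real (\<integral>(x, y). p ((x + y) / 2) \<partial>(M \<Otimes>\<^sub>M M)) = \<dots>" .
      have "(\<integral>(x, y). p ((x + y) / 2) \<partial>(M \<Otimes>\<^sub>M M)) \<le> cmod (complex_of_real (\<integral>(x, y). p ((x + y) / 2) \<partial>(M \<Otimes>\<^sub>M M)))" by simp
      also have "\<dots> \<le> (\<integral>u. cmod (Phi (a / 2 * u)) * (cmod (Phi (a / 2 * u)) * cmod (Phi (a * u))) \<partial>N)"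
        unfolding e by (rule order_trans[OF integral_norm_bound]) (simp add: norm_mult cmod_char_uminus)
      also have "\<dots> \<le> (\<integral>u. indicator {- (R / a)..R / a} u + 1/8 * (cmod (Phi (a / 2 * u)))\<^sup>2 \<partial>N)"
      proof (rule integral_mono)
        show "integrable N (\<lambda>u. cmod (Phi (a / 2 * u)) * (cmod (Phi (a / 2 * u)) * cmod (Phi (a * u))))"
          by (rule N.integrable_const_bound[of _ 1]) (auto intro!: mult_le_one cmod_char_le_1)
        have "integrable N (indicator {- (R / a)..R / a} :: real \<Rightarrow> real)" by (rule N.integrable_const_bound[of _ 1]) auto
        thus "integrable N (\<lambda>u. indicator {- (R / a)..R / a} u + 1/8 * (cmod (Phi (a / 2 * u)))\<^sup>2)"
          by (intro Bochner_Integration.integrable_add integrable_mult_right iq)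
        fix u :: real
        show "cmod (Phi (a / 2 * u)) * (cmod (Phi (a / 2 * u)) * cmod (Phi (a * u))) \<le> indicator {- (R / a)..R / a} u + 1/8 * (cmod (Phi (a / 2 * u)))\<^sup>2"
        proof (cases "\<bar>u\<bar> \<le> R / a")
          case True
          have "cmod (Phi (a / 2 * u)) * (cmod (Phi (a / 2 * u)) * cmod (Phi (a * u))) \<le> 1"
            by (intro mult_le_one cmod_char_le_1) (auto intro!: mult_le_one cmod_char_le_1)
          moreover have "u \<in> {- (R / a)..R / a}" using True by (auto simp: abs_le_iff)
          ultimately show ?thesis by (simp add: add_increasing2)
        next
          case False
          hence "R \<le> \<bar>a * u\<bar>" using a by (simp add: abs_mult field_simps)
          from dec[OF this]
          have "cmod (Phi (a / 2 * u)) * (cmod (Phi (a / 2 * u)) * cmod (Phi (a * u))) \<le> cmod (Phi (a / 2 * u)) * (cmod (Phi (a / 2 * u)) * (1/8))"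
            by (intro mult_left_mono) auto
          moreover have "0 \<le> (indicator {- (R / a)..R / a} u :: real)" by simp
          ultimately show ?thesis unfolding power2_eq_square by linarith
        qed
      qed
      also have "\<dots> = (\<integral>u. indicator {- (R / a)..R / a} u \<partial>N) + 1/8 * gauss_energy (a / 2)"
      proof -
        have "integrable N (indicator {- (R / a)..R / a} :: real \<Rightarrow> real)" by (rule N.integrable_const_bound[of _ 1]) auto
        thus ?thesis unfolding gauss_energy_fourier using iq[of "a / 2"] by simp
      qed
      also have "\<dots> \<le> R / a + 1/8 * (2 * gauss_energy a)"
        using gauss_energy_half[of a] N_ball[of "R / a"] R a by (intro add_mono mult_left_mono) auto
      finally show ?thesis by simp
    qed
    have "Z \<le> (\<integral>z. (case z of (x, y) \<Rightarrow> p ((x + y) / 2)) + \<gamma> * ((case z of (x, y) \<Rightarrow> \<bar>x\<bar> * p ((x + y) / 2))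
       + (case z of (x, y) \<Rightarrow> \<bar>y\<bar> * p ((x + y) / 2))) \<partial>(M \<Otimes>\<^sub>M M))"
      unfolding Z_def
    proof (rule integral_mono[OF iz])
      show "integrable (M \<Otimes>\<^sub>M M) (\<lambda>z. (case z of (x, y) \<Rightarrow> p ((x + y) / 2)) + \<gamma> * ((case z of (x, y) \<Rightarrow> \<bar>x\<bar> * p ((x + y) / 2))
       + (case z of (x, y) \<Rightarrow> \<bar>y\<bar> * p ((x + y) / 2))))"
        by (intro Bochner_Integration.integrable_add integrable_mult_right i0 i1 i2)
      fix z :: "real \<times> real"
      show "(case z of (x, y) \<Rightarrow> p ((x + y) / 2) * \<bar>x - y\<bar> powr \<gamma>) \<le>
        (case z of (x, y) \<Rightarrow> p ((x + y) / 2)) + \<gamma> * ((case z of (x, y) \<Rightarrow> \<bar>x\<bar> * p ((x + y) / 2))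
       + (case z of (x, y) \<Rightarrow> \<bar>y\<bar> * p ((x + y) / 2)))"
      proof (cases z)
        case (Pair x y)
        have "\<bar>x - y\<bar> powr \<gamma> \<le> 1 + \<gamma> * (\<bar>x - y\<bar> - 1)" using gamma_pos gamma_less by (intro powr_le_affine) auto
        also have "\<dots> \<le> 1 + \<gamma> * (\<bar>x\<bar> + \<bar>y\<bar>)"
          using gamma_pos abs_triangle_ineq4[of x y] by (intro add_left_mono mult_left_mono) auto
        finally have "p ((x + y) / 2) * \<bar>x - y\<bar> powr \<gamma> \<le> p ((x + y) / 2) * (1 + \<gamma> * (\<bar>x\<bar> + \<bar>y\<bar>))"
          using p by (intro mult_left_mono) auto
        thus ?thesis by (simp add: Pair algebra_simps)
      qed
    qed
    also have "\<dots> = (\<integral>(x, y). p ((x + y) / 2) \<partial>(M \<Otimes>\<^sub>M M)) + \<gamma> * ((\<integral>(x, y). \<bar>x\<bar> * p ((x + y) / 2) \<partial>(M \<Otimes>\<^sub>M M)) + (\<integral>(x, y). \<bar>x\<bar> * p ((x + y) / 2) \<partial>(M \<Otimes>\<^sub>M M)))"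
      using i0 i1 i2 v2 by simp
    also have "\<dots> \<le> (R / a + gauss_energy a / 4) + \<gamma> * (3/2 * gauss_energy a + 3/2 * gauss_energy a)"
      using T1 T2 gamma_pos by (intro add_mono mult_left_mono) auto
    finally show ?thesis by simp
  qed
  moreover have "\<gamma> * gauss_energy a \<le> 1/500 * gauss_energy a" using gamma_small gauss_energy_nonneg by (intro mult_right_mono) auto
  \<comment> \<open>Absorption: 1/2 from the loss term exceeds 1/4 + 3/500 from the gain term by
    more than 1/5.\<close>
  ultimately have "gauss_energy a * (1/5) \<le> R / a" using XZ gauss_energy_nonneg[of a] by simp
  thus ?thesis by (simp add: mult.commute)
qed

end

section \<open>Gaussian quadratic forms on the line and the passage to L^2\<close>

definition gauss_form :: "real \<Rightarrow> (real \<Rightarrow> real) \<Rightarrow> (real \<Rightarrow> real) \<Rightarrow> real" where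
  "gauss_form a f h = (\<integral>(x, y). f x * h y * exp (- (a * (x - y))\<^sup>2 / 2) \<partial>(lborel \<Otimes>\<^sub>M lborel))"

lemma
  fixes f h :: "real \<Rightarrow> 'a::{real_normed_field, banach, second_countable_topology}"
  assumes f: "integrable lborel f" and h: "integrable lborel h"
  shows integrable_lborel_prod: "integrable (lborel \<Otimes>\<^sub>M lborel) (\<lambda>(x, y). f x * h y)"
    and integral_lborel_prod: "(\<integral>(x, y). f x * h y \<partial>(lborel \<Otimes>\<^sub>M lborel)) = (\<integral>x. f x \<partial>lborel) * (\<integral>x. h x \<partial>lborel)"
proof -
  note [measurable] = borel_measurable_integrable[OF f] borel_measurable_integrable[OF h]
  show i: "integrable (lborel \<Otimes>\<^sub>M lborel) (\<lambda>(x, y). f x * h y)"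
    by (rule lborel_pair.Fubini_integrable) (use f h in \<open>auto simp: norm_mult\<close>)
  show "(\<integral>(x, y). f x * h y \<partial>(lborel \<Otimes>\<^sub>M lborel)) = (\<integral>x. f x \<partial>lborel) * (\<integral>x. h x \<partial>lborel)"
    unfolding lborel_pair.integral_fst'[OF i, symmetric] by simp
qed

lemma integrable_gauss_form:
  fixes f h :: "real \<Rightarrow> real"
  assumes f: "integrable lborel f" and h: "integrable lborel h"
  shows "integrable (lborel \<Otimes>\<^sub>M lborel) (\<lambda>(x, y). f x * h y * exp (- (a * (x - y))\<^sup>2 / 2))"
proof (rule Bochner_Integration.integrable_bound[OF integrable_lborel_prod[OF f h]])
  note [measurable] = borel_measurable_integrable[OF f] borel_measurable_integrable[OF h]
  show "(\<lambda>(x, y). f x * h y * exp (- (a * (x - y))\<^sup>2 / 2)) \<in> borel_measurable (lborel \<Otimes>\<^sub>M lborel)" by measurable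
  show "AE z in lborel \<Otimes>\<^sub>M lborel. norm (case z of (x, y) \<Rightarrow> f x * h y * exp (- (a * (x - y))\<^sup>2 / 2)) \<le> norm (case z of (x, y) \<Rightarrow> f x * h y)"
    by (intro AE_I2) (auto simp: abs_mult intro!: mult_left_le)
qed

lemma gauss_form_sym:
  assumes f: "integrable lborel f" and h: "integrable lborel h"
  shows "gauss_form a f h = gauss_form a h f"
proof -
  have e: "(a * (y - x))\<^sup>2 = (a * (x - y))\<^sup>2" for x y :: real by (simp add: power2_eq_square algebra_simps)
  show ?thesis
    using lborel_pair.integral_product_swap[OF borel_measurable_integrable[OF integrable_gauss_form[OF f h, of a]]]
    unfolding gauss_form_def by (simp add: e mult_ac)
qed

lemma gauss_form_diff_square:
  assumes f: "integrable lborel f" and h: "integrable lborel h"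
  shows "gauss_form a (\<lambda>x. f x - h x) (\<lambda>x. f x - h x) = gauss_form a f f - 2 * gauss_form a f h + gauss_form a h h"
proof -
  define E where "E f h = (\<lambda>(x, y). f x * h y * exp (- (a * (x - y))\<^sup>2 / 2))" for f h :: "real \<Rightarrow> real"
  have G: "gauss_form a f h = (\<integral>z. E f h z \<partial>(lborel \<Otimes>\<^sub>M lborel))" for f h by (simp add: gauss_form_def E_def)
  have iE: "integrable (lborel \<Otimes>\<^sub>M lborel) (E f h)" if "integrable lborel f" "integrable lborel h" for f h
    unfolding E_def by (rule integrable_gauss_form[OF that])
  have "gauss_form a (\<lambda>x. f x - h x) (\<lambda>x. f x - h x) = (\<integral>z. E f f z - E f h z - E h f z + E h h z \<partial>(lborel \<Otimes>\<^sub>M lborel))"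
    unfolding G by (intro Bochner_Integration.integral_cong refl) (auto simp: E_def algebra_simps)
  also have "\<dots> = gauss_form a f f - gauss_form a f h - gauss_form a h f + gauss_form a h h"
    unfolding G using iE f h by simp
  finally show ?thesis using gauss_form_sym[OF h f, of a] by simp
qed

text \<open>The Gaussian kernel is positive definite: writing it as an average of e^(i a (x - y) u)
  over \<open>N\<close> turns the form into the average of the squared modulus of the transform of
  f.\<close>

lemma gauss_form_nonneg:
  assumes f: "integrable lborel f"
  shows "0 \<le> gauss_form a f f"
proof -
  note [measurable] = borel_measurable_integrable[OF f]
  define c where "c z = (case z of (x, y) \<Rightarrow> complex_of_real (f x * f y))" for z
  define e where "e z u = (case z of (x, y) \<Rightarrow> iexp (a * (x - y) * u))" for z u
  have ic: "integrable (lborel \<Otimes>\<^sub>M lborel) c"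
    using integrable_lborel_prod[OF f f] unfolding c_def by (simp add: split_beta' flip: of_real_mult)
  have [measurable]: "c \<in> borel_measurable (lborel \<Otimes>\<^sub>M lborel)" "(\<lambda>(z, u). e z u) \<in> borel_measurable ((lborel \<Otimes>\<^sub>M lborel) \<Otimes>\<^sub>M N)"
    unfolding c_def e_def by measurable
  have ne: "cmod (e z u) = 1" for z u by (cases z) (simp add: e_def)
  interpret q: pair_sigma_finite "lborel \<Otimes>\<^sub>M lborel" N
    by (intro pair_sigma_finite.intro lborel_pair.sigma_finite_measure_axioms) unfold_locales
  have iF: "integrable ((lborel \<Otimes>\<^sub>M lborel) \<Otimes>\<^sub>M N) (\<lambda>(z, u). c z * e z u)"
  proof (rule q.Fubini_integrable)
    show "(\<lambda>(z, u). c z * e z u) \<in> borel_measurable ((lborel \<Otimes>\<^sub>M lborel) \<Otimes>\<^sub>M N)" by measurable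
    show "integrable (lborel \<Otimes>\<^sub>M lborel) (\<lambda>z. \<integral>u. norm (case (z, u) of (z, u) \<Rightarrow> c z * e z u) \<partial>N)"
      using ic N.prob_space by (simp add: norm_mult ne)
    have "e z \<in> borel_measurable borel" for z by (cases z) (simp add: e_def[abs_def])
    hence "integrable N (e z)" for z
      by (intro N.integrable_const_bound[of _ 1]) (auto simp: ne)
    thus "AE z in lborel \<Otimes>\<^sub>M lborel. integrable N (\<lambda>u. case (z, u) of (z, u) \<Rightarrow> c z * e z u)" by simp
  qed
  have "complex_of_real (gauss_form a f f) = (\<integral>z. complex_of_real (case z of (x, y) \<Rightarrow> f x * f y * exp (- (a * (x - y))\<^sup>2 / 2)) \<partial>(lborel \<Otimes>\<^sub>M lborel))"
    unfolding gauss_form_def by (rule integral_complex_of_real[symmetric])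
  also have "\<dots> = (\<integral>z. (\<integral>u. c z * e z u \<partial>N) \<partial>(lborel \<Otimes>\<^sub>M lborel))"
  proof (intro Bochner_Integration.integral_cong refl)
    fix z :: "real \<times> real"
    obtain x y where z: "z = (x, y)" by (cases z)
    have "complex_of_real (f x * f y * exp (- (a * (x - y))\<^sup>2 / 2)) = complex_of_real (f x * f y) * (\<integral>u. iexp (a * (x - y) * u) \<partial>N)"
      unfolding gauss_eq[symmetric] by simp
    thus "complex_of_real (case z of (x, y) \<Rightarrow> f x * f y * exp (- (a * (x - y))\<^sup>2 / 2)) = (\<integral>u. c z * e z u \<partial>N)"
      by (simp add: z c_def e_def)
  qed
  also have "\<dots> = (\<integral>u. (\<integral>z. c z * e z u \<partial>(lborel \<Otimes>\<^sub>M lborel)) \<partial>N)"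
    using q.Fubini_integral[OF iF] by simp
  also have "\<dots> = (\<integral>u. complex_of_real ((cmod (\<integral>x. f x * iexp (a * u * x) \<partial>lborel))\<^sup>2) \<partial>N)"
  proof (intro Bochner_Integration.integral_cong refl)
    fix u
    have i1: "integrable lborel (\<lambda>x. f x * iexp (b * x))" for b
    proof (rule Bochner_Integration.integrable_bound[OF f])
      show "(\<lambda>x. complex_of_real (f x) * iexp (b * x)) \<in> borel_measurable lborel" by measurable
    qed (auto simp: norm_mult)
    have "c z * e z u = (case z of (x, y) \<Rightarrow> (f x * iexp (a * u * x)) * (f y * iexp (- (a * u) * y)))" for z
      by (cases z) (simp add: c_def e_def exp_add[symmetric] algebra_simps)
    hence "(\<integral>z. c z * e z u \<partial>(lborel \<Otimes>\<^sub>M lborel)) = (\<integral>x. f x * iexp (a * u * x) \<partial>lborel) * (\<integral>x. f x * iexp (- (a * u) * x) \<partial>lborel)"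
      using integral_lborel_prod[OF i1[of "a * u"] i1[of "- (a * u)"]] by simp
    also have "(\<integral>x. f x * iexp (- (a * u) * x) \<partial>lborel) = cnj (\<integral>x. f x * iexp (a * u * x) \<partial>lborel)"
      unfolding Bochner_Integration.integral_cnj[symmetric] by (simp add: exp_cnj)
    finally show "(\<integral>z. c z * e z u \<partial>(lborel \<Otimes>\<^sub>M lborel)) = complex_of_real ((cmod (\<integral>x. f x * iexp (a * u * x) \<partial>lborel))\<^sup>2)"
      by (simp only: complex_norm_square)
  qed
  finally have "gauss_form a f f = (\<integral>u. (cmod (\<integral>x. f x * iexp (a * u * x) \<partial>lborel))\<^sup>2 \<partial>N)"
    unfolding integral_complex_of_real of_real_eq_iff .
  thus ?thesis by (simp add: Bochner_Integration.integral_nonneg)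
qed

lemma gauss_scale:
  fixes f :: "real \<Rightarrow> real"
  assumes a: "0 < a"
  shows "a / sqrt (2 * pi) * (\<integral>y. f y * exp (- (a * (x - y))\<^sup>2 / 2) \<partial>lborel) = (\<integral>u. std_normal_density u * f (x + u / a) \<partial>lborel)"
proof -
  have "(\<integral>y. f y * exp (- (a * (x - y))\<^sup>2 / 2) \<partial>lborel) = 1 / a * (\<integral>u. f (x + u / a) * exp (- u\<^sup>2 / 2) \<partial>lborel)"
    using a by (subst lborel_integral_real_affine[of "1 / a" _ x]) auto
  hence "a / sqrt (2 * pi) * (\<integral>y. f y * exp (- (a * (x - y))\<^sup>2 / 2) \<partial>lborel) = 1 / sqrt (2 * pi) * (\<integral>u. f (x + u / a) * exp (- u\<^sup>2 / 2) \<partial>lborel)"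
    using a by simp
  also have "\<dots> = (\<integral>u. std_normal_density u * f (x + u / a) \<partial>lborel)"
    unfolding integral_mult_right_zero[symmetric] by (simp add: std_normal_density_def mult_ac)
  finally show ?thesis .
qed

text \<open>Normalized, the kernel is an approximate identity acting on f. Continuity and
  boundedness are asked of f only: g will be the density of a steady state, known so far merely to
  be integrable.\<close>

lemma gauss_form_limit:
  assumes g: "integrable lborel g" and f: "integrable lborel f" and cont: "continuous_on UNIV f" and B: "\<And>x. \<bar>f x\<bar> \<le> B"
  shows "(\<lambda>n. real (Suc n) / sqrt (2 * pi) * gauss_form (real (Suc n)) g f) \<longlonglongrightarrow> (\<integral>x. g x * f x \<partial>lborel)"
proof -
  have [measurable]: "g \<in> borel_measurable borel" using borel_measurable_integrable[OF g] by simp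
  have fm[measurable]: "f \<in> borel_measurable borel" using cont by (rule borel_measurable_continuous_onI)
  have e: "real (Suc n) / sqrt (2 * pi) * gauss_form (real (Suc n)) g f = (\<integral>x. g x * (\<integral>u. f (x + u / real (Suc n)) \<partial>N) \<partial>lborel)" for n
  proof -
    have "real (Suc n) / sqrt (2 * pi) * gauss_form (real (Suc n)) g f
      = real (Suc n) / sqrt (2 * pi) * (\<integral>x. g x * (\<integral>y. f y * exp (- (real (Suc n) * (x - y))\<^sup>2 / 2) \<partial>lborel) \<partial>lborel)"
      unfolding gauss_form_def lborel_pair.integral_fst'[OF integrable_gauss_form[OF g f], symmetric] by (simp add: mult.assoc)
    also have "\<dots> = (\<integral>x. g x * (real (Suc n) / sqrt (2 * pi) * (\<integral>y. f y * exp (- (real (Suc n) * (x - y))\<^sup>2 / 2) \<partial>lborel)) \<partial>lborel)"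
      by (simp only: integral_mult_right_zero[symmetric] mult.left_commute)
    also have "\<dots> = (\<integral>x. g x * (\<integral>u. std_normal_density u * f (x + u / real (Suc n)) \<partial>lborel) \<partial>lborel)"
      by (subst gauss_scale) auto
    also have "\<dots> = (\<integral>x. g x * (\<integral>u. f (x + u / real (Suc n)) \<partial>N) \<partial>lborel)"
      by (subst integral_density) auto
    finally show ?thesis .
  qed
  have inner: "(\<lambda>n. \<integral>u. f (x + u / real (Suc n)) \<partial>N) \<longlonglongrightarrow> f x" for x
  proof -
    have "(\<lambda>n. \<integral>u. f (x + u / real (Suc n)) \<partial>N) \<longlonglongrightarrow> (\<integral>u. f x \<partial>N)"
    proof (rule integral_dominated_convergence[where w = "\<lambda>_. B"])
      show "AE u in N. (\<lambda>n. f (x + u / real (Suc n))) \<longlonglongrightarrow> f x"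
      proof (intro AE_I2)
        fix u :: real
        have "(\<lambda>n. x + u * inverse (real (Suc n))) \<longlonglongrightarrow> x + u * 0"
          by (intro tendsto_intros LIMSEQ_inverse_real_of_nat)
        hence "(\<lambda>n. x + u / real (Suc n)) \<longlonglongrightarrow> x" by (simp add: divide_inverse)
        moreover have "isCont f x" using cont by (simp add: continuous_on_eq_continuous_at)
        ultimately show "(\<lambda>n. f (x + u / real (Suc n))) \<longlonglongrightarrow> f x" by (rule isCont_tendsto_compose[rotated])
      qed
    qed (use B in auto)
    thus ?thesis using N.prob_space by simp
  qed
  have le: "\<bar>\<integral>u. f (x + u / real (Suc n)) \<partial>N\<bar> \<le> B" for x n
  proof -
    have "norm (\<integral>u. f (x + u / real (Suc n)) \<partial>N) \<le> (\<integral>u. B \<partial>N)"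
    proof (rule order_trans[OF integral_norm_bound integral_mono])
      show "integrable N (\<lambda>u. norm (f (x + u / real (Suc n))))"
        by (rule N.integrable_const_bound[of _ B]) (use B in auto)
    qed (use B in auto)
    thus ?thesis using N.prob_space by simp
  qed
  have mm: "(\<lambda>x. \<integral>u. f (x + u / real (Suc n)) \<partial>N) \<in> borel_measurable borel" for n
    by (rule N.borel_measurable_lebesgue_integral) measurable
  show ?thesis unfolding e
  proof (rule integral_dominated_convergence[where w = "\<lambda>x. \<bar>g x\<bar> * B"])
    show "(\<lambda>x. g x * (\<integral>u. f (x + u / real (Suc n)) \<partial>N)) \<in> borel_measurable lborel" for n
      using mm[of n] by simp
    show "AE x in lborel. (\<lambda>n. g x * (\<integral>u. f (x + u / real (Suc n)) \<partial>N)) \<longlonglongrightarrow> g x * f x"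
      by (intro AE_I2 tendsto_intros inner)
    show "AE x in lborel. norm (g x * (\<integral>u. f (x + u / real (Suc n)) \<partial>N)) \<le> \<bar>g x\<bar> * B" for n
      using le by (intro AE_I2) (simp add: abs_mult mult_left_mono)
  qed (use g in auto)
qed

text \<open>Continuous cutoff, equal to 1 for |x| \<le> k and to 0 for |x| \<ge> k + 1:
  multiplication by it keeps continuity and makes bounded functions integrable.\<close>

definition tent :: "nat \<Rightarrow> real \<Rightarrow> real" where
  "tent k x = max 0 (min 1 (real k + 1 - \<bar>x\<bar>))"

lemma tent_bounds: "0 \<le> tent k x" "tent k x \<le> 1" by (auto simp: tent_def)

lemma tent_continuous: "continuous_on UNIV (tent k)"
  unfolding tent_def[abs_def] by (intro continuous_intros)

lemma integrable_tent_mult: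
  assumes [measurable]: "f \<in> borel_measurable borel" and B: "\<And>x. \<bar>f x\<bar> \<le> (B::real)"
  shows "integrable lborel (\<lambda>x. f x * tent k x)"
proof (rule Bochner_Integration.integrable_bound[of lborel "\<lambda>x. B * indicator {- (real k + 1)..real k + 1} x"])
  have [measurable]: "tent k \<in> borel_measurable borel" using tent_continuous by (rule borel_measurable_continuous_onI)
  show "integrable lborel (\<lambda>x. B * indicator {- (real k + 1)..real k + 1} x)"
    using borel_integrable_compact[of "{- (real k + 1)..real k + 1}" "\<lambda>_. B"] by (simp add: mult.commute)
  show "(\<lambda>x. f x * tent k x) \<in> borel_measurable lborel" by measurable
  have B0: "0 \<le> B" using B[of 0] by linarith
  have "\<bar>f x * tent k x\<bar> \<le> \<bar>B * indicator {- (real k + 1)..real k + 1} x\<bar>" for x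
  proof (cases "x \<in> {- (real k + 1)..real k + 1}")
    case True
    have "\<bar>f x\<bar> * tent k x \<le> B * 1" using B tent_bounds B0 by (intro mult_mono) auto
    thus ?thesis using True tent_bounds B0 by (simp add: abs_mult)
  next
    case False
    hence "tent k x = 0" by (auto simp: tent_def)
    thus ?thesis by simp
  qed
  thus "AE x in lborel. norm (f x * tent k x) \<le> norm (B * indicator {- (real k + 1)..real k + 1} x)" by simp
qed

text \<open>
  Positivity of the Gaussian form on \<open>g - f\<close> with \<open>f\<close> continuous gives \<open>2 \<integral> g f \<le> C + \<integral> f\<^sup>2\<close>
  in the limit; then \<open>f\<close> approximates truncations of \<open>g\<close>.
\<close>
lemma L2_from_gauss_form:
  assumes g: "integrable lborel g" and g0: "\<And>x. 0 \<le> g x"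
    and C: "\<And>a. 0 < a \<Longrightarrow> a / sqrt (2 * pi) * gauss_form a g g \<le> C"
  shows "integrable lborel (\<lambda>x. (g x)\<^sup>2)" and "(\<integral>x. (g x)\<^sup>2 \<partial>lborel) \<le> C"
proof -
  have gm[measurable]: "g \<in> borel_measurable borel" using borel_measurable_integrable[OF g] by simp
  have tm[measurable]: "tent k \<in> borel_measurable borel" for k using tent_continuous by (rule borel_measurable_continuous_onI)
  have step1: "2 * (\<integral>x. g x * f x \<partial>lborel) \<le> C + (\<integral>x. f x * f x \<partial>lborel)"
    if f: "integrable lborel f" "continuous_on UNIV f" "\<And>x. \<bar>f x\<bar> \<le> B" for f B
  proof -
    define c where "c n = real (Suc n) / sqrt (2 * pi)" for n
    have c0: "0 \<le> c n" for n by (simp add: c_def)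
    have le: "2 * (c n * gauss_form (real (Suc n)) g f) \<le> C + c n * gauss_form (real (Suc n)) f f" for n
    proof -
      have "0 \<le> c n * gauss_form (real (Suc n)) (\<lambda>x. g x - f x) (\<lambda>x. g x - f x)"
        using c0[of n] gauss_form_nonneg[of "\<lambda>x. g x - f x"] g f by (intro mult_nonneg_nonneg) auto
      also have "\<dots> = c n * gauss_form (real (Suc n)) g g - 2 * (c n * gauss_form (real (Suc n)) g f) + c n * gauss_form (real (Suc n)) f f"
        unfolding gauss_form_diff_square[OF g f(1)] by (simp add: algebra_simps)
      finally show ?thesis using C[of "real (Suc n)"] by (simp add: c_def)
    qed
    have l1: "(\<lambda>n. 2 * (c n * gauss_form (real (Suc n)) g f)) \<longlonglongrightarrow> 2 * (\<integral>x. g x * f x \<partial>lborel)"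
      unfolding c_def by (intro tendsto_mult tendsto_const gauss_form_limit[OF g f])
    have l2: "(\<lambda>n. C + c n * gauss_form (real (Suc n)) f f) \<longlonglongrightarrow> C + (\<integral>x. f x * f x \<partial>lborel)"
      unfolding c_def by (intro tendsto_add tendsto_const gauss_form_limit[OF f(1) f])
    show ?thesis using le by (intro LIMSEQ_le[OF l1 l2] exI allI impI)
  qed
  \<comment> \<open>Truncation of g in height and support. It lies below g, so its square lies below
    g F, and it equals g at each point once k is large.\<close>
  define F where "F k x = max 0 (min (g x) (real k)) * tent k x" for k x
  have F0: "0 \<le> F k x" and Fg: "F k x \<le> g x" and Fk: "F k x \<le> real k" for k x
  proof -
    have "F k x \<le> max 0 (min (g x) (real k)) * 1" unfolding F_def
      using tent_bounds[of k x] by (intro mult_left_mono) auto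
    thus "F k x \<le> g x" "F k x \<le> real k" using g0[of x] by auto
    show "0 \<le> F k x" unfolding F_def using tent_bounds[of k x] by simp
  qed
  have [measurable]: "F k \<in> borel_measurable borel" for k unfolding F_def[abs_def] by measurable
  have iF: "integrable lborel (F k)" for k
    unfolding F_def[abs_def] by (rule integrable_tent_mult[where B = "real k"]) auto
  have iFF: "integrable lborel (\<lambda>x. (F k x)\<^sup>2)" for k
  proof (rule Bochner_Integration.integrable_bound[OF integrable_mult_right[OF iF, of "real k" k]])
    show "AE x in lborel. norm ((F k x)\<^sup>2) \<le> norm (real k * F k x)"
      using F0[of k] Fk[of k] by (intro AE_I2) (simp add: power2_eq_square mult_right_mono)
  qed auto
  have igF: "integrable lborel (\<lambda>x. g x * F k x)" for k
  proof (rule Bochner_Integration.integrable_bound[OF integrable_mult_right[OF g, of "real k"]])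
    show "AE x in lborel. norm (g x * F k x) \<le> norm (real k * g x)"
    proof (intro AE_I2)
      fix x
      have "g x * F k x \<le> real k * g x" using mult_right_mono[OF Fk[of k x] g0[of x]] by (simp add: mult.commute)
      thus "norm (g x * F k x) \<le> norm (real k * g x)" using F0[of k x] g0[of x] by simp
    qed
  qed auto
  have step2: "2 * (\<integral>x. g x * F k x \<partial>lborel) \<le> C + (\<integral>x. (F k x)\<^sup>2 \<partial>lborel)" for k
  proof -
    \<comment> \<open>\<open>step1\<close> asks for a continuous function and \<open>F k\<close> is
      only measurable. Continuous functions converging to g almost everywhere are truncated in the
      same way, so that one majorant serves for all of them.\<close>
    have "g \<in> borel_measurable lebesgue" using gm by (intro measurable_completion) simp
    from lebesgue_measurable_imp_measurable_on_nnreal_UNIV[OF this g0]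
    obtain A h where A: "negligible A" and h: "\<And>n. continuous_on UNIV (h n)"
      "\<And>x. x \<notin> A \<Longrightarrow> (\<lambda>n. h n x) \<longlonglongrightarrow> g x"
      unfolding measurable_on_def by auto
    have "AE x in lebesgue. x \<notin> A" using A by (auto simp: negligible_iff_null_sets intro: AE_not_in)
    hence AE: "AE x in lborel. x \<notin> A" by (simp add: AE_completion_iff)
    define f where "f n x = max 0 (min (h n x) (real k)) * tent k x" for n x
    have fc: "continuous_on UNIV (f n)" for n unfolding f_def[abs_def] by (intro continuous_intros h tent_continuous)
    have hm[measurable]: "h n \<in> borel_measurable borel" for n using h(1) by (rule borel_measurable_continuous_onI)
    have fi: "integrable lborel (f n)" for n
      unfolding f_def[abs_def] by (rule integrable_tent_mult[where B = "real k"]) auto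
    have fb: "\<bar>f n x\<bar> \<le> real k * tent k x" for n x
      unfolding f_def using tent_bounds[of k x] by (simp add: abs_mult mult_right_mono)
    have fb': "\<bar>f n x\<bar> \<le> real k" for n x
      using fb[of n x] tent_bounds[of k x] mult_left_le[of "tent k x" "real k"] by simp
    have flim: "AE x in lborel. (\<lambda>n. f n x) \<longlonglongrightarrow> F k x"
      using AE by eventually_elim (auto simp: f_def F_def intro!: tendsto_intros h)
    have [measurable]: "f n \<in> borel_measurable borel" for n unfolding f_def[abs_def] by measurable
    have L1: "(\<lambda>n. \<integral>x. g x * f n x \<partial>lborel) \<longlonglongrightarrow> (\<integral>x. g x * F k x \<partial>lborel)"
    proof (rule integral_dominated_convergence[where w = "\<lambda>x. g x * real k"])
      show "AE x in lborel. (\<lambda>n. g x * f n x) \<longlonglongrightarrow> g x * F k x"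
        using flim by eventually_elim (intro tendsto_intros)
      show "AE x in lborel. norm (g x * f n x) \<le> g x * real k" for n
        using fb'[of n] g0 by (intro AE_I2) (simp add: abs_mult mult_left_mono)
    qed (use g in auto)
    have L2: "(\<lambda>n. \<integral>x. f n x * f n x \<partial>lborel) \<longlonglongrightarrow> (\<integral>x. F k x * F k x \<partial>lborel)"
    proof (rule integral_dominated_convergence[where w = "\<lambda>x. (real k * real k) * tent k x"])
      show "integrable lborel (\<lambda>x. real k * real k * tent k x)" by (rule integrable_tent_mult[where B = "real k * real k"]) auto
      show "AE x in lborel. (\<lambda>n. f n x * f n x) \<longlonglongrightarrow> F k x * F k x"
        using flim by eventually_elim (intro tendsto_intros)
      have "\<bar>f n x\<bar> * \<bar>f n x\<bar> \<le> real k * (real k * tent k x)" for n x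
        using fb[of n x] fb'[of n x] by (intro mult_mono) auto
      thus "AE x in lborel. norm (f n x * f n x) \<le> real k * real k * tent k x" for n
        by (intro AE_I2) (simp add: abs_mult mult.assoc)
    qed auto
    have "2 * (\<integral>x. g x * F k x \<partial>lborel) \<le> C + (\<integral>x. F k x * F k x \<partial>lborel)"
    proof (rule LIMSEQ_le)
      show "(\<lambda>n. 2 * (\<integral>x. g x * f n x \<partial>lborel)) \<longlonglongrightarrow> 2 * (\<integral>x. g x * F k x \<partial>lborel)" by (intro tendsto_intros L1)
      show "(\<lambda>n. C + (\<integral>x. f n x * f n x \<partial>lborel)) \<longlonglongrightarrow> C + (\<integral>x. F k x * F k x \<partial>lborel)" by (intro tendsto_intros L2)
      show "\<exists>N. \<forall>n\<ge>N. 2 * (\<integral>x. g x * f n x \<partial>lborel) \<le> C + (\<integral>x. f n x * f n x \<partial>lborel)"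
        using step1[OF fi fc fb'] by blast
    qed
    thus ?thesis by (simp add: power2_eq_square)
  qed
  \<comment> \<open>From F^2 \<le> g F and \<open>step2\<close>, twice the integral of F^2 is at
    most C plus that integral, which is finite and can be subtracted.\<close>
  have bnd: "(\<integral>x. (F k x)\<^sup>2 \<partial>lborel) \<le> C" for k
  proof -
    have "(\<integral>x. (F k x)\<^sup>2 \<partial>lborel) \<le> (\<integral>x. g x * F k x \<partial>lborel)"
      using F0[of k] Fg[of k] by (intro integral_mono iFF igF) (simp add: power2_eq_square mult_right_mono)
    thus ?thesis using step2[of k] by simp
  qed
  have Fmono: "F j x \<le> F k x" if "j \<le> k" for j k x
    unfolding F_def using that by (intro mult_mono) (auto simp: tent_def)
  have mono: "mono (\<lambda>k. (F k x)\<^sup>2)" for x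
    using Fmono F0 by (auto intro!: monoI power_mono)
  have lim: "(\<lambda>k. (F k x)\<^sup>2) \<longlonglongrightarrow> (g x)\<^sup>2" for x
  proof (rule tendsto_eventually)
    obtain m :: nat where m: "max (g x) \<bar>x\<bar> \<le> real m" using real_arch_simple by blast
    show "eventually (\<lambda>k. (F k x)\<^sup>2 = (g x)\<^sup>2) sequentially"
      using eventually_ge_at_top[of m]
    proof eventually_elim
      case (elim k)
      hence "g x \<le> real k" "\<bar>x\<bar> \<le> real k" using m by (auto intro: order_trans)
      thus ?case using g0[of x] by (simp add: F_def tent_def)
    qed
  qed
  have "incseq (\<lambda>k. \<integral>x. (F k x)\<^sup>2 \<partial>lborel)"
    using mono by (intro monoI integral_mono iFF) (auto simp: mono_def)
  from incseq_convergent[OF this, of C] bnd obtain L where L: "(\<lambda>k. \<integral>x. (F k x)\<^sup>2 \<partial>lborel) \<longlonglongrightarrow> L" by blast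
  have "L \<le> C" using L bnd by (intro LIMSEQ_le_const2) auto
  show "integrable lborel (\<lambda>x. (g x)\<^sup>2)"
    by (rule integrable_monotone_convergence[OF iFF _ _ L]) (use mono lim in auto)
  have "(\<integral>x. (g x)\<^sup>2 \<partial>lborel) = L"
    by (rule integral_monotone_convergence[OF iFF _ _ L]) (use mono lim in auto)
  thus "(\<integral>x. (g x)\<^sup>2 \<partial>lborel) \<le> C" using \<open>L \<le> C\<close> by simp
qed

section \<open>The limit profile\<close>

text \<open>The half line is handled by the primitive F and doubled by reflection; the origin, where
  both halves meet, is a null set.\<close>

lemma even_integral_FTC:
  fixes f F :: "real \<Rightarrow> real"
  assumes [measurable]: "f \<in> borel_measurable borel" and nn: "\<And>x. 0 \<le> f x" and even: "\<And>x. f (- x) = f x"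
    and der: "\<And>x. 0 \<le> x \<Longrightarrow> (F has_real_derivative f x) (at x)" and lim: "(F \<longlongrightarrow> T) at_top"
  shows "integrable lborel f" and "(\<integral>x. f x \<partial>lborel) = 2 * (T - F 0)"
proof -
  define h where "h x = f x * indicator {0..} x" for x
  have hm[measurable]: "h \<in> borel_measurable borel" unfolding h_def[abs_def] by measurable
  have "(\<integral>\<^sup>+x. ennreal (f x) * indicator {0..} x \<partial>lborel) = ennreal (T - F 0)"
    using der lim nn by (intro nn_integral_FTC_atLeast) auto
  moreover have "ennreal (f x) * indicator {0..} x = ennreal (h x)" for x by (simp add: h_def split: split_indicator)
  ultimately have nni: "(\<integral>\<^sup>+x. ennreal (h x) \<partial>lborel) = ennreal (T - F 0)" by simp
  have TF: "0 \<le> T - F 0"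
  proof -
    have mono: "F 0 \<le> F x" if "0 \<le> x" for x
      by (rule DERIV_nonneg_imp_nondecreasing[OF that]) (use der nn in blast)
    have "eventually (\<lambda>x. F 0 \<le> F x) at_top" using mono by (rule eventually_mono[OF eventually_ge_at_top[of 0]])
    hence "F 0 \<le> T" using lim by (intro tendsto_lowerbound) auto
    thus ?thesis by simp
  qed
  have h: "has_bochner_integral lborel h (T - F 0)"
    by (rule has_bochner_integral_nn_integral) (use nni nn TF in \<open>auto simp: h_def split: split_indicator\<close>)
  have h': "has_bochner_integral lborel (\<lambda>x. h (- x)) (T - F 0)"
    using lborel_has_bochner_integral_real_affine_iff[of "-1" h "T - F 0" 0] h by simp
  have s: "has_bochner_integral lborel (\<lambda>x. h x + h (- x)) ((T - F 0) + (T - F 0))"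
    using h h' by (rule has_bochner_integral_add)
  have "AE x in lborel. x \<noteq> (0::real)" by (rule AE_lborel_singleton)
  hence ae: "AE x in lborel. h x + h (- x) = f x"
    by eventually_elim (auto simp: h_def even split: split_indicator)
  have "has_bochner_integral lborel f ((T - F 0) + (T - F 0))"
    using has_bochner_integralI_AE[OF s _ ae] by simp
  thus "integrable lborel f" "(\<integral>x. f x \<partial>lborel) = 2 * (T - F 0)"
    by (auto simp: has_bochner_integral_iff)
qed

lemma psi_measurable [measurable]: "psi \<in> borel_measurable borel"
  unfolding psi_def[abs_def] by measurable

lemma psi_continuous: "continuous_on UNIV psi"
  unfolding psi_def[abs_def] by (intro continuous_intros)

lemma psi_integrable: "integrable lborel psi"
proof (rule even_integral_FTC(1)[where F = "\<lambda>y. - ((2 + y) * exp (- y))" and T = 0])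
  show "((\<lambda>y::real. - ((2 + y) * exp (- y))) \<longlongrightarrow> 0) at_top" by real_asymp
  fix x :: real assume "0 \<le> x"
  thus "((\<lambda>y. - ((2 + y) * exp (- y))) has_real_derivative psi x) (at x)"
    by (auto intro!: derivative_eq_intros simp: psi_def algebra_simps)
qed (auto simp: psi_def)

text \<open>With c = 1 - ix the integrand on the positive half line is (1 + y) e^(-c y), which has
  an elementary primitive and integral 1/c + 1/c^2. The negative half line gives the complex
  conjugate, and c times its conjugate is 1 + x^2.\<close>

lemma psi_fourier: "(\<integral>y. psi y * iexp (x * y) \<partial>lborel) = complex_of_real (4 / (1 + x\<^sup>2)\<^sup>2)"
proof -
  define c :: complex where "c = 1 - \<i> * x"
  have c0: "c \<noteq> 0" by (simp add: c_def complex_eq_iff)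
  define k where "k y = complex_of_real (psi y) * iexp (x * y)" for y
  define F where "F y = - (((1 + y) / c + 1 / c\<^sup>2) * exp (- c * of_real y))" for y :: real
  have [measurable]: "k \<in> borel_measurable borel" unfolding k_def[abs_def] by measurable
  have nk: "cmod (k y) = psi y" for y using psi_bounds by (simp add: k_def norm_mult)
  have ik: "integrable lborel k"
    by (rule Bochner_Integration.integrable_bound[OF psi_integrable]) (use psi_bounds in \<open>auto simp: nk\<close>)
  define k0 where "k0 y = indicator {0..} y *\<^sub>R k y" for y
  have ik0: "integrable lborel k0" unfolding k0_def[abs_def] using ik by (rule integrable_mult_indicator[rotated]) auto
  have kc: "continuous_on UNIV k" unfolding k_def[abs_def] by (intro continuous_intros psi_continuous)
  have keq: "k y = (1 + y) * exp (- c * of_real y)" if "0 \<le> y" for y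
    using that by (simp add: k_def psi_def c_def exp_add[symmetric] exp_of_real[symmetric] algebra_simps)
  have dF: "(F has_vector_derivative k y) (at y within S)" if "0 \<le> y" for y S
  proof -
    have "((\<lambda>z. - (((1 + z) / c + 1 / c\<^sup>2) * exp (- c * z))) has_field_derivative (1 + of_real y) * exp (- c * of_real y)) (at (of_real y))"
      using c0 by (auto intro!: derivative_eq_intros simp: power2_eq_square field_simps)
    from has_vector_derivative_real_field[OF this] show ?thesis
      unfolding keq[OF that] F_def[abs_def] by (simp only: of_real_add of_real_1)
  qed
  have fin: "(\<integral>y. indicator {0..real n} y *\<^sub>R k y \<partial>lborel) = F (real n) - F 0" for n
    by (rule integral_FTC_Icc) (use dF kc in \<open>auto intro: continuous_on_subset\<close>)
  have "(\<lambda>n. \<integral>y. indicator {0..real n} y *\<^sub>R k y \<partial>lborel) \<longlonglongrightarrow> (\<integral>y. k0 y \<partial>lborel)"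
  proof (rule integral_dominated_convergence[where w = psi])
    show "AE y in lborel. (\<lambda>n. indicator {0..real n} y *\<^sub>R k y) \<longlonglongrightarrow> k0 y"
    proof (intro AE_I2 tendsto_eventually)
      fix y :: real
      obtain m :: nat where "y \<le> real m" using real_arch_simple by blast
      thus "eventually (\<lambda>n. indicator {0..real n} y *\<^sub>R k y = k0 y) sequentially"
        by (intro eventually_sequentiallyI[of m]) (auto simp: k0_def split: split_indicator)
    qed
    show "AE y in lborel. norm (indicator {0..real n} y *\<^sub>R k y) \<le> psi y" for n
      using psi_bounds by (intro AE_I2) (auto simp: nk split: split_indicator)
    show "k0 \<in> borel_measurable lborel" using ik0 by auto
  qed (use psi_integrable in auto)
  moreover have "(\<lambda>n. F (real n) - F 0) \<longlonglongrightarrow> 0 - F 0"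
  proof (intro tendsto_diff tendsto_const)
    show "(\<lambda>n. F (real n)) \<longlonglongrightarrow> 0"
    proof (rule Lim_null_comparison)
      show "eventually (\<lambda>n. norm (F (real n)) \<le> ((1 + real n) / cmod c + 1 / (cmod c)\<^sup>2) * exp (- real n)) sequentially"
      proof (intro always_eventually allI)
        fix n
        have "norm (F (real n)) = cmod ((1 + of_real (real n)) / c + 1 / c\<^sup>2) * exp (- real n)"
          unfolding F_def norm_minus_cancel norm_mult by (simp add: c_def)
        also have "\<dots> \<le> ((1 + real n) / cmod c + 1 / (cmod c)\<^sup>2) * exp (- real n)"
        proof (intro mult_right_mono)
          have "cmod ((1 + of_real (real n)) / c) = (1 + real n) / cmod c"
            unfolding norm_divide by (metis norm_of_real of_real_1 of_real_add abs_of_nonneg add_nonneg_nonneg of_nat_0_le_iff zero_le_one)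
          moreover have "cmod (1 / c\<^sup>2) = 1 / (cmod c)\<^sup>2" by (simp add: norm_divide norm_power)
          ultimately show "cmod ((1 + of_real (real n)) / c + 1 / c\<^sup>2) \<le> (1 + real n) / cmod c + 1 / (cmod c)\<^sup>2"
            using norm_triangle_ineq[of "(1 + of_real (real n)) / c" "1 / c\<^sup>2"] by linarith
        qed auto
        finally show "norm (F (real n)) \<le> ((1 + real n) / cmod c + 1 / (cmod c)\<^sup>2) * exp (- real n)" .
      qed
      define A where "A = 1 / cmod c"
      define B where "B = 1 / (cmod c)\<^sup>2"
      have "(\<lambda>n. ((1 + real n) * A + B) * exp (- real n)) \<longlonglongrightarrow> 0" by real_asymp
      thus "(\<lambda>n. ((1 + real n) / cmod c + 1 / (cmod c)\<^sup>2) * exp (- real n)) \<longlonglongrightarrow> 0"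
        by (simp add: A_def B_def)
    qed
  qed
  ultimately have K0: "(\<integral>y. k0 y \<partial>lborel) = 1 / c + 1 / c\<^sup>2"
    unfolding fin using LIMSEQ_unique by (fastforce simp: F_def)
  have k0c: "k0 (- y) = cnj (indicator {..0} y *\<^sub>R k y)" for y
    by (auto simp: k0_def k_def psi_def exp_cnj split: split_indicator)
  have R: "(\<integral>y. k0 y \<partial>lborel) = (\<integral>y. cnj (indicator {..0} y *\<^sub>R k y) \<partial>lborel)"
    using lborel_integral_real_affine[of "-1" k0 0] by (simp add: k0c)
  hence R': "(\<integral>y. indicator {..0} y *\<^sub>R k y \<partial>lborel) = cnj (\<integral>y. k0 y \<partial>lborel)"
    by (simp only: Bochner_Integration.integral_cnj complex_cnj_cnj)
  have im: "integrable lborel (\<lambda>y. indicator {..0} y *\<^sub>R k y)" using ik by (rule integrable_mult_indicator[rotated]) auto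
  have "AE x in lborel. x \<noteq> (0::real)" by (rule AE_lborel_singleton)
  hence ae: "AE y in lborel. k y = k0 y + indicator {..0} y *\<^sub>R k y"
    by eventually_elim (auto simp: k0_def split: split_indicator)
  have "(\<integral>y. k y \<partial>lborel) = (\<integral>y. k0 y + indicator {..0} y *\<^sub>R k y \<partial>lborel)"
    by (rule integral_cong_AE) (use ik ik0 im ae in auto)
  also have "\<dots> = (1 / c + 1 / c\<^sup>2) + cnj (1 / c + 1 / c\<^sup>2)" using ik0 im by (simp add: R' K0)
  also have "\<dots> = of_real (4 / (1 + x\<^sup>2)\<^sup>2)"
  proof -
    have cc: "c * cnj c = of_real (1 + x\<^sup>2)" by (simp add: c_def complex_eq_iff power2_eq_square)
    have sum: "c + cnj c = 2" "c\<^sup>2 + (cnj c)\<^sup>2 = 2 * (1 - of_real (x\<^sup>2))"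
      by (simp_all add: c_def complex_eq_iff power2_eq_square)
    have nz: "cnj c \<noteq> 0" using c0 by simp
    have "(1 / c + 1 / c\<^sup>2) + cnj (1 / c + 1 / c\<^sup>2) = (c + cnj c) / (c * cnj c) + (c\<^sup>2 + (cnj c)\<^sup>2) / (c * cnj c)\<^sup>2"
      using c0 nz by (simp add: field_simps power2_eq_square)
    also have "\<dots> = of_real (2 / (1 + x\<^sup>2) + 2 * (1 - x\<^sup>2) / (1 + x\<^sup>2)\<^sup>2)"
      unfolding cc sum by simp
    also have "2 / (1 + x\<^sup>2) + 2 * (1 - x\<^sup>2) / (1 + x\<^sup>2)\<^sup>2 = 4 / (1 + x\<^sup>2)\<^sup>2"
    proof -
      have p: "1 + x\<^sup>2 \<noteq> 0" using zero_le_power2[of x] by linarith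
      have "2 / P = 2 * P / P\<^sup>2" if "P \<noteq> 0" for P :: real using that by (simp add: power2_eq_square)
      from this[OF p] have "2 / (1 + x\<^sup>2) = 2 * (1 + x\<^sup>2) / (1 + x\<^sup>2)\<^sup>2" .
      thus ?thesis by (simp add: add_divide_distrib[symmetric])
    qed
    finally show ?thesis .
  qed
  finally show ?thesis unfolding k_def .
qed

lemma H_bounds: "0 \<le> H x" "H x \<le> 8 / pi * (1 + \<bar>x\<bar>) powr (-4)" "H x \<le> 1"
proof -
  have p: "0 < 1 + x\<^sup>2" using zero_le_power2[of x] by linarith
  show "0 \<le> H x" by (simp add: H_def)
  have "0 \<le> (1 - \<bar>x\<bar>)\<^sup>2" by simp
  hence "(1 + \<bar>x\<bar>)\<^sup>2 \<le> 2 * (1 + x\<^sup>2)" by (simp add: power2_sum power2_diff)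
  hence "((1 + \<bar>x\<bar>)\<^sup>2)\<^sup>2 \<le> (2 * (1 + x\<^sup>2))\<^sup>2" by (intro power_mono) auto
  moreover have "((1 + \<bar>x\<bar>)\<^sup>2)\<^sup>2 = (1 + \<bar>x\<bar>) ^ 4" by (simp flip: power_mult)
  moreover have "(2 * (1 + x\<^sup>2))\<^sup>2 = 4 * (1 + x\<^sup>2)\<^sup>2" by (simp only: power_mult_distrib) simp
  ultimately have "(1 + \<bar>x\<bar>) ^ 4 \<le> 4 * (1 + x\<^sup>2)\<^sup>2" by simp
  hence "(1 + \<bar>x\<bar>) ^ 4 / 4 \<le> (1 + x\<^sup>2)\<^sup>2" by simp
  hence "H x \<le> 2 / (pi * ((1 + \<bar>x\<bar>) ^ 4 / 4))"
    unfolding H_def using p by (intro divide_left_mono mult_left_mono mult_pos_pos) auto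
  also have "\<dots> = 8 / pi * inverse ((1 + \<bar>x\<bar>) ^ 4)"
  proof -
    have "2 / (pi * (W / 4)) = 8 / pi * inverse W" for W :: real
      by (cases "W = 0") (simp_all add: inverse_eq_divide)
    thus ?thesis .
  qed
  also have "inverse ((1 + \<bar>x\<bar>) ^ 4) = (1 + \<bar>x\<bar>) powr (-4)" by (subst powr_minus) simp
  finally show "H x \<le> 8 / pi * (1 + \<bar>x\<bar>) powr (-4)" .
  have "1 \<le> (1 + x\<^sup>2)\<^sup>2" using one_le_power[of "1 + x\<^sup>2" 2] by simp
  hence "2 * 1 \<le> pi * (1 + x\<^sup>2)\<^sup>2" using pi_gt3 by (intro mult_mono) auto
  moreover have "0 < pi * (1 + x\<^sup>2)\<^sup>2" using p by simp
  ultimately show "H x \<le> 1" by (simp add: H_def divide_le_eq)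
qed

lemma H_measurable [measurable]: "H \<in> borel_measurable borel"
  unfolding H_def[abs_def] by measurable

lemma integrable_weight_neg:
  assumes "p < -1"
  shows "integrable lborel (\<lambda>x::real. (1 + \<bar>x\<bar>) powr p)"
proof (rule even_integral_FTC(1)[where F = "\<lambda>x. (1 + x) powr (p + 1) / (p + 1)" and T = 0])
  fix x :: real assume "0 \<le> x"
  thus "((\<lambda>x. (1 + x) powr (p + 1) / (p + 1)) has_real_derivative (1 + \<bar>x\<bar>) powr p) (at x)"
    using assms by (auto intro!: derivative_eq_intros)
next
  have "((\<lambda>x::real. (1 + x) powr (p + 1)) \<longlongrightarrow> 0) at_top"
    using assms by (intro tendsto_neg_powr filterlim_tendsto_add_at_top[OF tendsto_const] filterlim_ident) auto
  thus "((\<lambda>x::real. (1 + x) powr (p + 1) / (p + 1)) \<longlongrightarrow> 0) at_top"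
    using tendsto_divide[OF _ tendsto_const, of "\<lambda>x. (1 + x) powr (p + 1)" 0 at_top "p + 1"] assms by simp
qed auto

lemma integrable_H_weight:
  assumes "q < 3"
  shows "integrable lborel (\<lambda>x. H x * (1 + \<bar>x\<bar>) powr q)"
proof (rule Bochner_Integration.integrable_bound[OF integrable_mult_right[OF integrable_weight_neg[of "q - 4"], of "8 / pi"]])
  show "AE x in lborel. norm (H x * (1 + \<bar>x\<bar>) powr q) \<le> norm (8 / pi * (1 + \<bar>x\<bar>) powr (q - 4))"
  proof (intro AE_I2)
    fix x :: real
    have "H x * (1 + \<bar>x\<bar>) powr q \<le> 8 / pi * (1 + \<bar>x\<bar>) powr (-4) * (1 + \<bar>x\<bar>) powr q"
      using H_bounds by (intro mult_right_mono) auto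
    also have "\<dots> = 8 / pi * (1 + \<bar>x\<bar>) powr (q - 4)" using powr_add[of "1 + \<bar>x\<bar>" "-4" q] by simp
    finally show "norm (H x * (1 + \<bar>x\<bar>) powr q) \<le> norm (8 / pi * (1 + \<bar>x\<bar>) powr (q - 4))"
      using H_bounds[of x] by simp
  qed
qed (use assms in auto)

lemma H_integrable: "integrable lborel H"
proof -
  have "1 + \<bar>x\<bar> \<noteq> 0" for x :: real using abs_ge_zero[of x] by linarith
  thus ?thesis using integrable_H_weight[of 0] by simp
qed

text \<open>Fourier inversion: both sides of the Gaussian regularization of \<open>psi_fourier\<close> converge.\<close>
lemma H_fourier: "(\<integral>x. H x * iexp (\<xi> * x) \<partial>lborel) = complex_of_real (psi \<xi>)"
proof -
  define q where "q x = 1 / (1 + x\<^sup>2)\<^sup>2" for x :: real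
  have Hq: "H x = 2 / pi * q x" for x by (simp add: H_def q_def)
  have [measurable]: "q \<in> borel_measurable borel" unfolding q_def[abs_def] by measurable
  have q0: "0 \<le> q x" for x by (simp add: q_def)
  have iq: "integrable lborel q"
    using integrable_mult_right[OF H_integrable, of "pi / 2"] by (simp add: Hq)
  define a where "a n = real (Suc n)" for n
  have a0: "0 < a n" for n by (simp add: a_def)
  \<comment> \<open>Substituting x = a u turns the Gaussian factor into the law \<open>N\<close>.
    Expressing q by \<open>psi_fourier\<close> and exchanging integrals leaves a Gaussian average of
    \<open>psi\<close> of width 1/a around \<xi>, once the evenness of \<open>psi\<close> has
    changed the sign of y.\<close>
  have step: "(\<integral>x. exp (- (x / a n)\<^sup>2 / 2) *\<^sub>R (q x * iexp (\<xi> * x)) \<partial>lborel) =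
     complex_of_real (pi / 2 * (\<integral>u. std_normal_density u * psi (\<xi> + u / a n) \<partial>lborel))" for n
  proof -
    interpret r: pair_sigma_finite lborel N by standard
    have qf: "complex_of_real (q x) = (\<integral>y. (psi y / 4) * iexp (x * y) \<partial>lborel)" for x
      using psi_fourier[of x] unfolding q_def by (simp add: field_simps)
    have iF: "integrable (lborel \<Otimes>\<^sub>M N) (\<lambda>(y, u). (psi y / 4) * iexp (a n * (y + \<xi>) * u))"
    proof (rule r.Fubini_integrable)
      show "integrable lborel (\<lambda>y. \<integral>u. norm (case (y, u) of (y, u) \<Rightarrow> (psi y / 4) * iexp (a n * (y + \<xi>) * u)) \<partial>N)"
        using psi_integrable psi_bounds N.prob_space by (simp add: norm_mult norm_divide)
      have "integrable N (\<lambda>u. iexp (c * u))" for c by (rule N.integrable_const_bound[of _ 1]) auto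
      from this[of "a n * (y + \<xi>)" for y]
      show "AE y in lborel. integrable N (\<lambda>u. case (y, u) of (y, u) \<Rightarrow> (psi y / 4) * iexp (a n * (y + \<xi>) * u))"
        by (intro AE_I2) (simp only: prod.case, intro integrable_mult_right)
    qed measurable
    have "(\<integral>x. exp (- (x / a n)\<^sup>2 / 2) *\<^sub>R (q x * iexp (\<xi> * x)) \<partial>lborel)
       = a n *\<^sub>R (\<integral>u. exp (- u\<^sup>2 / 2) *\<^sub>R (q (a n * u) * iexp (\<xi> * (a n * u))) \<partial>lborel)"
      using a0[of n] by (subst lborel_integral_real_affine[of "a n" _ 0]) auto
    also have "(\<integral>u. exp (- u\<^sup>2 / 2) *\<^sub>R (q (a n * u) * iexp (\<xi> * (a n * u))) \<partial>lborel)
       = sqrt (2 * pi) *\<^sub>R (\<integral>u. std_normal_density u *\<^sub>R (q (a n * u) * iexp (\<xi> * (a n * u))) \<partial>lborel)"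
      unfolding integral_scaleR_right[symmetric] by (simp add: std_normal_density_def)
    also have "(\<integral>u. std_normal_density u *\<^sub>R (q (a n * u) * iexp (\<xi> * (a n * u))) \<partial>lborel)
       = (\<integral>u. q (a n * u) * iexp (\<xi> * (a n * u)) \<partial>N)"
      by (rule integral_density[symmetric]) auto
    also have "\<dots> = (\<integral>u. (\<integral>y. (psi y / 4) * iexp (a n * (y + \<xi>) * u) \<partial>lborel) \<partial>N)"
    proof (intro Bochner_Integration.integral_cong refl)
      fix u
      have "(\<integral>y. (psi y / 4) * iexp (a n * (y + \<xi>) * u) \<partial>lborel) = (\<integral>y. ((psi y / 4) * iexp (a n * u * y)) * iexp (\<xi> * (a n * u)) \<partial>lborel)"
        by (intro Bochner_Integration.integral_cong refl) (simp add: exp_add[symmetric] algebra_simps)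
      also have "\<dots> = q (a n * u) * iexp (\<xi> * (a n * u))" unfolding qf by simp
      finally show "q (a n * u) * iexp (\<xi> * (a n * u)) = (\<integral>y. (psi y / 4) * iexp (a n * (y + \<xi>) * u) \<partial>lborel)" by simp
    qed
    also have "\<dots> = (\<integral>y. (\<integral>u. (psi y / 4) * iexp (a n * (y + \<xi>) * u) \<partial>N) \<partial>lborel)"
      using r.Fubini_integral[OF iF] by simp
    also have "\<dots> = (\<integral>y. complex_of_real (psi y / 4 * exp (- (a n * (y + \<xi>))\<^sup>2 / 2)) \<partial>lborel)"
      by (intro Bochner_Integration.integral_cong refl) (simp only: integral_mult_right_zero gauss_eq[symmetric] of_real_mult[symmetric])
    also have "\<dots> = complex_of_real (\<integral>y. psi y / 4 * exp (- (a n * (y + \<xi>))\<^sup>2 / 2) \<partial>lborel)"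
      by (rule integral_complex_of_real)
    also have "(\<integral>y. psi y / 4 * exp (- (a n * (y + \<xi>))\<^sup>2 / 2) \<partial>lborel) = 1/4 * (\<integral>y. psi y * exp (- (a n * (y + \<xi>))\<^sup>2 / 2) \<partial>lborel)"
      by simp
    also have "(\<integral>y. psi y * exp (- (a n * (y + \<xi>))\<^sup>2 / 2) \<partial>lborel) = (\<integral>y. psi y * exp (- (a n * (\<xi> - y))\<^sup>2 / 2) \<partial>lborel)"
      by (subst lborel_integral_real_affine[of "-1" _ 0]) (auto simp: psi_def)
    finally have "(\<integral>x. exp (- (x / a n)\<^sup>2 / 2) *\<^sub>R (q x * iexp (\<xi> * x)) \<partial>lborel) =
       complex_of_real (a n * (sqrt (2 * pi) * (1/4 * (\<integral>y. psi y * exp (- (a n * (\<xi> - y))\<^sup>2 / 2) \<partial>lborel))))"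
      by (simp add: scaleR_conv_of_real)
    also have "a n * (sqrt (2 * pi) * (1/4 * (\<integral>y. psi y * exp (- (a n * (\<xi> - y))\<^sup>2 / 2) \<partial>lborel)))
       = pi / 2 * (a n / sqrt (2 * pi) * (\<integral>y. psi y * exp (- (a n * (\<xi> - y))\<^sup>2 / 2) \<partial>lborel))"
    proof -
      have "sqrt (2 * pi) = 2 * pi / sqrt (2 * pi)" by (simp add: real_div_sqrt)
      thus ?thesis by (simp add: field_simps)
    qed
    finally show ?thesis unfolding gauss_scale[OF a0] .
  qed
  have l0: "(\<lambda>n. u / a n) \<longlonglongrightarrow> 0" for u
  proof -
    have "(\<lambda>n. u * inverse (real (Suc n))) \<longlonglongrightarrow> u * 0"
      by (intro tendsto_intros LIMSEQ_inverse_real_of_nat)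
    thus ?thesis by (simp add: a_def divide_inverse)
  qed
  have "(\<lambda>n. \<integral>x. exp (- (x / a n)\<^sup>2 / 2) *\<^sub>R (q x * iexp (\<xi> * x)) \<partial>lborel) \<longlonglongrightarrow> (\<integral>x. q x * iexp (\<xi> * x) \<partial>lborel)"
  proof (rule integral_dominated_convergence[where w = q])
    show "AE x in lborel. (\<lambda>n. exp (- (x / a n)\<^sup>2 / 2) *\<^sub>R (q x * iexp (\<xi> * x))) \<longlonglongrightarrow> q x * iexp (\<xi> * x)"
    proof (intro AE_I2)
      fix x :: real
      have "(\<lambda>n. exp (- (x / a n)\<^sup>2 / 2) *\<^sub>R (q x * iexp (\<xi> * x))) \<longlonglongrightarrow> exp (- 0\<^sup>2 / 2) *\<^sub>R (q x * iexp (\<xi> * x))"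
        by (intro tendsto_intros l0) auto
      thus "(\<lambda>n. exp (- (x / a n)\<^sup>2 / 2) *\<^sub>R (q x * iexp (\<xi> * x))) \<longlonglongrightarrow> q x * iexp (\<xi> * x)" by simp
    qed
    show "AE x in lborel. norm (exp (- (x / a n)\<^sup>2 / 2) *\<^sub>R (q x * iexp (\<xi> * x))) \<le> q x" for n
      using q0 by (intro AE_I2) (auto simp: norm_mult mult_left_le_one_le)
  qed (use iq in auto)
  moreover have "(\<lambda>n. complex_of_real (pi / 2 * (\<integral>u. std_normal_density u * psi (\<xi> + u / a n) \<partial>lborel))) \<longlonglongrightarrow> complex_of_real (pi / 2 * psi \<xi>)"
  proof (intro tendsto_of_real tendsto_mult tendsto_const)
    have "(\<lambda>n. \<integral>u. psi (\<xi> + u / a n) \<partial>N) \<longlonglongrightarrow> (\<integral>u. psi \<xi> \<partial>N)"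
    proof (rule integral_dominated_convergence[where w = "\<lambda>_. 1"])
      show "AE u in N. (\<lambda>n. psi (\<xi> + u / a n)) \<longlonglongrightarrow> psi \<xi>"
      proof (intro AE_I2)
        fix u :: real
        have "(\<lambda>n. \<xi> + u / a n) \<longlonglongrightarrow> \<xi> + 0" by (intro tendsto_intros l0)
        moreover have "isCont psi \<xi>" using psi_continuous by (simp add: continuous_on_eq_continuous_at)
        ultimately show "(\<lambda>n. psi (\<xi> + u / a n)) \<longlonglongrightarrow> psi \<xi>" by (intro isCont_tendsto_compose[of _ psi]) auto
      qed
    qed (use psi_bounds in auto)
    moreover have "(\<integral>u. psi (\<xi> + u / a n) \<partial>N) = (\<integral>u. std_normal_density u * psi (\<xi> + u / a n) \<partial>lborel)" for n
      by (subst integral_density) auto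
    ultimately show "(\<lambda>n. \<integral>u. std_normal_density u * psi (\<xi> + u / a n) \<partial>lborel) \<longlonglongrightarrow> psi \<xi>"
      using N.prob_space by simp
  qed
  ultimately have h1: "(\<integral>x. q x * iexp (\<xi> * x) \<partial>lborel) = complex_of_real (pi / 2 * psi \<xi>)"
    unfolding step by (rule LIMSEQ_unique)
  have h2: "(\<integral>x. H x * iexp (\<xi> * x) \<partial>lborel) = complex_of_real (2 / pi) * (\<integral>x. q x * iexp (\<xi> * x) \<partial>lborel)"
    unfolding integral_mult_right_zero[symmetric] Hq by (simp add: mult.assoc)
  show ?thesis unfolding h2 h1 of_real_mult[symmetric] by simp
qed

lemma H_integral: "(\<integral>x. H x \<partial>lborel) = 1"
  using H_fourier[of 0] by (simp add: psi_def)

text \<open>x^2 H = (2/pi) / (1 + x^2) - H, and the integral of 1 / (1 + x^2) is pi, so the value is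
  2 - 1.\<close>

lemma H_second_moment: "(\<integral>x. H x * x\<^sup>2 \<partial>lborel) = 1"
proof -
  define r where "r x = 1 / (1 + x\<^sup>2)" for x :: real
  have a: "integrable lborel r" "(\<integral>x. r x \<partial>lborel) = 2 * (pi / 2 - arctan 0)"
    unfolding r_def[abs_def] by (rule even_integral_FTC[where F = arctan and T = "pi / 2"];
        auto intro!: derivative_eq_intros tendsto_arctan_at_top simp: inverse_eq_divide)+
  have e: "H x * x\<^sup>2 = 2 / pi * r x - H x" for x
  proof -
    have p: "1 + x\<^sup>2 \<noteq> 0" using zero_le_power2[of x] by linarith
    have "2 / pi * (1 / P) = 2 / (pi * P\<^sup>2) * P" if "P \<noteq> 0" for P :: real
      using that by (simp add: power2_eq_square)
    from this[OF p] have "2 / pi * (1 / (1 + x\<^sup>2)) = H x * (1 + x\<^sup>2)" unfolding H_def .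
    thus ?thesis by (simp add: algebra_simps r_def)
  qed
  show ?thesis unfolding e using a H_integrable H_integral by simp
qed

lemma H_mean: "(\<integral>x. H x * x \<partial>lborel) = 0"
  using lborel_integral_real_affine[of "-1" "\<lambda>x. H x * x" 0] by (simp add: H_def)

abbreviation "Hm \<equiv> density lborel H"

interpretation Hm: real_distribution Hm
proof -
  have "emeasure Hm (space Hm) = (\<integral>\<^sup>+x. ennreal (H x) \<partial>lborel)" by (simp add: emeasure_density)
  also have "\<dots> = 1" using nn_integral_eq_integral[OF H_integrable] H_bounds H_integral by simp
  finally have "prob_space Hm" by (rule prob_spaceI)
  thus "real_distribution Hm" by (simp add: real_distribution_def real_distribution_axioms_def)
qed

lemma char_Hm: "char Hm \<xi> = psi \<xi>"
  unfolding char_def using H_fourier[of \<xi>] by (subst integral_density) (auto simp: H_bounds scaleR_conv_of_real)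

lemma Hm_moments: "q < 3 \<Longrightarrow> integrable Hm (\<lambda>x. (1 + \<bar>x\<bar>) powr q)"
  using integrable_H_weight by (subst integrable_density) (auto simp: H_bounds)

lemma Hm_diff_sq: "integrable (Hm \<Otimes>\<^sub>M Hm) (\<lambda>(x, y). (x - y)\<^sup>2)" "(\<integral>(x, y). (x - y)\<^sup>2 \<partial>(Hm \<Otimes>\<^sub>M Hm)) = 2"
proof -
  have i1: "integrable Hm (\<lambda>x. x)" by (rule Hm.integrable_dom(1)[OF Hm_moments[of 1], of _ 1]) auto
  have i2: "integrable Hm (\<lambda>x. x\<^sup>2)"
  proof (rule Hm.integrable_dom(1)[OF Hm_moments[of 2], of _ 1])
    show "norm (x\<^sup>2) \<le> 1 * (1 + \<bar>x\<bar>) powr 2" for x :: real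
      using power_mono[of "\<bar>x\<bar>" "1 + \<bar>x\<bar>" 2] by simp
  qed auto
  have v: "(\<integral>x. x \<partial>Hm) = 0" "(\<integral>x. x\<^sup>2 \<partial>Hm) = 1"
    using H_mean H_second_moment by (subst integral_density; auto simp: H_bounds)+
  show "integrable (Hm \<Otimes>\<^sub>M Hm) (\<lambda>(x, y). (x - y)\<^sup>2)"
  proof (rule Hm.integrable_prod_dom(1)[OF _ Hm_moments[of 2], of _ 1])
    fix x y :: real
    have "\<bar>x - y\<bar>\<^sup>2 \<le> (1 + \<bar>x\<bar> + \<bar>y\<bar>)\<^sup>2" by (intro power_mono) auto
    thus "norm (case (x, y) of (x, y) \<Rightarrow> (x - y)\<^sup>2) \<le> 1 * (1 + \<bar>x\<bar> + \<bar>y\<bar>) powr 2" by simp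
  qed auto
  have "(\<integral>(x, y). (x - y)\<^sup>2 \<partial>(Hm \<Otimes>\<^sub>M Hm)) =
     (\<integral>z. (case z of (x, y) \<Rightarrow> x\<^sup>2) + (case z of (x, y) \<Rightarrow> y\<^sup>2) - 2 * (case z of (x, y) \<Rightarrow> x * y) \<partial>(Hm \<Otimes>\<^sub>M Hm))"
    by (rule arg_cong[where f="integral\<^sup>L _"]) (auto simp: power2_diff fun_eq_iff)
  also have "\<dots> = 1 + 1 - 2 * (0 * 0)"
    using Hm.integrable_prod_fst[OF i2] Hm.integrable_prod_snd[OF i2] Hm.integrable_prod_mult[OF i1 i1]
    by (simp add: Hm.integral_prod_fst[OF i2] Hm.integral_prod_snd[OF i2] Hm.integral_prod_mult[OF i1 i1] v)
  finally show "(\<integral>(x, y). (x - y)\<^sup>2 \<partial>(Hm \<Otimes>\<^sub>M Hm)) = 2" by simp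
qed

section \<open>Convergence of the profiles\<close>

definition sq_ln :: "real \<Rightarrow> real" where "sq_ln d = d\<^sup>2 * ln \<bar>d\<bar>"

lemma sq_ln_measurable [measurable]: "sq_ln \<in> borel_measurable borel"
  unfolding sq_ln_def[abs_def] by measurable

lemma sq_ln_lower: "(d\<^sup>2 - 1) / 2 \<le> sq_ln d"
proof (cases "d = 0")
  case False
  have "d\<^sup>2 * ln (d\<^sup>2) \<ge> d\<^sup>2 - 1"
    using ln_le_minus_one[of "1 / d\<^sup>2"] False by (simp add: ln_div field_simps)
  moreover have "ln (d\<^sup>2) = 2 * ln \<bar>d\<bar>" using ln_realpow[of "\<bar>d\<bar>" 2] False by simp
  ultimately show ?thesis by (simp add: sq_ln_def)
qed (simp add: sq_ln_def)

lemma sq_ln_nonpos: "\<bar>d\<bar> \<le> 1 \<Longrightarrow> sq_ln d \<le> 0"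
  unfolding sq_ln_def by (cases "d = 0") (auto intro!: mult_nonneg_nonpos)

lemma sq_ln_large:
  assumes "1 \<le> \<bar>d\<bar>" shows "0 \<le> sq_ln d" "sq_ln d \<le> 2 * \<bar>d\<bar> powr (5/2)"
proof -
  show "0 \<le> sq_ln d" using assms by (simp add: sq_ln_def)
  have "ln (sqrt \<bar>d\<bar>) \<le> sqrt \<bar>d\<bar>" using ln_le_minus_one[of "sqrt \<bar>d\<bar>"] assms by fastforce
  hence "ln \<bar>d\<bar> \<le> 2 * sqrt \<bar>d\<bar>" using assms by (simp add: ln_sqrt)
  hence "sq_ln d \<le> d\<^sup>2 * (2 * sqrt \<bar>d\<bar>)" unfolding sq_ln_def by (intro mult_left_mono) auto
  also have "\<dots> = 2 * \<bar>d\<bar> powr (5/2)" using powr_add[of "\<bar>d\<bar>" 2 "1/2"] by (simp add: powr_half_sqrt)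
  finally show "sq_ln d \<le> 2 * \<bar>d\<bar> powr (5/2)" .
qed

lemma sq_ln_abs_le: "\<bar>sq_ln d\<bar> \<le> 2 * (1 + \<bar>d\<bar>) powr (5/2)"
proof (cases "\<bar>d\<bar> \<le> 1")
  case True
  have "1 \<le> (1 + \<bar>d\<bar>) powr (5/2)" by (intro ge_one_powr_ge_zero) auto
  moreover have "\<bar>f\<bar> \<le> 2 * W" if "1 \<le> W" "f \<le> 0" "(q - 1) / 2 \<le> f" "0 \<le> q" for f W q :: real
    using that by argo
  ultimately show ?thesis using sq_ln_nonpos[OF True] sq_ln_lower[of d] zero_le_power2[of d] by blast
next
  case False
  have "\<bar>d\<bar> powr (5/2) \<le> (1 + \<bar>d\<bar>) powr (5/2)" by (intro powr_mono2) auto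
  thus ?thesis using sq_ln_large[of d] False by simp
qed

lemma d_ln_bound: "\<bar>d\<bar> \<le> 1 \<Longrightarrow> \<bar>d * ln \<bar>d\<bar>\<bar> \<le> 1" for d :: real
proof (cases "d = 0")
  case False
  assume d: "\<bar>d\<bar> \<le> 1"
  have "\<bar>d\<bar> * ln \<bar>d\<bar> \<ge> \<bar>d\<bar> - 1"
    using ln_le_minus_one[of "1 / \<bar>d\<bar>"] False by (simp add: ln_div field_simps)
  moreover have "\<bar>d\<bar> * ln \<bar>d\<bar> \<le> 0" using d False by (intro mult_nonneg_nonpos) auto
  ultimately have "\<bar>\<bar>d\<bar> * ln \<bar>d\<bar>\<bar> \<le> 1" by linarith
  moreover have "\<bar>\<bar>d\<bar> * ln \<bar>d\<bar>\<bar> = \<bar>d * ln \<bar>d\<bar>\<bar>" by (simp add: abs_mult)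
  ultimately show ?thesis by metis
qed simp

lemma sq_ln_continuous: "isCont sq_ln d"
proof (cases "d = 0")
  case False
  thus ?thesis unfolding sq_ln_def[abs_def] by (intro continuous_intros) auto
next
  case True
  have "(sq_ln \<longlongrightarrow> 0) (at 0)"
  proof (rule Lim_null_comparison)
    have "eventually (\<lambda>x::real. \<bar>x\<bar> \<le> 1) (at 0)"
      using eventually_at_ball[of 1 "0::real" UNIV] by (auto elim!: eventually_mono simp: dist_real_def)
    thus "eventually (\<lambda>x. norm (sq_ln x) \<le> \<bar>x\<bar>) (at 0)"
    proof eventually_elim
      case (elim x)
      have "\<bar>sq_ln x\<bar> = \<bar>x\<bar> * \<bar>x * ln \<bar>x\<bar>\<bar>" by (simp add: sq_ln_def power2_eq_square abs_mult)
      also have "\<dots> \<le> \<bar>x\<bar> * 1" using d_ln_bound[OF elim] by (intro mult_left_mono) auto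
      finally show ?case by simp
    qed
    show "((\<lambda>x::real. \<bar>x\<bar>) \<longlongrightarrow> 0) (at 0)" by (auto intro!: tendsto_eq_intros)
  qed
  thus ?thesis using True by (simp add: isCont_def sq_ln_def)
qed

lemma exp_second_order: "\<bar>exp u - 1 - u\<bar> \<le> u\<^sup>2 * max 1 (exp u)" for u :: real
proof -
  have 1: "0 \<le> exp u - 1 - u" using exp_ge_add_one_self[of u] by linarith
  have "exp u * (1 - u) \<le> exp u * exp (- u)" using exp_ge_add_one_self[of "-u"] by (intro mult_left_mono) auto
  hence 2: "exp u - 1 \<le> u * exp u" by (simp add: exp_minus algebra_simps)
  have "exp u - 1 - u \<le> u\<^sup>2 * max 1 (exp u)"
  proof (cases "0 \<le> u")
    case True
    have "u * (exp u - 1) \<le> u * (u * exp u)" using 2 True by (intro mult_left_mono) auto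
    also have "\<dots> = u\<^sup>2 * exp u" by (simp add: power2_eq_square)
    also have "\<dots> \<le> u\<^sup>2 * max 1 (exp u)" by (intro mult_left_mono) auto
    finally show ?thesis using 2 by (simp add: algebra_simps)
  next
    case False
    have "1 - exp u \<le> - u" using exp_ge_add_one_self[of u] by linarith
    hence "- u * (1 - exp u) \<le> - u * (- u)" using False by (intro mult_left_mono) auto
    also have "\<dots> = u\<^sup>2 * 1" by (simp add: power2_eq_square)
    also have "\<dots> \<le> u\<^sup>2 * max 1 (exp u)" by (intro mult_left_mono) auto
    finally show ?thesis using 2 by (simp add: algebra_simps)
  qed
  thus ?thesis using 1 by simp
qed

text \<open>With l = ln |d| one has |d|^(2+\<gamma>) = d^2 e^(\<gamma> l), and the second-order
  remainder of the exponential leaves \<gamma> (d l)^2 max 1 (|d|^\<gamma>). For |d| \<le> 1 the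
  product d l is bounded by 1. For |d| > 1, l \<le> 8 |d|^(1/8) gives l^2 \<le> 64 |d|^(1/4), and
  the order 9/4 + \<gamma> stays below 11/4.\<close>

lemma sq_ln_difference_quotient:
  assumes g: "0 < \<gamma>" "\<gamma> \<le> 1/500"
  shows "\<bar>(\<bar>d\<bar> powr (2 + \<gamma>) - d\<^sup>2) / \<gamma> - sq_ln d\<bar> \<le> 64 * \<gamma> * (1 + \<bar>d\<bar>) powr (11/4)"
proof (cases "d = 0")
  case True
  thus ?thesis using g by (simp add: sq_ln_def)
next
  case False
  define l where "l = ln \<bar>d\<bar>"
  have e: "\<bar>d\<bar> powr \<gamma> = exp (\<gamma> * l)" using False by (simp add: powr_def l_def)
  have "(\<bar>d\<bar> powr (2 + \<gamma>) - d\<^sup>2) / \<gamma> - sq_ln d = d\<^sup>2 / \<gamma> * (exp (\<gamma> * l) - 1 - \<gamma> * l)"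
    using g by (simp add: powr_add e sq_ln_def l_def field_simps)
  hence "\<bar>(\<bar>d\<bar> powr (2 + \<gamma>) - d\<^sup>2) / \<gamma> - sq_ln d\<bar> = d\<^sup>2 / \<gamma> * \<bar>exp (\<gamma> * l) - 1 - \<gamma> * l\<bar>"
    using g by (simp add: abs_mult)
  also have "\<dots> \<le> d\<^sup>2 / \<gamma> * ((\<gamma> * l)\<^sup>2 * max 1 (exp (\<gamma> * l)))"
    using g by (intro mult_left_mono exp_second_order) auto
  also have "\<dots> = \<gamma> * ((d * l)\<^sup>2 * max 1 (\<bar>d\<bar> powr \<gamma>))" using g by (simp add: e power2_eq_square)
  also have "(d * l)\<^sup>2 * max 1 (\<bar>d\<bar> powr \<gamma>) \<le> 64 * (1 + \<bar>d\<bar>) powr (11/4)"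
  proof (cases "\<bar>d\<bar> \<le> 1")
    case True
    have "(d * l)\<^sup>2 \<le> 1" using d_ln_bound[OF True] by (simp add: abs_square_le_1 l_def)
    moreover have "\<bar>d\<bar> powr \<gamma> \<le> 1" using True g by (intro powr_le1) auto
    moreover have "1 \<le> (1 + \<bar>d\<bar>) powr (11/4)" by (intro ge_one_powr_ge_zero) auto
    ultimately show ?thesis by (simp add: max_def)
  next
    case d: False
    have l0: "0 \<le> l" using d by (simp add: l_def)
    have "ln (\<bar>d\<bar> powr (1/8)) \<le> \<bar>d\<bar> powr (1/8)" using ln_le_minus_one[of "\<bar>d\<bar> powr (1/8)"] d by fastforce
    hence "l \<le> 8 * \<bar>d\<bar> powr (1/8)" using d by (simp add: l_def ln_powr)
    hence "l\<^sup>2 \<le> (8 * \<bar>d\<bar> powr (1/8))\<^sup>2" using l0 by (intro power_mono) auto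
    also have "\<dots> = 64 * \<bar>d\<bar> powr (1/4)"
      using powr_add[of "\<bar>d\<bar>" "1/8" "1/8"] by (simp add: power_mult_distrib power2_eq_square)
    finally have l2: "l\<^sup>2 \<le> 64 * \<bar>d\<bar> powr (1/4)" .
    have "1 \<le> \<bar>d\<bar> powr \<gamma>" using d g by (intro ge_one_powr_ge_zero) auto
    hence "(d * l)\<^sup>2 * max 1 (\<bar>d\<bar> powr \<gamma>) = d\<^sup>2 * l\<^sup>2 * \<bar>d\<bar> powr \<gamma>" by (simp add: max_def power_mult_distrib)
    also have "\<dots> \<le> d\<^sup>2 * (64 * \<bar>d\<bar> powr (1/4)) * \<bar>d\<bar> powr \<gamma>" using l2 by (intro mult_right_mono mult_left_mono) auto
    also have "\<dots> = 64 * \<bar>d\<bar> powr (9/4 + \<gamma>)"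
      using powr_add[of "\<bar>d\<bar>" 2 "1/4"] by (simp add: powr_add)
    also have "\<dots> \<le> 64 * \<bar>d\<bar> powr (11/4)" using d g by (intro mult_left_mono powr_mono) auto
    also have "\<dots> \<le> 64 * (1 + \<bar>d\<bar>) powr (11/4)" by (intro mult_left_mono powr_mono2) auto
    finally show ?thesis .
  qed
  hence "\<gamma> * ((d * l)\<^sup>2 * max 1 (\<bar>d\<bar> powr \<gamma>)) \<le> \<gamma> * (64 * (1 + \<bar>d\<bar>) powr (11/4))" using g by (intro mult_left_mono) auto
  finally show ?thesis by (simp add: mult_ac)
qed

definition clip :: "real \<Rightarrow> real \<Rightarrow> real" where "clip k d = max (- k) (min k d)"

lemma clip_measurable [measurable]: "clip k \<in> borel_measurable borel"
  unfolding clip_def[abs_def] by measurable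

text \<open>Uniform integrability: beyond k the function grows at most like |d|^(5/2), which is
  |d|^(-1/4) \<le> k^(-1/4) times the weight of order 11/4. The clipped function is bounded and
  continuous, as weak convergence demands.\<close>

lemma sq_ln_clip:
  assumes k: "1 \<le> k"
  shows "\<bar>sq_ln d - sq_ln (clip k d)\<bar> \<le> 2 * k powr (- (1/4)) * (1 + \<bar>d\<bar>) powr (11/4)"
proof (cases "\<bar>d\<bar> \<le> k")
  case True
  hence "clip k d = d" by (auto simp: clip_def)
  thus ?thesis by simp
next
  case False
  have "clip k d = k \<or> clip k d = - k" using False k by (auto simp: clip_def)
  moreover have "sq_ln (- k) = sq_ln k" by (simp add: sq_ln_def)
  ultimately have c: "sq_ln (clip k d) = sq_ln k" by metis
  have "sq_ln k \<le> sq_ln d"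
  proof -
    have "k\<^sup>2 \<le> d\<^sup>2" using power_mono[of k "\<bar>d\<bar>" 2] False k by simp
    thus ?thesis unfolding sq_ln_def using False k by (intro mult_mono) auto
  qed
  hence "\<bar>sq_ln d - sq_ln (clip k d)\<bar> \<le> sq_ln d" using sq_ln_large(1)[of k] k unfolding c by simp
  also have "\<dots> \<le> 2 * \<bar>d\<bar> powr (5/2)" using sq_ln_large(2)[of d] False k by simp
  also have "\<dots> = 2 * (\<bar>d\<bar> powr (- (1/4)) * \<bar>d\<bar> powr (11/4))" using powr_add[of "\<bar>d\<bar>" "- (1/4)" "11/4"] by simp
  also have "\<dots> \<le> 2 * (k powr (- (1/4)) * (1 + \<bar>d\<bar>) powr (11/4))"
    using False k by (intro mult_left_mono mult_mono powr_mono2' powr_mono2) auto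
  finally show ?thesis by (simp add: mult.assoc)
qed

lemma weight_diff_le:
  fixes x y q :: real
  assumes "0 \<le> q" shows "(1 + \<bar>x - y\<bar>) powr q \<le> (1 + \<bar>x\<bar> + \<bar>y\<bar>) powr q"
  using assms abs_triangle_ineq4[of x y] by (intro powr_mono2) auto

section \<open>Logarithmic energy\<close>

context real_distribution
begin

definition log_energy :: real where "log_energy = (\<integral>(x, y). sq_ln (x - y) \<partial>(M \<Otimes>\<^sub>M M))"

text \<open>Turns a double integral of a function of x - y into a single one. Continuity theorems on
  the line then apply, since the characteristic function is the squared modulus of the original
  one.\<close>

definition difference_law :: "real measure" where "difference_law = distr (M \<Otimes>\<^sub>M M) borel (\<lambda>(x, y). x - y)"

lemma difference_law_distribution: "real_distribution difference_law"
proof -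
  have "prob_space difference_law" unfolding difference_law_def by (rule pp.prob_space_distr) measurable
  thus ?thesis by (simp add: real_distribution_def real_distribution_axioms_def difference_law_def)
qed

lemma integral_difference_law:
  fixes h :: "real \<Rightarrow> 'b::{banach, second_countable_topology}"
  assumes "h \<in> borel_measurable borel"
  shows "(\<integral>d. h d \<partial>difference_law) = (\<integral>(x, y). h (x - y) \<partial>(M \<Otimes>\<^sub>M M))"
  unfolding difference_law_def using assms by (subst integral_distr) (auto simp: split_beta')

lemma char_difference_law: "char difference_law t = complex_of_real ((cmod (char M t))\<^sup>2)"
proof -
  have i: "integrable (M \<Otimes>\<^sub>M M) (\<lambda>(x, y). iexp (t * x) * iexp (- t * y))"
    by (rule pp.integrable_const_bound[of _ 1]) (auto simp: norm_mult)
  have "char difference_law t = (\<integral>(x, y). iexp (t * (x - y)) \<partial>(M \<Otimes>\<^sub>M M))"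
    unfolding char_def by (rule integral_difference_law) auto
  also have "\<dots> = (\<integral>(x, y). iexp (t * x) * iexp (- t * y) \<partial>(M \<Otimes>\<^sub>M M))"
    by (intro Bochner_Integration.integral_cong refl) (auto simp: exp_add[symmetric] algebra_simps)
  also have "\<dots> = (\<integral>x. iexp (t * x) * (\<integral>y. iexp (- t * y) \<partial>M) \<partial>M)"
    unfolding pp.integral_fst'[OF i, symmetric] by simp
  also have "\<dots> = char M t * char M (- t)" unfolding char_def by simp
  finally show ?thesis unfolding char_uminus complex_norm_square .
qed

lemma log_energy_clip:
  assumes k: "1 \<le> k" and int: "integrable M (\<lambda>x. (1 + \<bar>x\<bar>) powr (11/4))"
  shows "\<bar>log_energy - (\<integral>d. sq_ln (clip k d) \<partial>difference_law)\<bar> \<le> 2 * k powr (- (1/4)) * (weighted_moment (11/4))\<^sup>2"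
proof -
  have i1: "integrable (M \<Otimes>\<^sub>M M) (\<lambda>(x, y). sq_ln (x - y))"
  proof (rule integrable_prod_dom(1)[OF _ int, of _ 2])
    fix x y :: real
    have "(1 + \<bar>x - y\<bar>) powr (5/2) \<le> (1 + \<bar>x - y\<bar>) powr (11/4)" by (intro powr_mono) auto
    thus "norm (case (x, y) of (x, y) \<Rightarrow> sq_ln (x - y)) \<le> 2 * (1 + \<bar>x\<bar> + \<bar>y\<bar>) powr (11/4)"
      using sq_ln_abs_le[of "x - y"] weight_diff_le[of "11/4" x y] by simp
  qed auto
  have i2: "integrable (M \<Otimes>\<^sub>M M) (\<lambda>(x, y). sq_ln (clip k (x - y)))"
  proof (rule pp.integrable_const_bound[of _ "2 * (1 + k) powr (5/2)"])
    have "\<bar>sq_ln (clip k d)\<bar> \<le> 2 * (1 + k) powr (5/2)" for d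
    proof -
      have "(1 + \<bar>clip k d\<bar>) powr (5/2) \<le> (1 + k) powr (5/2)" using k by (intro powr_mono2) (auto simp: clip_def)
      thus ?thesis using sq_ln_abs_le[of "clip k d"] by simp
    qed
    thus "AE z in M \<Otimes>\<^sub>M M. norm (case z of (x, y) \<Rightarrow> sq_ln (clip k (x - y))) \<le> 2 * (1 + k) powr (5/2)" by (auto intro!: AE_I2)
  qed measurable
  define F1 F2 where F: "F1 = (\<lambda>(x, y). sq_ln (x - y))" "F2 = (\<lambda>(x, y). sq_ln (clip k (x - y)))"
  note iF = i1[folded F(1)] i2[folded F(2)]
  have "(\<integral>d. sq_ln (clip k d) \<partial>difference_law) = (\<integral>z. F2 z \<partial>(M \<Otimes>\<^sub>M M))" unfolding F by (rule integral_difference_law) measurable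
  hence "log_energy - (\<integral>d. sq_ln (clip k d) \<partial>difference_law) = (\<integral>z. F1 z - F2 z \<partial>(M \<Otimes>\<^sub>M M))"
    unfolding log_energy_def F(1)[symmetric] using iF by simp
  also have "norm \<dots> \<le> (\<integral>z. norm (F1 z - F2 z) \<partial>(M \<Otimes>\<^sub>M M))" by (rule integral_norm_bound)
  also have "\<dots> \<le> 2 * k powr (- (1/4)) * (weighted_moment (11/4))\<^sup>2"
  proof (rule integral_prod_dom[OF _ int])
    fix x y :: real
    have "2 * k powr (- (1/4)) * (1 + \<bar>x - y\<bar>) powr (11/4) \<le> 2 * k powr (- (1/4)) * (1 + \<bar>x\<bar> + \<bar>y\<bar>) powr (11/4)"
      by (intro mult_left_mono weight_diff_le) auto
    thus "norm (F1 (x, y) - F2 (x, y)) \<le> 2 * k powr (- (1/4)) * (1 + \<bar>x\<bar> + \<bar>y\<bar>) powr (11/4)"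
      using sq_ln_clip[OF k, of "x - y"] by (simp add: F)
  qed (use iF in auto)
  finally show ?thesis by simp
qed

end

context small_profile
begin

text \<open>By the energy identity 1/s is half of E|x - y|^(2+\<gamma>), and E(x - y)^2 = 2, so the
  left quotient is half the mean of the difference quotient in
  \<open>sq_ln_difference_quotient\<close>.\<close>

lemma energy_expansion: "\<bar>(1 / s - 1) / \<gamma> - log_energy / 2\<bar> \<le> 32 * \<gamma> * K\<^sup>2"
proof -
  define P where "P = (\<integral>(x, y). \<bar>x - y\<bar> powr (2 + \<gamma>) \<partial>(M \<Otimes>\<^sub>M M))"
  have iP: "integrable (M \<Otimes>\<^sub>M M) (\<lambda>(x, y). \<bar>x - y\<bar> powr (2 + \<gamma>))"
    using integrable_diff_powr[of "2 + \<gamma>"] gamma_pos gamma_less by simp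
  have sP: "s * P = 2" using energy_identity by (simp add: P_def)
  hence s2: "1 / s = P / 2" using s_pos by (simp add: field_simps)
  have e: "(1 / s - 1) / \<gamma> = (P - 2) / \<gamma> / 2" unfolding s2 by (simp add: diff_divide_distrib)
  have ifD: "integrable (M \<Otimes>\<^sub>M M) (\<lambda>(x, y). sq_ln (x - y))"
  proof (rule integrable_prod_dom(1)[OF _ moments[of "5/2"], of _ 2])
    fix x y :: real
    show "norm (case (x, y) of (x, y) \<Rightarrow> sq_ln (x - y)) \<le> 2 * (1 + \<bar>x\<bar> + \<bar>y\<bar>) powr (5/2)"
      using sq_ln_abs_le[of "x - y"] weight_diff_le[of "5/2" x y] by simp
  qed auto
  define F1 F2 F3 where F: "F1 = (\<lambda>(x, y). \<bar>x - y\<bar> powr (2 + \<gamma>))" "F2 = (\<lambda>(x, y). (x - y :: real)\<^sup>2)" "F3 = (\<lambda>(x, y). sq_ln (x - y))"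
  define Q where "Q z = (F1 z - F2 z) / \<gamma> - F3 z" for z
  note iF = iP[folded F(1)] integrable_diff_sq[folded F(2)] ifD[folded F(3)]
  have iQ: "integrable (M \<Otimes>\<^sub>M M) Q" unfolding Q_def[abs_def] using iF by simp
  have "(P - 2) / \<gamma> - log_energy = (\<integral>z. Q z \<partial>(M \<Otimes>\<^sub>M M))"
    unfolding Q_def log_energy_def P_def F[symmetric] using iF integral_diff_sq[folded F(2)] by simp
  also have "norm \<dots> \<le> (\<integral>z. norm (Q z) \<partial>(M \<Otimes>\<^sub>M M))" by (rule integral_norm_bound)
  also have "\<dots> \<le> 64 * \<gamma> * (weighted_moment (11/4))\<^sup>2"
  proof (rule integral_prod_dom[OF _ moments])
    fix x y :: real
    have "64 * \<gamma> * (1 + \<bar>x - y\<bar>) powr (11/4) \<le> 64 * \<gamma> * (1 + \<bar>x\<bar> + \<bar>y\<bar>) powr (11/4)"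
      using gamma_pos by (intro mult_left_mono weight_diff_le) auto
    thus "norm (Q (x, y)) \<le> 64 * \<gamma> * (1 + \<bar>x\<bar> + \<bar>y\<bar>) powr (11/4)"
      using sq_ln_difference_quotient[OF gamma_pos gamma_small, of "x - y"] by (simp add: Q_def F)
  qed (use iQ in auto)
  also have "\<dots> \<le> 64 * \<gamma> * K\<^sup>2" using weighted_moment_11_4 weighted_moment_nonneg gamma_pos by (intro mult_left_mono power_mono) auto
  finally have "\<bar>(P - 2) / \<gamma> - log_energy\<bar> \<le> 64 * \<gamma> * K\<^sup>2" by simp
  thus ?thesis unfolding e by (simp add: abs_le_iff)
qed

end

lemma I0_eq: "I0 H H = Hm.log_energy"
proof -
  have sym: "sq_ln (x - y) = sq_ln (y - x)" for x y by (simp add: sq_ln_def power2_commute abs_minus_commute)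
  have i: "integrable (Hm \<Otimes>\<^sub>M Hm) (\<lambda>(x, y). sq_ln (x - y))"
  proof (rule Hm.integrable_prod_dom(1)[OF _ Hm_moments[of "5/2"], of _ 2])
    fix x y :: real
    show "norm (case (x, y) of (x, y) \<Rightarrow> sq_ln (x - y)) \<le> 2 * (1 + \<bar>x\<bar> + \<bar>y\<bar>) powr (5/2)"
      using sq_ln_abs_le[of "x - y"] weight_diff_le[of "5/2" x y] by simp
  qed auto
  have inner: "(LINT x|lebesgue. H x * H y * \<bar>x - y\<bar>\<^sup>2 * ln \<bar>x - y\<bar>) = H y * (\<integral>x. sq_ln (y - x) \<partial>Hm)" for y
  proof -
    have "(LINT x|lebesgue. H x * H y * \<bar>x - y\<bar>\<^sup>2 * ln \<bar>x - y\<bar>) = (LINT x|lborel. H x * H y * \<bar>x - y\<bar>\<^sup>2 * ln \<bar>x - y\<bar>)"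
      by (rule integral_completion) measurable
    also have "\<dots> = (LINT x|lborel. H y * (H x * sq_ln (y - x)))"
      by (intro Bochner_Integration.integral_cong refl) (simp add: sq_ln_def power2_commute abs_minus_commute mult_ac)
    also have "\<dots> = H y * (\<integral>x. sq_ln (y - x) \<partial>Hm)" by (subst integral_density) (auto simp: H_bounds)
    finally show ?thesis .
  qed
  have m: "(\<lambda>y. \<integral>x. sq_ln (y - x) \<partial>Hm) \<in> borel_measurable borel"
    by (rule Hm.borel_measurable_lebesgue_integral) measurable
  have "I0 H H = (LINT y|lborel. H y * (\<integral>x. sq_ln (y - x) \<partial>Hm))"
    unfolding I0_def inner by (rule integral_completion) (use m in measurable)
  also have "\<dots> = (\<integral>y. (\<integral>x. sq_ln (y - x) \<partial>Hm) \<partial>Hm)"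
    by (rule integral_real_density[symmetric]) (use m in \<open>auto simp: H_bounds\<close>)
  also have "\<dots> = Hm.log_energy" unfolding Hm.log_energy_def using Hm.pp.integral_fst'[OF i] by simp
  finally show ?thesis .
qed

lemma I0_pos: "0 < I0 H H"
proof -
  have i: "integrable (Hm \<Otimes>\<^sub>M Hm) (\<lambda>(x, y). sq_ln (x - y))"
  proof (rule Hm.integrable_prod_dom(1)[OF _ Hm_moments[of "5/2"], of _ 2])
    fix x y :: real
    show "norm (case (x, y) of (x, y) \<Rightarrow> sq_ln (x - y)) \<le> 2 * (1 + \<bar>x\<bar> + \<bar>y\<bar>) powr (5/2)"
      using sq_ln_abs_le[of "x - y"] weight_diff_le[of "5/2" x y] by simp
  qed auto
  have "(\<integral>z. ((case z of (x, y) \<Rightarrow> (x - y)\<^sup>2) - 1) / 2 \<partial>(Hm \<Otimes>\<^sub>M Hm)) \<le> Hm.log_energy"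
    unfolding Hm.log_energy_def using Hm_diff_sq(1) i
  proof (intro integral_mono)
    fix z :: "real \<times> real"
    show "((case z of (x, y) \<Rightarrow> (x - y)\<^sup>2) - 1) / 2 \<le> (case z of (x, y) \<Rightarrow> sq_ln (x - y))"
      by (cases z) (simp only: prod.case sq_ln_lower)
  qed auto
  also have "(\<integral>z. ((case z of (x, y) \<Rightarrow> (x - y)\<^sup>2) - 1) / 2 \<partial>(Hm \<Otimes>\<^sub>M Hm)) = 1/2"
    using Hm_diff_sq Hm.pp.prob_space by simp
  finally show ?thesis unfolding I0_eq by simp
qed

text \<open>\<open>Phi_close\<close> is locally uniform, so the argument may vary with n. This
  absorbs the converging scale factors in \<open>profile_weak_limit\<close>.\<close>

lemma profile_char_limit:
  assumes p: "\<And>n. profile (M n) (s n) (\<gamma> n)" and small: "\<And>n. \<gamma> n \<le> 1/500" and lim: "\<gamma> \<longlonglongrightarrow> 0"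
    and t: "t \<longlonglongrightarrow> (\<tau>::real)"
  shows "(\<lambda>n. char (M n) (t n)) \<longlonglongrightarrow> complex_of_real (psi \<tau>)"
proof -
  define k :: real where "k = 6404"
  have close: "cmod (char (M n) (t n) - psi (t n)) \<le> 378 * k ^ 3 * \<gamma> n * \<bar>t n\<bar> powr (5/2)" for n
  proof -
    interpret profile "M n" "s n" "\<gamma> n" by (rule p)
    interpret small_profile "M n" "s n" "\<gamma> n" by unfold_locales (rule small)
    show ?thesis using Phi_close[of "t n"] by (simp add: K_def k_def)
  qed
  have "(\<lambda>n. 378 * k ^ 3 * \<gamma> n * \<bar>t n\<bar> powr (5/2)) \<longlonglongrightarrow> 378 * k ^ 3 * 0 * \<bar>\<tau>\<bar> powr (5/2)"
    by (intro tendsto_mult tendsto_const lim tendsto_powr' tendsto_rabs t) auto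
  hence "(\<lambda>n. 378 * k ^ 3 * \<gamma> n * \<bar>t n\<bar> powr (5/2)) \<longlonglongrightarrow> 0" by simp
  hence "(\<lambda>n. char (M n) (t n) - psi (t n)) \<longlonglongrightarrow> 0"
    by (rule Lim_null_comparison[rotated]) (use close in auto)
  moreover have "isCont psi \<tau>" using psi_continuous by (simp add: continuous_on_eq_continuous_at)
  hence "(\<lambda>n. complex_of_real (psi (t n))) \<longlonglongrightarrow> complex_of_real (psi \<tau>)"
    by (intro tendsto_of_real isCont_tendsto_compose[OF _ t])
  ultimately have "(\<lambda>n. (char (M n) (t n) - psi (t n)) + psi (t n)) \<longlonglongrightarrow> 0 + complex_of_real (psi \<tau>)" by (rule tendsto_add)
  thus ?thesis by simp
qed

text \<open>The integrand is unbounded, so it is clipped at height k first, with an error uniform in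
  n by the moment bound. For fixed k the difference laws converge weakly by Levy's theorem, as their
  characteristic functions converge to psi^2.\<close>

lemma profile_log_energy_limit:
  assumes p: "\<And>n. profile (M n) (s n) (\<gamma> n)" and small: "\<And>n. \<gamma> n \<le> 1/500" and lim: "\<gamma> \<longlonglongrightarrow> 0"
  shows "(\<lambda>n. real_distribution.log_energy (M n)) \<longlonglongrightarrow> I0 H H"
proof (rule LIMSEQ_I)
  fix e :: real assume e: "0 < e"
  \<comment> \<open>The sum of the two squared moments, so that a single k makes both clipping
    errors add up to less than e/2.\<close>
  define C where "C = (6404 :: real)\<^sup>2 + (Hm.weighted_moment (11/4))\<^sup>2"
  have C0: "0 < C" by (simp add: C_def add_pos_nonneg)
  have rd: "real_distribution (M n)" for n using p[of n] by (simp add: profile_def)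
  have "((\<lambda>k::real. 2 * k powr (- (1/4)) * C) \<longlongrightarrow> 2 * 0 * C) at_top"
    by (intro tendsto_intros tendsto_neg_powr filterlim_ident) auto
  hence "eventually (\<lambda>k::real. 2 * k powr (- (1/4)) * C < e / 2) at_top"
    using e by (intro order_tendstoD) auto
  hence "eventually (\<lambda>k::real. 2 * k powr (- (1/4)) * C < e / 2 \<and> 1 \<le> k) at_top"
    using eventually_ge_at_top[of 1] by eventually_elim auto
  then obtain k :: real where k: "1 \<le> k" "2 * k powr (- (1/4)) * C < e / 2"
    by (auto simp: eventually_at_top_linorder)
  have cn: "\<bar>real_distribution.log_energy (M n) - (\<integral>d. sq_ln (clip k d) \<partial>real_distribution.difference_law (M n))\<bar> \<le> 2 * k powr (- (1/4)) * 6404\<^sup>2" for n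
  proof -
    interpret profile "M n" "s n" "\<gamma> n" by (rule p)
    interpret small_profile "M n" "s n" "\<gamma> n" by unfold_locales (rule small)
    have "(weighted_moment (11/4))\<^sup>2 \<le> 6404\<^sup>2" using weighted_moment_11_4 weighted_moment_nonneg by (intro power_mono) (auto simp: K_def)
    hence "2 * k powr (- (1/4)) * (weighted_moment (11/4))\<^sup>2 \<le> 2 * k powr (- (1/4)) * 6404\<^sup>2" by (intro mult_left_mono) auto
    thus ?thesis using log_energy_clip[OF k(1) moments] by simp
  qed
  have c0: "\<bar>Hm.log_energy - (\<integral>d. sq_ln (clip k d) \<partial>Hm.difference_law)\<bar> \<le> 2 * k powr (- (1/4)) * (Hm.weighted_moment (11/4))\<^sup>2"
    by (rule Hm.log_energy_clip[OF k(1) Hm_moments]) simp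
  have "weak_conv_m (\<lambda>n. real_distribution.difference_law (M n)) Hm.difference_law"
  proof (rule levy_continuity)
    show "real_distribution (real_distribution.difference_law (M n))" for n by (rule real_distribution.difference_law_distribution[OF rd])
    show "real_distribution Hm.difference_law" by (rule Hm.difference_law_distribution)
    show "(\<lambda>n. char (real_distribution.difference_law (M n)) t) \<longlonglongrightarrow> char Hm.difference_law t" for t
    proof -
      have "(\<lambda>n. char (M n) t) \<longlonglongrightarrow> complex_of_real (psi t)"
        by (rule profile_char_limit[where t = "\<lambda>_. t", OF p small lim]) auto
      hence "(\<lambda>n. complex_of_real ((cmod (char (M n) t))\<^sup>2)) \<longlonglongrightarrow> complex_of_real ((cmod (complex_of_real (psi t)))\<^sup>2)"
        by (intro tendsto_of_real tendsto_power tendsto_norm)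
      thus ?thesis unfolding real_distribution.char_difference_law[OF rd] Hm.char_difference_law char_Hm .
    qed
  qed
  hence "(\<lambda>n. \<integral>d. sq_ln (clip k d) \<partial>real_distribution.difference_law (M n)) \<longlonglongrightarrow> (\<integral>d. sq_ln (clip k d) \<partial>Hm.difference_law)"
  proof (rule weak_conv_imp_integral_bdd_continuous_conv[rotated 2])
    show "real_distribution (real_distribution.difference_law (M n))" for n by (rule real_distribution.difference_law_distribution[OF rd])
    show "real_distribution Hm.difference_law" by (rule Hm.difference_law_distribution)
    show "isCont (\<lambda>d. sq_ln (clip k d)) d" for d
    proof -
      have "isCont (clip k) d" unfolding clip_def[abs_def] by (intro continuous_intros)
      thus ?thesis by (rule isCont_o2[OF _ sq_ln_continuous])
    qed
    show "norm (sq_ln (clip k d)) \<le> 2 * (1 + k) powr (5/2)" for d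
    proof -
      have "(1 + \<bar>clip k d\<bar>) powr (5/2) \<le> (1 + k) powr (5/2)" using k by (intro powr_mono2) (auto simp: clip_def)
      thus ?thesis using sq_ln_abs_le[of "clip k d"] by simp
    qed
  qed
  from LIMSEQ_D[OF this, of "e / 2"] e obtain n0 where n0:
    "\<And>n. n \<ge> n0 \<Longrightarrow> norm ((\<integral>d. sq_ln (clip k d) \<partial>real_distribution.difference_law (M n)) - (\<integral>d. sq_ln (clip k d) \<partial>Hm.difference_law)) < e / 2" by auto
  have "2 * k powr (- (1/4)) * 6404\<^sup>2 + 2 * k powr (- (1/4)) * (Hm.weighted_moment (11/4))\<^sup>2 < e / 2"
    using k(2) by (simp add: C_def distrib_left)
  hence "norm (real_distribution.log_energy (M n) - I0 H H) < e" if "n \<ge> n0" for n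
    using cn[of n] c0 n0[OF that] unfolding I0_eq real_norm_def by linarith
  thus "\<exists>n0. \<forall>n\<ge>n0. norm (real_distribution.log_energy (M n) - I0 H H) < e" by blast
qed

lemma profile_scale_limit:
  assumes p: "\<And>n. profile (M n) (s n) (\<gamma> n)" and small: "\<And>n. \<gamma> n \<le> 1/500" and lim: "\<gamma> \<longlonglongrightarrow> 0"
  shows "(\<lambda>n. s n powr (1 / \<gamma> n)) \<longlonglongrightarrow> 1 / lambda0"
proof -
  define A where "A n = (1 / s n - 1) / \<gamma> n" for n
  have gp: "0 < \<gamma> n" and sp: "0 < s n" for n using p[of n] by (auto simp: profile_def profile_axioms_def)
  have "(\<lambda>n. A n - real_distribution.log_energy (M n) / 2) \<longlonglongrightarrow> 0"
  proof (rule Lim_null_comparison)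
    show "eventually (\<lambda>n. norm (A n - real_distribution.log_energy (M n) / 2) \<le> 32 * \<gamma> n * 6404\<^sup>2) sequentially"
    proof (intro always_eventually allI)
      fix n
      interpret profile "M n" "s n" "\<gamma> n" by (rule p)
      interpret small_profile "M n" "s n" "\<gamma> n" by unfold_locales (rule small)
      show "norm (A n - real_distribution.log_energy (M n) / 2) \<le> 32 * \<gamma> n * 6404\<^sup>2"
        using energy_expansion by (simp add: A_def K_def)
    qed
    have "(\<lambda>n. 32 * \<gamma> n * 6404\<^sup>2) \<longlonglongrightarrow> 32 * 0 * 6404\<^sup>2" by (intro tendsto_intros lim)
    thus "(\<lambda>n. 32 * \<gamma> n * 6404\<^sup>2) \<longlonglongrightarrow> 0" by simp
  qed
  from tendsto_add[OF this tendsto_divide[OF profile_log_energy_limit[OF p small lim] tendsto_const, of 2]]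
  have A: "A \<longlonglongrightarrow> I0 H H / 2" by simp
  have gA: "(\<lambda>n. \<gamma> n * A n) \<longlonglongrightarrow> 0" using tendsto_mult[OF lim A] by simp
  have s: "1 / s n = 1 + \<gamma> n * A n" for n using gp[of n] by (simp add: A_def)
  \<comment> \<open>Linearization of ln(1/s) = ln(1 + \<gamma>A): the error 2 \<gamma> A^2 is valid
    once |\<gamma>A| < 1/2 and vanishes because A converges.\<close>
  have "(\<lambda>n. ln (1 + \<gamma> n * A n) / \<gamma> n - A n) \<longlonglongrightarrow> 0"
  proof (rule Lim_null_comparison)
    have "eventually (\<lambda>n. norm (\<gamma> n * A n) < 1/2) sequentially"
      using tendsto_norm[OF gA] by (intro order_tendstoD) auto
    thus "eventually (\<lambda>n. norm (ln (1 + \<gamma> n * A n) / \<gamma> n - A n) \<le> 2 * (\<gamma> n * A n) * A n) sequentially"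
    proof eventually_elim
      case (elim n)
      have "\<bar>ln (1 + \<gamma> n * A n) - \<gamma> n * A n\<bar> \<le> 2 * (\<gamma> n * A n)\<^sup>2"
        using elim by (intro abs_ln_one_plus_x_minus_x_bound) auto
      hence "\<bar>ln (1 + \<gamma> n * A n) - \<gamma> n * A n\<bar> / \<gamma> n \<le> 2 * (\<gamma> n * A n)\<^sup>2 / \<gamma> n"
        using gp[of n] by (intro divide_right_mono) auto
      moreover have "\<bar>ln (1 + \<gamma> n * A n) / \<gamma> n - A n\<bar> = \<bar>ln (1 + \<gamma> n * A n) - \<gamma> n * A n\<bar> / \<gamma> n"
      proof -
        have "ln (1 + \<gamma> n * A n) / \<gamma> n - A n = (ln (1 + \<gamma> n * A n) - \<gamma> n * A n) / \<gamma> n"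
          using gp[of n] by (simp add: diff_divide_distrib)
        thus ?thesis using gp[of n] by simp
      qed
      moreover have "2 * (\<gamma> n * A n)\<^sup>2 / \<gamma> n = 2 * (\<gamma> n * A n) * A n" using gp[of n] by (simp add: power2_eq_square)
      ultimately show ?case by simp
    qed
    have "(\<lambda>n. 2 * (\<gamma> n * A n) * A n) \<longlonglongrightarrow> 2 * 0 * (I0 H H / 2)" by (intro tendsto_intros gA A)
    thus "(\<lambda>n. 2 * (\<gamma> n * A n) * A n) \<longlonglongrightarrow> 0" by simp
  qed
  from tendsto_add[OF this A] have "(\<lambda>n. ln (1 / s n) / \<gamma> n) \<longlonglongrightarrow> I0 H H / 2" by (simp add: s)
  hence "(\<lambda>n. exp (- (ln (1 / s n) / \<gamma> n))) \<longlonglongrightarrow> exp (- (I0 H H / 2))"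
    by (intro tendsto_exp tendsto_minus)
  moreover have "exp (- (ln (1 / s n) / \<gamma> n)) = s n powr (1 / \<gamma> n)" for n
    using sp[of n] by (simp add: powr_def ln_div)
  ultimately show ?thesis by (simp add: lambda0_def exp_minus inverse_eq_divide)
qed

text \<open>Undoing the normalization: the law of \<sigma> times the profile variable has
  characteristic function Phi(\<sigma> t), which converges to psi(t / \<open>lambda0\<close>).
  Levy's theorem turns this into weak convergence.\<close>

lemma profile_weak_limit:
  fixes \<phi> :: "real \<Rightarrow> real"
  assumes p: "\<And>n. profile (M n) (s n) (\<gamma> n)" and small: "\<And>n. \<gamma> n \<le> 1/500" and lim: "\<gamma> \<longlonglongrightarrow> 0"
    and \<phi>: "continuous_on UNIV \<phi>" and B: "\<And>x. \<bar>\<phi> x\<bar> \<le> B"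
  shows "(\<lambda>n. \<integral>x. \<phi> (s n powr (1 / \<gamma> n) * x) \<partial>M n) \<longlonglongrightarrow> (\<integral>x. \<phi> (x / lambda0) \<partial>Hm)"
proof -
  define \<sigma> where "\<sigma> n = s n powr (1 / \<gamma> n)" for n
  have \<sigma>: "\<sigma> \<longlonglongrightarrow> 1 / lambda0" unfolding \<sigma>_def[abs_def] by (rule profile_scale_limit[OF p small lim])
  have rd: "real_distribution (M n)" for n using p[of n] by (simp add: profile_def)
  define L where "L n = distr (M n) borel (\<lambda>x. \<sigma> n * x)" for n
  define L0 where "L0 = distr Hm borel (\<lambda>x. x / lambda0)"
  have [measurable_cong]: "sets (M n) = sets borel" for n using rd[of n] by (rule real_distribution.events_eq_borel)
  have intL: "(\<integral>x. h x \<partial>L n) = (\<integral>x. h (\<sigma> n * x) \<partial>M n)"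
    if "h \<in> borel_measurable borel" for h :: "real \<Rightarrow> 'b::{banach, second_countable_topology}" and n
    unfolding L_def using that by (subst integral_distr) auto
  have intL0: "(\<integral>x. h x \<partial>L0) = (\<integral>x. h (x / lambda0) \<partial>Hm)"
    if "h \<in> borel_measurable borel" for h :: "real \<Rightarrow> 'b::{banach, second_countable_topology}"
    unfolding L0_def using that by (subst integral_distr) auto
  have rdL: "real_distribution (L n)" for n
  proof -
    interpret real_distribution "M n" by (rule rd)
    have "prob_space (L n)" unfolding L_def by (rule prob_space_distr) measurable
    thus ?thesis by (simp add: real_distribution_def real_distribution_axioms_def L_def)
  qed
  have rdL0: "real_distribution L0"
  proof -
    have "prob_space L0" unfolding L0_def by (rule Hm.prob_space_distr) measurable
    thus ?thesis by (simp add: real_distribution_def real_distribution_axioms_def L0_def)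
  qed
  have "weak_conv_m L L0"
  proof (rule levy_continuity[OF rdL rdL0])
    fix t :: real
    have "char (L n) t = char (M n) (\<sigma> n * t)" for n
      unfolding char_def by (subst intL) (auto simp: mult_ac)
    moreover have "char L0 t = complex_of_real (psi (1 / lambda0 * t))"
      unfolding char_Hm[symmetric] unfolding char_def by (subst intL0) auto
    moreover have "(\<lambda>n. char (M n) (\<sigma> n * t)) \<longlonglongrightarrow> complex_of_real (psi (1 / lambda0 * t))"
      by (rule profile_char_limit[OF p small lim]) (intro tendsto_intros \<sigma>)
    ultimately show "(\<lambda>n. char (L n) t) \<longlonglongrightarrow> char L0 t" by simp
  qed
  hence "(\<lambda>n. \<integral>x. \<phi> x \<partial>L n) \<longlonglongrightarrow> (\<integral>x. \<phi> x \<partial>L0)"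
    by (rule weak_conv_imp_integral_bdd_continuous_conv[OF rdL rdL0])
      (use \<phi> B in \<open>auto simp: continuous_on_eq_continuous_at\<close>)
  moreover have "\<phi> \<in> borel_measurable borel" using \<phi> by (rule borel_measurable_continuous_onI)
  ultimately show ?thesis by (simp add: intL intL0 \<sigma>_def)
qed

section \<open>Steady states\<close>

text \<open>Densities, image measures and products are handled on \<open>lborel\<close> with Borel
  representatives; this and \<open>lebesgue_prod_eq\<close> carry integrals over from
  \<open>lebesgue\<close>.\<close>

lemma lebesgue_lborel_eq:
  fixes F f :: "real \<Rightarrow> real"
  assumes F: "F \<in> borel_measurable lebesgue" and f: "f \<in> borel_measurable borel" and ae: "AE x in lborel. F x = f x"
  shows "(LINT x|lebesgue. F x) = (LINT x|lborel. f x)"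
    and "integrable lebesgue F \<longleftrightarrow> integrable lborel f"
proof -
  have f': "f \<in> borel_measurable lborel" using f by simp
  have fl: "f \<in> borel_measurable lebesgue" using f' by (rule measurable_completion)
  have ael: "AE x in lebesgue. F x = f x" using ae by (simp add: AE_completion_iff)
  show "(LINT x|lebesgue. F x) = (LINT x|lborel. f x)"
    using integral_cong_AE[OF F fl ael] integral_completion[OF f'] by simp
  show "integrable lebesgue F \<longleftrightarrow> integrable lborel f"
    using integrable_cong_AE[OF F fl ael] integrable_completion[OF f'] by simp
qed

lemma id_lebesgue_lborel: "(\<lambda>x. x) \<in> lebesgue \<rightarrow>\<^sub>M (lborel :: real measure)"
  by (rule measurable_completion) simp

lemma id_lebesgue_lborel_prod:
  "(\<lambda>z. z) \<in> lebesgue \<Otimes>\<^sub>M lebesgue \<rightarrow>\<^sub>M (lborel :: real measure) \<Otimes>\<^sub>M (lborel :: real measure)"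
proof -
  have "(\<lambda>z. (fst z, snd z)) \<in> lebesgue \<Otimes>\<^sub>M lebesgue \<rightarrow>\<^sub>M (lborel :: real measure) \<Otimes>\<^sub>M (lborel :: real measure)"
    by (intro measurable_Pair measurable_compose[OF measurable_fst id_lebesgue_lborel]
        measurable_compose[OF measurable_snd id_lebesgue_lborel])
  thus ?thesis by simp
qed

lemma lebesgue_prod_measurable:
  "f \<in> borel_measurable (lborel \<Otimes>\<^sub>M lborel) \<Longrightarrow> (f :: real \<times> real \<Rightarrow> real) \<in> borel_measurable (lebesgue \<Otimes>\<^sub>M lebesgue)"
  by (rule measurable_compose[OF id_lebesgue_lborel_prod])

text \<open>A product of completions need not be the completion of the product. The identity map
  nevertheless pushes the product of the completed measures forward to
  \<open>lborel \<Otimes>\<^sub>M lborel\<close>, and image measures preserve integrals and null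
  sets.\<close>

lemma lebesgue_prod_eq:
  fixes F f :: "real \<times> real \<Rightarrow> real"
  assumes F: "F \<in> borel_measurable (lebesgue \<Otimes>\<^sub>M lebesgue)" and f: "f \<in> borel_measurable (lborel \<Otimes>\<^sub>M lborel)"
    and ae: "AE z in lborel \<Otimes>\<^sub>M lborel. F z = f z"
  shows "(LINT z|(lebesgue \<Otimes>\<^sub>M lebesgue). F z) = (LINT z|(lborel \<Otimes>\<^sub>M lborel). f z)"
proof -
  have d: "distr lebesgue lborel (\<lambda>x. x) = (lborel :: real measure)"
  proof (rule measure_eqI)
    fix A :: "real set" assume "A \<in> sets (distr lebesgue lborel (\<lambda>x. x))"
    hence A: "A \<in> sets lborel" by simp
    have "emeasure (distr lebesgue lborel (\<lambda>x. x)) A = emeasure lebesgue A"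
      using A by (subst emeasure_distr[OF id_lebesgue_lborel]) auto
    also have "\<dots> = emeasure lborel A" using A by simp
    finally show "emeasure (distr lebesgue lborel (\<lambda>x. x)) A = emeasure lborel A" .
  qed simp
  note T = id_lebesgue_lborel_prod
  have "sigma_finite_measure (distr lebesgue lborel (\<lambda>x::real. x))" unfolding d by (rule sigma_finite_lborel)
  from pair_measure_distr[OF id_lebesgue_lborel id_lebesgue_lborel this]
  have dd: "(lborel :: real measure) \<Otimes>\<^sub>M (lborel :: real measure) = distr (lebesgue \<Otimes>\<^sub>M lebesgue) (lborel \<Otimes>\<^sub>M lborel) (\<lambda>z. z)"
    unfolding d by (simp add: split_beta')
  note fl = lebesgue_prod_measurable[OF f]
  have ael: "AE z in lebesgue \<Otimes>\<^sub>M lebesgue. F z = f z"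
    by (rule AE_distrD[OF T]) (use ae in \<open>simp only: dd[symmetric]\<close>)
  have "(LINT z|(lebesgue \<Otimes>\<^sub>M lebesgue). F z) = (LINT z|(lebesgue \<Otimes>\<^sub>M lebesgue). f z)"
    by (rule integral_cong_AE[OF F fl ael])
  also have "\<dots> = (LINT z|distr (lebesgue \<Otimes>\<^sub>M lebesgue) (lborel \<Otimes>\<^sub>M lborel) (\<lambda>z. z). f z)"
    by (rule integral_distr[OF T f, symmetric])
  finally show "(LINT z|(lebesgue \<Otimes>\<^sub>M lebesgue). F z) = (LINT z|(lborel \<Otimes>\<^sub>M lborel). f z)" unfolding dd[symmetric] .
qed

lemma AE_lborel_pair:
  assumes "AE x in lborel. P (x::real)"
  shows "AE z in lborel \<Otimes>\<^sub>M lborel. P (fst z) \<and> P (snd z)"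
proof -
  obtain A where A: "{x \<in> space lborel. \<not> P x} \<subseteq> A" "emeasure lborel A = 0" "A \<in> sets lborel"
    using assms by (rule AE_E)
  have 1: "A \<times> UNIV \<in> null_sets (lborel \<Otimes>\<^sub>M (lborel :: real measure))" "UNIV \<times> A \<in> null_sets ((lborel :: real measure) \<Otimes>\<^sub>M lborel)"
    using A by (auto simp: null_sets_def lborel.emeasure_pair_measure_Times simp del: sets_lborel)
  from AE_not_in[OF 1(1)] AE_not_in[OF 1(2)]
  show ?thesis by eventually_elim (use A(1) in \<open>auto simp: mem_Times_iff\<close>)
qed

section \<open>Rescaling of a steady state to variance one\<close>

definition scaled_law :: "(real \<Rightarrow> real) \<Rightarrow> real \<Rightarrow> real measure" where
  "scaled_law g \<sigma> = distr (density lborel g) borel (\<lambda>x. x / \<sigma>)"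

context
  fixes g :: "real \<Rightarrow> real" and \<sigma> :: real
  assumes gm [measurable]: "g \<in> borel_measurable borel" and g0: "\<And>x. 0 \<le> g x" and g1: "integrable lborel g" "(\<integral>x. g x \<partial>lborel) = 1"
    and \<sigma>: "0 < \<sigma>"
begin

lemma prob_space_density_g: "prob_space (density lborel g)"
proof
  have "emeasure (density lborel g) (space (density lborel g)) = (\<integral>\<^sup>+x. ennreal (g x) \<partial>lborel)" by (simp add: emeasure_density)
  also have "\<dots> = 1" using nn_integral_eq_integral[OF g1(1)] g0 g1(2) by simp
  finally show "emeasure (density lborel g) (space (density lborel g)) = 1" .
qed

lemma scaled_law_distribution: "real_distribution (scaled_law g \<sigma>)"
proof -
  interpret D: prob_space "density lborel g" by (rule prob_space_density_g)
  have "prob_space (scaled_law g \<sigma>)" unfolding scaled_law_def by (rule D.prob_space_distr) measurable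
  thus ?thesis by (simp add: real_distribution_def real_distribution_axioms_def scaled_law_def)
qed

lemma integral_scaled_law:
  fixes h :: "real \<Rightarrow> real"
  assumes [measurable]: "h \<in> borel_measurable borel"
  shows "(\<integral>x. h x \<partial>scaled_law g \<sigma>) = (\<integral>x. g x * h (x / \<sigma>) \<partial>lborel)"
    and "integrable (scaled_law g \<sigma>) h \<longleftrightarrow> integrable lborel (\<lambda>x. g x * h (x / \<sigma>))"
proof -
  have "(\<integral>x. h x \<partial>scaled_law g \<sigma>) = (\<integral>x. h (x / \<sigma>) \<partial>density lborel g)"
    unfolding scaled_law_def by (rule integral_distr) measurable
  also have "\<dots> = (\<integral>x. g x * h (x / \<sigma>) \<partial>lborel)" by (subst integral_density) (auto simp: g0)
  finally show "(\<integral>x. h x \<partial>scaled_law g \<sigma>) = (\<integral>x. g x * h (x / \<sigma>) \<partial>lborel)" .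
  have "integrable (scaled_law g \<sigma>) h \<longleftrightarrow> integrable (density lborel g) (\<lambda>x. h (x / \<sigma>))"
    unfolding scaled_law_def by (rule integrable_distr_eq) measurable
  also have "\<dots> \<longleftrightarrow> integrable lborel (\<lambda>x. g x * h (x / \<sigma>))" by (subst integrable_density) (auto simp: g0)
  finally show "integrable (scaled_law g \<sigma>) h \<longleftrightarrow> integrable lborel (\<lambda>x. g x * h (x / \<sigma>))" .
qed

lemma integral_scaled_law_prod:
  fixes h :: "real \<times> real \<Rightarrow> real"
  assumes [measurable]: "h \<in> borel_measurable (borel \<Otimes>\<^sub>M borel)"
  shows "(\<integral>z. h z \<partial>(scaled_law g \<sigma> \<Otimes>\<^sub>M scaled_law g \<sigma>)) = (\<integral>(x, y). g x * g y * h (x / \<sigma>, y / \<sigma>) \<partial>(lborel \<Otimes>\<^sub>M lborel))"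
proof -
  let ?D = "density lborel g"
  interpret D: prob_space ?D by (rule prob_space_density_g)
  interpret S: real_distribution "scaled_law g \<sigma>" by (rule scaled_law_distribution)
  have fm: "(\<lambda>x. x / \<sigma>) \<in> measurable ?D borel" by measurable
  have "sigma_finite_measure (distr ?D borel (\<lambda>x. x / \<sigma>))"
    using S.sigma_finite_measure_axioms unfolding scaled_law_def .
  from pair_measure_distr[OF fm fm this]
  have e: "scaled_law g \<sigma> \<Otimes>\<^sub>M scaled_law g \<sigma> = distr (?D \<Otimes>\<^sub>M ?D) (borel \<Otimes>\<^sub>M borel) (\<lambda>(x, y). (x / \<sigma>, y / \<sigma>))"
    by (simp add: scaled_law_def)
  have "?D \<Otimes>\<^sub>M ?D = density (lborel \<Otimes>\<^sub>M lborel) (\<lambda>(x, y). ennreal (g x) * ennreal (g y))"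
    by (rule pair_measure_density) (auto intro: sigma_finite_lborel D.sigma_finite_measure_axioms)
  also have "\<dots> = density (lborel \<Otimes>\<^sub>M lborel) (\<lambda>z. ennreal (case z of (x, y) \<Rightarrow> g x * g y))"
    by (rule arg_cong[where f = "density _"]) (auto simp: ennreal_mult g0)
  finally have DD: "?D \<Otimes>\<^sub>M ?D = density (lborel \<Otimes>\<^sub>M lborel) (\<lambda>z. ennreal (case z of (x, y) \<Rightarrow> g x * g y))" .
  have "(\<integral>z. h z \<partial>(scaled_law g \<sigma> \<Otimes>\<^sub>M scaled_law g \<sigma>)) = (\<integral>z. h (case z of (x, y) \<Rightarrow> (x / \<sigma>, y / \<sigma>)) \<partial>(?D \<Otimes>\<^sub>M ?D))"
    unfolding e by (rule integral_distr) measurable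
  also have "\<dots> = (\<integral>z. (case z of (x, y) \<Rightarrow> g x * g y) *\<^sub>R h (case z of (x, y) \<Rightarrow> (x / \<sigma>, y / \<sigma>)) \<partial>(lborel \<Otimes>\<^sub>M lborel))"
    unfolding DD by (rule integral_density) (auto intro!: AE_I2 simp: g0)
  also have "\<dots> = (\<integral>(x, y). g x * g y * h (x / \<sigma>, y / \<sigma>) \<partial>(lborel \<Otimes>\<^sub>M lborel))"
    by (intro Bochner_Integration.integral_cong refl) auto
  finally show ?thesis .
qed

lemma gauss_form_scaled_law: "gauss_form a g g = real_distribution.gauss_energy (scaled_law g \<sigma>) (a * \<sigma>)"
proof -
  interpret S: real_distribution "scaled_law g \<sigma>" by (rule scaled_law_distribution)
  have i: "integrable (scaled_law g \<sigma> \<Otimes>\<^sub>M scaled_law g \<sigma>) (\<lambda>(x, y). exp (- (a * \<sigma> * (x - y))\<^sup>2 / 2))"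
    by (rule S.pp.integrable_const_bound[of _ 1]) auto
  have "S.gauss_energy (a * \<sigma>) = (\<integral>(x, y). exp (- (a * \<sigma> * (x - y))\<^sup>2 / 2) \<partial>(scaled_law g \<sigma> \<Otimes>\<^sub>M scaled_law g \<sigma>))"
    unfolding S.gauss_energy_def S.gauss_average_def using S.pp.integral_fst'[OF i] by simp
  also have "\<dots> = (\<integral>(x, y). g x * g y * exp (- (a * \<sigma> * (x / \<sigma> - y / \<sigma>))\<^sup>2 / 2) \<partial>(lborel \<Otimes>\<^sub>M lborel))"
    by (subst integral_scaled_law_prod) auto
  also have "\<dots> = gauss_form a g g"
  proof -
    have "a * \<sigma> * (x / \<sigma> - y / \<sigma>) = a * (x - y)" for x y using \<sigma> by (simp add: field_simps)
    thus ?thesis by (simp only: gauss_form_def)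
  qed
  finally show ?thesis by simp
qed

end

text \<open>A nonnegative Borel version g of G is divided by the standard deviation \<sigma>, and s
  = \<sigma>^\<gamma>. The conclusion writes \<sigma> as \<open>s powr (1 / \<gamma>)\<close>, the
  form in which the asymptotics of s are used.\<close>

lemma steady_profile:
  assumes \<gamma>: "0 < \<gamma>" "\<gamma> < 1" and G: "G \<in> steady_states \<gamma>"
  obtains g s where "g \<in> borel_measurable borel" "\<And>x. 0 \<le> g x" "integrable lborel g" "(\<integral>x. g x \<partial>lborel) = 1"
    "AE x in lborel. G x = g x" "0 < s" "profile (scaled_law g (s powr (1 / \<gamma>))) s \<gamma>"
proof -
  have Gpos: "AE x in lebesgue. 0 \<le> G x" and GL: "\<And>q. q < 3 \<Longrightarrow> G \<in> L1_weight q"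
    and Gint: "(LINT x|lebesgue. G x) = 1" and Gmean: "(LINT x|lebesgue. x * G x) = 0"
    and Gw: "\<And>\<phi>. \<phi> \<in> C1_bounded \<Longrightarrow> - (1/4) * (LINT x|lebesgue. x * deriv \<phi> x * G x) = Q_weak \<gamma> G G \<phi>"
    using G by (auto simp: steady_states_def)
  have Gm[measurable]: "G \<in> borel_measurable lebesgue" using GL[of 0] by (simp add: L1_weight_def)
  obtain g' where g': "g' \<in> borel_measurable lborel" "AE x in lborel. G x = g' x"
    using completion_ex_borel_measurable_real[OF Gm] by blast
  define g where "g x = max 0 (g' x)" for x
  have gm[measurable]: "g \<in> borel_measurable borel" using g'(1) unfolding g_def[abs_def] by simp
  have g0: "0 \<le> g x" for x by (simp add: g_def)
  have "AE x in lborel. 0 \<le> G x" using Gpos by (simp add: AE_completion_iff)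
  with g'(2) have ae: "AE x in lborel. G x = g x" by eventually_elim (simp add: g_def)
  have wm: "(\<lambda>x. k x * G x) \<in> borel_measurable lebesgue" if "k \<in> borel_measurable borel" for k
    using Gm measurable_completion[of k lborel borel] that by (intro borel_measurable_times) auto
  have trans: "(LINT x|lebesgue. k x * G x) = (LINT x|lborel. k x * g x)"
    "integrable lebesgue (\<lambda>x. k x * G x) \<longleftrightarrow> integrable lborel (\<lambda>x. k x * g x)"
    if k: "k \<in> borel_measurable borel" for k
  proof -
    have a: "(\<lambda>x. k x * g x) \<in> borel_measurable borel" "AE x in lborel. k x * G x = k x * g x"
      using k ae by (auto elim: eventually_mono)
    show "(LINT x|lebesgue. k x * G x) = (LINT x|lborel. k x * g x)"
      "integrable lebesgue (\<lambda>x. k x * G x) \<longleftrightarrow> integrable lborel (\<lambda>x. k x * g x)"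
      using lebesgue_lborel_eq[OF wm[OF k] a] by auto
  qed
  have igw: "integrable lborel (\<lambda>x. (1 + \<bar>x\<bar>) powr q * g x)" if "q < 3" for q
  proof -
    have "integrable lebesgue (\<lambda>x. \<bar>G x\<bar> * weight q x)" using GL[OF that] by (simp add: L1_weight_def)
    hence i: "integrable lebesgue (\<lambda>x. norm ((1 + \<bar>x\<bar>) powr q * G x))" by (simp add: weight_def abs_mult mult.commute)
    have "integrable lebesgue (\<lambda>x. (1 + \<bar>x\<bar>) powr q * G x)"
      using i by (subst (asm) integrable_norm_iff) (auto intro!: wm)
    thus ?thesis by (subst (asm) trans(2)) auto
  qed
  have ig: "integrable lborel g"
  proof -
    have "1 + \<bar>x\<bar> \<noteq> 0" for x :: real using abs_ge_zero[of x] by linarith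
    thus ?thesis using igw[of 0] by simp
  qed
  have g1: "(\<integral>x. g x \<partial>lborel) = 1" using trans(1)[of "\<lambda>_. 1"] Gint by simp
  have gmean: "(\<integral>x. x * g x \<partial>lborel) = 0" using trans(1)[of "\<lambda>x. x"] Gmean by simp
  have ig2: "integrable lborel (\<lambda>x. x\<^sup>2 * g x)"
  proof (rule Bochner_Integration.integrable_bound[OF igw[of 2]])
    show "AE x in lborel. norm (x\<^sup>2 * g x) \<le> norm ((1 + \<bar>x\<bar>) powr 2 * g x)"
    proof (intro AE_I2)
      fix x :: real
      have "\<bar>x\<bar>\<^sup>2 \<le> (1 + \<bar>x\<bar>)\<^sup>2" by (intro power_mono) auto
      thus "norm (x\<^sup>2 * g x) \<le> norm ((1 + \<bar>x\<bar>) powr 2 * g x)" using g0[of x] by (simp add: mult_right_mono)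
    qed
  qed auto
  define m where "m = (\<integral>x. x\<^sup>2 * g x \<partial>lborel)"
  have m0: "0 < m"
  \<comment> \<open>A vanishing second moment would force g = 0 off the origin, hence almost
    everywhere, against the integral one.\<close>
  proof (rule ccontr)
    assume "\<not> 0 < m"
    moreover have "0 \<le> m" unfolding m_def using g0 by (intro Bochner_Integration.integral_nonneg) auto
    ultimately have "m = 0" by simp
    hence "AE x in lborel. x\<^sup>2 * g x = 0"
      using integral_nonneg_eq_0_iff_AE[OF ig2] g0 unfolding m_def by auto
    moreover have "AE x in lborel. x \<noteq> (0::real)" by (rule AE_lborel_singleton)
    ultimately have "AE x in lborel. g x = 0" by eventually_elim auto
    hence "(\<integral>x. g x \<partial>lborel) = 0" by (rule integral_eq_zero_AE)
    thus False using g1 by simp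
  qed
  define \<sigma> where "\<sigma> = sqrt m"
  have \<sigma>: "0 < \<sigma>" "\<sigma>\<^sup>2 = m" using m0 by (auto simp: \<sigma>_def)
  define s where "s = \<sigma> powr \<gamma>"
  have s: "0 < s" "s powr (1 / \<gamma>) = \<sigma>" using \<sigma> \<gamma> by (auto simp: s_def powr_powr)
  note ctx = gm g0 ig g1 \<sigma>(1)
  let ?S = "scaled_law g \<sigma>"
  have "profile ?S s \<gamma>"
  proof (intro profile.intro profile_axioms.intro)
    show "real_distribution ?S" by (rule scaled_law_distribution[OF ctx])
    show "0 < \<gamma>" "\<gamma> < 1" "0 < s" using \<gamma> s by auto
    show "integrable ?S (\<lambda>x. (1 + \<bar>x\<bar>) powr q)" if q: "q < 3" for q
    proof (subst integral_scaled_law(2)[OF ctx])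
      \<comment> \<open>The weight at x/\<sigma> is compared with the weight at x through 1 +
        |x/\<sigma>| \<le> c (1 + |x|). A negative exponent is first raised to 0, since only
        nonnegative powers are monotone in the base.\<close>
      define c where "c = max 1 (1 / \<sigma>)"
      define p where "p = max q 0"
      show "integrable lborel (\<lambda>x. g x * (1 + \<bar>x / \<sigma>\<bar>) powr q)"
      proof (rule Bochner_Integration.integrable_bound[OF integrable_mult_right[OF igw[of p], of "c powr p"]])
        show "AE x in lborel. norm (g x * (1 + \<bar>x / \<sigma>\<bar>) powr q) \<le> norm (c powr p * ((1 + \<bar>x\<bar>) powr p * g x))"
        proof (intro AE_I2)
          fix x :: real
          have "\<bar>x / \<sigma>\<bar> \<le> c * \<bar>x\<bar>" using \<sigma> mult_right_mono[of "1 / \<sigma>" c "\<bar>x\<bar>"] by (simp add: c_def)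
          hence "1 + \<bar>x / \<sigma>\<bar> \<le> c * (1 + \<bar>x\<bar>)" by (simp add: c_def distrib_left)
          hence "(1 + \<bar>x / \<sigma>\<bar>) powr p \<le> (c * (1 + \<bar>x\<bar>)) powr p" by (intro powr_mono2) (auto simp: p_def)
          also have "\<dots> = c powr p * (1 + \<bar>x\<bar>) powr p" by (rule powr_mult)
          finally have "(1 + \<bar>x / \<sigma>\<bar>) powr p \<le> c powr p * (1 + \<bar>x\<bar>) powr p" .
          moreover have "(1 + \<bar>x / \<sigma>\<bar>) powr q \<le> (1 + \<bar>x / \<sigma>\<bar>) powr p" by (intro powr_mono) (auto simp: p_def)
          ultimately have "(1 + \<bar>x / \<sigma>\<bar>) powr q * g x \<le> c powr p * (1 + \<bar>x\<bar>) powr p * g x"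
            using g0[of x] by (intro mult_right_mono) auto
          thus "norm (g x * (1 + \<bar>x / \<sigma>\<bar>) powr q) \<le> norm (c powr p * ((1 + \<bar>x\<bar>) powr p * g x))"
            using g0[of x] by (simp add: mult_ac)
        qed
      qed (use q in \<open>auto simp: p_def\<close>)
    qed auto
    show "(\<integral>x. x \<partial>?S) = 0"
    proof -
      have "(\<integral>x. x \<partial>?S) = (\<integral>x. 1 / \<sigma> * (x * g x) \<partial>lborel)"
        by (subst integral_scaled_law(1)[OF ctx]) (auto simp: mult_ac)
      also have "\<dots> = 0" by (subst integral_mult_right_zero) (simp add: gmean)
      finally show ?thesis .
    qed
    show "(\<integral>x. x\<^sup>2 \<partial>?S) = 1"
    proof -
      have "(\<integral>x. x\<^sup>2 \<partial>?S) = (\<integral>x. 1 / m * (x\<^sup>2 * g x) \<partial>lborel)"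
        using \<sigma> by (subst integral_scaled_law(1)[OF ctx]) (auto simp: power_divide mult_ac)
      also have "\<dots> = 1 / m * m" by (subst integral_mult_right_zero) (simp add: m_def)
      finally show ?thesis using m0 by simp
    qed
    fix \<phi> :: "real \<Rightarrow> real" assume \<phi>: "\<phi> \<in> C1_bounded"
    obtain D where D: "\<And>x. (\<phi> has_real_derivative D x) (at x)" "continuous_on UNIV D"
      using \<phi> unfolding C1_bounded_def C1_differentiable_on_def
      by (auto simp: has_real_derivative_iff_has_vector_derivative)
    have dD: "deriv \<phi> = D" using D(1) DERIV_imp_deriv by blast
    obtain B where B: "\<And>x. \<bar>\<phi> x\<bar> \<le> B" using \<phi> by (auto simp: C1_bounded_def bounded_iff)
    obtain B' where B': "\<And>x. \<bar>D x\<bar> \<le> B'" using \<phi> by (auto simp: C1_bounded_def bounded_iff dD)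
    have \<phi>m[measurable]: "\<phi> \<in> borel_measurable borel"
      using D(1) by (meson DERIV_isCont borel_measurable_continuous_onI continuous_at_imp_continuous_on)
    have Dm[measurable]: "D \<in> borel_measurable borel" using D(2) by (rule borel_measurable_continuous_onI)
    \<comment> \<open>The equation for G tested with the dilated function \<phi>(x/\<sigma>) is the
      equation of the scaled law tested with \<phi>: the drift is unchanged and the homogeneous
      kernel yields the factor s.\<close>
    define \<eta> where "\<eta> x = \<phi> (x / \<sigma>)" for x
    have d\<eta>: "(\<eta> has_real_derivative D (x / \<sigma>) / \<sigma>) (at x)" for x
    proof -
      have "((\<lambda>x. x / \<sigma>) has_real_derivative 1 / \<sigma>) (at x)" using \<sigma> by (auto intro!: derivative_eq_intros)
      from DERIV_chain2[OF D(1) this] show ?thesis unfolding \<eta>_def by simp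
    qed
    have c1: "continuous_on UNIV (\<lambda>x. D (x / \<sigma>) / \<sigma>)"
      using \<sigma> by (intro continuous_intros continuous_on_compose2[OF D(2)]) auto
    have c2: "\<bar>D (x / \<sigma>) / \<sigma>\<bar> \<le> B' / \<sigma>" for x using B' \<sigma> by (simp add: divide_right_mono)
    have \<eta>: "\<eta> \<in> C1_bounded" "deriv \<eta> = (\<lambda>x. D (x / \<sigma>) / \<sigma>)"
      using C1_boundedI[OF d\<eta> c1 _ c2, of B] B by (auto simp: \<eta>_def)
    have [measurable]: "\<eta> \<in> borel_measurable borel" unfolding \<eta>_def[abs_def] by measurable
    have L: "(LINT x|lebesgue. x * deriv \<eta> x * G x) = (\<integral>x. x * deriv \<phi> x \<partial>?S)"
    proof -
      have "(LINT x|lebesgue. x * deriv \<eta> x * G x) = (\<integral>x. x * (D (x / \<sigma>) / \<sigma>) * g x \<partial>lborel)"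
        unfolding \<eta>(2) by (rule trans(1)) measurable
      also have "\<dots> = (\<integral>x. x * D x \<partial>?S)"
        by (subst integral_scaled_law(1)[OF ctx]) (auto simp: mult_ac)
      finally show ?thesis by (simp add: dD)
    qed
    define q where "q = (\<lambda>(x, y). (2 * \<phi> ((x + y) / 2) - \<phi> x - \<phi> y) * \<bar>x - y\<bar> powr \<gamma>)"
    have qm: "q \<in> borel_measurable (borel \<Otimes>\<^sub>M borel)" unfolding q_def by measurable
    define E where "E = (\<lambda>(x, y). (2 * \<eta> ((x + y) / 2) - \<eta> x - \<eta> y) * \<bar>x - y\<bar> powr \<gamma>)"
    have Em: "E \<in> borel_measurable (lborel \<Otimes>\<^sub>M lborel)" unfolding E_def by measurable
    have Eq: "E (x, y) = s * q (x / \<sigma>, y / \<sigma>)" for x y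
    proof -
      have "\<bar>x - y\<bar> powr \<gamma> = s * \<bar>x / \<sigma> - y / \<sigma>\<bar> powr \<gamma>"
      proof -
        have "\<bar>x - y\<bar> = \<sigma> * \<bar>x / \<sigma> - y / \<sigma>\<bar>" using \<sigma> by (simp add: diff_divide_distrib[symmetric])
        thus ?thesis by (simp add: s_def powr_mult)
      qed
      moreover have "(x + y) / 2 / \<sigma> = (x / \<sigma> + y / \<sigma>) / 2" by (simp add: add_divide_distrib)
      ultimately show ?thesis by (simp only: E_def q_def \<eta>_def prod.case mult_ac)
    qed
    have R: "Q_weak \<gamma> G G \<eta> = s / 2 * (\<integral>z. q z \<partial>(?S \<Otimes>\<^sub>M ?S))"
    proof -
      define P where "P = (\<lambda>z. G (fst z) * G (snd z) * E z)"
      define p where "p = (\<lambda>z. g (fst z) * g (snd z) * E z)"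
      have pm: "p \<in> borel_measurable (lborel \<Otimes>\<^sub>M lborel)" unfolding p_def using Em by measurable
      note Eml = lebesgue_prod_measurable[OF Em]
      have Pm: "P \<in> borel_measurable (lebesgue \<Otimes>\<^sub>M lebesgue)"
        unfolding P_def by (intro borel_measurable_times Eml measurable_compose[OF measurable_fst Gm] measurable_compose[OF measurable_snd Gm])
      have "AE z in lborel \<Otimes>\<^sub>M lborel. P z = p z"
        using AE_lborel_pair[OF ae] by eventually_elim (simp add: P_def p_def)
      from lebesgue_prod_eq[OF Pm pm this]
      have "(LINT z|(lebesgue \<Otimes>\<^sub>M lebesgue). P z) = (LINT z|(lborel \<Otimes>\<^sub>M lborel). p z)" .
      moreover have "Q_weak \<gamma> G G \<eta> = 1/2 * (LINT z|(lebesgue \<Otimes>\<^sub>M lebesgue). P z)"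
        unfolding Q_weak_def P_def E_def by (simp add: split_beta' mult.assoc)
      moreover have "(LINT z|(lborel \<Otimes>\<^sub>M lborel). p z) = (\<integral>z. s * (case z of (x, y) \<Rightarrow> g x * g y * q (x / \<sigma>, y / \<sigma>)) \<partial>(lborel \<Otimes>\<^sub>M lborel))"
        by (intro Bochner_Integration.integral_cong refl) (auto simp: p_def Eq mult_ac)
      moreover have "\<dots> = s * (\<integral>z. q z \<partial>(?S \<Otimes>\<^sub>M ?S))"
        by (subst integral_mult_right_zero, subst integral_scaled_law_prod[OF ctx qm]) simp
      ultimately show ?thesis by simp
    qed
    show "- (1/4) * (\<integral>x. x * deriv \<phi> x \<partial>?S) = s / 2 * (\<integral>(x, y). (2 * \<phi> ((x + y) / 2) - \<phi> x - \<phi> y) * \<bar>x - y\<bar> powr \<gamma> \<partial>(?S \<Otimes>\<^sub>M ?S))"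
      using Gw[OF \<eta>(1)] unfolding L R q_def .
  qed
  thus ?thesis using that[of g s] gm g0 ig g1 ae s by simp
qed

section \<open>Uniform bounds for steady states\<close>

lemma two_powr_less:
  fixes u :: real
  assumes u: "0 < u" "u < 1"
  shows "2 powr (- u) < 1 - u / 2"
proof -
  \<comment> \<open>\<open>powr_le_affine\<close> is not strict. Writing 2^(-u) as the square of t^u
    with t^2 = 1/2 gains strictness from u^2 < u after squaring.\<close>
  define t where "t = 1 / sqrt 2"
  have t: "0 < t" "t\<^sup>2 = 1 / 2" "t < 1" by (auto simp: t_def power_divide)
  have "2 powr (- u) = (1 / 2) powr u" by (simp add: powr_minus powr_divide field_simps)
  also have "\<dots> = (t powr u)\<^sup>2" using t by (simp add: power2_eq_square powr_mult flip: t(2))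
  also have "\<dots> \<le> (1 + u * (t - 1))\<^sup>2" using powr_le_affine[of t u] t u by (intro power_mono) auto
  also have "\<dots> = 1 - 2 * u * (1 - t) + u * (u * (1 - t)\<^sup>2)" by (simp add: power2_eq_square algebra_simps)
  also have "\<dots> < 1 - 2 * u * (1 - t) + u * (1 - t)\<^sup>2" using u t by simp
  also have "\<dots> = 1 - u * (1 - t\<^sup>2)" by (simp add: power2_eq_square algebra_simps)
  also have "\<dots> = 1 - u / 2" using t by simp
  finally show ?thesis .
qed

text \<open>\<sigma> = exp(ln s / \<gamma>) stays away from 0 because 1 - s is of order \<gamma>.
  With e = 13K\<gamma>, where 13K = 83252 is rounded up to 100000, the threshold keeps e \<le> 1/2,
  so that ln s \<ge> ln(1 - e) \<ge> -2e \<ge> -200000 \<gamma>.\<close>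

lemma (in small_profile) scale_bounds:
  assumes g: "\<gamma> \<le> 1/200000"
  shows "s powr (1 / \<gamma>) \<le> 1" "exp (- 200000) \<le> s powr (1 / \<gamma>)"
proof -
  show "s powr (1 / \<gamma>) \<le> 1" using powr_mono2[of "1 / \<gamma>" s 1] s_le_1 s_pos gamma_pos by simp
  define e where "e = 13 * K * \<gamma>"
  have e: "0 \<le> e" "e \<le> 1/2" "e \<le> 100000 * \<gamma>" using g gamma_pos by (auto simp: e_def K_def)
  have "e * (2 * e) \<le> e * 1" using e by (intro mult_left_mono) auto
  hence "- (2 * e) \<le> - e - 2 * e\<^sup>2" by (simp add: power2_eq_square)
  also have "\<dots> \<le> ln (1 - e)" using e by (intro ln_one_minus_pos_lower_bound) auto
  also have "\<dots> \<le> ln s" using one_minus_s e by (intro ln_mono) (auto simp: e_def)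
  finally have "- 200000 * \<gamma> \<le> ln s" using e by linarith
  hence "- 200000 \<le> ln s / \<gamma>" using gamma_pos by (simp add: pos_le_divide_eq)
  hence "exp (- 200000) \<le> exp (ln s / \<gamma>)" by simp
  also have "\<dots> = s powr (1 / \<gamma>)" using s_pos by (simp add: powr_def)
  finally show "exp (- 200000) \<le> s powr (1 / \<gamma>)" .
qed

text \<open>d is the bracket of \<open>moment_bound\<close> at \<gamma> = 0. The factor 1/(1 +
  5\<gamma>) lowers it by at most 10\<gamma> \<le> d/2, and 16 / (d/2) = 32/d.\<close>

lemma (in profile) moment_bound_uniform:
  fixes d k :: real
  assumes k: "2 \<le> k" "k + \<gamma> < 3" and d: "d = 2 * (1 - 2 powr (1 - k)) - k / 2" "0 < d" "\<gamma> \<le> d / 20"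
  shows "Mp k \<le> 32 / d"
proof -
  define c where "c = 1 - 2 powr (1 - k)"
  have c: "0 \<le> c" "c \<le> 1" using k powr_mono[of "1 - k" 0 2] by (auto simp: c_def)
  have "(1 - 5 * \<gamma>) * (1 + 5 * \<gamma>) \<le> 1" by (simp add: algebra_simps)
  hence "1 - 5 * \<gamma> \<le> 1 / (1 + 5 * \<gamma>)" using gamma_pos by (simp add: pos_le_divide_eq)
  hence "2 * c * (1 - 5 * \<gamma>) \<le> 2 * c * (1 / (1 + 5 * \<gamma>))" using c by (intro mult_left_mono) auto
  moreover have "c * \<gamma> \<le> 1 * \<gamma>" using c gamma_pos by (intro mult_right_mono) auto
  ultimately have "d / 2 \<le> 2 * c / (1 + 5 * \<gamma>) - k / 2" using d by (simp add: c_def[symmetric] algebra_simps)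
  moreover have "0 \<le> Mp k" by (intro Bochner_Integration.integral_nonneg) auto
  ultimately have "Mp k * (d / 2) \<le> Mp k * (2 * c / (1 + 5 * \<gamma>) - k / 2)" by (intro mult_left_mono) auto
  also have "\<dots> \<le> 16" using moment_bound[OF k] by (simp add: c_def)
  finally show ?thesis using d(2) by (simp add: pos_le_divide_eq mult_ac)
qed

text \<open>Any exponent below 3 serves, since membership in a weighted space includes
  measurability.\<close>

lemma steady_states_measurable: "G \<in> steady_states \<gamma> \<Longrightarrow> G \<in> borel_measurable lebesgue"
  using lt_ex[of "3 :: real"] by (auto simp: steady_states_def L1_weight_def)

lemma steady_states_bounded:
  assumes \<delta>: "0 < \<delta>" "\<delta> < 1/2"
  obtains C \<gamma>\<^sub>1 where "0 < C" "0 < \<gamma>\<^sub>1" "\<gamma>\<^sub>1 < 1"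
    "\<And>\<gamma> G. 0 < \<gamma> \<Longrightarrow> \<gamma> < \<gamma>\<^sub>1 \<Longrightarrow> G \<in> steady_states \<gamma> \<Longrightarrow>
       G \<in> L2 \<and> L2_norm G \<le> C \<and> (\<forall>k\<in>{0<..<3 - \<delta>}. moment k G \<le> C)"
proof -
  obtain R \<gamma>\<^sub>0 where R: "1 \<le> R" and \<gamma>\<^sub>0: "0 < \<gamma>\<^sub>0" "\<gamma>\<^sub>0 \<le> 1/500"
    and dec: "\<And>M s \<gamma> \<xi>. profile M s \<gamma> \<Longrightarrow> \<gamma> < \<gamma>\<^sub>0 \<Longrightarrow> R \<le> \<bar>\<xi>\<bar> \<Longrightarrow> cmod (char M \<xi>) \<le> 1/8"
    and sig: "\<And>M s \<gamma> x. profile M s \<gamma> \<Longrightarrow> \<gamma> < \<gamma>\<^sub>0 \<Longrightarrow> 1/2 \<le> (\<integral>y. \<bar>x - y\<bar> powr \<gamma> \<partial>M)"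
    by (rule uniform_decay) blast
  define k\<^sub>0 where "k\<^sub>0 = 3 - \<delta>"
  define d where "d = 2 * (1 - 2 powr (1 - k\<^sub>0)) - k\<^sub>0 / 2"
  have d0: "0 < d"
  proof -
    have "2 powr (1 - k\<^sub>0) = 2 powr (- (1 - \<delta>)) / 2" by (simp add: k\<^sub>0_def powr_diff powr_minus field_simps)
    also have "\<dots> < (1 - (1 - \<delta>) / 2) / 2" using two_powr_less[of "1 - \<delta>"] \<delta> by simp
    finally have "4 * 2 powr (1 - k\<^sub>0) < k\<^sub>0 * (- 1) + 4" unfolding k\<^sub>0_def by (simp only: field_simps) simp
    thus ?thesis by (simp add: d_def)
  qed
  define \<gamma>\<^sub>1 where "\<gamma>\<^sub>1 = min (min \<gamma>\<^sub>0 \<delta>) (min (d / 20) (1/200000))"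
  define C where "C = 5 * R * exp 200000"
  define C' where "C' = sqrt C + 1 + 32 / d"
  have C0: "0 \<le> C" using R by (simp add: C_def)
  show ?thesis
  proof
    show "0 < C'" using C0 d0 by (simp add: C'_def add_nonneg_pos)
    show "0 < \<gamma>\<^sub>1" "\<gamma>\<^sub>1 < 1" using \<gamma>\<^sub>0 \<delta> d0 by (auto simp: \<gamma>\<^sub>1_def)
    fix \<gamma> G assume \<gamma>: "0 < \<gamma>" "\<gamma> < \<gamma>\<^sub>1" and G: "G \<in> steady_states \<gamma>"
    have "\<gamma> < 1" using \<gamma> by (simp add: \<gamma>\<^sub>1_def)
    then obtain g s where gm[measurable]: "g \<in> borel_measurable borel" and g0: "\<And>x. 0 \<le> g x" and gi: "integrable lborel g"
      and g1: "(\<integral>x. g x \<partial>lborel) = 1" and ae: "AE x in lborel. G x = g x" and s: "0 < s"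
      and pr: "profile (scaled_law g (s powr (1 / \<gamma>))) s \<gamma>"
      using steady_profile[OF \<gamma>(1) _ G] by blast
    define \<sigma> where "\<sigma> = s powr (1 / \<gamma>)"
    have \<sigma>: "0 < \<sigma>" using s by (simp add: \<sigma>_def)
    note ctx = gm g0 gi g1 \<sigma>
    interpret small_profile "scaled_law g \<sigma>" s \<gamma>
      using pr \<gamma> \<gamma>\<^sub>0 by (auto simp: small_profile_def small_profile_axioms_def \<sigma>_def \<gamma>\<^sub>1_def)
    have prof: "profile (scaled_law g \<sigma>) s \<gamma>" by unfold_locales
    have \<sigma>b: "\<sigma> \<le> 1" "exp (- 200000) \<le> \<sigma>" unfolding \<sigma>_def using \<gamma> by (auto intro!: scale_bounds simp: \<gamma>\<^sub>1_def)
    have Gm[measurable]: "G \<in> borel_measurable lebesgue"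
      using G by (rule steady_states_measurable)
    have gf: "a / sqrt (2 * pi) * gauss_form a g g \<le> C" if a: "0 < a" for a
    proof -
      have "gauss_form a g g \<le> 5 * R / (a * \<sigma>)"
        unfolding gauss_form_scaled_law[OF ctx]
        using a \<sigma> R \<gamma> by (intro energy_estimate dec[OF prof] sig[OF prof]) (auto simp: \<gamma>\<^sub>1_def)
      hence "a / sqrt (2 * pi) * gauss_form a g g \<le> a / sqrt (2 * pi) * (5 * R / (a * \<sigma>))"
        using a by (intro mult_left_mono) auto
      also have "\<dots> = (1 / sqrt (2 * pi)) * (5 * R * (1 / \<sigma>))" using a \<sigma> by (simp add: field_simps)
      also have "\<dots> \<le> 1 * (5 * R * exp 200000)"
      proof (intro mult_mono)
        have "1 \<le> 2 * pi" using pi_ge_two by linarith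
        thus "1 / sqrt (2 * pi) \<le> 1" by simp
        show "1 / \<sigma> \<le> exp 200000" using \<sigma>b(2) \<sigma> by (simp add: exp_minus field_simps)
      qed (use R \<sigma> in auto)
      finally show ?thesis by (simp add: C_def)
    qed
    note L2 = L2_from_gauss_form[OF gi g0 gf]
    have G2m: "(\<lambda>x. (G x)\<^sup>2) \<in> borel_measurable lebesgue" by measurable
    have ae2: "AE x in lborel. (G x)\<^sup>2 = (g x)\<^sup>2" using ae by eventually_elim simp
    have g2m: "(\<lambda>x. (g x)\<^sup>2) \<in> borel_measurable borel" by measurable
    note e2 = lebesgue_lborel_eq[OF G2m g2m ae2]
    have "G \<in> L2" using e2(2) L2(1) Gm by (simp add: L2_def)
    moreover have "L2_norm G \<le> C'"
    proof -
      have "L2_norm G \<le> sqrt C" unfolding L2_norm_def e2(1) using L2(2) by simp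
      thus ?thesis using d0 by (simp add: C'_def add_increasing2)
    qed
    moreover have "moment k G \<le> C'" if k: "0 < k" "k < 3 - \<delta>" for k
    proof -
      have pm: "(\<lambda>x::real. \<bar>x\<bar> powr k) \<in> borel_measurable lebesgue"
        by (rule measurable_completion) simp
      have Gk: "(\<lambda>x. G x * \<bar>x\<bar> powr k) \<in> borel_measurable lebesgue" using Gm pm by (rule borel_measurable_times)
      have aek: "AE x in lborel. G x * \<bar>x\<bar> powr k = g x * \<bar>x\<bar> powr k" using ae by eventually_elim simp
      have gk: "(\<lambda>x. g x * \<bar>x\<bar> powr k) \<in> borel_measurable borel" by measurable
      have k0: "2 \<le> k\<^sub>0" "k\<^sub>0 + \<gamma> < 3" "k\<^sub>0 < 3" "0 \<le> k\<^sub>0" using \<delta> \<gamma> by (auto simp: k\<^sub>0_def \<gamma>\<^sub>1_def)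
      have "moment k G = (\<integral>x. g x * \<bar>\<sigma> * (x / \<sigma>)\<bar> powr k \<partial>lborel)"
        unfolding moment_def lebesgue_lborel_eq(1)[OF Gk gk aek] using \<sigma> by simp
      also have "\<dots> = (\<integral>x. \<bar>\<sigma> * x\<bar> powr k \<partial>scaled_law g \<sigma>)"
        by (subst integral_scaled_law(1)[OF ctx]) auto
      also have "\<dots> \<le> (\<integral>x. 1 + \<bar>x\<bar> powr k\<^sub>0 \<partial>scaled_law g \<sigma>)"
      proof (rule integral_mono_AE')
        show "AE x in scaled_law g \<sigma>. \<bar>\<sigma> * x\<bar> powr k \<le> 1 + \<bar>x\<bar> powr k\<^sub>0"
        proof (intro AE_I2)
          fix x :: real
          have "\<bar>\<sigma> * x\<bar> \<le> 1 * \<bar>x\<bar>" using \<sigma> \<sigma>b by (simp only: abs_mult) (intro mult_right_mono, auto)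
          hence "\<bar>\<sigma> * x\<bar> powr k \<le> \<bar>x\<bar> powr k" using k by (intro powr_mono2) auto
          also have "\<dots> \<le> 1 + \<bar>x\<bar> powr k\<^sub>0"
          proof (cases "\<bar>x\<bar> \<le> 1")
            case True
            hence "\<bar>x\<bar> powr k \<le> 1" using powr_mono2[of k "\<bar>x\<bar>" 1] k by simp
            thus ?thesis by (simp add: add_increasing2)
          next
            case False
            hence "\<bar>x\<bar> powr k \<le> \<bar>x\<bar> powr k\<^sub>0" using k by (intro powr_mono) (auto simp: k\<^sub>0_def)
            thus ?thesis by simp
          qed
          finally show "\<bar>\<sigma> * x\<bar> powr k \<le> 1 + \<bar>x\<bar> powr k\<^sub>0" .
        qed
      qed (use integrable_abs_powr[of k\<^sub>0] k0 in \<open>auto simp: add_nonneg_nonneg\<close>)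
      also have "\<dots> = 1 + (\<integral>x. \<bar>x\<bar> powr k\<^sub>0 \<partial>scaled_law g \<sigma>)"
        using integrable_abs_powr[of k\<^sub>0] k0 prob_space by simp
      also have "\<dots> \<le> 1 + 32 / d"
        using moment_bound_uniform[OF k0(1,2) d_def d0] \<gamma> by (simp add: \<gamma>\<^sub>1_def)
      finally show ?thesis using real_sqrt_ge_zero[OF C0] unfolding C'_def by linarith
    qed
    ultimately show "G \<in> L2 \<and> L2_norm G \<le> C' \<and> (\<forall>k\<in>{0<..<3 - \<delta>}. moment k G \<le> C')" by auto
  qed
qed

lemma lambda0_ge_1: "1 \<le> lambda0"
  using I0_pos by (simp add: lambda0_def)

lemma G0_measurable [measurable]: "G0 \<in> borel_measurable borel"
  unfolding G0_def[abs_def] by measurable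

lemma G0_integral:
  fixes \<phi> :: "real \<Rightarrow> real"
  assumes [measurable]: "\<phi> \<in> borel_measurable borel"
  shows "(LINT x|lebesgue. G0 x * \<phi> x) = (\<integral>x. \<phi> (x / lambda0) \<partial>Hm)"
proof -
  have l: "0 < lambda0" using lambda0_ge_1 by simp
  have m: "(\<lambda>x. G0 x * \<phi> x) \<in> borel_measurable borel" by measurable
  have "(LINT x|lebesgue. G0 x * \<phi> x) = (\<integral>x. G0 x * \<phi> x \<partial>lborel)"
    using lebesgue_lborel_eq(1)[OF measurable_completion m] m by simp
  also have "\<dots> = lambda0 * (\<integral>x. H (lambda0 * x) * \<phi> (lambda0 * x / lambda0) \<partial>lborel)"
    using l by (simp add: G0_def mult.assoc)
  also have "\<dots> = (\<integral>x. H x * \<phi> (x / lambda0) \<partial>lborel)"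
    using l by (subst (2) lborel_integral_real_affine[of lambda0 _ 0]) auto
  also have "\<dots> = (\<integral>x. \<phi> (x / lambda0) \<partial>Hm)"
    by (subst integral_density) (auto simp: H_bounds)
  finally show ?thesis .
qed

lemma G0_integrable: "integrable lborel G0"
proof -
  have "0 < lambda0" using lambda0_ge_1 by simp
  hence "integrable lborel (\<lambda>x. H (0 + lambda0 * x))"
    by (subst lborel_integrable_real_affine_iff) (auto intro: H_integrable)
  thus ?thesis unfolding G0_def[abs_def] by simp
qed

lemma G0_L2: "G0 \<in> L2"
proof -
  have l: "0 \<le> lambda0" using lambda0_ge_1 by simp
  have m: "(\<lambda>x. (G0 x)\<^sup>2) \<in> borel_measurable borel" by measurable
  have "integrable lborel (\<lambda>x. (G0 x)\<^sup>2)"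
  proof (rule Bochner_Integration.integrable_bound[OF integrable_mult_right[OF G0_integrable, of lambda0]])
    show "AE x in lborel. norm ((G0 x)\<^sup>2) \<le> norm (lambda0 * G0 x)"
    proof (intro AE_I2)
      fix x
      have "0 \<le> G0 x" "G0 x \<le> lambda0" using H_bounds[of "lambda0 * x"] l by (auto simp: G0_def mult_left_le)
      thus "norm ((G0 x)\<^sup>2) \<le> norm (lambda0 * G0 x)" using l by (simp add: power2_eq_square mult_right_mono)
    qed
  qed measurable
  have l2: "(\<lambda>x. (G0 x)\<^sup>2) \<in> borel_measurable lebesgue" and l1: "G0 \<in> borel_measurable lebesgue"
    by (rule measurable_completion, simp)+
  have "integrable lebesgue (\<lambda>x. (G0 x)\<^sup>2)"
    by (rule lebesgue_lborel_eq(2)[OF l2 m AE_I2[OF refl], THEN iffD2]) fact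
  thus ?thesis using l1 unfolding L2_def by blast
qed

lemma G0_moment_le:
  assumes k: "0 < k" "k < q" and q: "q < 3"
  shows "moment k G0 \<le> (\<integral>x. (1 + \<bar>x\<bar>) powr q \<partial>Hm)"
proof -
  have "moment k G0 = (\<integral>x. \<bar>x / lambda0\<bar> powr k \<partial>Hm)"
    unfolding moment_def by (rule G0_integral) measurable
  also have "\<dots> \<le> (\<integral>x. (1 + \<bar>x\<bar>) powr q \<partial>Hm)"
  proof (rule integral_mono_AE'[OF Hm_moments[OF q]])
    show "AE x in Hm. \<bar>x / lambda0\<bar> powr k \<le> (1 + \<bar>x\<bar>) powr q"
    proof (intro AE_I2)
      fix x :: real
      have "\<bar>x / lambda0\<bar> \<le> \<bar>x\<bar> / 1" using lambda0_ge_1 by (simp only: abs_divide) (intro divide_left_mono, auto)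
      hence "\<bar>x / lambda0\<bar> powr k \<le> (1 + \<bar>x\<bar>) powr k" using k by (intro powr_mono2) auto
      also have "\<dots> \<le> (1 + \<bar>x\<bar>) powr q" using k by (intro powr_mono) auto
      finally show "\<bar>x / lambda0\<bar> powr k \<le> (1 + \<bar>x\<bar>) powr q" .
    qed
  qed auto
  finally show ?thesis .
qed

lemma steady_states_weak_limit:
  fixes G :: "real \<Rightarrow> real \<Rightarrow> real" and \<phi> :: "real \<Rightarrow> real"
  assumes G: "\<And>\<gamma>. 0 < \<gamma> \<Longrightarrow> \<gamma> < 1 \<Longrightarrow> G \<gamma> \<in> steady_states \<gamma>"
    and \<phi>: "continuous_on UNIV \<phi>" and B: "\<And>x. \<bar>\<phi> x\<bar> \<le> B"
  shows "((\<lambda>\<gamma>. LINT x|lebesgue. G \<gamma> x * \<phi> x) \<longlongrightarrow> (LINT x|lebesgue. G0 x * \<phi> x)) (at_right 0)"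
  unfolding tendsto_at_iff_sequentially
proof (intro allI impI)
  fix X :: "nat \<Rightarrow> real" assume X: "\<forall>i. X i \<in> {0<..} - {0}" and lim: "X \<longlonglongrightarrow> 0"
  have \<phi>m[measurable]: "\<phi> \<in> borel_measurable borel" using \<phi> by (rule borel_measurable_continuous_onI)
  have "eventually (\<lambda>n. X n < 1/500) sequentially" using lim by (rule order_tendstoD) simp
  then obtain m where m: "\<And>n. m \<le> n \<Longrightarrow> X n < 1/500" by (auto simp: eventually_sequentially)
  define Y where "Y n = X (n + m)" for n
  have Y: "0 < Y n" "Y n \<le> 1/500" for n using X m[of "n + m"] by (auto simp: Y_def less_imp_le)
  have Y1: "Y n < 1" for n using Y(2)[of n] by simp
  have Ylim: "Y \<longlonglongrightarrow> 0" unfolding Y_def using lim by (rule LIMSEQ_ignore_initial_segment)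
  have "\<exists>M s. profile M s (Y n) \<and> (LINT x|lebesgue. G (Y n) x * \<phi> x) = (\<integral>x. \<phi> (s powr (1 / Y n) * x) \<partial>M)" for n
  proof -
    have Gs: "G (Y n) \<in> steady_states (Y n)" using G Y(1) Y1 by blast
    obtain g s where gm[measurable]: "g \<in> borel_measurable borel" and g0: "\<And>x. 0 \<le> g x" and gi: "integrable lborel g"
      and g1: "(\<integral>x. g x \<partial>lborel) = 1" and ae: "AE x in lborel. G (Y n) x = g x" and s: "0 < s"
      and pr: "profile (scaled_law g (s powr (1 / Y n))) s (Y n)"
      using steady_profile[OF Y(1) Y1 Gs] by blast
    define \<sigma> where "\<sigma> = s powr (1 / Y n)"
    have \<sigma>: "0 < \<sigma>" using s by (simp add: \<sigma>_def)
    have Gm: "G (Y n) \<in> borel_measurable lebesgue" using Gs by (rule steady_states_measurable)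
    have a: "(\<lambda>x. G (Y n) x * \<phi> x) \<in> borel_measurable lebesgue"
      using Gm by (intro borel_measurable_times) (auto intro: measurable_completion)
    have b: "(\<lambda>x. g x * \<phi> x) \<in> borel_measurable borel" by measurable
    have c: "AE x in lborel. G (Y n) x * \<phi> x = g x * \<phi> x" using ae by eventually_elim simp
    have "(LINT x|lebesgue. G (Y n) x * \<phi> x) = (\<integral>x. g x * \<phi> (\<sigma> * (x / \<sigma>)) \<partial>lborel)"
      unfolding lebesgue_lborel_eq(1)[OF a b c] using \<sigma> by simp
    also have "\<dots> = (\<integral>x. \<phi> (\<sigma> * x) \<partial>scaled_law g \<sigma>)"
      by (subst integral_scaled_law(1)[OF gm g0 gi g1 \<sigma>]) auto
    finally show ?thesis using pr unfolding \<sigma>_def by blast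
  qed
  then obtain M s where M: "\<And>n. profile (M n) (s n) (Y n)"
    and e: "\<And>n. (LINT x|lebesgue. G (Y n) x * \<phi> x) = (\<integral>x. \<phi> (s n powr (1 / Y n) * x) \<partial>M n)"
    by metis
  have "(\<lambda>n. LINT x|lebesgue. G (Y n) x * \<phi> x) \<longlonglongrightarrow> (LINT x|lebesgue. G0 x * \<phi> x)"
    unfolding e G0_integral[OF \<phi>m] by (rule profile_weak_limit[OF M Y(2) Ylim \<phi> B])
  hence "(\<lambda>n. LINT x|lebesgue. G (X n) x * \<phi> x) \<longlonglongrightarrow> (LINT x|lebesgue. G0 x * \<phi> x)"
    unfolding Y_def by (rule LIMSEQ_offset)
  thus "((\<lambda>\<gamma>. LINT x|lebesgue. G \<gamma> x * \<phi> x) \<circ> X) \<longlonglongrightarrow> (LINT x|lebesgue. G0 x * \<phi> x)"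
    by (simp add: comp_def)
qed

theorem theorem1p4:
  shows "I0 H H > 0 \<and>
    (\<forall>(G :: real \<Rightarrow> real \<Rightarrow> real) (\<phi> :: real \<Rightarrow> real).
       (\<forall>\<gamma>\<in>{0<..<1}. G \<gamma> \<in> steady_states \<gamma>) \<longrightarrow>
       continuous_on UNIV \<phi> \<longrightarrow> bounded (range \<phi>) \<longrightarrow>
       ((\<lambda>\<gamma>. LINT x|lebesgue. G \<gamma> x * \<phi> x) \<longlongrightarrow> (LINT x|lebesgue. G0 x * \<phi> x)) (at_right 0)) \<and>
    (\<forall>\<delta>\<in>{0<..<1/2 :: real}. \<exists>C\<^sub>0>0. \<exists>\<gamma>\<^sub>1\<in>{0<..<1}. \<forall>\<gamma>\<in>{0..<\<gamma>\<^sub>1}. \<forall>G.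
       (if \<gamma> = 0 then G = G0 else G \<in> steady_states \<gamma>) \<longrightarrow>
       G \<in> L2 \<and> L2_norm G \<le> C\<^sub>0 \<and> (\<forall>k\<in>{0<..<3 - \<delta>}. moment k G \<le> C\<^sub>0))"
proof (intro conjI allI impI ballI)
  show "I0 H H > 0" by (rule I0_pos)
next
  fix G :: "real \<Rightarrow> real \<Rightarrow> real" and \<phi> :: "real \<Rightarrow> real"
  assume G: "\<forall>\<gamma>\<in>{0<..<1}. G \<gamma> \<in> steady_states \<gamma>" and \<phi>: "continuous_on UNIV \<phi>" "bounded (range \<phi>)"
  obtain B where B: "\<And>x. \<bar>\<phi> x\<bar> \<le> B" using \<phi>(2) by (auto simp: bounded_iff)
  show "((\<lambda>\<gamma>. LINT x|lebesgue. G \<gamma> x * \<phi> x) \<longlongrightarrow> (LINT x|lebesgue. G0 x * \<phi> x)) (at_right 0)"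
    using G by (intro steady_states_weak_limit[OF _ \<phi>(1) B]) auto
next
  fix \<delta> :: real assume "\<delta> \<in> {0<..<1/2}"
  hence \<delta>: "0 < \<delta>" "\<delta> < 1/2" by auto
  obtain C \<gamma>\<^sub>1 where C: "0 < C" "0 < \<gamma>\<^sub>1" "\<gamma>\<^sub>1 < 1"
    "\<And>\<gamma> G. 0 < \<gamma> \<Longrightarrow> \<gamma> < \<gamma>\<^sub>1 \<Longrightarrow> G \<in> steady_states \<gamma> \<Longrightarrow>
       G \<in> L2 \<and> L2_norm G \<le> C \<and> (\<forall>k\<in>{0<..<3 - \<delta>}. moment k G \<le> C)"
    by (rule steady_states_bounded[OF \<delta>]) blast
  define C\<^sub>0 where "C\<^sub>0 = max C (max (L2_norm G0) (\<integral>x. (1 + \<bar>x\<bar>) powr (3 - \<delta>) \<partial>Hm))"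
  show "\<exists>C\<^sub>0>0. \<exists>\<gamma>\<^sub>1\<in>{0<..<1}. \<forall>\<gamma>\<in>{0..<\<gamma>\<^sub>1}. \<forall>G.
       (if \<gamma> = 0 then G = G0 else G \<in> steady_states \<gamma>) \<longrightarrow>
       G \<in> L2 \<and> L2_norm G \<le> C\<^sub>0 \<and> (\<forall>k\<in>{0<..<3 - \<delta>}. moment k G \<le> C\<^sub>0)"
  proof (rule exI[of _ C\<^sub>0], rule conjI, use C(1) in \<open>simp add: C\<^sub>0_def\<close>, rule bexI[of _ \<gamma>\<^sub>1], intro ballI allI impI)
    fix \<gamma> G assume \<gamma>: "\<gamma> \<in> {0..<\<gamma>\<^sub>1}" and G: "if \<gamma> = 0 then G = G0 else G \<in> steady_states \<gamma>"
    show "G \<in> L2 \<and> L2_norm G \<le> C\<^sub>0 \<and> (\<forall>k\<in>{0<..<3 - \<delta>}. moment k G \<le> C\<^sub>0)"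
    proof (cases "\<gamma> = 0")
      case True
      have "moment k G0 \<le> C\<^sub>0" if "0 < k" "k < 3 - \<delta>" for k
        using G0_moment_le[of k "3 - \<delta>"] that \<delta> by (simp add: C\<^sub>0_def)
      with True G G0_L2 show ?thesis by (simp add: C\<^sub>0_def)
    next
      case False
      have "C \<le> C\<^sub>0" by (simp add: C\<^sub>0_def)
      with C(4)[of \<gamma> G] False \<gamma> G show ?thesis by force
    qed
  qed (use C in auto)
qed

end
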